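(* Let $k$ be an algebraically closed field, $G$ a finite group with $\mathrm{char}(k)\nmid |G|$, and $X$ an integral scheme over $k$. Let $\mathcal{E}$ be a non-splitting torsion-free coherent $\mathcal{O}_X[G]$-module of type $W$. Then $\mathcal{E}\simeq \mathcal{O}(V)\otimes_{\mathcal{O}_X}\mathcal{F}$ as $\mathcal{O}_X[G]$-modules, where $\mathcal{F}$ is a non-splitting $\mathcal{O}_X$-module (with trivial $G$-action), $V$ is an irreducible representation of $G$ over $k$, and $W\simeq V^{\mathrm{rank}\,\mathcal{F}}$.
   Context: An $\mathcal{O}_X[G]$-module is an $\mathcal{O}_X$-module $\mathcal{E}$ together with a $k$-algebra homomorphism $k[G]\to \mathrm{End}(\mathcal{E})$ (equivalently, an $\mathcal{O}_X$-linear $G$-action). It is coherent or torsion-free if it is so as an $\mathcal{O}_X$-module. Non-splitting means (nonzero and) not isomorphic to a direct sum of two nonzero objects, in the category of $\mathcal{O}_X[G]$-modules for $\mathcal{E}$ and in the category of $\mathcal{O}_X$-modules for $\mathcal{F}$. For a representation $V$ of $G$ over $k$, $\mathcal{O}(V):=\mathcal{O}_X\otimes_k V$ with the induced $G$-action. If $K$ is the function field and $\epsilon$ the generic point of $X$, the type of a torsion-free coherent $\mathcal{O}_X[G]$-module $\mathcal{E}$ is the representation $W$ of $G$ over $k$ (unique up to isomorphism) with $\mathcal{E}_\epsilon\simeq W\otimes_k K$ as representations of $G$ over $K$. The rank is the dimension over $K$ of the stalk at $\epsilon$. *)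

theory Defs
  imports
    "HOL-Algebra.Algebraic_Closure"
    "HOL-Algebra.Free_Abelian_Groups"
    "HOL-Analysis.Abstract_Topology"
    "Jordan_Normal_Form.Missing_VectorSpace"
begin

section \<open>Sheaves of sets and germs\<close>

locale presheaf =
  fixes T :: "'x topology"
    and F :: "'x set \<Rightarrow> 's set"
    and r :: "'x set \<Rightarrow> 'x set \<Rightarrow> 's \<Rightarrow> 's"
  assumes res_closed:
      "\<lbrakk>openin T U; openin T V; V \<subseteq> U; s \<in> F U\<rbrakk> \<Longrightarrow> r U V s \<in> F V"
    and res_id: "\<lbrakk>openin T U; s \<in> F U\<rbrakk> \<Longrightarrow> r U U s = s"
    and res_comp:
      "\<lbrakk>openin T U; openin T V; openin T W; W \<subseteq> V; V \<subseteq> U; s \<in> F U\<rbrakk>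
        \<Longrightarrow> r V W (r U V s) = r U W s"

text \<open>
  Covers are sets of open sets rather than indexed families. This is no restriction: in a
  compatible indexed family, two members over the same open set agree. The empty cover is
  included, so there is exactly one section over the empty set.
\<close>

locale sheaf = presheaf +
  assumes glue:
      "\<lbrakk>\<forall>U\<in>\<U>. openin T U; \<forall>U\<in>\<U>. s U \<in> F U;
        \<forall>U\<in>\<U>. \<forall>V\<in>\<U>. r U (U \<inter> V) (s U) = r V (U \<inter> V) (s V)\<rbrakk>
        \<Longrightarrow> \<exists>!t. t \<in> F (\<Union>\<U>) \<and> (\<forall>U\<in>\<U>. r (\<Union>\<U>) U t = s U)"

definition germ ::
  "'x topology \<Rightarrow> ('x set \<Rightarrow> 's set) \<Rightarrow> ('x set \<Rightarrow> 'x set \<Rightarrow> 's \<Rightarrow> 's)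
    \<Rightarrow> 'x \<Rightarrow> 'x set \<Rightarrow> 's \<Rightarrow> ('x set \<times> 's) set"
  where "germ T F r x U s =
    {(V, t). openin T V \<and> x \<in> V \<and> t \<in> F V
      \<and> (\<exists>W. openin T W \<and> x \<in> W \<and> W \<subseteq> U \<inter> V \<and> r U W s = r V W t)}"

definition germs ::
  "'x topology \<Rightarrow> ('x set \<Rightarrow> 's set) \<Rightarrow> ('x set \<Rightarrow> 'x set \<Rightarrow> 's \<Rightarrow> 's)
    \<Rightarrow> 'x \<Rightarrow> ('x set \<times> 's) set set"
  where "germs T F r x = {germ T F r x U s | U s. openin T U \<and> x \<in> U \<and> s \<in> F U}"


section \<open>Locally ringed spaces\<close>

record ('x, 'r) rspace =
  pts :: "'x topology"
  sec_ring :: "'x set \<Rightarrow> 'r ring"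
  ring_res :: "'x set \<Rightarrow> 'x set \<Rightarrow> 'r \<Rightarrow> 'r"

abbreviation ring_germ :: "('x, 'r) rspace \<Rightarrow> 'x \<Rightarrow> 'x set \<Rightarrow> 'r \<Rightarrow> ('x set \<times> 'r) set"
  where "ring_germ S \<equiv> germ (pts S) (\<lambda>U. carrier (sec_ring S U)) (ring_res S)"

text \<open>
  Operations on equivalence classes are written as unions over all representatives, as the
  library does for quotient rings: the sets united are all equal.
\<close>

definition ring_stalk :: "('x, 'r) rspace \<Rightarrow> 'x \<Rightarrow> ('x set \<times> 'r) set ring"
  where "ring_stalk S x =
    \<lparr>carrier = germs (pts S) (\<lambda>U. carrier (sec_ring S U)) (ring_res S) x,
     monoid.mult = (\<lambda>A B. \<Union>(U, s)\<in>A. \<Union>(V, t)\<in>B. ring_germ S x (U \<inter> V)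
       (ring_res S U (U \<inter> V) s \<otimes>\<^bsub>sec_ring S (U \<inter> V)\<^esub> ring_res S V (U \<inter> V) t)),
     monoid.one = ring_germ S x (topspace (pts S)) \<one>\<^bsub>sec_ring S (topspace (pts S))\<^esub>,
     ring.zero = ring_germ S x (topspace (pts S)) \<zero>\<^bsub>sec_ring S (topspace (pts S))\<^esub>,
     ring.add = (\<lambda>A B. \<Union>(U, s)\<in>A. \<Union>(V, t)\<in>B. ring_germ S x (U \<inter> V)
       (ring_res S U (U \<inter> V) s \<oplus>\<^bsub>sec_ring S (U \<inter> V)\<^esub> ring_res S V (U \<inter> V) t))\<rparr>"

locale ringed_space =
  fixes S :: "('x, 'r) rspace"
  assumes sheaf_of_rings: "sheaf (pts S) (\<lambda>U. carrier (sec_ring S U)) (ring_res S)"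
    and sec_cring: "openin (pts S) U \<Longrightarrow> cring (sec_ring S U)"
    and res_ring_hom:
      "\<lbrakk>openin (pts S) U; openin (pts S) V; V \<subseteq> U\<rbrakk>
        \<Longrightarrow> ring_res S U V \<in> ring_hom (sec_ring S U) (sec_ring S V)"

definition local_ring :: "('a, 'b) ring_scheme \<Rightarrow> bool"
  where "local_ring R \<longleftrightarrow> cring R \<and> (\<exists>!I. maximalideal I R)"

locale locally_ringed_space = ringed_space +
  assumes stalk_local: "x \<in> topspace (pts S) \<Longrightarrow> local_ring (ring_stalk S x)"

definition preim :: "('x, 'r) rspace \<Rightarrow> ('x \<Rightarrow> 'y) \<Rightarrow> 'y set \<Rightarrow> 'x set"
  where "preim S f V = {x \<in> topspace (pts S). f x \<in> V}"

text \<open>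
  The comorphism component \<open>\<phi> V\<close> goes from sections of \<open>Y\<close> over \<open>V\<close>
  to sections of \<open>S\<close> over the preimage of \<open>V\<close>.
\<close>

definition stalk_map ::
  "('x, 'r) rspace \<Rightarrow> ('x \<Rightarrow> 'y) \<Rightarrow> ('y set \<Rightarrow> 's \<Rightarrow> 'r)
    \<Rightarrow> 'x \<Rightarrow> ('y set \<times> 's) set \<Rightarrow> ('x set \<times> 'r) set"
  where "stalk_map S f \<phi> x A = (\<Union>(V, s)\<in>A. ring_germ S x (preim S f V) (\<phi> V s))"

locale lrs_morphism = S: locally_ringed_space S + Y: locally_ringed_space Y
  for S :: "('x, 'r) rspace" and Y :: "('y, 's) rspace" +
  fixes f :: "'x \<Rightarrow> 'y" and \<phi> :: "'y set \<Rightarrow> 's \<Rightarrow> 'r"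
  assumes continuous: "continuous_map (pts S) (pts Y) f"
    and comorphism_hom:
      "openin (pts Y) V \<Longrightarrow> \<phi> V \<in> ring_hom (sec_ring Y V) (sec_ring S (preim S f V))"
    and comorphism_res:
      "\<lbrakk>openin (pts Y) V; openin (pts Y) W; W \<subseteq> V; s \<in> carrier (sec_ring Y V)\<rbrakk>
        \<Longrightarrow> \<phi> W (ring_res Y V W s) = ring_res S (preim S f V) (preim S f W) (\<phi> V s)"
    and local_on_stalks:
      "\<lbrakk>x \<in> topspace (pts S); A \<in> carrier (ring_stalk Y (f x));
        stalk_map S f \<phi> x A \<in> Units (ring_stalk S x)\<rbrakk>
        \<Longrightarrow> A \<in> Units (ring_stalk Y (f x))"

locale lrs_isomorphism = lrs_morphism +
  assumes homeomorphic: "homeomorphic_map (pts S) (pts Y) f"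
    and comorphism_iso:
      "openin (pts Y) V \<Longrightarrow> \<phi> V \<in> ring_iso (sec_ring Y V) (sec_ring S (preim S f V))"

definition open_subspace :: "('x, 'r) rspace \<Rightarrow> 'x set \<Rightarrow> ('x, 'r) rspace"
  where "open_subspace S U = S\<lparr>pts := subtopology (pts S) U\<rparr>"


section \<open>Schemes\<close>

definition Zariski :: "('a, 'b) ring_scheme \<Rightarrow> 'a set topology"
  where "Zariski A =
    topology (\<lambda>U. \<exists>S\<subseteq>carrier A. U = {P. primeideal P A \<and> \<not> S \<subseteq> P})"

lemma istopology_Zariski:
  fixes A (structure)
  shows "istopology (\<lambda>U. \<exists>S\<subseteq>carrier A. U = {P. primeideal P A \<and> \<not> S \<subseteq> P})"
    (is "istopology ?open")
  unfolding istopology_def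
proof (intro conjI allI impI)
  fix U V
  assume "?open U" "?open V"
  then obtain S T where S: "S \<subseteq> carrier A" "U = {P. primeideal P A \<and> \<not> S \<subseteq> P}"
    and T: "T \<subseteq> carrier A" "V = {P. primeideal P A \<and> \<not> T \<subseteq> P}"
    by blast
  define Q where "Q = {x. \<exists>s\<in>S. \<exists>t\<in>T. x = s \<otimes> t} \<inter> carrier A"
  have *: "\<not> Q \<subseteq> P \<longleftrightarrow> \<not> S \<subseteq> P \<and> \<not> T \<subseteq> P" if "primeideal P A" for P
  proof
    interpret primeideal P A by fact
    show "\<not> S \<subseteq> P \<and> \<not> T \<subseteq> P" if "\<not> Q \<subseteq> P"
    proof -
      from that obtain s t where st: "s \<in> S" "t \<in> T" "s \<otimes> t \<notin> P"
        unfolding Q_def by blast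
      then have "s \<in> carrier A" "t \<in> carrier A" using S(1) T(1) by auto
      then show ?thesis using st I_l_closed I_r_closed by blast
    qed
    show "\<not> Q \<subseteq> P" if "\<not> S \<subseteq> P \<and> \<not> T \<subseteq> P"
    proof -
      from that obtain s t where st: "s \<in> S" "t \<in> T" "s \<notin> P" "t \<notin> P" by blast
      have c: "s \<in> carrier A" "t \<in> carrier A" using st S(1) T(1) by auto
      have "s \<otimes> t \<notin> P" using I_prime[OF c] st by blast
      moreover have "s \<otimes> t \<in> Q" using st c unfolding Q_def by blast
      ultimately show ?thesis by blast
    qed
  qed
  have "Q \<subseteq> carrier A" by (simp add: Q_def)
  moreover have "U \<inter> V = {P. primeideal P A \<and> \<not> Q \<subseteq> P}"
    using S(2) T(2) * by blast
  ultimately show "?open (U \<inter> V)" by blast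
next
  fix K
  assume "\<forall>U\<in>K. ?open U"
  then obtain S where S: "\<And>U. U \<in> K \<Longrightarrow> S U \<subseteq> carrier A"
      "\<And>U. U \<in> K \<Longrightarrow> U = {P. primeideal P A \<and> \<not> S U \<subseteq> P}"
    by metis
  have "(\<Union>U\<in>K. S U) \<subseteq> carrier A" using S(1) by blast
  moreover have "\<Union>K = {P. primeideal P A \<and> \<not> (\<Union>U\<in>K. S U) \<subseteq> P}"
    using S(2) by blast
  ultimately show "?open (\<Union>K)" by blast
qed

lemma openin_Zariski:
  "openin (Zariski A) U \<longleftrightarrow>
    (\<exists>S\<subseteq>carrier A. U = {P. primeideal P A \<and> \<not> S \<subseteq> P})"
  unfolding Zariski_def by (subst topology_inverse'[OF istopology_Zariski]) (rule refl)

definition frac :: "('a, 'b) ring_scheme \<Rightarrow> 'a set \<Rightarrow> 'a \<Rightarrow> 'a \<Rightarrow> ('a \<times> 'a) set"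
  where "frac A M a s =
    {(b, t). b \<in> carrier A \<and> t \<in> M
      \<and> (\<exists>u\<in>M. u \<otimes>\<^bsub>A\<^esub> (t \<otimes>\<^bsub>A\<^esub> a) = u \<otimes>\<^bsub>A\<^esub> (s \<otimes>\<^bsub>A\<^esub> b))}"

definition localization :: "('a, 'b) ring_scheme \<Rightarrow> 'a set \<Rightarrow> ('a \<times> 'a) set ring"
  where "localization A M =
    \<lparr>carrier = {frac A M a s | a s. a \<in> carrier A \<and> s \<in> M},
     monoid.mult = (\<lambda>P Q. \<Union>(a, s)\<in>P. \<Union>(b, t)\<in>Q. frac A M (a \<otimes>\<^bsub>A\<^esub> b) (s \<otimes>\<^bsub>A\<^esub> t)),
     monoid.one = frac A M \<one>\<^bsub>A\<^esub> \<one>\<^bsub>A\<^esub>,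
     ring.zero = frac A M \<zero>\<^bsub>A\<^esub> \<one>\<^bsub>A\<^esub>,
     ring.add = (\<lambda>P Q. \<Union>(a, s)\<in>P. \<Union>(b, t)\<in>Q.
       frac A M (a \<otimes>\<^bsub>A\<^esub> t \<oplus>\<^bsub>A\<^esub> b \<otimes>\<^bsub>A\<^esub> s) (s \<otimes>\<^bsub>A\<^esub> t))\<rparr>"

abbreviation local_at :: "('a, 'b) ring_scheme \<Rightarrow> 'a set \<Rightarrow> ('a \<times> 'a) set ring"
  where "local_at A P \<equiv> localization A (carrier A - P)"

definition spec_sections ::
  "('a, 'b) ring_scheme \<Rightarrow> 'a set set \<Rightarrow> ('a set \<Rightarrow> ('a \<times> 'a) set) set"
  where "spec_sections A U =
    {s \<in> \<Pi>\<^sub>E P\<in>U. carrier (local_at A P).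
      \<forall>P\<in>U. \<exists>V. openin (Zariski A) V \<and> P \<in> V \<and> V \<subseteq> U
        \<and> (\<exists>a\<in>carrier A. \<exists>d\<in>carrier A.
              \<forall>Q\<in>V. d \<notin> Q \<and> s Q = frac A (carrier A - Q) a d)}"

definition Spec :: "('a, 'b) ring_scheme \<Rightarrow> ('a set, 'a set \<Rightarrow> ('a \<times> 'a) set) rspace"
  where "Spec A =
    \<lparr>pts = Zariski A,
     sec_ring = (\<lambda>U.
       \<lparr>carrier = spec_sections A U,
        monoid.mult = (\<lambda>s t. \<lambda>P\<in>U. s P \<otimes>\<^bsub>local_at A P\<^esub> t P),
        monoid.one = (\<lambda>P\<in>U. \<one>\<^bsub>local_at A P\<^esub>),
        ring.zero = (\<lambda>P\<in>U. \<zero>\<^bsub>local_at A P\<^esub>),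
        ring.add = (\<lambda>s t. \<lambda>P\<in>U. s P \<oplus>\<^bsub>local_at A P\<^esub> t P)\<rparr>),
     ring_res = (\<lambda>U V s. restrict s V)\<rparr>"

text \<open>
  The ring \<open>A\<close> in the next definition may be taken with elements of the type of the sections
  of \<open>S\<close>, since it is necessarily isomorphic to the ring of sections over \<open>U\<close>.
\<close>

definition scheme :: "('x, 'r) rspace \<Rightarrow> bool"
  where "scheme S \<longleftrightarrow> locally_ringed_space S \<and>
    (\<forall>x\<in>topspace (pts S). \<exists>U. openin (pts S) U \<and> x \<in> U \<and>
      (\<exists>(A :: 'r ring) f \<phi>. cring A \<and> lrs_isomorphism (open_subspace S U) (Spec A) f \<phi>))"

definition integral_scheme :: "('x, 'r) rspace \<Rightarrow> bool"
  where "integral_scheme S \<longleftrightarrow> scheme S \<and> topspace (pts S) \<noteq> {}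
    \<and> (\<forall>U. openin (pts S) U \<and> U \<noteq> {} \<longrightarrow> domain (sec_ring S U))"

definition generic_point :: "('x, 'r) rspace \<Rightarrow> 'x \<Rightarrow> bool"
  where "generic_point S \<epsilon> \<longleftrightarrow>
    \<epsilon> \<in> topspace (pts S) \<and> pts S closure_of {\<epsilon>} = topspace (pts S)"

definition scheme_over ::
  "('k, 'c) ring_scheme \<Rightarrow> ('x, 'r) rspace \<Rightarrow> ('x \<Rightarrow> 'k set)
    \<Rightarrow> ('k set set \<Rightarrow> ('k set \<Rightarrow> ('k \<times> 'k) set) \<Rightarrow> 'r) \<Rightarrow> bool"
  where "scheme_over k S p \<phi> \<longleftrightarrow> scheme S \<and> lrs_morphism S (Spec k) p \<phi>"

text \<open>
  The ring homomorphism from \<open>k\<close> to the sections over \<open>U\<close> given by a structure morphism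
  with comorphism \<open>\<phi>\<close>: an element of \<open>k\<close> becomes a global section of \<open>Spec k\<close>,
  which is pulled back to \<open>S\<close> and restricted to \<open>U\<close>.
\<close>

definition scalar_section ::
  "('k, 'c) ring_scheme \<Rightarrow> ('x, 'r) rspace
    \<Rightarrow> ('k set set \<Rightarrow> ('k set \<Rightarrow> ('k \<times> 'k) set) \<Rightarrow> 'r) \<Rightarrow> 'x set \<Rightarrow> 'k \<Rightarrow> 'r"
  where "scalar_section k S \<phi> U c =
    ring_res S (topspace (pts S)) U
      (\<phi> (topspace (Zariski k))
        (\<lambda>P\<in>topspace (Zariski k). frac k (carrier k - P) c \<one>\<^bsub>k\<^esub>))"


section \<open>Sheaves of modules\<close>

record ('x, 'r, 'm) msheaf =
  sec :: "'x set \<Rightarrow> ('r, 'm) module"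
  mres :: "'x set \<Rightarrow> 'x set \<Rightarrow> 'm \<Rightarrow> 'm"

record ('x, 'r, 'm, 'g) gmsheaf = "('x, 'r, 'm) msheaf" +
  act :: "'g \<Rightarrow> 'x set \<Rightarrow> 'm \<Rightarrow> 'm"

locale sheaf_of_modules = ringed_space S
  for S :: "('x, 'r) rspace" +
  fixes M :: "('x, 'r, 'm, 'z) msheaf_scheme"
  assumes sheaf_of_sections: "sheaf (pts S) (\<lambda>U. carrier (sec M U)) (mres M)"
    and sec_module: "openin (pts S) U \<Longrightarrow> module (sec_ring S U) (sec M U)"
    and mres_add:
      "\<lbrakk>openin (pts S) U; openin (pts S) V; V \<subseteq> U; m \<in> carrier (sec M U); n \<in> carrier (sec M U)\<rbrakk>
        \<Longrightarrow> mres M U V (m \<oplus>\<^bsub>sec M U\<^esub> n) = mres M U V m \<oplus>\<^bsub>sec M V\<^esub> mres M U V n"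
    and mres_smult:
      "\<lbrakk>openin (pts S) U; openin (pts S) V; V \<subseteq> U; a \<in> carrier (sec_ring S U);
        m \<in> carrier (sec M U)\<rbrakk>
        \<Longrightarrow> mres M U V (a \<odot>\<^bsub>sec M U\<^esub> m) = ring_res S U V a \<odot>\<^bsub>sec M V\<^esub> mres M U V m"

text \<open>Sheaves of modules with a linear action of a group \<open>G\<close>.\<close>

locale sheaf_of_gmodules = sheaf_of_modules S E + group G
  for G :: "('g, 'c) monoid_scheme" and S :: "('x, 'r) rspace"
    and E :: "('x, 'r, 'm, 'g) gmsheaf" +
  assumes act_hom:
      "\<lbrakk>g \<in> carrier G; openin (pts S) U\<rbrakk>
        \<Longrightarrow> act E g U \<in> module_hom (sec_ring S U) (sec E U) (sec E U)"
    and act_res: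
      "\<lbrakk>g \<in> carrier G; openin (pts S) U; openin (pts S) V; V \<subseteq> U; m \<in> carrier (sec E U)\<rbrakk>
        \<Longrightarrow> mres E U V (act E g U m) = act E g V (mres E U V m)"
    and act_one: "\<lbrakk>openin (pts S) U; m \<in> carrier (sec E U)\<rbrakk> \<Longrightarrow> act E \<one>\<^bsub>G\<^esub> U m = m"
    and act_mult:
      "\<lbrakk>g \<in> carrier G; h \<in> carrier G; openin (pts S) U; m \<in> carrier (sec E U)\<rbrakk>
        \<Longrightarrow> act E (g \<otimes>\<^bsub>G\<^esub> h) U m = act E g U (act E h U m)"

definition mod_isomorphism ::
  "('x, 'r) rspace \<Rightarrow> ('x, 'r, 'm, 'y) msheaf_scheme \<Rightarrow> ('x, 'r, 'n, 'z) msheaf_scheme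
    \<Rightarrow> ('x set \<Rightarrow> 'm \<Rightarrow> 'n) \<Rightarrow> bool"
  where "mod_isomorphism S M N h \<longleftrightarrow>
    (\<forall>U. openin (pts S) U \<longrightarrow>
      h U \<in> module_hom (sec_ring S U) (sec M U) (sec N U)
      \<and> bij_betw (h U) (carrier (sec M U)) (carrier (sec N U)))
    \<and> (\<forall>U V. openin (pts S) U \<and> openin (pts S) V \<and> V \<subseteq> U \<longrightarrow>
        (\<forall>m\<in>carrier (sec M U). mres N U V (h U m) = h V (mres M U V m)))"

definition mod_isomorphic ::
  "('x, 'r) rspace \<Rightarrow> ('x, 'r, 'm, 'y) msheaf_scheme \<Rightarrow> ('x, 'r, 'n, 'z) msheaf_scheme \<Rightarrow> bool"
  where "mod_isomorphic S M N \<longleftrightarrow> (\<exists>h. mod_isomorphism S M N h)"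

definition gmod_isomorphic ::
  "('g, 'c) monoid_scheme \<Rightarrow> ('x, 'r) rspace \<Rightarrow> ('x, 'r, 'm, 'g) gmsheaf
    \<Rightarrow> ('x, 'r, 'n, 'g) gmsheaf \<Rightarrow> bool"
  where "gmod_isomorphic G S E F \<longleftrightarrow>
    (\<exists>h. mod_isomorphism S E F h
      \<and> (\<forall>g\<in>carrier G. \<forall>U. openin (pts S) U \<longrightarrow>
          (\<forall>m\<in>carrier (sec E U). h U (act E g U m) = act F g U (h U m))))"

definition mod_sum ::
  "('x, 'r, 'm, 'y) msheaf_scheme \<Rightarrow> ('x, 'r, 'n, 'z) msheaf_scheme \<Rightarrow> ('x, 'r, 'm \<times> 'n) msheaf"
  where "mod_sum M N =
    \<lparr>sec = (\<lambda>U. direct_sum (sec M U) (sec N U)),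
     mres = (\<lambda>U V. map_prod (mres M U V) (mres N U V))\<rparr>"

definition gmod_sum ::
  "('x, 'r, 'm, 'g) gmsheaf \<Rightarrow> ('x, 'r, 'n, 'g) gmsheaf \<Rightarrow> ('x, 'r, 'm \<times> 'n, 'g) gmsheaf"
  where "gmod_sum E F =
    \<lparr>sec = (\<lambda>U. direct_sum (sec E U) (sec F U)),
     mres = (\<lambda>U V. map_prod (mres E U V) (mres F U V)),
     act = (\<lambda>g U. map_prod (act E g U) (act F g U))\<rparr>"

definition nonzero_mod :: "('x, 'r) rspace \<Rightarrow> ('x, 'r, 'm, 'z) msheaf_scheme \<Rightarrow> bool"
  where "nonzero_mod S M \<longleftrightarrow>
    (\<exists>U. openin (pts S) U \<and> carrier (sec M U) \<noteq> {\<zero>\<^bsub>sec M U\<^esub>})"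

text \<open>
  The summands may be taken with sections of the same type as the given module, since they
  are isomorphic to submodules of it.
\<close>

definition nonsplitting_module :: "('x, 'r) rspace \<Rightarrow> ('x, 'r, 'm) msheaf \<Rightarrow> bool"
  where "nonsplitting_module S F \<longleftrightarrow> nonzero_mod S F \<and>
    \<not> (\<exists>(A :: ('x, 'r, 'm) msheaf) (B :: ('x, 'r, 'm) msheaf).
         sheaf_of_modules S A \<and> sheaf_of_modules S B \<and> nonzero_mod S A \<and> nonzero_mod S B
         \<and> mod_isomorphic S F (mod_sum A B))"

definition nonsplitting_gmodule ::
  "('g, 'c) monoid_scheme \<Rightarrow> ('x, 'r) rspace \<Rightarrow> ('x, 'r, 'm, 'g) gmsheaf \<Rightarrow> bool"
  where "nonsplitting_gmodule G S E \<longleftrightarrow> nonzero_mod S E \<and>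
    \<not> (\<exists>(A :: ('x, 'r, 'm, 'g) gmsheaf) (B :: ('x, 'r, 'm, 'g) gmsheaf).
         sheaf_of_gmodules G S A \<and> sheaf_of_gmodules G S B
         \<and> nonzero_mod S A \<and> nonzero_mod S B \<and> gmod_isomorphic G S E (gmod_sum A B))"

abbreviation mod_germ ::
  "('x, 'r) rspace \<Rightarrow> ('x, 'r, 'm, 'z) msheaf_scheme \<Rightarrow> 'x \<Rightarrow> 'x set \<Rightarrow> 'm \<Rightarrow> ('x set \<times> 'm) set"
  where "mod_germ S M \<equiv> germ (pts S) (\<lambda>U. carrier (sec M U)) (mres M)"

definition mod_stalk ::
  "('x, 'r) rspace \<Rightarrow> ('x, 'r, 'm, 'z) msheaf_scheme \<Rightarrow> 'x
    \<Rightarrow> (('x set \<times> 'r) set, ('x set \<times> 'm) set) module"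
  where "mod_stalk S M x =
    \<lparr>carrier = germs (pts S) (\<lambda>U. carrier (sec M U)) (mres M) x,
     monoid.mult = undefined, monoid.one = undefined,
     ring.zero = mod_germ S M x (topspace (pts S)) \<zero>\<^bsub>sec M (topspace (pts S))\<^esub>,
     ring.add = (\<lambda>A B. \<Union>(U, m)\<in>A. \<Union>(V, n)\<in>B. mod_germ S M x (U \<inter> V)
       (mres M U (U \<inter> V) m \<oplus>\<^bsub>sec M (U \<inter> V)\<^esub> mres M V (U \<inter> V) n)),
     module.smult = (\<lambda>A B. \<Union>(U, a)\<in>A. \<Union>(V, m)\<in>B. mod_germ S M x (U \<inter> V)
       (ring_res S U (U \<inter> V) a \<odot>\<^bsub>sec M (U \<inter> V)\<^esub> mres M V (U \<inter> V) m))\<rparr>"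

definition stalk_act ::
  "('x, 'r) rspace \<Rightarrow> ('x, 'r, 'm, 'g) gmsheaf \<Rightarrow> 'x \<Rightarrow> 'g
    \<Rightarrow> ('x set \<times> 'm) set \<Rightarrow> ('x set \<times> 'm) set"
  where "stalk_act S E x g A = (\<Union>(U, m)\<in>A. mod_germ S E x U (act E g U m))"

text \<open>The stalks of an integral scheme are domains, so zero is their only zero divisor.\<close>

definition torsion_free :: "('x, 'r) rspace \<Rightarrow> ('x, 'r, 'm, 'z) msheaf_scheme \<Rightarrow> bool"
  where "torsion_free S M \<longleftrightarrow>
    (\<forall>x\<in>topspace (pts S). \<forall>a\<in>carrier (ring_stalk S x). \<forall>m\<in>carrier (mod_stalk S M x).
      a \<odot>\<^bsub>mod_stalk S M x\<^esub> m = \<zero>\<^bsub>mod_stalk S M x\<^esub>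
        \<longrightarrow> a = \<zero>\<^bsub>ring_stalk S x\<^esub> \<or> m = \<zero>\<^bsub>mod_stalk S M x\<^esub>)"

text \<open>
  The sections \<open>s 0, \<dots>, s (n - 1)\<close> over \<open>U\<close> define a morphism from the free module of
  rank \<open>n\<close> to \<open>M\<close> over \<open>U\<close>; it is an epimorphism of sheaves if it is locally
  surjective, and \<open>relation_sheaf\<close> is its kernel.
\<close>

definition generates ::
  "('x, 'r) rspace \<Rightarrow> ('x, 'r, 'm, 'z) msheaf_scheme \<Rightarrow> 'x set \<Rightarrow> nat \<Rightarrow> (nat \<Rightarrow> 'm) \<Rightarrow> bool"
  where "generates S M U n s \<longleftrightarrow>
    (\<forall>V. openin (pts S) V \<and> V \<subseteq> U \<longrightarrow> (\<forall>t\<in>carrier (sec M V). \<forall>x\<in>V.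
      \<exists>W. openin (pts S) W \<and> x \<in> W \<and> W \<subseteq> V
        \<and> (\<exists>a\<in>{..<n} \<rightarrow> carrier (sec_ring S W).
             mres M V W t =
               (\<Oplus>\<^bsub>sec M W\<^esub>i\<in>{..<n}. a i \<odot>\<^bsub>sec M W\<^esub> mres M U W (s i)))))"

definition finite_type :: "('x, 'r) rspace \<Rightarrow> ('x, 'r, 'm, 'z) msheaf_scheme \<Rightarrow> bool"
  where "finite_type S M \<longleftrightarrow>
    (\<forall>x\<in>topspace (pts S). \<exists>U. openin (pts S) U \<and> x \<in> U \<and>
      (\<exists>n. \<exists>s\<in>{..<n} \<rightarrow> carrier (sec M U). generates S M U n s))"

definition relation_sheaf ::
  "('x, 'r) rspace \<Rightarrow> ('x, 'r, 'm, 'z) msheaf_scheme \<Rightarrow> 'x set \<Rightarrow> nat \<Rightarrow> (nat \<Rightarrow> 'm)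
    \<Rightarrow> ('x, 'r, nat \<Rightarrow> 'r) msheaf"
  where "relation_sheaf S M U n s =
    \<lparr>sec = (\<lambda>V.
       \<lparr>carrier = {a \<in> {..<n} \<rightarrow>\<^sub>E carrier (sec_ring S V).
          (\<Oplus>\<^bsub>sec M V\<^esub>i\<in>{..<n}. a i \<odot>\<^bsub>sec M V\<^esub> mres M U V (s i)) = \<zero>\<^bsub>sec M V\<^esub>},
        monoid.mult = undefined, monoid.one = undefined,
        ring.zero = (\<lambda>i\<in>{..<n}. \<zero>\<^bsub>sec_ring S V\<^esub>),
        ring.add = (\<lambda>a b. \<lambda>i\<in>{..<n}. a i \<oplus>\<^bsub>sec_ring S V\<^esub> b i),
        module.smult = (\<lambda>c a. \<lambda>i\<in>{..<n}. c \<otimes>\<^bsub>sec_ring S V\<^esub> a i)\<rparr>),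
     mres = (\<lambda>V W a. \<lambda>i\<in>{..<n}. ring_res S V W (a i))\<rparr>"

definition coherent :: "('x, 'r) rspace \<Rightarrow> ('x, 'r, 'm, 'z) msheaf_scheme \<Rightarrow> bool"
  where "coherent S M \<longleftrightarrow> finite_type S M \<and>
    (\<forall>U n s. openin (pts S) U \<and> s \<in> {..<n} \<rightarrow> carrier (sec M U) \<longrightarrow>
      finite_type (open_subspace S U) (relation_sheaf S M U n s))"

definition sheafification ::
  "('x, 'r) rspace \<Rightarrow> ('x, 'r, 'm, 'g) gmsheaf \<Rightarrow> ('x, 'r, 'x \<Rightarrow> ('x set \<times> 'm) set, 'g) gmsheaf"
  where "sheafification S P =
    \<lparr>sec = (\<lambda>U.
       \<lparr>carrier = {s \<in> \<Pi>\<^sub>E x\<in>U. carrier (mod_stalk S P x).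
          \<forall>x\<in>U. \<exists>V. openin (pts S) V \<and> x \<in> V \<and> V \<subseteq> U
            \<and> (\<exists>m\<in>carrier (sec P V). \<forall>y\<in>V. s y = mod_germ S P y V m)},
        monoid.mult = undefined, monoid.one = undefined,
        ring.zero = (\<lambda>x\<in>U. \<zero>\<^bsub>mod_stalk S P x\<^esub>),
        ring.add = (\<lambda>s t. \<lambda>x\<in>U. s x \<oplus>\<^bsub>mod_stalk S P x\<^esub> t x),
        module.smult = (\<lambda>a s. \<lambda>x\<in>U. ring_germ S x U a \<odot>\<^bsub>mod_stalk S P x\<^esub> s x)\<rparr>),
     mres = (\<lambda>U V s. restrict s V),
     act = (\<lambda>g U s. \<lambda>x\<in>U. stalk_act S P x g (s x))\<rparr>"

definition trivial_action :: "('x, 'r, 'm) msheaf \<Rightarrow> ('x, 'r, 'm, 'g) gmsheaf"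
  where "trivial_action F = \<lparr>sec = sec F, mres = mres F, act = (\<lambda>g U m. m)\<rparr>"


section \<open>Tensor products\<close>

text \<open>
  The tensor product of two modules over \<open>R\<close> is the quotient of the free abelian group on
  pairs by the subgroup \<open>tensor_relations\<close>.
\<close>

abbreviation pair_group ::
  "('r, 'm, 'y) module_scheme \<Rightarrow> ('r, 'n, 'z) module_scheme \<Rightarrow> (('m \<times> 'n) \<Rightarrow>\<^sub>0 int) monoid"
  where "pair_group M N \<equiv> free_Abelian_group (carrier M \<times> carrier N)"

definition tensor_relations ::
  "('r, 'c) ring_scheme \<Rightarrow> ('r, 'm, 'y) module_scheme \<Rightarrow> ('r, 'n, 'z) module_scheme
    \<Rightarrow> (('m \<times> 'n) \<Rightarrow>\<^sub>0 int) set"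
  where "tensor_relations R M N = generate (pair_group M N)
    ({frag_of (m \<oplus>\<^bsub>M\<^esub> m', n) - frag_of (m, n) - frag_of (m', n) | m m' n.
        m \<in> carrier M \<and> m' \<in> carrier M \<and> n \<in> carrier N}
     \<union> {frag_of (m, n \<oplus>\<^bsub>N\<^esub> n') - frag_of (m, n) - frag_of (m, n') | m n n'.
        m \<in> carrier M \<and> n \<in> carrier N \<and> n' \<in> carrier N}
     \<union> {frag_of (a \<odot>\<^bsub>M\<^esub> m, n) - frag_of (m, a \<odot>\<^bsub>N\<^esub> n) | a m n.
        a \<in> carrier R \<and> m \<in> carrier M \<and> n \<in> carrier N})"

text \<open>
  \<open>tensor_map R M N f g\<close> is the tensor product of two maps \<open>f\<close> and \<open>g\<close> into
  \<open>M\<close> and \<open>N\<close>, with values in the tensor product of \<open>M\<close> and \<open>N\<close> over \<open>R\<close>.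
\<close>

definition tensor_map ::
  "('r, 'c) ring_scheme \<Rightarrow> ('r, 'm, 'y) module_scheme \<Rightarrow> ('r, 'n, 'z) module_scheme
    \<Rightarrow> ('p \<Rightarrow> 'm) \<Rightarrow> ('q \<Rightarrow> 'n) \<Rightarrow> (('p \<times> 'q) \<Rightarrow>\<^sub>0 int) set \<Rightarrow> (('m \<times> 'n) \<Rightarrow>\<^sub>0 int) set"
  where "tensor_map R M N f g A =
    (\<Union>c\<in>A. tensor_relations R M N
       #>\<^bsub>pair_group M N\<^esub> frag_extend (\<lambda>(p, q). frag_of (f p, g q)) c)"

text \<open>
  The tensor product over \<open>R\<close>, made into a module over a possibly different ring, whose
  elements \<open>s\<close> act on the left factor by \<open>\<mu> s\<close>.
\<close>

definition tensor_module ::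
  "('r, 'c) ring_scheme \<Rightarrow> ('r, 'm, 'y) module_scheme \<Rightarrow> ('r, 'n, 'z) module_scheme
    \<Rightarrow> ('s \<Rightarrow> 'm \<Rightarrow> 'm) \<Rightarrow> ('s, (('m \<times> 'n) \<Rightarrow>\<^sub>0 int) set) module"
  where "tensor_module R M N \<mu> =
    \<lparr>carrier = carrier (pair_group M N Mod tensor_relations R M N),
     monoid.mult = undefined, monoid.one = undefined,
     ring.zero = \<one>\<^bsub>pair_group M N Mod tensor_relations R M N\<^esub>,
     ring.add = (\<lambda>A B. A \<otimes>\<^bsub>pair_group M N Mod tensor_relations R M N\<^esub> B),
     module.smult = (\<lambda>s. tensor_map R M N (\<mu> s) id)\<rparr>"

definition algebra_module ::
  "('r, 'c) ring_scheme \<Rightarrow> ('k \<Rightarrow> 'r) \<Rightarrow> ('k, 'r) module"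
  where "algebra_module R \<sigma> =
    \<lparr>carrier = carrier R, monoid.mult = monoid.mult R, monoid.one = monoid.one R,
     ring.zero = ring.zero R, ring.add = ring.add R,
     module.smult = (\<lambda>c a. \<sigma> c \<otimes>\<^bsub>R\<^esub> a)\<rparr>"

text \<open>The tensor product of sheaves of modules carries the diagonal action.\<close>

definition tensor_sheaf ::
  "('x, 'r) rspace \<Rightarrow> ('x, 'r, 'm, 'g) gmsheaf \<Rightarrow> ('x, 'r, 'n, 'g) gmsheaf
    \<Rightarrow> ('x, 'r, 'x \<Rightarrow> ('x set \<times> (('m \<times> 'n) \<Rightarrow>\<^sub>0 int) set) set, 'g) gmsheaf"
  where "tensor_sheaf S E F = sheafification S
    \<lparr>sec = (\<lambda>U. tensor_module (sec_ring S U) (sec E U) (sec F U)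
       (\<lambda>a m. a \<odot>\<^bsub>sec E U\<^esub> m)),
     mres = (\<lambda>U V. tensor_map (sec_ring S V) (sec E V) (sec F V) (mres E U V) (mres F U V)),
     act = (\<lambda>g U. tensor_map (sec_ring S U) (sec E U) (sec F U) (act E g U) (act F g U))\<rparr>"


section \<open>Representations\<close>

locale group_rep = vectorspace k V + G: group G
  for k :: "('k, 'c) ring_scheme" and G :: "('g, 'b) monoid_scheme"
    and V :: "('k, 'v, 'z) module_scheme" +
  fixes \<rho> :: "'g \<Rightarrow> 'v \<Rightarrow> 'v"
  assumes rep_hom: "g \<in> carrier G \<Longrightarrow> \<rho> g \<in> module_hom k V V"
    and rep_one: "v \<in> carrier V \<Longrightarrow> \<rho> \<one>\<^bsub>G\<^esub> v = v"
    and rep_mult: "\<lbrakk>g \<in> carrier G; h \<in> carrier G; v \<in> carrier V\<rbrakk>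
      \<Longrightarrow> \<rho> (g \<otimes>\<^bsub>G\<^esub> h) v = \<rho> g (\<rho> h v)"

locale irreducible_group_rep = group_rep +
  assumes nontrivial: "carrier V \<noteq> {\<zero>\<^bsub>V\<^esub>}"
    and no_invariant_subspace:
      "\<lbrakk>VectorSpace.subspace k H V; \<forall>g\<in>carrier G. \<rho> g ` H \<subseteq> H\<rbrakk>
        \<Longrightarrow> H = {\<zero>\<^bsub>V\<^esub>} \<or> H = carrier V"

definition rep_isomorphic ::
  "('k, 'c) ring_scheme \<Rightarrow> ('g, 'b) monoid_scheme
    \<Rightarrow> ('k, 'v, 'y) module_scheme \<Rightarrow> ('g \<Rightarrow> 'v \<Rightarrow> 'v)
    \<Rightarrow> ('k, 'w, 'z) module_scheme \<Rightarrow> ('g \<Rightarrow> 'w \<Rightarrow> 'w) \<Rightarrow> bool"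
  where "rep_isomorphic k G V \<rho> W \<sigma> \<longleftrightarrow>
    (\<exists>h\<in>module_hom k V W. bij_betw h (carrier V) (carrier W)
      \<and> (\<forall>g\<in>carrier G. \<forall>v\<in>carrier V. h (\<rho> g v) = \<sigma> g (h v)))"

definition power_module :: "('k, 'v, 'z) module_scheme \<Rightarrow> nat \<Rightarrow> ('k, nat \<Rightarrow> 'v) module"
  where "power_module V n =
    \<lparr>carrier = {..<n} \<rightarrow>\<^sub>E carrier V,
     monoid.mult = undefined, monoid.one = undefined,
     ring.zero = (\<lambda>i\<in>{..<n}. \<zero>\<^bsub>V\<^esub>),
     ring.add = (\<lambda>v w. \<lambda>i\<in>{..<n}. v i \<oplus>\<^bsub>V\<^esub> w i),
     module.smult = (\<lambda>c v. \<lambda>i\<in>{..<n}. c \<odot>\<^bsub>V\<^esub> v i)\<rparr>"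

definition power_action :: "('g \<Rightarrow> 'v \<Rightarrow> 'v) \<Rightarrow> nat \<Rightarrow> 'g \<Rightarrow> (nat \<Rightarrow> 'v) \<Rightarrow> (nat \<Rightarrow> 'v)"
  where "power_action \<rho> n g v = (\<lambda>i\<in>{..<n}. \<rho> g (v i))"

text \<open>
  The sheaf obtained by tensoring the structure sheaf over \<open>k\<close> with a representation.
\<close>

definition rep_sheaf ::
  "('k, 'c) ring_scheme \<Rightarrow> ('x, 'r) rspace
    \<Rightarrow> ('k set set \<Rightarrow> ('k set \<Rightarrow> ('k \<times> 'k) set) \<Rightarrow> 'r)
    \<Rightarrow> ('k, 'v, 'z) module_scheme \<Rightarrow> ('g \<Rightarrow> 'v \<Rightarrow> 'v)
    \<Rightarrow> ('x, 'r, 'x \<Rightarrow> ('x set \<times> (('r \<times> 'v) \<Rightarrow>\<^sub>0 int) set) set, 'g) gmsheaf"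
  where "rep_sheaf k S \<phi> V \<rho> = (let
      O\<^sub>k = (\<lambda>U. algebra_module (sec_ring S U) (scalar_section k S \<phi> U))
    in sheafification S
      \<lparr>sec = (\<lambda>U. tensor_module k (O\<^sub>k U) V (\<lambda>a b. a \<otimes>\<^bsub>sec_ring S U\<^esub> b)),
       mres = (\<lambda>U W. tensor_map k (O\<^sub>k W) V (ring_res S U W) id),
       act = (\<lambda>g U. tensor_map k (O\<^sub>k U) V id (\<rho> g))\<rparr>)"

text \<open>
  A module with action has type \<open>W\<close> if its generic stalk is isomorphic to the base change of
  \<open>W\<close> to the function field \<open>K\<close>.
\<close>

definition has_type ::
  "('k, 'c) ring_scheme \<Rightarrow> ('g, 'b) monoid_scheme \<Rightarrow> ('x, 'r) rspace
    \<Rightarrow> ('k set set \<Rightarrow> ('k set \<Rightarrow> ('k \<times> 'k) set) \<Rightarrow> 'r) \<Rightarrow> 'x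
    \<Rightarrow> ('x, 'r, 'm, 'g) gmsheaf \<Rightarrow> ('k, 'w, 'z) module_scheme \<Rightarrow> ('g \<Rightarrow> 'w \<Rightarrow> 'w) \<Rightarrow> bool"
  where "has_type k G S \<phi> \<epsilon> E W \<sigma> \<longleftrightarrow> (let
      K = ring_stalk S \<epsilon>;
      K\<^sub>k = algebra_module K
        (\<lambda>c. ring_germ S \<epsilon> (topspace (pts S)) (scalar_section k S \<phi> (topspace (pts S)) c));
      W\<^sub>K = tensor_module k K\<^sub>k W (\<lambda>a b. a \<otimes>\<^bsub>K\<^esub> b)
    in \<exists>h\<in>module_hom K (mod_stalk S E \<epsilon>) W\<^sub>K.
        bij_betw h (carrier (mod_stalk S E \<epsilon>)) (carrier W\<^sub>K)
        \<and> (\<forall>g\<in>carrier G. \<forall>m\<in>carrier (mod_stalk S E \<epsilon>).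
            h (stalk_act S E \<epsilon> g m) = tensor_map k K\<^sub>k W id (\<sigma> g) (h m)))"

definition mod_rank :: "('x, 'r) rspace \<Rightarrow> 'x \<Rightarrow> ('x, 'r, 'm, 'z) msheaf_scheme \<Rightarrow> nat"
  where "mod_rank S \<epsilon> M = vectorspace.dim (ring_stalk S \<epsilon>) (mod_stalk S M \<epsilon>)"

definition ring_char :: "('a, 'b) ring_scheme \<Rightarrow> nat"
  where "ring_char R =
    (if \<exists>n>0. add_pow R (n :: nat) \<one>\<^bsub>R\<^esub> = \<zero>\<^bsub>R\<^esub>
     then LEAST n :: nat. n > 0 \<and> add_pow R n \<one>\<^bsub>R\<^esub> = \<zero>\<^bsub>R\<^esub> else 0)"

end

theory Submission
  imports Defs
begin

text \<open>
  Let \<open>V\<close> be an irreducible subrepresentation of \<open>W\<close>. By the Schur orthogonality relations, certain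
  elements \<open>E\<^sub>i\<^sub>j\<close> of the group algebra, defined from the matrix coefficients of \<open>V\<close>, act as matrix
  units on every representation over \<open>k\<close>: on the sections of \<open>\<E>\<close>, on its generic stalk and on \<open>W\<close>.
  The central idempotent \<open>\<Sum>\<^sub>i E\<^sub>i\<^sub>i\<close> acts on the non-splitting module \<open>\<E>\<close> as zero or as the identity; it is
  not zero, because \<open>W\<close> embeds into the generic stalk and contains \<open>V\<close>. With \<open>\<F> = E\<^sub>0\<^sub>0 \<E>\<close>, the map
  \<open>m \<mapsto> \<Sum>\<^sub>i e\<^sub>i \<otimes> E\<^sub>0\<^sub>i m\<close> is then an isomorphism from \<open>\<E>\<close> to \<open>\<O>(V) \<otimes> \<F>\<close>, and a splitting of \<open>\<F>\<close>
  would induce one of \<open>\<E>\<close>. In the same way \<open>W\<close> is a sum of copies of \<open>V\<close>, whose number is the dimension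
  of \<open>E\<^sub>0\<^sub>0 W\<close>; the base change of this space to the function field is the generic stalk of \<open>\<F>\<close>.
\<close>

text \<open>The intrinsic candidate for F is the sheaf of equivariant maps from V to E. Taking F =
  E_00 E instead keeps everything inside E: the E_ij are finite k-linear combinations of group
  elements, so by \<open>munit_natural\<close> they commute with restriction, with germs and with
  the embedding of W into the generic stalk, and one computation serves all these places. The tensor
  products in the statement are sheafifications of presheaves; the presheaf for O(V) is free, and
  the one for O(V) \<otimes> F is isomorphic to the sheaf E, so both are sheaves already and the
  maps to their sheafifications are isomorphisms. The division by the order of G hides in
  \<open>\<mu>\<close>: if \<open>s0\<close> is the common value of the sums over g of A_ia(g)
  A_ai(g^-1), then n s0 = |G|, which is nonzero in k. At the start W is not known to have finite
  dimension; that and the injectivity of W into the generic stalk are obtained by extending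
  functionals from W to the generic stalk. Coherence enters through the finite dimension of W and,
  with torsion-freeness, through the nonvanishing of the generic stalk.\<close>

section \<open>Additive maps and finite sums\<close>

text \<open>Restriction maps, tensor products and base changes go between modules over different
  rings, where linearity has no single meaning. Additivity is what it takes to pass through a finite
  sum.\<close>

definition additive_map :: "('a, 'c) ring_scheme \<Rightarrow> ('b, 'd) ring_scheme \<Rightarrow> ('a \<Rightarrow> 'b) \<Rightarrow> bool"
  where "additive_map A B f \<longleftrightarrow> f \<in> carrier A \<rightarrow> carrier B
    \<and> (\<forall>x\<in>carrier A. \<forall>y\<in>carrier A. f (x \<oplus>\<^bsub>A\<^esub> y) = f x \<oplus>\<^bsub>B\<^esub> f y)"

lemma additive_closed: "additive_map A B f \<Longrightarrow> x \<in> carrier A \<Longrightarrow> f x \<in> carrier B"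
  by (auto simp: additive_map_def)

lemma additive_add:
  "additive_map A B f \<Longrightarrow> x \<in> carrier A \<Longrightarrow> y \<in> carrier A \<Longrightarrow> f (x \<oplus>\<^bsub>A\<^esub> y) = f x \<oplus>\<^bsub>B\<^esub> f y"
  by (auto simp: additive_map_def)

lemma additive_zero:
  assumes "abelian_group A" "abelian_group B" "additive_map A B f"
  shows "f \<zero>\<^bsub>A\<^esub> = \<zero>\<^bsub>B\<^esub>"
proof -
  interpret A: abelian_group A by fact
  interpret B: abelian_group B by fact
  have c: "f \<zero>\<^bsub>A\<^esub> \<in> carrier B" using assms(3) by (auto intro: additive_closed)
  have "f \<zero>\<^bsub>A\<^esub> \<oplus>\<^bsub>B\<^esub> f \<zero>\<^bsub>A\<^esub> = f \<zero>\<^bsub>A\<^esub> \<oplus>\<^bsub>B\<^esub> \<zero>\<^bsub>B\<^esub>"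
    using additive_add[OF assms(3), of "\<zero>\<^bsub>A\<^esub>" "\<zero>\<^bsub>A\<^esub>"] c by simp
  then show ?thesis using c by (simp only: B.add.l_cancel B.zero_closed)
qed

lemma additive_finsum:
  assumes "abelian_group A" "abelian_group B" "additive_map A B f" "g \<in> I \<rightarrow> carrier A"
  shows "f (\<Oplus>\<^bsub>A\<^esub>i\<in>I. g i) = (\<Oplus>\<^bsub>B\<^esub>i\<in>I. f (g i))"
proof -
  interpret A: abelian_group A by fact
  interpret B: abelian_group B by fact
  note z = additive_zero[OF assms(1-3)]
  show ?thesis using assms(4)
  \<comment> \<open>\<open>finsum\<close> over an infinite index set is zero by convention, so that
    case is preservation of zero.\<close>
  proof (induction I rule: infinite_finite_induct)
    case (insert i I)
    then show ?case
      using assms(3) by (simp add: additive_add Pi_iff additive_closed)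
  qed (simp_all add: z)
qed

lemma additive_compose:
  "additive_map A B f \<Longrightarrow> additive_map B C g \<Longrightarrow> additive_map A C (\<lambda>x. g (f x))"
  unfolding additive_map_def by (simp add: Pi_iff)

lemma additive_finsum_fun:
  assumes "abelian_group B" "\<And>i. i \<in> I \<Longrightarrow> additive_map A B (f i)"
  shows "additive_map A B (\<lambda>x. \<Oplus>\<^bsub>B\<^esub>i\<in>I. f i x)"
proof -
  interpret B: abelian_group B by fact
  show ?thesis unfolding additive_map_def
  proof (intro conjI ballI funcsetI)
    fix x assume "x \<in> carrier A"
    then show "(\<Oplus>\<^bsub>B\<^esub>i\<in>I. f i x) \<in> carrier B"
      using assms(2) by (auto intro!: B.finsum_closed simp: additive_map_def)
  next
    fix x y assume xy: "x \<in> carrier A" "y \<in> carrier A"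
    have "(\<Oplus>\<^bsub>B\<^esub>i\<in>I. f i (x \<oplus>\<^bsub>A\<^esub> y)) = (\<Oplus>\<^bsub>B\<^esub>i\<in>I. f i x \<oplus>\<^bsub>B\<^esub> f i y)"
      using xy assms(2) by (intro B.finsum_cong') (auto simp: additive_map_def Pi_iff)
    also have "\<dots> = (\<Oplus>\<^bsub>B\<^esub>i\<in>I. f i x) \<oplus>\<^bsub>B\<^esub> (\<Oplus>\<^bsub>B\<^esub>i\<in>I. f i y)"
      using xy assms(2) by (intro B.finsum_addf) (auto simp: additive_map_def Pi_iff)
    finally show "(\<Oplus>\<^bsub>B\<^esub>i\<in>I. f i (x \<oplus>\<^bsub>A\<^esub> y)) = (\<Oplus>\<^bsub>B\<^esub>i\<in>I. f i x) \<oplus>\<^bsub>B\<^esub> (\<Oplus>\<^bsub>B\<^esub>i\<in>I. f i y)" .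
  qed
qed

lemma (in abelian_group) finsum_swap:
  assumes "finite I" "finite J" "\<And>i j. i \<in> I \<Longrightarrow> j \<in> J \<Longrightarrow> f i j \<in> carrier G"
  shows "(\<Oplus>i\<in>I. \<Oplus>j\<in>J. f i j) = (\<Oplus>j\<in>J. \<Oplus>i\<in>I. f i j)"
  using assms(1,3)
proof (induction I rule: finite_induct)
  case empty
  then show ?case by simp
next
  case (insert x I)
  have "(\<Oplus>i\<in>insert x I. \<Oplus>j\<in>J. f i j) = (\<Oplus>j\<in>J. f x j) \<oplus> (\<Oplus>j\<in>J. \<Oplus>i\<in>I. f i j)"
    using insert by (subst finsum_insert) auto
  also have "\<dots> = (\<Oplus>j\<in>J. f x j \<oplus> (\<Oplus>i\<in>I. f i j))"
    using insert by (subst finsum_addf) (auto simp: Pi_iff)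
  also have "\<dots> = (\<Oplus>j\<in>J. \<Oplus>i\<in>insert x I. f i j)"
    using insert by (intro finsum_cong') auto
  finally show ?case .
qed

lemma (in abelian_group) finsum_delta:
  assumes "finite I" "i \<in> I" "f i \<in> carrier G"
  shows "(\<Oplus>j\<in>I. if j = i then f j else \<zero>) = f i"
proof -
  have "(\<Oplus>j\<in>I. if j = i then f j else \<zero>) = (\<Oplus>j\<in>I. if i = j then (if j = i then f j else \<zero>) else \<zero>)"
    using assms by (intro finsum_cong') (auto split: if_splits)
  also have "\<dots> = f i" using assms by (subst finsum_singleton) (auto split: if_splits)
  finally show ?thesis .
qed

lemma module_homI:
  assumes "additive_map M N f" "\<And>r m. r \<in> carrier R \<Longrightarrow> m \<in> carrier M \<Longrightarrow> f (r \<odot>\<^bsub>M\<^esub> m) = r \<odot>\<^bsub>N\<^esub> f m"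
  shows "f \<in> module_hom R M N"
  using assms by (auto simp: additive_map_def module_hom_def)

lemma module_hom_apply: "f \<in> module_hom R M N \<Longrightarrow> x \<in> carrier M \<Longrightarrow> f x \<in> carrier N"
  using module_hom_closed by (rule funcset_mem)

lemma module_hom_additive: "f \<in> module_hom R M N \<Longrightarrow> additive_map M N f"
  by (auto simp: additive_map_def module_hom_def)

lemma additive_smult: "module R M \<Longrightarrow> a \<in> carrier R \<Longrightarrow> additive_map M M (\<lambda>m. a \<odot>\<^bsub>M\<^esub> m)"
  by (auto simp: additive_map_def module.smult_closed module.smult_r_distr)

lemma additive_smult_left: "module R M \<Longrightarrow> m \<in> carrier M \<Longrightarrow> additive_map R M (\<lambda>a. a \<odot>\<^bsub>M\<^esub> m)"
  by (auto simp: additive_map_def module.smult_closed module.smult_l_distr)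

section \<open>Bases\<close>

text \<open>A basis comes with its coordinate functionals \<open>c\<close>. This form makes sense
  over any commutative ring, hence over rings of sections, and passes through isomorphisms and base
  change without an argument about linear independence, which is encoded in
  \<open>c_b\<close>.\<close>

locale coord_basis = module R M for R (structure) and M (structure) +
  fixes n :: nat and b c
  assumes b_closed: "i < n \<Longrightarrow> b i \<in> carrier M"
    and c_hom: "i < n \<Longrightarrow> c i \<in> carrier M \<rightarrow> carrier R"
    and c_add: "\<lbrakk>i < n; x \<in> carrier M; y \<in> carrier M\<rbrakk> \<Longrightarrow> c i (x \<oplus>\<^bsub>M\<^esub> y) = c i x \<oplus> c i y"
    and c_smult: "\<lbrakk>i < n; a \<in> carrier R; x \<in> carrier M\<rbrakk> \<Longrightarrow> c i (a \<odot>\<^bsub>M\<^esub> x) = a \<otimes> c i x"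
    and c_b: "\<lbrakk>i < n; j < n\<rbrakk> \<Longrightarrow> c i (b j) = (if i = j then \<one> else \<zero>)"
    and expand: "x \<in> carrier M \<Longrightarrow> x = (\<Oplus>\<^bsub>M\<^esub>i\<in>{..<n}. c i x \<odot>\<^bsub>M\<^esub> b i)"
begin

lemma c_closed: "i < n \<Longrightarrow> x \<in> carrier M \<Longrightarrow> c i x \<in> carrier R"
  using c_hom by auto

lemma c_additive: "i < n \<Longrightarrow> additive_map M R (c i)"
  using c_hom c_add by (auto simp: additive_map_def)

lemma c_lincomb:
  assumes "i < n" "a \<in> {..<n} \<rightarrow> carrier R"
  shows "c i (\<Oplus>\<^bsub>M\<^esub>j\<in>{..<n}. a j \<odot>\<^bsub>M\<^esub> b j) = a i"
proof -
  have "c i (\<Oplus>\<^bsub>M\<^esub>j\<in>{..<n}. a j \<odot>\<^bsub>M\<^esub> b j) = (\<Oplus>j\<in>{..<n}. c i (a j \<odot>\<^bsub>M\<^esub> b j))"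
    using assms b_closed by (intro additive_finsum[OF M.abelian_group_axioms R.abelian_group_axioms c_additive]) auto
  also have "\<dots> = (\<Oplus>j\<in>{..<n}. if j = i then a j else \<zero>)"
    using assms b_closed by (intro R.finsum_cong') (auto simp: c_smult c_b Pi_iff)
  also have "\<dots> = a i" using assms by (intro R.finsum_delta) auto
  finally show ?thesis .
qed

lemma lincomb_closed':
  "a \<in> {..<n} \<rightarrow> carrier R \<Longrightarrow> (\<Oplus>\<^bsub>M\<^esub>j\<in>{..<n}. a j \<odot>\<^bsub>M\<^esub> b j) \<in> carrier M"
  using b_closed by (auto intro!: M.finsum_closed)

end

lemma (in vectorspace) coord_basis_exists:
  assumes fin_dim
  obtains n b c where "coord_basis K V n b c" "b ` {..<n} \<subseteq> carrier V"
proof -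
  obtain B where B: "finite B" "basis B" using finite_basis_exists[OF assms] by blast
  then have BV: "B \<subseteq> carrier V" by (simp add: basis_def)
  define n where "n = card B"
  obtain b where b: "bij_betw b {..<n} B"
    using B(1) unfolding n_def by (metis bij_betw_from_nat_into_finite)
  have uniq: "\<exists>!a. a \<in> B \<rightarrow>\<^sub>E carrier K \<and> lincomb a B = v" if "v \<in> carrier V" for v
    using basis_criterion[OF B(1) BV] B(2) that by blast
  \<comment> \<open>Coefficient functions are unique because they are taken to be extensional on
    B.\<close>
  define d where "d v = (THE a. a \<in> B \<rightarrow>\<^sub>E carrier K \<and> lincomb a B = v)" for v
  have d: "d v \<in> B \<rightarrow>\<^sub>E carrier K" "lincomb (d v) B = v" if "v \<in> carrier V" for v
    using theI'[OF uniq[OF that]] unfolding d_def by auto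
  have dI: "d v = restrict a B" if "a \<in> B \<rightarrow> carrier K" "lincomb a B = v" for a v
  proof -
    have v: "v \<in> carrier V" using that BV by auto
    have "lincomb (restrict a B) B = v"
      using that BV by (subst that(2)[symmetric], intro lincomb_cong) auto
    then show ?thesis using uniq[OF v] d[OF v] that by (metis restrict_PiE_iff Pi_mem)
  qed
  have bB: "b i \<in> B" if "i < n" for i using b that by (auto simp: bij_betw_def)
  have sum: "(\<Oplus>\<^bsub>V\<^esub>i\<in>{..<n}. f (b i)) = (\<Oplus>\<^bsub>V\<^esub>v\<in>B. f v)" if "f \<in> B \<rightarrow> carrier V" for f
    using finsum_reindex[of f b "{..<n}"] b that by (auto simp: bij_betw_def)
  have "coord_basis K V n b (\<lambda>i v. d v (b i))"
  proof unfold_locales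
    fix i assume i: "i < n"
    show "b i \<in> carrier V" using bB[OF i] BV by auto
    show "(\<lambda>v. d v (b i)) \<in> carrier V \<rightarrow> carrier K" using d(1) bB[OF i] by blast
    show "d (x \<oplus>\<^bsub>V\<^esub> y) (b i) = d x (b i) \<oplus>\<^bsub>K\<^esub> d y (b i)"
      if "x \<in> carrier V" "y \<in> carrier V" for x y
    proof -
      have "lincomb (\<lambda>v. d x v \<oplus>\<^bsub>K\<^esub> d y v) B = lincomb (d x) B \<oplus>\<^bsub>V\<^esub> lincomb (d y) B"
        using d(1)[OF that(1)] d(1)[OF that(2)] by (intro lincomb_sum[OF B(1) BV]) auto
      then have "d (x \<oplus>\<^bsub>V\<^esub> y) = restrict (\<lambda>v. d x v \<oplus>\<^bsub>K\<^esub> d y v) B"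
        using d[OF that(1)] d[OF that(2)] by (intro dI) (auto simp: PiE_iff)
      then show ?thesis using bB[OF i] by simp
    qed
    show "d (a \<odot>\<^bsub>V\<^esub> x) (b i) = a \<otimes>\<^bsub>K\<^esub> d x (b i)" if "a \<in> carrier K" "x \<in> carrier V" for a x
    proof -
      have "lincomb (\<lambda>v. a \<otimes>\<^bsub>K\<^esub> d x v) B = a \<odot>\<^bsub>V\<^esub> lincomb (d x) B"
        using d(1)[OF that(2)] that by (intro lincomb_smult[OF BV]) auto
      then have "d (a \<odot>\<^bsub>V\<^esub> x) = restrict (\<lambda>v. a \<otimes>\<^bsub>K\<^esub> d x v) B"
        using d[OF that(2)] that by (intro dI) (auto simp: PiE_iff)
      then show ?thesis using bB[OF i] by simp
    qed
    show "d (b j) (b i) = (if i = j then \<one>\<^bsub>K\<^esub> else \<zero>\<^bsub>K\<^esub>)" if j: "j < n" for j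
    proof -
      have "lincomb (\<lambda>v. if v = b j then \<one>\<^bsub>K\<^esub> else \<zero>\<^bsub>K\<^esub>) B
          = (\<Oplus>\<^bsub>V\<^esub>v\<in>B. if v = b j then v else \<zero>\<^bsub>V\<^esub>)"
        unfolding lincomb_def using BV by (intro finsum_cong') auto
      also have "\<dots> = b j" using finsum_delta[OF B(1) bB[OF j], of "\<lambda>v. v"] bB[OF j] BV by auto
      finally have "d (b j) = restrict (\<lambda>v. if v = b j then \<one>\<^bsub>K\<^esub> else \<zero>\<^bsub>K\<^esub>) B"
        by (intro dI) auto
      then show ?thesis using bB[OF i] b i j by (auto simp: bij_betw_def inj_on_def)
    qed
  next
    fix x assume x: "x \<in> carrier V"
    have "(\<lambda>v. d x v \<odot>\<^bsub>V\<^esub> v) \<in> B \<rightarrow> carrier V" using d(1)[OF x] BV by auto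
    then show "x = (\<Oplus>\<^bsub>V\<^esub>i\<in>{..<n}. d x (b i) \<odot>\<^bsub>V\<^esub> b i)"
      using sum[of "\<lambda>v. d x v \<odot>\<^bsub>V\<^esub> v"] d[OF x] BV by (auto simp: lincomb_def PiE_iff)
  qed
  then show thesis using that bB BV by blast
qed

text \<open>Applying \<open>c i\<close> to a vanishing combination isolates its i-th coefficient,
  which gives independence, and \<open>expand\<close> gives spanning.\<close>

lemma (in vectorspace) coord_basis_dim:
  assumes "coord_basis K V n b c"
  shows "dim = n"
proof -
  interpret coord_basis K V n b c by fact
  have inj: "inj_on b {..<n}"
  proof (rule inj_onI)
    fix i j assume ij: "i \<in> {..<n}" "j \<in> {..<n}" "b i = b j"
    then have "c i (b i) = c i (b j)" by simp
    then show "i = j" using ij c_b by (metis one_not_zero lessThan_iff)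
  qed
  have sub: "b ` {..<n} \<subseteq> carrier V" using b_closed by auto
  have lc: "lincomb a (b ` {..<n}) = (\<Oplus>\<^bsub>V\<^esub>i\<in>{..<n}. a (b i) \<odot>\<^bsub>V\<^esub> b i)"
    if "a \<in> b ` {..<n} \<rightarrow> carrier K" for a
    unfolding lincomb_def using inj that b_closed by (intro finsum_reindex) auto
  have "basis (b ` {..<n})"
    unfolding basis_def
  proof (intro conjI sub)
    show "lin_indpt (b ` {..<n})"
    proof (rule finite_lin_indpt2[OF _ sub])
      fix a assume a: "a \<in> b ` {..<n} \<rightarrow> carrier K" "lincomb a (b ` {..<n}) = \<zero>\<^bsub>V\<^esub>"
      have "a (b i) = \<zero>\<^bsub>K\<^esub>" if i: "i < n" for i
      proof -
        have "a (b i) = c i (\<Oplus>\<^bsub>V\<^esub>i\<in>{..<n}. a (b i) \<odot>\<^bsub>V\<^esub> b i)"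
          using i a by (subst c_lincomb) auto
        also have "\<dots> = c i \<zero>\<^bsub>V\<^esub>" using a lc[OF a(1)] by simp
        also have "\<dots> = \<zero>\<^bsub>K\<^esub>"
          using additive_zero[OF M.abelian_group_axioms R.abelian_group_axioms c_additive[OF i]] .
        finally show ?thesis .
      qed
      then show "\<forall>v\<in>b ` {..<n}. a v = \<zero>\<^bsub>K\<^esub>" by auto
    qed auto
    have "x \<in> span (b ` {..<n})" if x: "x \<in> carrier V" for x
    proof -
      define a where "a v = c (the_inv_into {..<n} b v) x" for v
      have ab: "a (b i) = c i x" if "i < n" for i
        using that inj by (simp add: a_def the_inv_into_f_f)
      have a: "a \<in> b ` {..<n} \<rightarrow> carrier K" using ab c_closed x by auto
      have "x = (\<Oplus>\<^bsub>V\<^esub>i\<in>{..<n}. c i x \<odot>\<^bsub>V\<^esub> b i)" by (rule expand[OF x])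
      also have "\<dots> = lincomb a (b ` {..<n})"
        using lc[OF a] ab b_closed c_closed x by (simp, intro finsum_cong') auto
      finally show ?thesis unfolding span_def using a by blast
    qed
    then show "span (b ` {..<n}) = carrier V" using span_is_subset2[OF sub] by blast
  qed
  then have "dim = card (b ` {..<n})" by (intro dim_basis) auto
  then show ?thesis by (simp add: card_image[OF inj])
qed

text \<open>Zorn's lemma yields a submodule M maximal among those that contain H and miss w. Then V
  is the direct sum of M and the line through w, and the functional is the coefficient of w. The
  dimension is unrestricted, since this is applied to the type W before its finite dimension is
  established.\<close>

lemma (in vectorspace) separating_functional:
  assumes H: "VectorSpace.subspace K H V" and w: "w \<in> carrier V" "w \<notin> H"
  obtains l where "additive_map V K l" "\<And>a x. a \<in> carrier K \<Longrightarrow> x \<in> carrier V \<Longrightarrow> l (a \<odot>\<^bsub>V\<^esub> x) = a \<otimes>\<^bsub>K\<^esub> l x"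
    "l w = \<one>\<^bsub>K\<^esub>" "\<And>h. h \<in> H \<Longrightarrow> l h = \<zero>\<^bsub>K\<^esub>"
proof -
  define A where "A = {N. submodule K N V \<and> H \<subseteq> N \<and> w \<notin> N}"
  have "\<exists>M\<in>A. \<forall>Q\<in>A. M \<subseteq> Q \<longrightarrow> Q = M"
  proof (rule subset_Zorn_nonempty)
    have "H \<in> A" using H w by (auto simp: A_def subspace_def)
    then show "A \<noteq> {}" by blast
    fix C assume C: "C \<noteq> {}" "subset.chain A C"
    then have CA: "C \<subseteq> A" and tot: "\<And>Q Y. Q \<in> C \<Longrightarrow> Y \<in> C \<Longrightarrow> Q \<subseteq> Y \<or> Y \<subseteq> Q"
      by (auto simp: subset_chain_def)
    have sub: "N \<subseteq> carrier V" "\<zero>\<^bsub>V\<^esub> \<in> N" "\<And>x y. x \<in> N \<Longrightarrow> y \<in> N \<Longrightarrow> x \<oplus>\<^bsub>V\<^esub> y \<in> N"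
      "\<And>a x. a \<in> carrier K \<Longrightarrow> x \<in> N \<Longrightarrow> a \<odot>\<^bsub>V\<^esub> x \<in> N" if "N \<in> C" for N
      using that CA by (auto simp: A_def submodule_def)
    have "submodule K (\<Union>C) V"
      unfolding submodule_def
    proof (intro conjI allI impI)
      show "Module.module K V" by (rule module_axioms)
      show "\<Union>C \<subseteq> carrier V" using sub(1) by blast
      show "\<zero>\<^bsub>V\<^esub> \<in> \<Union>C" using C(1) sub(2) by blast
      show "x \<oplus>\<^bsub>V\<^esub> y \<in> \<Union>C" if xy: "x \<in> \<Union>C" "y \<in> \<Union>C" for x y
      proof -
        obtain Q Y where "Q \<in> C" "Y \<in> C" "x \<in> Q" "y \<in> Y" using xy by blast
        then obtain Z where "Z \<in> C" "x \<in> Z" "y \<in> Z" using tot by blast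
        then show ?thesis using sub(3) by blast
      qed
      show "a \<odot>\<^bsub>V\<^esub> x \<in> \<Union>C" if "a \<in> carrier K" "x \<in> \<Union>C" for a x
        using that sub(4) by blast
    qed
    moreover obtain N where "N \<in> C" using C(1) by blast
    then have "H \<subseteq> \<Union>C" using CA by (auto simp: A_def)
    moreover have "w \<notin> \<Union>C" using CA by (auto simp: A_def)
    ultimately show "\<Union>C \<in> A" by (simp add: A_def)
  qed
  then obtain M where MA: "M \<in> A" and maxA: "\<And>Q. Q \<in> A \<Longrightarrow> M \<subseteq> Q \<Longrightarrow> Q = M" by blast
  then have M: "submodule K M V" "H \<subseteq> M" "w \<notin> M" by (auto simp: A_def)
  have max: "Q = M" if "submodule K Q V" "M \<subseteq> Q" "w \<notin> Q" for Q
    using that M(2) by (intro maxA) (auto simp: A_def)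
  have Mc: "x \<in> carrier V" if "x \<in> M" for x using that M(1) by (auto simp: submodule_def)
  have Ma: "x \<oplus>\<^bsub>V\<^esub> y \<in> M" if "x \<in> M" "y \<in> M" for x y using that M(1) by (auto simp: submodule_def)
  have Ms: "a \<odot>\<^bsub>V\<^esub> x \<in> M" if "a \<in> carrier K" "x \<in> M" for a x using that M(1) by (auto simp: submodule_def)
  have M0: "\<zero>\<^bsub>V\<^esub> \<in> M" using M(1) by (auto simp: submodule_def)
  have Mn: "\<ominus>\<^bsub>V\<^esub> x \<in> M" if "x \<in> M" for x
    using Ms[of "\<ominus>\<^bsub>K\<^esub> \<one>\<^bsub>K\<^esub>" x] that Mc[OF that] by (simp add: smult_minus_1)
  \<comment> \<open>For x outside M the larger submodule M + K x contains w by maximality. The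
    coefficient of x in w is nonzero because w is not in M, so the relation can be solved for
    x.\<close>
  have ex: "\<exists>a\<in>carrier K. \<exists>m\<in>M. x = m \<oplus>\<^bsub>V\<^esub> a \<odot>\<^bsub>V\<^esub> w" if x: "x \<in> carrier V" for x
  proof (cases "x \<in> M")
    case True
    then show ?thesis using w Mc by (intro bexI[of _ "\<zero>\<^bsub>K\<^esub>"] bexI[of _ x]) auto
  next
    case False
    define Q where "Q = {m \<oplus>\<^bsub>V\<^esub> a \<odot>\<^bsub>V\<^esub> x | m a. m \<in> M \<and> a \<in> carrier K}"
    have "submodule K Q V"
      unfolding submodule_def
    proof (intro conjI allI impI)
      show "Module.module K V" by (rule module_axioms)
      show "Q \<subseteq> carrier V" using x Mc by (auto simp: Q_def)
      have "\<zero>\<^bsub>V\<^esub> \<oplus>\<^bsub>V\<^esub> \<zero>\<^bsub>K\<^esub> \<odot>\<^bsub>V\<^esub> x \<in> Q" using M0 unfolding Q_def by blast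
      then show "\<zero>\<^bsub>V\<^esub> \<in> Q" using x by simp
      show "y \<oplus>\<^bsub>V\<^esub> z \<in> Q" if yz: "y \<in> Q" "z \<in> Q" for y z
      proof -
        obtain m a m' a' where e: "m \<in> M" "a \<in> carrier K" "m' \<in> M" "a' \<in> carrier K"
          "y = m \<oplus>\<^bsub>V\<^esub> a \<odot>\<^bsub>V\<^esub> x" "z = m' \<oplus>\<^bsub>V\<^esub> a' \<odot>\<^bsub>V\<^esub> x" using yz unfolding Q_def by blast
        then have "y \<oplus>\<^bsub>V\<^esub> z = (m \<oplus>\<^bsub>V\<^esub> m') \<oplus>\<^bsub>V\<^esub> (a \<oplus>\<^bsub>K\<^esub> a') \<odot>\<^bsub>V\<^esub> x"
          using x Mc by (simp add: smult_l_distr M.a_ac)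
        then show ?thesis using e Ma unfolding Q_def by blast
      qed
      show "d \<odot>\<^bsub>V\<^esub> y \<in> Q" if dy: "d \<in> carrier K" "y \<in> Q" for d y
      proof -
        obtain m a where e: "m \<in> M" "a \<in> carrier K" "y = m \<oplus>\<^bsub>V\<^esub> a \<odot>\<^bsub>V\<^esub> x" using dy unfolding Q_def by blast
        then have "d \<odot>\<^bsub>V\<^esub> y = d \<odot>\<^bsub>V\<^esub> m \<oplus>\<^bsub>V\<^esub> (d \<otimes>\<^bsub>K\<^esub> a) \<odot>\<^bsub>V\<^esub> x"
          using x Mc dy by (simp add: smult_r_distr smult_assoc1)
        then show ?thesis using e Ms dy unfolding Q_def by blast
      qed
    qed
    moreover have "M \<subseteq> Q"
    proof
      fix m assume m: "m \<in> M"
      then have "m = m \<oplus>\<^bsub>V\<^esub> \<zero>\<^bsub>K\<^esub> \<odot>\<^bsub>V\<^esub> x" using x Mc by simp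
      then show "m \<in> Q" using m unfolding Q_def by blast
    qed
    moreover have "x \<in> Q"
    proof -
      have "x = \<zero>\<^bsub>V\<^esub> \<oplus>\<^bsub>V\<^esub> \<one>\<^bsub>K\<^esub> \<odot>\<^bsub>V\<^esub> x" using x by simp
      then show ?thesis using M0 unfolding Q_def by blast
    qed
    ultimately have "w \<in> Q" using max False by blast
    then obtain m a where e: "m \<in> M" "a \<in> carrier K" "w = m \<oplus>\<^bsub>V\<^esub> a \<odot>\<^bsub>V\<^esub> x" unfolding Q_def by blast
    have "a \<noteq> \<zero>\<^bsub>K\<^esub>" using e M(3) x Mc by auto
    then have ia: "inv\<^bsub>K\<^esub> a \<in> carrier K" "inv\<^bsub>K\<^esub> a \<otimes>\<^bsub>K\<^esub> a = \<one>\<^bsub>K\<^esub>" using e by (auto simp: field_Units)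
    have "(\<ominus>\<^bsub>V\<^esub> (inv\<^bsub>K\<^esub> a \<odot>\<^bsub>V\<^esub> m)) \<oplus>\<^bsub>V\<^esub> inv\<^bsub>K\<^esub> a \<odot>\<^bsub>V\<^esub> w
        = (\<ominus>\<^bsub>V\<^esub> (inv\<^bsub>K\<^esub> a \<odot>\<^bsub>V\<^esub> m)) \<oplus>\<^bsub>V\<^esub> (inv\<^bsub>K\<^esub> a \<odot>\<^bsub>V\<^esub> m \<oplus>\<^bsub>V\<^esub> (inv\<^bsub>K\<^esub> a \<otimes>\<^bsub>K\<^esub> a) \<odot>\<^bsub>V\<^esub> x)"
      using e ia(1) x Mc by (simp add: smult_r_distr smult_assoc1)
    also have "\<dots> = x" using e ia x Mc by (simp add: M.a_assoc[symmetric] M.l_neg)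
    finally show ?thesis using ia(1) Mn[OF Ms[OF ia(1) e(1)]] by metis
  qed
  \<comment> \<open>Two different coefficients would put a nonzero multiple of w, hence w itself,
    into M.\<close>
  have uniq: "a = a'" if e: "a \<in> carrier K" "a' \<in> carrier K" "m \<in> M" "m' \<in> M"
    "m \<oplus>\<^bsub>V\<^esub> a \<odot>\<^bsub>V\<^esub> w = m' \<oplus>\<^bsub>V\<^esub> a' \<odot>\<^bsub>V\<^esub> w" for a a' m m'
  proof (rule ccontr)
    assume ne: "a \<noteq> a'"
    define d where "d = a \<oplus>\<^bsub>K\<^esub> \<ominus>\<^bsub>K\<^esub> a'"
    have d: "d \<in> carrier K" "d \<noteq> \<zero>\<^bsub>K\<^esub>"
      using ne e by (auto simp: d_def) (metis R.minus_equality R.minus_minus R.a_inv_closed)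
    have "d \<odot>\<^bsub>V\<^esub> w = \<ominus>\<^bsub>V\<^esub> m \<oplus>\<^bsub>V\<^esub> (m \<oplus>\<^bsub>V\<^esub> a \<odot>\<^bsub>V\<^esub> w) \<oplus>\<^bsub>V\<^esub> \<ominus>\<^bsub>V\<^esub> (a' \<odot>\<^bsub>V\<^esub> w)"
      using e(1-4) w Mc by (simp add: d_def smult_l_distr smult_l_minus M.a_assoc[symmetric] M.l_neg)
    also have "\<dots> = \<ominus>\<^bsub>V\<^esub> m \<oplus>\<^bsub>V\<^esub> m'"
      unfolding e(5) using e w Mc by (simp add: M.a_assoc M.r_neg)
    finally have dM: "d \<odot>\<^bsub>V\<^esub> w \<in> M" using e Ma Mn by simp
    have ia: "inv\<^bsub>K\<^esub> d \<in> carrier K" "inv\<^bsub>K\<^esub> d \<otimes>\<^bsub>K\<^esub> d = \<one>\<^bsub>K\<^esub>" using d by (auto simp: field_Units)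
    have "inv\<^bsub>K\<^esub> d \<odot>\<^bsub>V\<^esub> (d \<odot>\<^bsub>V\<^esub> w) = w" using ia d w by (simp add: smult_assoc1[symmetric])
    then show False using Ms[OF ia(1) dM] M(3) by simp
  qed
  define l where "l x = (THE a. a \<in> carrier K \<and> (\<exists>m\<in>M. x = m \<oplus>\<^bsub>V\<^esub> a \<odot>\<^bsub>V\<^esub> w))" for x
  have lI: "l (m \<oplus>\<^bsub>V\<^esub> a \<odot>\<^bsub>V\<^esub> w) = a" if "m \<in> M" "a \<in> carrier K" for m a
    unfolding l_def using that uniq by (intro the_equality) blast+
  show thesis
  proof (rule that)
    show "additive_map V K l" unfolding additive_map_def
    proof (intro conjI ballI funcsetI)
      fix x assume "x \<in> carrier V"
      then show "l x \<in> carrier K" using ex lI by metis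
      fix y assume "y \<in> carrier V"
      with \<open>x \<in> carrier V\<close> obtain m a m' a' where e: "m \<in> M" "a \<in> carrier K" "m' \<in> M" "a' \<in> carrier K"
          "x = m \<oplus>\<^bsub>V\<^esub> a \<odot>\<^bsub>V\<^esub> w" "y = m' \<oplus>\<^bsub>V\<^esub> a' \<odot>\<^bsub>V\<^esub> w" using ex by meson
      then have "x \<oplus>\<^bsub>V\<^esub> y = (m \<oplus>\<^bsub>V\<^esub> m') \<oplus>\<^bsub>V\<^esub> (a \<oplus>\<^bsub>K\<^esub> a') \<odot>\<^bsub>V\<^esub> w"
        using w Mc by (simp add: smult_l_distr M.a_ac)
      then show "l (x \<oplus>\<^bsub>V\<^esub> y) = l x \<oplus>\<^bsub>K\<^esub> l y" using e lI Ma by simp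
    qed
    fix d x assume dx: "d \<in> carrier K" "x \<in> carrier V"
    then obtain m a where e: "m \<in> M" "a \<in> carrier K" "x = m \<oplus>\<^bsub>V\<^esub> a \<odot>\<^bsub>V\<^esub> w" using ex by meson
    then have "d \<odot>\<^bsub>V\<^esub> x = d \<odot>\<^bsub>V\<^esub> m \<oplus>\<^bsub>V\<^esub> (d \<otimes>\<^bsub>K\<^esub> a) \<odot>\<^bsub>V\<^esub> w"
      using w Mc dx by (simp add: smult_r_distr smult_assoc1)
    then show "l (d \<odot>\<^bsub>V\<^esub> x) = d \<otimes>\<^bsub>K\<^esub> l x" using e dx lI Ms by simp
  next
    show "l w = \<one>\<^bsub>K\<^esub>" using lI[OF M0, of "\<one>\<^bsub>K\<^esub>"] w by simp
    fix h assume "h \<in> H"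
    then show "l h = \<zero>\<^bsub>K\<^esub>" using lI[of h "\<zero>\<^bsub>K\<^esub>"] M(2) w Mc by auto
  qed
qed

section \<open>Eigenvalues and Schur's lemma\<close>

text \<open>The vector p(T) v. Coefficients run from the highest degree down, as in the polynomials
  of \<open>eval\<close> and \<open>roots\<close>, so that a root of p in K can be used to factor
  p(T).\<close>

fun poly_op :: "('k, 'v, 'z) module_scheme \<Rightarrow> ('v \<Rightarrow> 'v) \<Rightarrow> 'k list \<Rightarrow> 'v \<Rightarrow> 'v"
  where "poly_op V T [] v = \<zero>\<^bsub>V\<^esub>"
  | "poly_op V T (c # p) v = c \<odot>\<^bsub>V\<^esub> (T ^^ length p) v \<oplus>\<^bsub>V\<^esub> poly_op V T p v"

locale endomorphism = vectorspace K V for K V +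
  fixes T
  assumes T_hom: "T \<in> module_hom K V V"
begin

lemma T_closed: "v \<in> carrier V \<Longrightarrow> T v \<in> carrier V"
  using T_hom by (auto simp: module_hom_def)

lemma T_pow_closed: "v \<in> carrier V \<Longrightarrow> (T ^^ i) v \<in> carrier V"
  by (induction i) (auto intro: T_closed)

lemma map2_closed:
  "length p = length q \<Longrightarrow> set p \<subseteq> carrier K \<Longrightarrow> set q \<subseteq> carrier K \<Longrightarrow> set (map2 (\<oplus>\<^bsub>K\<^esub>) p q) \<subseteq> carrier K"
  by (induction p q rule: list_induct2) auto

lemma poly_op_closed: "set p \<subseteq> carrier K \<Longrightarrow> v \<in> carrier V \<Longrightarrow> poly_op V T p v \<in> carrier V"
  by (induction p) (auto intro: T_pow_closed)

lemma poly_op_add: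
  "length p = length q \<Longrightarrow> set p \<subseteq> carrier K \<Longrightarrow> set q \<subseteq> carrier K \<Longrightarrow> v \<in> carrier V
    \<Longrightarrow> poly_op V T (map2 (\<oplus>\<^bsub>K\<^esub>) p q) v = poly_op V T p v \<oplus>\<^bsub>V\<^esub> poly_op V T q v"
  by (induction p q rule: list_induct2)
    (auto simp: T_pow_closed poly_op_closed smult_l_distr M.a_ac)

lemma poly_op_smult:
  "a \<in> carrier K \<Longrightarrow> set p \<subseteq> carrier K \<Longrightarrow> v \<in> carrier V
    \<Longrightarrow> poly_op V T (map ((\<otimes>\<^bsub>K\<^esub>) a) p) v = a \<odot>\<^bsub>V\<^esub> poly_op V T p v"
  by (induction p) (auto simp: T_pow_closed poly_op_closed smult_r_distr smult_assoc1)

text \<open>Division of a polynomial by X - a, with its value at a as remainder, carried out on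
  vectors. The list \<open>q\<close> is the quotient of Horner's scheme: one shorter than the
  dividend, with the same leading coefficient.\<close>

lemma horner:
  assumes "a \<in> carrier K" "b \<in> carrier K" "set p \<subseteq> carrier K" "v \<in> carrier V"
  shows "\<exists>q. length q = length p \<and> set q \<subseteq> carrier K \<and> (q \<noteq> [] \<longrightarrow> hd q = b)
    \<and> poly_op V T (b # p) v = (T (poly_op V T q v) \<oplus>\<^bsub>V\<^esub> \<ominus>\<^bsub>V\<^esub> (a \<odot>\<^bsub>V\<^esub> poly_op V T q v))
        \<oplus>\<^bsub>V\<^esub> R.eval (b # p) a \<odot>\<^bsub>V\<^esub> v"
  using assms(2,3)
proof (induction p arbitrary: b)
  case Nil
  have "T \<zero>\<^bsub>V\<^esub> = \<zero>\<^bsub>V\<^esub>"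
    by (rule additive_zero[OF M.abelian_group_axioms M.abelian_group_axioms module_hom_additive[OF T_hom]])
  then show ?case using assms Nil by (auto simp: M.r_neg)
next
  case (Cons c p)
  define n where "n = length p"
  \<comment> \<open>Since b X^(n+1) + c X^n = b (X - a) X^n + (a b + c) X^n, the coefficient b joins
    the quotient and \<open>b'\<close> replaces the two leading coefficients without changing the
    value at a.\<close>
  define b' where "b' = a \<otimes>\<^bsub>K\<^esub> b \<oplus>\<^bsub>K\<^esub> c"
  have b': "b' \<in> carrier K" using Cons assms by (auto simp: b'_def)
  then obtain q where q: "length q = length p" "set q \<subseteq> carrier K"
    and eq: "poly_op V T (b' # p) v = (T (poly_op V T q v) \<oplus>\<^bsub>V\<^esub> \<ominus>\<^bsub>V\<^esub> (a \<odot>\<^bsub>V\<^esub> poly_op V T q v))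
        \<oplus>\<^bsub>V\<^esub> R.eval (b' # p) a \<odot>\<^bsub>V\<^esub> v"
    using Cons by (metis set_subset_Cons subset_trans)
  let ?x = "(T ^^ n) v" and ?y = "poly_op V T q v" and ?z = "poly_op V T p v"
  have cl: "?x \<in> carrier V" "?y \<in> carrier V" "?z \<in> carrier V" "T ?x \<in> carrier V" "T ?y \<in> carrier V"
    "c \<in> carrier K" "b \<in> carrier K" "R.eval (b' # p) a \<in> carrier K" "R.eval p a \<in> carrier K"
    using T_pow_closed T_closed poly_op_closed q Cons assms b' by (auto intro!: R.eval_in_carrier)
  have ev: "R.eval (b # c # p) a = R.eval (b' # p) a"
  proof -
    have "R.eval (b # c # p) a = b \<otimes>\<^bsub>K\<^esub> (a [^]\<^bsub>K\<^esub> n \<otimes>\<^bsub>K\<^esub> a) \<oplus>\<^bsub>K\<^esub> (c \<otimes>\<^bsub>K\<^esub> a [^]\<^bsub>K\<^esub> n \<oplus>\<^bsub>K\<^esub> R.eval p a)"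
      by (simp add: n_def)
    also have "\<dots> = (a \<otimes>\<^bsub>K\<^esub> b \<oplus>\<^bsub>K\<^esub> c) \<otimes>\<^bsub>K\<^esub> a [^]\<^bsub>K\<^esub> n \<oplus>\<^bsub>K\<^esub> R.eval p a"
      using cl assms by (simp add: R.l_distr R.r_distr R.a_assoc R.m_ac)
    finally show ?thesis by (simp add: b'_def n_def)
  qed
  have Tq: "T (b \<odot>\<^bsub>V\<^esub> ?x \<oplus>\<^bsub>V\<^esub> ?y) = b \<odot>\<^bsub>V\<^esub> T ?x \<oplus>\<^bsub>V\<^esub> T ?y"
    using T_hom cl by (auto simp: module_hom_def)
  have 1: "poly_op V T (b # c # p) v = b \<odot>\<^bsub>V\<^esub> T ?x \<oplus>\<^bsub>V\<^esub> (c \<odot>\<^bsub>V\<^esub> ?x \<oplus>\<^bsub>V\<^esub> ?z)"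
    by (simp add: n_def)
  have 2: "b' \<odot>\<^bsub>V\<^esub> ?x \<oplus>\<^bsub>V\<^esub> ?z = (T ?y \<oplus>\<^bsub>V\<^esub> \<ominus>\<^bsub>V\<^esub> (a \<odot>\<^bsub>V\<^esub> ?y)) \<oplus>\<^bsub>V\<^esub> R.eval (b' # p) a \<odot>\<^bsub>V\<^esub> v"
    using eq by (simp add: n_def)
  have "(T (b \<odot>\<^bsub>V\<^esub> ?x \<oplus>\<^bsub>V\<^esub> ?y) \<oplus>\<^bsub>V\<^esub> \<ominus>\<^bsub>V\<^esub> (a \<odot>\<^bsub>V\<^esub> (b \<odot>\<^bsub>V\<^esub> ?x \<oplus>\<^bsub>V\<^esub> ?y))) \<oplus>\<^bsub>V\<^esub> R.eval (b' # p) a \<odot>\<^bsub>V\<^esub> v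
      = b \<odot>\<^bsub>V\<^esub> T ?x \<oplus>\<^bsub>V\<^esub> (\<ominus>\<^bsub>V\<^esub> (a \<odot>\<^bsub>V\<^esub> (b \<odot>\<^bsub>V\<^esub> ?x)) \<oplus>\<^bsub>V\<^esub> ((T ?y \<oplus>\<^bsub>V\<^esub> \<ominus>\<^bsub>V\<^esub> (a \<odot>\<^bsub>V\<^esub> ?y)) \<oplus>\<^bsub>V\<^esub> R.eval (b' # p) a \<odot>\<^bsub>V\<^esub> v))"
    unfolding Tq using cl assms by (simp add: smult_r_distr M.minus_add M.a_ac del: R.eval.simps)
  also have "\<dots> = b \<odot>\<^bsub>V\<^esub> T ?x \<oplus>\<^bsub>V\<^esub> (\<ominus>\<^bsub>V\<^esub> ((a \<otimes>\<^bsub>K\<^esub> b) \<odot>\<^bsub>V\<^esub> ?x) \<oplus>\<^bsub>V\<^esub> (((a \<otimes>\<^bsub>K\<^esub> b) \<odot>\<^bsub>V\<^esub> ?x \<oplus>\<^bsub>V\<^esub> c \<odot>\<^bsub>V\<^esub> ?x) \<oplus>\<^bsub>V\<^esub> ?z))"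
    unfolding 2[symmetric] using cl assms by (simp add: b'_def smult_l_distr smult_assoc1)
  also have "\<dots> = poly_op V T (b # c # p) v"
    unfolding 1 using cl assms by (simp add: M.a_assoc[symmetric] M.l_neg)
  finally show ?case
    using q cl ev by (intro exI[of _ "b # q"]) (auto simp del: R.eval.simps simp: n_def)
qed

text \<open>For an eigenvector it suffices to annihilate a single vector v, and in finite dimension
  the iterates of v under T cannot all be independent.\<close>

lemma annihilating_polynomial:
  assumes fin_dim "v \<in> carrier V"
  obtains p where "p \<noteq> []" "set p \<subseteq> carrier K" "hd p \<noteq> \<zero>\<^bsub>K\<^esub>" "poly_op V T p v = \<zero>\<^bsub>V\<^esub>"
proof -
  define x where "x i = (T ^^ i) v" for i
  have xc: "x i \<in> carrier V" for i using T_pow_closed assms by (simp add: x_def)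
  \<comment> \<open>If every iterate escaped the span of its predecessors, \<open>Suc dim\<close> of
    them would be independent.\<close>
  have "\<exists>N. x N \<in> span (x ` {..<N})"
  proof (rule ccontr)
    assume no: "\<not> ?thesis"
    have "lin_indpt (x ` {..<N}) \<and> card (x ` {..<N}) = N" for N
    proof (induction N)
      case 0
      show ?case by (simp add: lin_dep_def)
    next
      case (Suc N)
      have sub: "x ` {..<N} \<subseteq> carrier V" using xc by auto
      have notin: "x N \<notin> span (x ` {..<N})" using no by blast
      then have nin: "x N \<notin> x ` {..<N}" using span_mem[OF sub] by blast
      have "lin_indpt (x ` {..<N} \<union> {x N})"
        using lin_dep_iff_in_span[OF sub _ xc nin] Suc notin by blast
      then show ?case using Suc nin by (auto simp: lessThan_Suc)
    qed
    from this[of "Suc dim"] li_le_dim(2)[OF assms(1), of "x ` {..<Suc dim}"] xc show False by auto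
  qed
  then obtain N where N: "x N \<in> span (x ` {..<N})" by blast
  \<comment> \<open>The values at v of polynomials with N coefficients. They form a submodule
    containing the first N iterates, so the span above lies in it and \<open>x N\<close> is such a
    value.\<close>
  define U where "U = {poly_op V T p v | p. length p = N \<and> set p \<subseteq> carrier K}"
  have zero: "poly_op V T (replicate m \<zero>\<^bsub>K\<^esub>) v = \<zero>\<^bsub>V\<^esub>" for m
    using assms by (induction m) (auto simp: T_pow_closed)
  have "submodule K U V"
    unfolding submodule_def
  proof (intro conjI allI impI)
    show "Module.module K V" by (rule module_axioms)
    show "U \<subseteq> carrier V" using assms by (auto simp: U_def poly_op_closed)
    show "\<zero>\<^bsub>V\<^esub> \<in> U" using zero[of N] unfolding U_def by (force intro!: exI[of _ "replicate N \<zero>\<^bsub>K\<^esub>"])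
    show "y \<oplus>\<^bsub>V\<^esub> z \<in> U" if "y \<in> U" "z \<in> U" for y z
    proof -
      obtain p q where e: "length p = N" "set p \<subseteq> carrier K" "length q = N" "set q \<subseteq> carrier K"
        "y = poly_op V T p v" "z = poly_op V T q v" using \<open>y \<in> U\<close> \<open>z \<in> U\<close> unfolding U_def by blast
      have "set (map2 (\<oplus>\<^bsub>K\<^esub>) p q) \<subseteq> carrier K" using e by (intro map2_closed) auto
      then show ?thesis unfolding U_def using e poly_op_add[of p q v] assms
        by (auto intro!: exI[of _ "map2 (\<oplus>\<^bsub>K\<^esub>) p q"])
    qed
    show "a \<odot>\<^bsub>V\<^esub> y \<in> U" if "a \<in> carrier K" "y \<in> U" for a y
    proof -
      obtain p where e: "length p = N" "set p \<subseteq> carrier K" "y = poly_op V T p v"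
        using \<open>y \<in> U\<close> unfolding U_def by blast
      moreover have "set (map ((\<otimes>\<^bsub>K\<^esub>) a) p) \<subseteq> carrier K" using e that by auto
      ultimately show ?thesis unfolding U_def using poly_op_smult[of a p v] assms that
        by (auto simp del: set_map intro!: exI[of _ "map ((\<otimes>\<^bsub>K\<^esub>) a) p"])
    qed
  qed
  moreover have "x ` {..<N} \<subseteq> U"
  proof
    fix y assume "y \<in> x ` {..<N}"
    then obtain i where i: "i < N" "y = x i" by blast
    \<comment> \<open>The monomial X^i, padded with leading zeros to N coefficients.\<close>
    define p where "p = replicate (N - Suc i) \<zero>\<^bsub>K\<^esub> @ \<one>\<^bsub>K\<^esub> # replicate i \<zero>\<^bsub>K\<^esub>"
    have "poly_op V T (replicate m \<zero>\<^bsub>K\<^esub> @ \<one>\<^bsub>K\<^esub> # replicate i \<zero>\<^bsub>K\<^esub>) v = x i" for m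
      using assms xc zero by (induction m) (auto simp: T_pow_closed T_closed x_def)
    then show "y \<in> U" unfolding U_def using i by (auto intro!: exI[of _ p] simp: p_def)
  qed
  ultimately have "span (x ` {..<N}) \<subseteq> U" by (intro span_is_subset)
  then obtain p where p: "length p = N" "set p \<subseteq> carrier K" "x N = poly_op V T p v"
    using N unfolding U_def by blast
  \<comment> \<open>The polynomial X^N - p, whose leading coefficient is one.\<close>
  let ?p = "\<one>\<^bsub>K\<^esub> # map ((\<otimes>\<^bsub>K\<^esub>) (\<ominus>\<^bsub>K\<^esub> \<one>\<^bsub>K\<^esub>)) p"
  have "poly_op V T ?p v = x N \<oplus>\<^bsub>V\<^esub> (\<ominus>\<^bsub>K\<^esub> \<one>\<^bsub>K\<^esub>) \<odot>\<^bsub>V\<^esub> x N"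
    using p assms xc[of N] by (simp add: poly_op_smult x_def)
  then have "poly_op V T ?p v = \<zero>\<^bsub>V\<^esub>" using xc by (simp add: smult_minus_1 M.r_neg)
  then show thesis using p by (intro that[of ?p]) auto
qed

text \<open>Induction on the length of p. For a root a of p, Horner division writes p(T) v as (T -
  a) q(T) v. Either q(T) v is nonzero and is an eigenvector for a, or it vanishes and the shorter q,
  with the same leading coefficient, takes the place of p.\<close>

lemma eigenvalue:
  assumes "algebraically_closed K" "p \<noteq> []" "set p \<subseteq> carrier K" "hd p \<noteq> \<zero>\<^bsub>K\<^esub>"
    "v \<in> carrier V" "v \<noteq> \<zero>\<^bsub>V\<^esub>" "poly_op V T p v = \<zero>\<^bsub>V\<^esub>"
  shows "\<exists>a\<in>carrier K. \<exists>w\<in>carrier V. w \<noteq> \<zero>\<^bsub>V\<^esub> \<and> T w = a \<odot>\<^bsub>V\<^esub> w"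
  using assms(2-)
proof (induction "length p" arbitrary: p rule: less_induct)
  case less
  obtain b r where p: "p = b # r" using less.prems by (cases p) auto
  have b: "b \<in> carrier K" "b \<noteq> \<zero>\<^bsub>K\<^esub>" "set r \<subseteq> carrier K" using less.prems p by auto
  have pc: "p \<in> carrier (poly_ring K)"
    using b p unfolding univ_poly_carrier[symmetric] polynomial_def by auto
  show ?case
  proof (cases "r = []")
    case True
    then have "b \<odot>\<^bsub>V\<^esub> v = \<zero>\<^bsub>V\<^esub>" using less.prems p b by simp
    moreover have "inv\<^bsub>K\<^esub> b \<in> carrier K" "inv\<^bsub>K\<^esub> b \<otimes>\<^bsub>K\<^esub> b = \<one>\<^bsub>K\<^esub>" using b by (auto simp: field_Units)
    ultimately have "v = \<zero>\<^bsub>V\<^esub>"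
      using smult_assoc1[of "inv\<^bsub>K\<^esub> b" b v] less.prems(4) b by simp
    then show ?thesis using less.prems by simp
  next
    case False
    interpret AC: algebraically_closed K by (rule assms(1))
    have "size (R.roots p) = degree p" using AC.roots_over_carrier[OF pc] by (simp add: R.splitted_def)
    moreover have "degree p > 0" using False p by simp
    ultimately have "R.roots p \<noteq> {#}" by auto
    then obtain a where "a \<in># R.roots p" by (rule multiset_nonemptyE)
    then have "R.is_root p a" using roots_mem_iff_is_root[OF pc] by blast
    then have a: "a \<in> carrier K" "R.eval p a = \<zero>\<^bsub>K\<^esub>" by (auto simp: R.is_root_def)
    obtain q where q: "length q = length r" "set q \<subseteq> carrier K" "q \<noteq> [] \<longrightarrow> hd q = b"
      and eq: "poly_op V T p v = (T (poly_op V T q v) \<oplus>\<^bsub>V\<^esub> \<ominus>\<^bsub>V\<^esub> (a \<odot>\<^bsub>V\<^esub> poly_op V T q v))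
        \<oplus>\<^bsub>V\<^esub> R.eval p a \<odot>\<^bsub>V\<^esub> v"
      using horner[OF a(1) b(1,3) less.prems(4)] p by auto
    let ?w = "poly_op V T q v"
    have w: "?w \<in> carrier V" "T ?w \<in> carrier V" using poly_op_closed q less.prems T_closed by auto
    show ?thesis
    proof (cases "?w = \<zero>\<^bsub>V\<^esub>")
      case True
      have "length q < length p" "q \<noteq> []" "hd q \<noteq> \<zero>\<^bsub>K\<^esub>" using q p False b by auto
      then show ?thesis using less.hyps[of q] True less.prems q by blast
    next
      case nz: False
      have "T ?w \<oplus>\<^bsub>V\<^esub> \<ominus>\<^bsub>V\<^esub> (a \<odot>\<^bsub>V\<^esub> ?w) = \<zero>\<^bsub>V\<^esub>"
        using eq a(2) less.prems w a(1) by simp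
      then have "T ?w = a \<odot>\<^bsub>V\<^esub> ?w"
        using w a(1) by (metis M.minus_equality M.minus_minus M.a_inv_closed smult_closed)
      then show ?thesis using a(1) w nz by blast
    qed
  qed
qed

end

text \<open>Over an algebraically closed field T has an eigenvector. The corresponding eigenspace is
  invariant because T is equivariant, so by irreducibility it is all of V.\<close>

lemma (in irreducible_group_rep) schur:
  assumes "algebraically_closed k" fin_dim "T \<in> module_hom k V V"
    and "\<And>g v. g \<in> carrier G \<Longrightarrow> v \<in> carrier V \<Longrightarrow> T (\<rho> g v) = \<rho> g (T v)"
  shows "\<exists>a\<in>carrier k. \<forall>v\<in>carrier V. T v = a \<odot>\<^bsub>V\<^esub> v"
proof -
  interpret endomorphism k V T by unfold_locales (rule assms(3))
  obtain v where v: "v \<in> carrier V" "v \<noteq> \<zero>\<^bsub>V\<^esub>" using nontrivial by auto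
  obtain a w where aw: "a \<in> carrier k" "w \<in> carrier V" "w \<noteq> \<zero>\<^bsub>V\<^esub>" "T w = a \<odot>\<^bsub>V\<^esub> w"
    using annihilating_polynomial[OF assms(2) v(1)] eigenvalue[OF assms(1) _ _ _ v] by metis
  define H where "H = {x \<in> carrier V. T x = a \<odot>\<^bsub>V\<^esub> x}"
  have "VectorSpace.subspace k H V"
  proof (intro VectorSpace.subspace.intro vectorspace_axioms submodule.intro module_axioms)
    show "H \<subseteq> carrier V" by (auto simp: H_def)
    show "\<zero>\<^bsub>V\<^esub> \<in> H"
      using additive_zero[OF M.abelian_group_axioms M.abelian_group_axioms module_hom_additive[OF T_hom]] aw(1)
      by (auto simp: H_def)
    show "x \<oplus>\<^bsub>V\<^esub> y \<in> H" if "x \<in> H" "y \<in> H" for x y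
      using that aw(1) T_hom by (auto simp: H_def module_hom_def smult_r_distr)
    show "c \<odot>\<^bsub>V\<^esub> x \<in> H" if "c \<in> carrier k" "x \<in> H" for c x
      using that aw(1) T_hom by (auto simp: H_def module_hom_def smult_assoc1[symmetric] R.m_comm)
  qed
  moreover have "\<forall>g\<in>carrier G. \<rho> g ` H \<subseteq> H"
  proof clarify
    fix g x assume gx: "g \<in> carrier G" "x \<in> H"
    then have "\<rho> g x \<in> carrier V" "\<rho> g (a \<odot>\<^bsub>V\<^esub> x) = a \<odot>\<^bsub>V\<^esub> \<rho> g x"
      using rep_hom[OF gx(1)] aw(1) by (auto simp: H_def module_hom_def)
    then show "\<rho> g x \<in> H" using gx assms(4) by (auto simp: H_def)
  qed
  ultimately have "H = {\<zero>\<^bsub>V\<^esub>} \<or> H = carrier V" by (rule no_invariant_subspace)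
  then have "H = carrier V" using aw by (auto simp: H_def)
  then show ?thesis using aw(1) by (auto simp: H_def)
qed

section \<open>Matrix units\<close>

lemma (in Group.group) finite_sum_translate:
  assumes "abelian_monoid M" "f \<in> carrier G \<rightarrow> carrier M" "h \<in> carrier G"
  shows "(\<Oplus>\<^bsub>M\<^esub>g\<in>carrier G. f (h \<otimes> g)) = (\<Oplus>\<^bsub>M\<^esub>g\<in>carrier G. f g)"
    "(\<Oplus>\<^bsub>M\<^esub>g\<in>carrier G. f (g \<otimes> h)) = (\<Oplus>\<^bsub>M\<^esub>g\<in>carrier G. f g)"
    "(\<Oplus>\<^bsub>M\<^esub>g\<in>carrier G. f (inv g)) = (\<Oplus>\<^bsub>M\<^esub>g\<in>carrier G. f g)"
proof -
  interpret M: abelian_monoid M by fact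
  have 1: "(\<lambda>g. h \<otimes> g) ` carrier G = carrier G"
  proof -
    have "g = h \<otimes> (inv h \<otimes> g)" if "g \<in> carrier G" for g
      using that assms(3) by (simp add: m_assoc[symmetric])
    then show ?thesis using assms(3) by (auto intro!: image_eqI[where x="inv h \<otimes> _"])
  qed
  have 2: "(\<lambda>g. g \<otimes> h) ` carrier G = carrier G"
  proof -
    have "g = (g \<otimes> inv h) \<otimes> h" if "g \<in> carrier G" for g
      using that assms(3) by (simp add: m_assoc)
    then show ?thesis using assms(3) by (auto intro!: image_eqI[where x="_ \<otimes> inv h"])
  qed
  have 3: "(\<lambda>g. inv g) ` carrier G = carrier G"
    by (auto intro!: image_eqI[where x="inv _"])
  show "(\<Oplus>\<^bsub>M\<^esub>g\<in>carrier G. f (h \<otimes> g)) = (\<Oplus>\<^bsub>M\<^esub>g\<in>carrier G. f g)"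
    using M.finsum_reindex[of f "\<lambda>g. h \<otimes> g" "carrier G"] assms 1 by (simp add: inj_on_def)
  show "(\<Oplus>\<^bsub>M\<^esub>g\<in>carrier G. f (g \<otimes> h)) = (\<Oplus>\<^bsub>M\<^esub>g\<in>carrier G. f g)"
    using M.finsum_reindex[of f "\<lambda>g. g \<otimes> h" "carrier G"] assms 2 by (simp add: inj_on_def)
  show "(\<Oplus>\<^bsub>M\<^esub>g\<in>carrier G. f (inv g)) = (\<Oplus>\<^bsub>M\<^esub>g\<in>carrier G. f g)"
    using M.finsum_reindex[of f "\<lambda>g. inv g" "carrier G"] assms 3 inv_inj by simp
qed

text \<open>
  The matrix coefficients \<open>A\<close> of an irreducible representation satisfy the Schur orthogonality
  relations \<open>orth\<close>; \<open>\<mu>\<close> is the dimension divided by the group order. By these relations the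
  elements \<open>\<mu> \<Sum>\<^sub>g A(g\<^sup>-\<^sup>1)\<^sub>j\<^sub>i g\<close> of the group algebra multiply like matrix units.
\<close>

locale irr_matrix =
  fixes k :: "('k, 'c) ring_scheme" and G :: "('g, 'b) monoid_scheme"
    and n :: nat and A :: "'g \<Rightarrow> nat \<Rightarrow> nat \<Rightarrow> 'k" and \<mu> :: 'k
  assumes finite_G: "finite (carrier G)"
    and n_pos: "0 < n"
    and A_closed: "\<lbrakk>g \<in> carrier G; i < n; j < n\<rbrakk> \<Longrightarrow> A g i j \<in> carrier k"
    and A_mult: "\<lbrakk>g \<in> carrier G; h \<in> carrier G; i < n; j < n\<rbrakk>
      \<Longrightarrow> A (g \<otimes>\<^bsub>G\<^esub> h) i j = (\<Oplus>\<^bsub>k\<^esub>l\<in>{..<n}. A g i l \<otimes>\<^bsub>k\<^esub> A h l j)"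
    and mu_closed: "\<mu> \<in> carrier k"
    and orth: "\<lbrakk>i < n; a < n; b < n; j < n\<rbrakk>
      \<Longrightarrow> (\<Oplus>\<^bsub>k\<^esub>g\<in>carrier G. \<mu> \<otimes>\<^bsub>k\<^esub> (A g i a \<otimes>\<^bsub>k\<^esub> A (inv\<^bsub>G\<^esub> g) b j))
        = (if i = j \<and> a = b then \<one>\<^bsub>k\<^esub> else \<zero>\<^bsub>k\<^esub>)"

definition munit ::
  "('k, 'c) ring_scheme \<Rightarrow> ('g, 'b) monoid_scheme \<Rightarrow> ('g \<Rightarrow> nat \<Rightarrow> nat \<Rightarrow> 'k) \<Rightarrow> 'k
    \<Rightarrow> ('k, 'm, 'z) module_scheme \<Rightarrow> ('g \<Rightarrow> 'm \<Rightarrow> 'm) \<Rightarrow> nat \<Rightarrow> nat \<Rightarrow> 'm \<Rightarrow> 'm"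
  where "munit k G A \<mu> M \<alpha> i j m =
    (\<Oplus>\<^bsub>M\<^esub>g\<in>carrier G. (\<mu> \<otimes>\<^bsub>k\<^esub> A (inv\<^bsub>G\<^esub> g) j i) \<odot>\<^bsub>M\<^esub> \<alpha> g m)"

locale munits = irr_matrix k G n A \<mu> + group_rep k G V \<rho>
  for k :: "('k, 'c) ring_scheme" and G :: "('g, 'b) monoid_scheme" and n A \<mu>
    and V :: "('k, 'v, 'z) module_scheme" and \<rho>
begin

abbreviation E where "E \<equiv> munit k G A \<mu> V \<rho>"

lemma rho_closed: "g \<in> carrier G \<Longrightarrow> v \<in> carrier V \<Longrightarrow> \<rho> g v \<in> carrier V"
  using module_hom_apply[OF rep_hom] .

lemma rho_smult: "g \<in> carrier G \<Longrightarrow> a \<in> carrier k \<Longrightarrow> v \<in> carrier V \<Longrightarrow> \<rho> g (a \<odot>\<^bsub>V\<^esub> v) = a \<odot>\<^bsub>V\<^esub> \<rho> g v"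
  using module_hom_smult[OF rep_hom] .

lemma rho_additive: "g \<in> carrier G \<Longrightarrow> additive_map V V (\<rho> g)"
  using module_hom_additive[OF rep_hom] .

lemma coeff_closed: "g \<in> carrier G \<Longrightarrow> i < n \<Longrightarrow> j < n \<Longrightarrow> \<mu> \<otimes>\<^bsub>k\<^esub> A (inv\<^bsub>G\<^esub> g) j i \<in> carrier k"
  by (intro R.m_closed mu_closed A_closed G.inv_closed)

lemma munit_additive: "i < n \<Longrightarrow> j < n \<Longrightarrow> additive_map V V (E i j)"
  unfolding munit_def
  by (intro additive_finsum_fun M.abelian_group_axioms additive_compose[OF rho_additive additive_smult[OF module_axioms]]
      coeff_closed) auto

lemma munit_closed: "i < n \<Longrightarrow> j < n \<Longrightarrow> v \<in> carrier V \<Longrightarrow> E i j v \<in> carrier V"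
  using additive_closed[OF munit_additive] .

text \<open>
  Applied to a scalar or to a restriction map, naturality says that matrix units are linear and are
  morphisms of sheaves.
\<close>

lemma munit_natural:
  assumes "abelian_group V'" "additive_map V V' f" "i < n" "j < n" "v \<in> carrier V"
    and "\<And>a x. a \<in> carrier k \<Longrightarrow> x \<in> carrier V \<Longrightarrow> f (a \<odot>\<^bsub>V\<^esub> x) = a \<odot>\<^bsub>V'\<^esub> f x"
    and "\<And>g x. g \<in> carrier G \<Longrightarrow> x \<in> carrier V \<Longrightarrow> f (\<rho> g x) = \<rho>' g (f x)"
    and "\<And>a x. a \<in> carrier k \<Longrightarrow> x \<in> carrier V' \<Longrightarrow> a \<odot>\<^bsub>V'\<^esub> x \<in> carrier V'"
    and "\<And>g x. g \<in> carrier G \<Longrightarrow> x \<in> carrier V' \<Longrightarrow> \<rho>' g x \<in> carrier V'"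
  shows "f (E i j v) = munit k G A \<mu> V' \<rho>' i j (f v)"
proof -
  interpret V': abelian_group V' by fact
  have fv: "f v \<in> carrier V'" using assms(2,5) by (rule additive_closed)
  have "f (E i j v) = (\<Oplus>\<^bsub>V'\<^esub>g\<in>carrier G. f ((\<mu> \<otimes>\<^bsub>k\<^esub> A (inv\<^bsub>G\<^esub> g) j i) \<odot>\<^bsub>V\<^esub> \<rho> g v))"
    unfolding munit_def using assms(3-5) coeff_closed rho_closed
    by (intro additive_finsum[OF M.abelian_group_axioms assms(1,2)]) auto
  also have "\<dots> = munit k G A \<mu> V' \<rho>' i j (f v)"
    unfolding munit_def using assms(3-9) coeff_closed rho_closed fv
    by (intro V'.finsum_cong') auto
  finally show ?thesis .
qed

lemma munit_smult:
  "i < n \<Longrightarrow> j < n \<Longrightarrow> a \<in> carrier k \<Longrightarrow> v \<in> carrier V \<Longrightarrow> E i j (a \<odot>\<^bsub>V\<^esub> v) = a \<odot>\<^bsub>V\<^esub> E i j v"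
  using rho_smult rho_closed
  by (intro munit_natural[symmetric] M.abelian_group_axioms additive_smult[OF module_axioms])
    (auto simp: smult_assoc1[symmetric] R.m_comm)

text \<open>Vectors that transform like the basis of the irreducible representation are moved by the
  E_ij as a standard basis is moved by matrix units. This serves twice: for the family
  \<open>E r m v\<close> with r varying, where it gives the multiplication table, and for a basis of
  an irreducible subrepresentation, where it gives that the central idempotent does not
  vanish.\<close>

lemma munit_family:
  assumes x: "x \<in> {..<n} \<rightarrow> carrier V"
    and act: "\<And>g l. g \<in> carrier G \<Longrightarrow> l < n \<Longrightarrow> \<rho> g (x l) = (\<Oplus>\<^bsub>V\<^esub>r\<in>{..<n}. A g r l \<odot>\<^bsub>V\<^esub> x r)"
    and ij: "i < n" "j < n" "l < n"
  shows "E i j (x l) = (if j = l then x i else \<zero>\<^bsub>V\<^esub>)"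
proof -
  let ?a = "\<lambda>g r. \<mu> \<otimes>\<^bsub>k\<^esub> (A g r l \<otimes>\<^bsub>k\<^esub> A (inv\<^bsub>G\<^esub> g) j i)"
  have xc: "x r \<in> carrier V" if "r < n" for r using x that by auto
  have ac: "?a g r \<in> carrier k" if "g \<in> carrier G" "r < n" for g r
    using that ij A_closed mu_closed by simp
  have "E i j (x l) = (\<Oplus>\<^bsub>V\<^esub>g\<in>carrier G. \<Oplus>\<^bsub>V\<^esub>r\<in>{..<n}. ?a g r \<odot>\<^bsub>V\<^esub> x r)"
    unfolding munit_def
  proof (intro M.finsum_cong' refl)
    fix g assume g: "g \<in> carrier G"
    have "(\<mu> \<otimes>\<^bsub>k\<^esub> A (inv\<^bsub>G\<^esub> g) j i) \<odot>\<^bsub>V\<^esub> \<rho> g (x l)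
        = (\<Oplus>\<^bsub>V\<^esub>r\<in>{..<n}. (\<mu> \<otimes>\<^bsub>k\<^esub> A (inv\<^bsub>G\<^esub> g) j i) \<odot>\<^bsub>V\<^esub> (A g r l \<odot>\<^bsub>V\<^esub> x r))"
      unfolding act[OF g ij(3)] using g ij xc A_closed by (intro finsum_smult coeff_closed) auto
    also have "\<dots> = (\<Oplus>\<^bsub>V\<^esub>r\<in>{..<n}. ?a g r \<odot>\<^bsub>V\<^esub> x r)"
      using g ij xc A_closed mu_closed ac
      by (intro M.finsum_cong') (auto simp: smult_assoc1[symmetric] R.m_ac)
    finally show "(\<mu> \<otimes>\<^bsub>k\<^esub> A (inv\<^bsub>G\<^esub> g) j i) \<odot>\<^bsub>V\<^esub> \<rho> g (x l) = (\<Oplus>\<^bsub>V\<^esub>r\<in>{..<n}. ?a g r \<odot>\<^bsub>V\<^esub> x r)" .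
  qed (use xc ac in \<open>auto intro!: M.finsum_closed\<close>)
  \<comment> \<open>With the sum over G inside, the coefficient of \<open>x r\<close> is the
    orthogonality sum of A_rl(g) and A_ji(g^-1): one if r = i and j = l, zero otherwise.\<close>
  also have "\<dots> = (\<Oplus>\<^bsub>V\<^esub>r\<in>{..<n}. \<Oplus>\<^bsub>V\<^esub>g\<in>carrier G. ?a g r \<odot>\<^bsub>V\<^esub> x r)"
    using finite_G xc ac by (intro M.finsum_swap) auto
  also have "\<dots> = (\<Oplus>\<^bsub>V\<^esub>r\<in>{..<n}. if r = i then (if j = l then x r else \<zero>\<^bsub>V\<^esub>) else \<zero>\<^bsub>V\<^esub>)"
  proof (intro M.finsum_cong' refl)
    fix r assume r: "r \<in> {..<n}"
    have "(\<Oplus>\<^bsub>V\<^esub>g\<in>carrier G. ?a g r \<odot>\<^bsub>V\<^esub> x r) = (\<Oplus>\<^bsub>k\<^esub>g\<in>carrier G. ?a g r) \<odot>\<^bsub>V\<^esub> x r"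
      using r xc ac by (intro finsum_smult_r[symmetric]) auto
    then show "(\<Oplus>\<^bsub>V\<^esub>g\<in>carrier G. ?a g r \<odot>\<^bsub>V\<^esub> x r)
        = (if r = i then (if j = l then x r else \<zero>\<^bsub>V\<^esub>) else \<zero>\<^bsub>V\<^esub>)"
      using orth[of r l j i] r ij xc by auto
  qed (use xc in auto)
  also have "\<dots> = (if j = l then x i else \<zero>\<^bsub>V\<^esub>)"
    using xc ij by (subst M.finsum_delta) auto
  finally show ?thesis .
qed

text \<open>Substituting h g for g moves h into the coefficient A(g^-1 h), which
  \<open>A_mult\<close> splits. For fixed j and v the vectors \<open>E r j v\<close> thus transform
  under G by the matrices A, as \<open>munit_family\<close> requires.\<close>

lemma act_munit:
  assumes h: "h \<in> carrier G" and ij: "i < n" "j < n" and v: "v \<in> carrier V"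
  shows "\<rho> h (E i j v) = (\<Oplus>\<^bsub>V\<^esub>r\<in>{..<n}. A h r i \<odot>\<^bsub>V\<^esub> E r j v)"
proof -
  let ?f = "\<lambda>g. (\<mu> \<otimes>\<^bsub>k\<^esub> A (inv\<^bsub>G\<^esub> g \<otimes>\<^bsub>G\<^esub> h) j i) \<odot>\<^bsub>V\<^esub> \<rho> g v"
  have fc: "?f g \<in> carrier V" if "g \<in> carrier G" for g
    using that h ij v A_closed mu_closed rho_closed by simp
  have "\<rho> h (E i j v) = (\<Oplus>\<^bsub>V\<^esub>g\<in>carrier G. \<rho> h ((\<mu> \<otimes>\<^bsub>k\<^esub> A (inv\<^bsub>G\<^esub> g) j i) \<odot>\<^bsub>V\<^esub> \<rho> g v))"
    unfolding munit_def using ij v h coeff_closed rho_closed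
    by (intro additive_finsum[OF M.abelian_group_axioms M.abelian_group_axioms rho_additive]) auto
  also have "\<dots> = (\<Oplus>\<^bsub>V\<^esub>g\<in>carrier G. ?f (h \<otimes>\<^bsub>G\<^esub> g))"
    using ij v h coeff_closed rho_closed fc
    by (intro M.finsum_cong') (auto simp: rho_smult rep_mult G.inv_mult_group G.m_assoc)
  also have "\<dots> = (\<Oplus>\<^bsub>V\<^esub>g\<in>carrier G. ?f g)"
    using h fc by (intro G.finite_sum_translate(1)[of V ?f h] M.abelian_monoid_axioms) auto
  also have "\<dots> = (\<Oplus>\<^bsub>V\<^esub>g\<in>carrier G. \<Oplus>\<^bsub>V\<^esub>r\<in>{..<n}. A h r i \<odot>\<^bsub>V\<^esub> ((\<mu> \<otimes>\<^bsub>k\<^esub> A (inv\<^bsub>G\<^esub> g) j r) \<odot>\<^bsub>V\<^esub> \<rho> g v))"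
  proof (intro M.finsum_cong' refl)
    fix g assume g: "g \<in> carrier G"
    have "?f g = (\<Oplus>\<^bsub>k\<^esub>r\<in>{..<n}. \<mu> \<otimes>\<^bsub>k\<^esub> (A (inv\<^bsub>G\<^esub> g) j r \<otimes>\<^bsub>k\<^esub> A h r i)) \<odot>\<^bsub>V\<^esub> \<rho> g v"
      using g h ij A_closed mu_closed by (simp add: A_mult R.finsum_rdistr Pi_iff)
    also have "\<dots> = (\<Oplus>\<^bsub>V\<^esub>r\<in>{..<n}. (\<mu> \<otimes>\<^bsub>k\<^esub> (A (inv\<^bsub>G\<^esub> g) j r \<otimes>\<^bsub>k\<^esub> A h r i)) \<odot>\<^bsub>V\<^esub> \<rho> g v)"
      using g h ij v A_closed mu_closed rho_closed by (intro finsum_smult_r) auto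
    also have "\<dots> = (\<Oplus>\<^bsub>V\<^esub>r\<in>{..<n}. A h r i \<odot>\<^bsub>V\<^esub> ((\<mu> \<otimes>\<^bsub>k\<^esub> A (inv\<^bsub>G\<^esub> g) j r) \<odot>\<^bsub>V\<^esub> \<rho> g v))"
      using g h ij v A_closed mu_closed rho_closed
      by (intro M.finsum_cong') (auto simp: smult_assoc1[symmetric] R.m_ac)
    finally show "?f g = (\<Oplus>\<^bsub>V\<^esub>r\<in>{..<n}. A h r i \<odot>\<^bsub>V\<^esub> ((\<mu> \<otimes>\<^bsub>k\<^esub> A (inv\<^bsub>G\<^esub> g) j r) \<odot>\<^bsub>V\<^esub> \<rho> g v))" .
  qed (use h ij v A_closed coeff_closed rho_closed in \<open>auto intro!: M.finsum_closed\<close>)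
  also have "\<dots> = (\<Oplus>\<^bsub>V\<^esub>r\<in>{..<n}. \<Oplus>\<^bsub>V\<^esub>g\<in>carrier G. A h r i \<odot>\<^bsub>V\<^esub> ((\<mu> \<otimes>\<^bsub>k\<^esub> A (inv\<^bsub>G\<^esub> g) j r) \<odot>\<^bsub>V\<^esub> \<rho> g v))"
    using finite_G h ij v A_closed coeff_closed rho_closed by (intro M.finsum_swap) auto
  also have "\<dots> = (\<Oplus>\<^bsub>V\<^esub>r\<in>{..<n}. A h r i \<odot>\<^bsub>V\<^esub> E r j v)"
    unfolding munit_def using h ij v A_closed coeff_closed rho_closed
    by (intro M.finsum_cong') (auto intro!: finsum_smult[symmetric] M.finsum_closed smult_closed)
  finally show ?thesis .
qed

text \<open>The counterpart of \<open>act_munit\<close> for the right index, from the substitution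
  of g h for g. It says that the components \<open>E i l v\<close>, with l varying, transform like
  coordinates in the basis of the irreducible representation; the equivariance of the later
  isomorphisms rests on it.\<close>

lemma munit_act:
  assumes h: "h \<in> carrier G" and ij: "i < n" "j < n" and v: "v \<in> carrier V"
  shows "E i j (\<rho> h v) = (\<Oplus>\<^bsub>V\<^esub>l\<in>{..<n}. A h j l \<odot>\<^bsub>V\<^esub> E i l v)"
proof -
  let ?f = "\<lambda>g. (\<mu> \<otimes>\<^bsub>k\<^esub> A (h \<otimes>\<^bsub>G\<^esub> inv\<^bsub>G\<^esub> g) j i) \<odot>\<^bsub>V\<^esub> \<rho> g v"
  have fc: "?f g \<in> carrier V" if "g \<in> carrier G" for g
    using that h ij v A_closed mu_closed rho_closed by simp
  have "E i j (\<rho> h v) = (\<Oplus>\<^bsub>V\<^esub>g\<in>carrier G. ?f (g \<otimes>\<^bsub>G\<^esub> h))"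
    unfolding munit_def using ij v h coeff_closed rho_closed fc
    by (intro M.finsum_cong') (auto simp: rep_mult G.inv_mult_group G.m_assoc[symmetric])
  also have "\<dots> = (\<Oplus>\<^bsub>V\<^esub>g\<in>carrier G. ?f g)"
    using h fc by (intro G.finite_sum_translate(2)[of V ?f h] M.abelian_monoid_axioms) auto
  also have "\<dots> = (\<Oplus>\<^bsub>V\<^esub>g\<in>carrier G. \<Oplus>\<^bsub>V\<^esub>r\<in>{..<n}. A h j r \<odot>\<^bsub>V\<^esub> ((\<mu> \<otimes>\<^bsub>k\<^esub> A (inv\<^bsub>G\<^esub> g) r i) \<odot>\<^bsub>V\<^esub> \<rho> g v))"
  proof (intro M.finsum_cong' refl)
    fix g assume g: "g \<in> carrier G"
    have "?f g = (\<Oplus>\<^bsub>k\<^esub>r\<in>{..<n}. \<mu> \<otimes>\<^bsub>k\<^esub> (A h j r \<otimes>\<^bsub>k\<^esub> A (inv\<^bsub>G\<^esub> g) r i)) \<odot>\<^bsub>V\<^esub> \<rho> g v"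
      using g h ij A_closed mu_closed by (simp add: A_mult R.finsum_rdistr Pi_iff)
    also have "\<dots> = (\<Oplus>\<^bsub>V\<^esub>r\<in>{..<n}. (\<mu> \<otimes>\<^bsub>k\<^esub> (A h j r \<otimes>\<^bsub>k\<^esub> A (inv\<^bsub>G\<^esub> g) r i)) \<odot>\<^bsub>V\<^esub> \<rho> g v)"
      using g h ij v A_closed mu_closed rho_closed by (intro finsum_smult_r) auto
    also have "\<dots> = (\<Oplus>\<^bsub>V\<^esub>r\<in>{..<n}. A h j r \<odot>\<^bsub>V\<^esub> ((\<mu> \<otimes>\<^bsub>k\<^esub> A (inv\<^bsub>G\<^esub> g) r i) \<odot>\<^bsub>V\<^esub> \<rho> g v))"
      using g h ij v A_closed mu_closed rho_closed
      by (intro M.finsum_cong') (auto simp: smult_assoc1[symmetric] R.m_ac)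
    finally show "?f g = (\<Oplus>\<^bsub>V\<^esub>r\<in>{..<n}. A h j r \<odot>\<^bsub>V\<^esub> ((\<mu> \<otimes>\<^bsub>k\<^esub> A (inv\<^bsub>G\<^esub> g) r i) \<odot>\<^bsub>V\<^esub> \<rho> g v))" .
  qed (use h ij v A_closed coeff_closed rho_closed in \<open>auto intro!: M.finsum_closed\<close>)
  also have "\<dots> = (\<Oplus>\<^bsub>V\<^esub>r\<in>{..<n}. \<Oplus>\<^bsub>V\<^esub>g\<in>carrier G. A h j r \<odot>\<^bsub>V\<^esub> ((\<mu> \<otimes>\<^bsub>k\<^esub> A (inv\<^bsub>G\<^esub> g) r i) \<odot>\<^bsub>V\<^esub> \<rho> g v))"
    using finite_G h ij v A_closed coeff_closed rho_closed by (intro M.finsum_swap) auto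
  also have "\<dots> = (\<Oplus>\<^bsub>V\<^esub>r\<in>{..<n}. A h j r \<odot>\<^bsub>V\<^esub> E i r v)"
    unfolding munit_def using h ij v A_closed coeff_closed rho_closed
    by (intro M.finsum_cong') (auto intro!: finsum_smult[symmetric] M.finsum_closed smult_closed)
  finally show ?thesis .
qed

text \<open>By \<open>act_munit\<close> the vectors \<open>E r m v\<close> are a family as in
  \<open>munit_family\<close>.\<close>

lemma munit_munit:
  assumes "i < n" "j < n" "l < n" "m < n" "v \<in> carrier V"
  shows "E i j (E l m v) = (if j = l then E i m v else \<zero>\<^bsub>V\<^esub>)"
  using munit_family[of "\<lambda>r. E r m v" i j l] assms munit_closed act_munit by auto

end

text \<open>If n times one were zero, the characteristic c would be positive and the remainder of n
  modulo c would also annihilate one. By minimality of c this remainder is zero.\<close>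

lemma not_ring_char_dvd:
  assumes "field k" "\<not> ring_char k dvd n"
  shows "add_pow k n \<one>\<^bsub>k\<^esub> \<noteq> \<zero>\<^bsub>k\<^esub>"
proof
  interpret field k by fact
  assume z: "add_pow k n \<one>\<^bsub>k\<^esub> = \<zero>\<^bsub>k\<^esub>"
  let ?P = "\<lambda>n. n > 0 \<and> add_pow k (n::nat) \<one>\<^bsub>k\<^esub> = \<zero>\<^bsub>k\<^esub>"
  have "n > 0" using assms(2) by (cases n) auto
  then have P: "?P n" using z by simp
  define c where "c = (LEAST n. ?P n)"
  have c: "?P c" unfolding c_def using P by (rule LeastI)
  have min: "c \<le> m" if "?P m" for m unfolding c_def using that by (rule Least_le)
  have "\<exists>n>0. add_pow k (n::nat) \<one>\<^bsub>k\<^esub> = \<zero>\<^bsub>k\<^esub>" using P by blast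
  then have "ring_char k = c" by (simp add: ring_char_def c_def)
  have "add_pow k n \<one>\<^bsub>k\<^esub> = add_pow k (c * (n div c)) \<one>\<^bsub>k\<^esub> \<oplus>\<^bsub>k\<^esub> add_pow k (n mod c) \<one>\<^bsub>k\<^esub>"
    by (simp add: add.nat_pow_mult)
  also have "add_pow k (c * (n div c)) \<one>\<^bsub>k\<^esub> = \<zero>\<^bsub>k\<^esub>"
    using c add.nat_pow_pow[of "\<one>\<^bsub>k\<^esub>" "n div c" c] by (simp add: mult.commute)
  finally have "add_pow k (n mod c) \<one>\<^bsub>k\<^esub> = \<zero>\<^bsub>k\<^esub>" using z by simp
  then have "n mod c = 0" using min[of "n mod c"] c mod_less_divisor[of c n] by fastforce
  then show False using assms(2) \<open>ring_char k = c\<close> by auto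
qed

text \<open>Schur orthogonality by averaging. The constant \<open>\<mu>\<close> is the inverse of
  the common value \<open>s0\<close> of the nonvanishing sums, and its existence is where the order
  of G has to be nonzero in k.\<close>

lemma (in irreducible_group_rep) irr_matrix_exists:
  assumes "algebraically_closed k" "finite (carrier G)" "\<not> ring_char k dvd order G"
    and "coord_basis k V n b c"
  shows "\<exists>\<mu>. irr_matrix k G n (\<lambda>g i j. c i (\<rho> g (b j))) \<mu>"
proof -
  interpret B: coord_basis k V n b c by fact
  define A where "A g i j = c i (\<rho> g (b j))" for g i j
  have rc: "\<rho> g v \<in> carrier V" if "g \<in> carrier G" "v \<in> carrier V" for g v
    using module_hom_apply[OF rep_hom] that .
  have ra: "additive_map V V (\<rho> g)" if "g \<in> carrier G" for g
    using module_hom_additive[OF rep_hom[OF that]] .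
  have rs: "\<rho> g (a \<odot>\<^bsub>V\<^esub> v) = a \<odot>\<^bsub>V\<^esub> \<rho> g v" if "g \<in> carrier G" "a \<in> carrier k" "v \<in> carrier V" for g a v
    using module_hom_smult[OF rep_hom] that .
  have Ac: "A g i j \<in> carrier k" if "g \<in> carrier G" "i < n" "j < n" for g i j
    using that by (simp add: A_def B.c_closed rc B.b_closed)
  have act: "\<rho> g (b j) = (\<Oplus>\<^bsub>V\<^esub>i\<in>{..<n}. A g i j \<odot>\<^bsub>V\<^esub> b i)" if "g \<in> carrier G" "j < n" for g j
    unfolding A_def using that by (intro B.expand rc B.b_closed)
  have A_mult: "A (g \<otimes>\<^bsub>G\<^esub> h) i j = (\<Oplus>\<^bsub>k\<^esub>l\<in>{..<n}. A g i l \<otimes>\<^bsub>k\<^esub> A h l j)"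
    if "g \<in> carrier G" "h \<in> carrier G" "i < n" "j < n" for g h i j
  proof -
    have "A (g \<otimes>\<^bsub>G\<^esub> h) i j = c i (\<rho> g (\<Oplus>\<^bsub>V\<^esub>l\<in>{..<n}. A h l j \<odot>\<^bsub>V\<^esub> b l))"
      using that by (simp only: A_def[of "g \<otimes>\<^bsub>G\<^esub> h"] rep_mult B.b_closed act[of h j])
    also have "\<dots> = (\<Oplus>\<^bsub>k\<^esub>l\<in>{..<n}. c i (\<rho> g (A h l j \<odot>\<^bsub>V\<^esub> b l)))"
      using that Ac B.b_closed
      by (intro additive_finsum[OF M.abelian_group_axioms R.abelian_group_axioms
            additive_compose[OF ra B.c_additive]]) auto
    also have "\<dots> = (\<Oplus>\<^bsub>k\<^esub>l\<in>{..<n}. A g i l \<otimes>\<^bsub>k\<^esub> A h l j)"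
      using that Ac B.b_closed rc
      by (intro R.finsum_cong') (auto simp: rs B.c_smult A_def[of g] R.m_comm B.c_closed)
    finally show ?thesis .
  qed
  have A_one: "A \<one>\<^bsub>G\<^esub> i j = (if i = j then \<one>\<^bsub>k\<^esub> else \<zero>\<^bsub>k\<^esub>)" if "i < n" "j < n" for i j
    using that by (simp add: A_def rep_one B.b_closed B.c_b)
  define S where "S i a b' j = (\<Oplus>\<^bsub>k\<^esub>g\<in>carrier G. A g i a \<otimes>\<^bsub>k\<^esub> A (inv\<^bsub>G\<^esub> g) b' j)" for i a b' j
  have ex: "\<exists>l\<in>carrier k. \<forall>i<n. \<forall>j<n. S i a b' j = (if i = j then l else \<zero>\<^bsub>k\<^esub>)" if ab: "a < n" "b' < n" for a b'
  proof -
    \<comment> \<open>The sum over G of the conjugates of the rank-one map v -> c_b'(v) b_a. It is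
      equivariant, hence a scalar by Schur's lemma, and its (i, j) matrix entry is
      \<open>S i a b' j\<close>.\<close>
    define T where "T v = (\<Oplus>\<^bsub>V\<^esub>g\<in>carrier G. c b' (\<rho> (inv\<^bsub>G\<^esub> g) v) \<odot>\<^bsub>V\<^esub> \<rho> g (b a))" for v
    have tc: "c b' (\<rho> (inv\<^bsub>G\<^esub> g) v) \<odot>\<^bsub>V\<^esub> \<rho> g (b a) \<in> carrier V" if "g \<in> carrier G" "v \<in> carrier V" for g v
      using that ab by (simp add: B.c_closed rc B.b_closed)
    have "additive_map V V T"
      unfolding T_def using ab
      by (intro additive_finsum_fun M.abelian_group_axioms
          additive_compose[OF additive_compose[OF ra B.c_additive] additive_smult_left] module_axioms rc B.b_closed) auto
    moreover have "T (d \<odot>\<^bsub>V\<^esub> v) = d \<odot>\<^bsub>V\<^esub> T v" if "d \<in> carrier k" "v \<in> carrier V" for d v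
    proof -
      have "T (d \<odot>\<^bsub>V\<^esub> v) = (\<Oplus>\<^bsub>V\<^esub>g\<in>carrier G. d \<odot>\<^bsub>V\<^esub> (c b' (\<rho> (inv\<^bsub>G\<^esub> g) v) \<odot>\<^bsub>V\<^esub> \<rho> g (b a)))"
        unfolding T_def using that ab tc
        by (intro M.finsum_cong') (auto simp: rs B.c_smult smult_assoc1 rc B.c_closed B.b_closed)
      then show ?thesis unfolding T_def using that tc by (subst finsum_smult) auto
    qed
    ultimately have T_hom: "T \<in> module_hom k V V" by (intro module_homI) auto
    have T_act: "T (\<rho> h v) = \<rho> h (T v)" if h: "h \<in> carrier G" "v \<in> carrier V" for h v
    proof -
      let ?f = "\<lambda>g. c b' (\<rho> (inv\<^bsub>G\<^esub> g) (\<rho> h v)) \<odot>\<^bsub>V\<^esub> \<rho> g (b a)"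
      have "T (\<rho> h v) = (\<Oplus>\<^bsub>V\<^esub>g\<in>carrier G. ?f (h \<otimes>\<^bsub>G\<^esub> g))"
        unfolding T_def using h tc rc
        by (intro G.finite_sum_translate(1)[of V ?f h, symmetric] M.abelian_monoid_axioms) auto
      also have "\<dots> = (\<Oplus>\<^bsub>V\<^esub>g\<in>carrier G. \<rho> h (c b' (\<rho> (inv\<^bsub>G\<^esub> g) v) \<odot>\<^bsub>V\<^esub> \<rho> g (b a)))"
      proof (intro M.finsum_cong' refl)
        fix g assume g: "g \<in> carrier G"
        have "\<rho> (inv\<^bsub>G\<^esub> (h \<otimes>\<^bsub>G\<^esub> g)) (\<rho> h v) = \<rho> (inv\<^bsub>G\<^esub> g) v"
          using g h by (simp add: rep_mult[symmetric] G.inv_mult_group G.m_assoc)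
        then show "?f (h \<otimes>\<^bsub>G\<^esub> g) = \<rho> h (c b' (\<rho> (inv\<^bsub>G\<^esub> g) v) \<odot>\<^bsub>V\<^esub> \<rho> g (b a))"
          using g h ab by (simp add: rs rep_mult rc B.c_closed B.b_closed)
      qed (use h rc tc in auto)
      also have "\<dots> = \<rho> h (T v)"
        unfolding T_def using h tc
        by (intro additive_finsum[OF M.abelian_group_axioms M.abelian_group_axioms ra, symmetric]) auto
      finally show ?thesis .
    qed
    have fd: fin_dim
    proof -
      have "x \<in> span (b ` {..<n})" if x: "x \<in> carrier V" for x
      proof -
        have sub: "b ` {..<n} \<subseteq> carrier V" using B.b_closed by auto
        have "(\<Oplus>\<^bsub>V\<^esub>i\<in>I. c i x \<odot>\<^bsub>V\<^esub> b i) \<in> span (b ` {..<n})" if "I \<subseteq> {..<n}" for I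
        proof -
          have "finite I" using that finite_subset by blast
          then show ?thesis using that
          proof (induction I)
            case empty
            show ?case by (simp add: span_zero)
          next
            case (insert i I)
            interpret sp: submodule k "span (b ` {..<n})" V using span_is_submodule[OF sub] .
            have "c i x \<odot>\<^bsub>V\<^esub> b i \<in> span (b ` {..<n})"
              using insert x by (intro sp.smult_closed span_mem[OF sub] B.c_closed) auto
            then show ?case
              using insert x sub by (subst M.finsum_insert) (auto intro!: span_add1 B.c_closed B.b_closed)
          qed
        qed
        then show ?thesis by (subst B.expand[OF x]) blast
      qed
      then have "span (b ` {..<n}) = carrier V"
        using B.b_closed span_is_subset2[of "b ` {..<n}"] by auto
      then show ?thesis unfolding fin_dim_def using B.b_closed by (intro exI[of _ "b ` {..<n}"]) auto
    qed
    obtain l where l: "l \<in> carrier k" "\<And>v. v \<in> carrier V \<Longrightarrow> T v = l \<odot>\<^bsub>V\<^esub> v"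
      using schur[OF assms(1) fd T_hom T_act] by blast
    have "S i a b' j = (if i = j then l else \<zero>\<^bsub>k\<^esub>)" if ij: "i < n" "j < n" for i j
    proof -
      have "c i (T (b j)) = (\<Oplus>\<^bsub>k\<^esub>g\<in>carrier G. c i (c b' (\<rho> (inv\<^bsub>G\<^esub> g) (b j)) \<odot>\<^bsub>V\<^esub> \<rho> g (b a)))"
        unfolding T_def using ij tc B.b_closed
        by (intro additive_finsum[OF M.abelian_group_axioms R.abelian_group_axioms B.c_additive]) auto
      also have "\<dots> = S i a b' j"
        unfolding S_def using ij ab
        by (intro R.finsum_cong') (auto simp: A_def B.c_smult rc B.b_closed B.c_closed R.m_comm)
      finally have "S i a b' j = l \<otimes>\<^bsub>k\<^esub> (if i = j then \<one>\<^bsub>k\<^esub> else \<zero>\<^bsub>k\<^esub>)"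
        using l ij by (simp add: B.b_closed B.c_smult B.c_b)
      then show ?thesis using l by simp
    qed
    then show ?thesis using l by blast
  qed
  \<comment> \<open>Inversion of G exchanges the two factors. Schur's lemma describes S in the outer
    indices i and j; this symmetry transfers the description to the inner indices.\<close>
  have sym: "S i a b' j = S b' j i a" if "i < n" "a < n" "b' < n" "j < n" for i a b' j
  proof -
    let ?f = "\<lambda>g. A g i a \<otimes>\<^bsub>k\<^esub> A (inv\<^bsub>G\<^esub> g) b' j"
    have "S i a b' j = (\<Oplus>\<^bsub>k\<^esub>g\<in>carrier G. ?f (inv\<^bsub>G\<^esub> g))"
      unfolding S_def using that Ac
      by (intro G.finite_sum_translate(3)[of k ?f "\<one>\<^bsub>G\<^esub>", symmetric] R.abelian_monoid_axioms) auto
    also have "\<dots> = S b' j i a"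
      unfolding S_def using that Ac by (intro R.finsum_cong') (auto simp: R.m_comm)
    finally show ?thesis .
  qed
  have n_pos: "0 < n"
  proof (rule ccontr)
    assume "\<not> 0 < n"
    then have "v = \<zero>\<^bsub>V\<^esub>" if "v \<in> carrier V" for v using B.expand[OF that] by simp
    then show False using nontrivial by auto
  qed
  define s0 where "s0 = S 0 0 0 0"
  have lc: "s0 \<in> carrier k" unfolding s0_def S_def using n_pos Ac by (auto intro!: R.finsum_closed)
  have S: "S i a b' j = (if i = j \<and> a = b' then s0 else \<zero>\<^bsub>k\<^esub>)" if ij: "i < n" "a < n" "b' < n" "j < n" for i a b' j
  proof (cases "i = j")
    case False
    then show ?thesis using ex[OF ij(2,3)] ij by auto
  next
    case True
    show ?thesis
    proof (cases "a = b'")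
      case False
      have "S i a b' j = S b' j i a" using sym ij by blast
      also have "\<dots> = \<zero>\<^bsub>k\<^esub>" using ex[OF ij(4,1)] ij False by auto
      finally show ?thesis using False by simp
    next
      case ab: True
      have "S i a a i = S 0 a a 0" using ex[OF ij(2) ij(2)] ij n_pos by auto
      also have "\<dots> = S a 0 0 a" using sym ij n_pos by blast
      also have "\<dots> = S 0 0 0 0" using ex[OF n_pos n_pos] ij n_pos by auto
      finally show ?thesis using ab True by (simp add: s0_def)
    qed
  qed
  \<comment> \<open>Summing the diagonal sums over a multiplies the matrices of g and of its
    inverse. Each group element then contributes A(1)_00 = 1, so n s0 is the order of G in
    k.\<close>
  have "add_pow k n s0 = (\<Oplus>\<^bsub>k\<^esub>a\<in>{..<n}. S 0 a a 0)"
    using S n_pos lc by (simp add: R.add.finprod_const cong: R.finsum_cong)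
  also have "\<dots> = (\<Oplus>\<^bsub>k\<^esub>g\<in>carrier G. \<Oplus>\<^bsub>k\<^esub>a\<in>{..<n}. A g 0 a \<otimes>\<^bsub>k\<^esub> A (inv\<^bsub>G\<^esub> g) a 0)"
    unfolding S_def using n_pos Ac assms(2) by (intro R.finsum_swap) auto
  also have "\<dots> = (\<Oplus>\<^bsub>k\<^esub>g\<in>carrier G. \<one>\<^bsub>k\<^esub>)"
    using n_pos Ac A_mult A_one by (intro R.finsum_cong') (auto simp flip: A_mult)
  also have "\<dots> = add_pow k (order G) \<one>\<^bsub>k\<^esub>"
    by (simp add: R.add.finprod_const order_def)
  finally have "add_pow k n s0 \<noteq> \<zero>\<^bsub>k\<^esub>" using not_ring_char_dvd[OF field_axioms assms(3)] by simp
  then have "s0 \<noteq> \<zero>\<^bsub>k\<^esub>" by auto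
  then have mu: "inv\<^bsub>k\<^esub> s0 \<in> carrier k" "inv\<^bsub>k\<^esub> s0 \<otimes>\<^bsub>k\<^esub> s0 = \<one>\<^bsub>k\<^esub>" using lc by (auto simp: field_Units)
  have "irr_matrix k G n A (inv\<^bsub>k\<^esub> s0)"
  proof
    fix i a b' j assume ij: "i < n" "a < n" "b' < n" "j < n"
    have "(\<Oplus>\<^bsub>k\<^esub>g\<in>carrier G. inv\<^bsub>k\<^esub> s0 \<otimes>\<^bsub>k\<^esub> (A g i a \<otimes>\<^bsub>k\<^esub> A (inv\<^bsub>G\<^esub> g) b' j)) = inv\<^bsub>k\<^esub> s0 \<otimes>\<^bsub>k\<^esub> S i a b' j"
      unfolding S_def using mu ij Ac assms(2) by (intro R.finsum_rdistr[symmetric]) auto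
    then show "(\<Oplus>\<^bsub>k\<^esub>g\<in>carrier G. inv\<^bsub>k\<^esub> s0 \<otimes>\<^bsub>k\<^esub> (A g i a \<otimes>\<^bsub>k\<^esub> A (inv\<^bsub>G\<^esub> g) b' j))
        = (if i = j \<and> a = b' then \<one>\<^bsub>k\<^esub> else \<zero>\<^bsub>k\<^esub>)"
      using S[OF ij] mu by auto
  qed (use assms(2) n_pos Ac A_mult mu in auto)
  then show ?thesis unfolding A_def by blast
qed

section \<open>Tensor products\<close>

definition pure_tensor ::
  "('r, 'c) ring_scheme \<Rightarrow> ('r, 'm, 'y) module_scheme \<Rightarrow> ('r, 'n, 'z) module_scheme
    \<Rightarrow> 'm \<Rightarrow> 'n \<Rightarrow> (('m \<times> 'n) \<Rightarrow>\<^sub>0 int) set"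
  where "pure_tensor R M N m n = tensor_relations R M N #>\<^bsub>pair_group M N\<^esub> frag_of (m, n)"

locale tensor_product = M: module R M + N: module R N
  for R :: "('r, 'c) ring_scheme" and M :: "('r, 'm, 'y) module_scheme"
    and N :: "('r, 'n, 'z) module_scheme"
begin

abbreviation P where "P \<equiv> pair_group M N"
abbreviation Rel where "Rel \<equiv> tensor_relations R M N"
abbreviation cls where "cls c \<equiv> Rel #>\<^bsub>P\<^esub> c"
abbreviation T where "T \<equiv> tensor_module R M N"
abbreviation pure where "pure \<equiv> pure_tensor R M N"

lemma group_P: "Group.group P" and comm_group_P: "comm_group P"
  by (simp_all add: abelian_free_Abelian_group)

text \<open>The generating relations get a name of their own because maps out of the tensor product
  are tested on exactly these elements.\<close>

definition gens where "gens = 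
    {frag_of (m \<oplus>\<^bsub>M\<^esub> m', n) - frag_of (m, n) - frag_of (m', n) | m m' n.
        m \<in> carrier M \<and> m' \<in> carrier M \<and> n \<in> carrier N}
     \<union> {frag_of (m, n \<oplus>\<^bsub>N\<^esub> n') - frag_of (m, n) - frag_of (m, n') | m n n'.
        m \<in> carrier M \<and> n \<in> carrier N \<and> n' \<in> carrier N}
     \<union> {frag_of (a \<odot>\<^bsub>M\<^esub> m, n) - frag_of (m, a \<odot>\<^bsub>N\<^esub> n) | a m n.
        a \<in> carrier R \<and> m \<in> carrier M \<and> n \<in> carrier N}"

lemma Rel_gens: "Rel = generate P gens"
  by (simp add: tensor_relations_def gens_def)

lemma frag_in_P: "m \<in> carrier M \<Longrightarrow> n \<in> carrier N \<Longrightarrow> frag_of (m, n) \<in> carrier P"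
  by simp

lemma P_add: "c \<in> carrier P \<Longrightarrow> d \<in> carrier P \<Longrightarrow> c + d \<in> carrier P"
  using group.is_monoid[OF group_P, THEN monoid.m_closed, of c d] by simp

lemma P_uminus: "c \<in> carrier P \<Longrightarrow> - c \<in> carrier P"
  by simp

lemma P_diff: "c \<in> carrier P \<Longrightarrow> d \<in> carrier P \<Longrightarrow> c - d \<in> carrier P"
  using P_add[of c "- d"] by simp

lemma gens_sub: "gens \<subseteq> carrier P"
  unfolding gens_def by (auto intro!: P_diff simp del: carrier_free_Abelian_group_iff)

lemma subgroup_Rel: "subgroup Rel P"
  unfolding Rel_gens by (rule group.generate_is_subgroup[OF group_P gens_sub])

lemma normal_Rel: "Rel \<lhd> P"
  using comm_group.normal_iff_subgroup[OF comm_group_P] subgroup_Rel by blast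

lemma cls_closed: "c \<in> carrier P \<Longrightarrow> cls c \<in> carrier (T \<mu>)"
  by (auto simp: tensor_module_def FactGroup_def RCOSETS_def)

lemma cls_cases:
  assumes "A \<in> carrier (T \<mu>)"
  obtains c where "c \<in> carrier P" "A = cls c"
  using assms by (auto simp: tensor_module_def FactGroup_def RCOSETS_def)

lemma cls_add: "c \<in> carrier P \<Longrightarrow> d \<in> carrier P \<Longrightarrow> cls c \<oplus>\<^bsub>T \<mu>\<^esub> cls d = cls (c + d)"
  using normal.rcos_sum[OF normal_Rel, of c d] by (simp add: tensor_module_def)

lemma cls_Rel: "r \<in> Rel \<Longrightarrow> c \<in> carrier P \<Longrightarrow> cls (r + c) = cls c"
proof -
  assume r: "r \<in> Rel" and c: "c \<in> carrier P"
  have rP: "r \<in> carrier P" using r subgroup.subset[OF subgroup_Rel] by blast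
  have "cls (r + c) = (Rel #>\<^bsub>P\<^esub> r) #>\<^bsub>P\<^esub> c"
    using group.coset_mult_assoc[OF group_P subgroup.subset[OF subgroup_Rel] rP c] by simp
  also have "Rel #>\<^bsub>P\<^esub> r = Rel"
    by (rule group.coset_join2[OF group_P rP subgroup_Rel r])
  finally show ?thesis .
qed

lemma cls_eqI: "c - d \<in> Rel \<Longrightarrow> d \<in> carrier P \<Longrightarrow> cls c = cls d"
  using cls_Rel[of "c - d" d] by simp

lemma cls_self: "c \<in> carrier P \<Longrightarrow> c \<in> cls c"
  using group.rcos_self[OF group_P _ subgroup_Rel] by blast

lemma cls_eq: "c \<in> carrier P \<Longrightarrow> d \<in> cls c \<Longrightarrow> cls d = cls c"
proof -
  assume c: "c \<in> carrier P" and "d \<in> cls c"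
  then obtain r where "r \<in> Rel" "d = r + c" by (auto simp: r_coset_def)
  then show ?thesis using cls_Rel c by simp
qed

lemma cls_carrier: "c \<in> carrier P \<Longrightarrow> d \<in> cls c \<Longrightarrow> d \<in> carrier P"
  using monoid.r_coset_subset_G[OF group.is_monoid[OF group_P] subgroup.subset[OF subgroup_Rel]] by blast

lemma T_zero: "\<zero>\<^bsub>T \<mu>\<^esub> = cls 0"
proof -
  have "cls 0 = Rel"
    using group.coset_join2[OF group_P _ subgroup_Rel, of 0] subgroup.one_closed[OF subgroup_Rel] by simp
  then show ?thesis by (simp add: tensor_module_def FactGroup_def)
qed

lemma abelian_group_T: "abelian_group (T \<mu>)"
proof (rule abelian_groupI)
  fix x y assume x: "x \<in> carrier (T \<mu>)" and y: "y \<in> carrier (T \<mu>)"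
  obtain c d where cd: "c \<in> carrier P" "x = cls c" "d \<in> carrier P" "y = cls d"
    using x y by (metis cls_cases)
  show "x \<oplus>\<^bsub>T \<mu>\<^esub> y \<in> carrier (T \<mu>)" using cd cls_closed[OF P_add] by (simp only: cls_add)
  show "x \<oplus>\<^bsub>T \<mu>\<^esub> y = y \<oplus>\<^bsub>T \<mu>\<^esub> x" using cd by (simp only: cls_add add.commute)
  show "\<zero>\<^bsub>T \<mu>\<^esub> \<oplus>\<^bsub>T \<mu>\<^esub> x = x" using cd by (simp add: T_zero cls_add del: carrier_free_Abelian_group_iff) (simp add: cls_add)
  show "\<exists>y\<in>carrier (T \<mu>). y \<oplus>\<^bsub>T \<mu>\<^esub> x = \<zero>\<^bsub>T \<mu>\<^esub>"
    using cd cls_closed[OF P_uminus[OF cd(1)]] P_uminus[OF cd(1)]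
    by (intro bexI[of _ "cls (- c)"]) (simp_all only: cls_add T_zero ab_left_minus)
  fix z assume "z \<in> carrier (T \<mu>)"
  then obtain e where "e \<in> carrier P" "z = cls e" by (metis cls_cases)
  then show "x \<oplus>\<^bsub>T \<mu>\<^esub> y \<oplus>\<^bsub>T \<mu>\<^esub> z = x \<oplus>\<^bsub>T \<mu>\<^esub> (y \<oplus>\<^bsub>T \<mu>\<^esub> z)"
    using cd P_add by (simp only: cls_add add.assoc)
next
  show "\<zero>\<^bsub>T \<mu>\<^esub> \<in> carrier (T \<mu>)" unfolding T_zero by (rule cls_closed) simp
qed

lemma pure_closed: "m \<in> carrier M \<Longrightarrow> n \<in> carrier N \<Longrightarrow> pure m n \<in> carrier (T \<mu>)"
  unfolding pure_tensor_def by (intro cls_closed frag_in_P)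

lemma pure_add_left:
  assumes "m \<in> carrier M" "m' \<in> carrier M" "n \<in> carrier N"
  shows "pure (m \<oplus>\<^bsub>M\<^esub> m') n = pure m n \<oplus>\<^bsub>T \<mu>\<^esub> pure m' n"
proof -
  have "frag_of (m \<oplus>\<^bsub>M\<^esub> m', n) - (frag_of (m, n) + frag_of (m', n)) \<in> Rel"
    unfolding Rel_gens diff_diff_eq[symmetric]
    by (rule generate.incl) (use assms in \<open>auto simp: gens_def\<close>)
  then show ?thesis unfolding pure_tensor_def
    using assms cls_eqI frag_in_P P_add by (simp only: cls_add)
qed

lemma pure_add_right:
  assumes "m \<in> carrier M" "n \<in> carrier N" "n' \<in> carrier N"
  shows "pure m (n \<oplus>\<^bsub>N\<^esub> n') = pure m n \<oplus>\<^bsub>T \<mu>\<^esub> pure m n'"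
proof -
  have "frag_of (m, n \<oplus>\<^bsub>N\<^esub> n') - (frag_of (m, n) + frag_of (m, n')) \<in> Rel"
    unfolding Rel_gens diff_diff_eq[symmetric]
    by (rule generate.incl) (use assms in \<open>auto simp: gens_def\<close>)
  then show ?thesis unfolding pure_tensor_def
    using assms cls_eqI frag_in_P P_add by (simp only: cls_add)
qed

lemma pure_smult:
  assumes "a \<in> carrier R" "m \<in> carrier M" "n \<in> carrier N"
  shows "pure (a \<odot>\<^bsub>M\<^esub> m) n = pure m (a \<odot>\<^bsub>N\<^esub> n)"
proof -
  have "frag_of (a \<odot>\<^bsub>M\<^esub> m, n) - frag_of (m, a \<odot>\<^bsub>N\<^esub> n) \<in> Rel"
    unfolding Rel_gens by (rule generate.incl) (use assms in \<open>auto simp: gens_def\<close>)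
  then show ?thesis unfolding pure_tensor_def
    using assms cls_eqI frag_in_P N.smult_closed by simp
qed

lemma pure_additive_left: "n \<in> carrier N \<Longrightarrow> additive_map M (T \<mu>) (\<lambda>m. pure m n)"
  unfolding additive_map_def using pure_closed pure_add_left by blast

lemma pure_additive_right: "m \<in> carrier M \<Longrightarrow> additive_map N (T \<mu>) (\<lambda>n. pure m n)"
  unfolding additive_map_def using pure_closed pure_add_right by blast

lemma tensor_induct [consumes 1, case_names zero pure add]:
  assumes A: "A \<in> carrier (T \<mu>)"
    and zero: "Q \<zero>\<^bsub>T \<mu>\<^esub>"
    and pure: "\<And>m n. m \<in> carrier M \<Longrightarrow> n \<in> carrier N \<Longrightarrow> Q (pure m n)"
    and add: "\<And>A B. A \<in> carrier (T \<mu>) \<Longrightarrow> B \<in> carrier (T \<mu>) \<Longrightarrow> Q A \<Longrightarrow> Q B \<Longrightarrow> Q (A \<oplus>\<^bsub>T \<mu>\<^esub> B)"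
  shows "Q A"
proof -
  interpret T: abelian_group "T \<mu>" by (rule abelian_group_T)
  obtain c where c: "c \<in> carrier P" "A = cls c" using A by (rule cls_cases)
  have "Poly_Mapping.keys c \<subseteq> carrier M \<times> carrier N" using c by simp
  \<comment> \<open>Induction on the free abelian group forms differences, so c and - c have to be
    treated together.\<close>
  then have "Q (cls c) \<and> Q (cls (- c))"
  proof (induction rule: free_Abelian_group_induct[consumes 1, case_names z d f])
    case z
    then show ?case using zero by (simp add: T_zero)
  next
    case (d x y)
    then have xy: "x \<in> carrier P" "y \<in> carrier P" "- x \<in> carrier P" "- y \<in> carrier P" by simp_all
    have "cls (x - y) = cls x \<oplus>\<^bsub>T \<mu>\<^esub> cls (- y)" "cls (- (x - y)) = cls y \<oplus>\<^bsub>T \<mu>\<^esub> cls (- x)"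
      using xy by (simp_all only: cls_add) simp_all
    then show ?case using d xy by (auto intro!: add cls_closed simp del: carrier_free_Abelian_group_iff)
  next
    case (f a)
    then obtain m n where a: "a = (m, n)" "m \<in> carrier M" "n \<in> carrier N" by auto
    \<comment> \<open>The class of minus a generator is again a pure tensor, with the sign absorbed
      by the left factor.\<close>
    have "pure (\<ominus>\<^bsub>M\<^esub> m) n \<oplus>\<^bsub>T \<mu>\<^esub> pure m n = \<zero>\<^bsub>T \<mu>\<^esub>"
      using a pure_add_left[of "\<ominus>\<^bsub>M\<^esub> m" m n \<mu>]
        additive_zero[OF M.M.abelian_group_axioms abelian_group_T pure_additive_left, of n]
      by (simp add: M.M.l_neg)
    moreover have "cls (- frag_of a) \<oplus>\<^bsub>T \<mu>\<^esub> pure m n = \<zero>\<^bsub>T \<mu>\<^esub>"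
      unfolding pure_tensor_def T_zero a using a frag_in_P[OF a(2,3)] P_uminus[OF frag_in_P[OF a(2,3)]]
      by (simp only: cls_add) simp
    ultimately have "cls (- frag_of a) = pure (\<ominus>\<^bsub>M\<^esub> m) n"
      using a pure_closed cls_closed[OF P_uminus[OF frag_in_P[OF a(2,3)]]] 
      by (metis T.add.r_cancel M.M.a_inv_closed)
    then show ?case using pure[of m n] pure[of "\<ominus>\<^bsub>M\<^esub> m" n] a by (simp add: pure_tensor_def)
  qed
  then show ?thesis using c by simp
qed

lemma additive_ext:
  assumes "abelian_group Q" "additive_map (T \<mu>) Q f" "additive_map (T \<mu>) Q g"
    and "\<And>m n. m \<in> carrier M \<Longrightarrow> n \<in> carrier N \<Longrightarrow> f (pure m n) = g (pure m n)"
    and "A \<in> carrier (T \<mu>)"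
  shows "f A = g A"
  using assms(5)
proof (induction rule: tensor_induct)
  case zero
  show ?case using additive_zero[OF abelian_group_T assms(1)] assms(2,3) by metis
next
  case (add A B)
  then show ?case using assms(2,3) by (simp add: additive_add)
qed (use assms in auto)

text \<open>The target is only an abelian group, so the same statement yields maps into modules over
  another ring, such as functionals on a base change. Compatibility with scalars is checked
  afterwards on pure tensors by \<open>additive_ext\<close>.\<close>

lemma tensor_universal:
  assumes "abelian_group Q"
    and "\<And>n. n \<in> carrier N \<Longrightarrow> additive_map M Q (\<lambda>m. \<beta> m n)"
    and "\<And>m. m \<in> carrier M \<Longrightarrow> additive_map N Q (\<lambda>n. \<beta> m n)"
    and "\<And>a m n. \<lbrakk>a \<in> carrier R; m \<in> carrier M; n \<in> carrier N\<rbrakk> \<Longrightarrow> \<beta> (a \<odot>\<^bsub>M\<^esub> m) n = \<beta> m (a \<odot>\<^bsub>N\<^esub> n)"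
  obtains h where "additive_map (T \<mu>) Q h"
    "\<And>m n. m \<in> carrier M \<Longrightarrow> n \<in> carrier N \<Longrightarrow> h (pure m n) = \<beta> m n"
proof -
  interpret Q: abelian_group Q by fact
  have bc: "\<beta> m n \<in> carrier Q" if "m \<in> carrier M" "n \<in> carrier N" for m n
    using assms(2) that by (auto simp: additive_map_def)
  have img: "(\<lambda>(m, n). \<beta> m n) ` (carrier M \<times> carrier N) \<subseteq> carrier (add_monoid Q)" using bc by auto
  obtain h0 where h0: "h0 \<in> hom P (add_monoid Q)"
    and h0f: "\<And>x. x \<in> carrier M \<times> carrier N \<Longrightarrow> h0 (frag_of x) = (\<lambda>(m, n). \<beta> m n) x"
    using comm_group.free_Abelian_group_universal[OF Q.a_comm_group img] by blast
  interpret h0: group_hom P "add_monoid Q" h0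
    using h0 group_P comm_group.axioms(2)[OF Q.a_comm_group] by (simp add: group_hom_def group_hom_axioms_def)
  have h0c: "h0 c \<in> carrier Q" if "c \<in> carrier P" for c using h0.hom_closed[OF that] by simp
  have h0a: "h0 (c + d) = h0 c \<oplus>\<^bsub>Q\<^esub> h0 d" if "c \<in> carrier P" "d \<in> carrier P" for c d
    using h0.hom_mult[OF that] by simp
  have h0d: "h0 (c - d) = h0 c \<ominus>\<^bsub>Q\<^esub> h0 d" if "c \<in> carrier P" "d \<in> carrier P" for c d
  proof -
    have "h0 (c - d) \<oplus>\<^bsub>Q\<^esub> h0 d = h0 c" using h0a[OF P_diff[OF that] that(2)] by simp
    then show ?thesis using h0c[OF that(1)] h0c[OF that(2)] h0c[OF P_diff[OF that]]
      by (metis Q.minus_eq Q.add.inv_solve_right)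
  qed
  have gen0: "h0 g = \<zero>\<^bsub>Q\<^esub>" if "g \<in> gens" for g
    using that unfolding gens_def
  proof (elim UnE)
    assume "g \<in> {frag_of (m \<oplus>\<^bsub>M\<^esub> m', n) - frag_of (m, n) - frag_of (m', n) | m m' n.
        m \<in> carrier M \<and> m' \<in> carrier M \<and> n \<in> carrier N}"
    then obtain m m' n where e: "g = frag_of (m \<oplus>\<^bsub>M\<^esub> m', n) - frag_of (m, n) - frag_of (m', n)"
      "m \<in> carrier M" "m' \<in> carrier M" "n \<in> carrier N" by blast
    have "h0 g = \<beta> (m \<oplus>\<^bsub>M\<^esub> m') n \<ominus>\<^bsub>Q\<^esub> \<beta> m n \<ominus>\<^bsub>Q\<^esub> \<beta> m' n"
      using e by (simp add: h0d h0f P_diff del: carrier_free_Abelian_group_iff)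
    then show ?thesis using e bc additive_add[OF assms(2), of n m m']
      by (simp add: Q.minus_eq Q.a_ac Q.r_neg Q.r_neg1)
  next
    assume "g \<in> {frag_of (m, n \<oplus>\<^bsub>N\<^esub> n') - frag_of (m, n) - frag_of (m, n') | m n n'.
        m \<in> carrier M \<and> n \<in> carrier N \<and> n' \<in> carrier N}"
    then obtain m n n' where e: "g = frag_of (m, n \<oplus>\<^bsub>N\<^esub> n') - frag_of (m, n) - frag_of (m, n')"
      "m \<in> carrier M" "n \<in> carrier N" "n' \<in> carrier N" by blast
    have "h0 g = \<beta> m (n \<oplus>\<^bsub>N\<^esub> n') \<ominus>\<^bsub>Q\<^esub> \<beta> m n \<ominus>\<^bsub>Q\<^esub> \<beta> m n'"
      using e by (simp add: h0d h0f P_diff del: carrier_free_Abelian_group_iff)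
    then show ?thesis using e bc additive_add[OF assms(3), of m n n']
      by (simp add: Q.minus_eq Q.a_ac Q.r_neg Q.r_neg1)
  next
    assume "g \<in> {frag_of (a \<odot>\<^bsub>M\<^esub> m, n) - frag_of (m, a \<odot>\<^bsub>N\<^esub> n) | a m n.
        a \<in> carrier R \<and> m \<in> carrier M \<and> n \<in> carrier N}"
    then obtain a m n where e: "g = frag_of (a \<odot>\<^bsub>M\<^esub> m, n) - frag_of (m, a \<odot>\<^bsub>N\<^esub> n)"
      "a \<in> carrier R" "m \<in> carrier M" "n \<in> carrier N" by blast
    have "h0 g = \<beta> (a \<odot>\<^bsub>M\<^esub> m) n \<ominus>\<^bsub>Q\<^esub> \<beta> m (a \<odot>\<^bsub>N\<^esub> n)"
      using e by (simp add: h0d h0f)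
    then show ?thesis using e bc assms(4) by (simp add: Q.r_neg Q.minus_eq)
  qed
  have "Rel \<subseteq> kernel P (add_monoid Q) h0"
    unfolding Rel_gens
  proof (rule group.generate_subgroup_incl[OF group_P _ h0.subgroup_kernel])
    show "gens \<subseteq> kernel P (add_monoid Q) h0" using gens_sub gen0 unfolding kernel_def
      by (auto simp del: carrier_free_Abelian_group_iff)
  qed
  then have Rel0: "h0 r = \<zero>\<^bsub>Q\<^esub>" if "r \<in> Rel" for r using that by (auto simp: kernel_def)
  \<comment> \<open>The choice of representative does not matter, because \<open>h0\<close> vanishes
    on all relations.\<close>
  define h where "h A = h0 (SOME c. c \<in> A)" for A
  have hcls: "h (cls c) = h0 c" if c: "c \<in> carrier P" for c
  proof -
    have "(SOME d. d \<in> cls c) \<in> cls c" using cls_self[OF c] by (rule someI)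
    then obtain r where r: "r \<in> Rel" "(SOME d. d \<in> cls c) = r + c" by (auto simp: r_coset_def)
    have "r \<in> carrier P" using r(1) subgroup.subset[OF subgroup_Rel] by blast
    then show ?thesis unfolding h_def r(2) using h0a[OF _ c, of r] Rel0[OF r(1)] h0c[OF c] by simp
  qed
  show thesis
  proof (rule that)
    show "additive_map (T \<mu>) Q h"
      unfolding additive_map_def
    proof (intro conjI ballI funcsetI)
      fix x assume x: "x \<in> carrier (T \<mu>)"
      then show "h x \<in> carrier Q" using hcls h0c by (metis cls_cases)
      fix y assume y: "y \<in> carrier (T \<mu>)"
      obtain c d where cd: "c \<in> carrier P" "x = cls c" "d \<in> carrier P" "y = cls d"
        using x y by (metis cls_cases)
      then show "h (x \<oplus>\<^bsub>T \<mu>\<^esub> y) = h x \<oplus>\<^bsub>Q\<^esub> h y"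
        using P_add[of c d] by (simp only: cls_add hcls h0a)
    qed
    show "h (pure m n) = \<beta> m n" if "m \<in> carrier M" "n \<in> carrier N" for m n
      unfolding pure_tensor_def using that frag_in_P[OF that] by (simp only: hcls) (simp add: h0f)
  qed
qed

end

text \<open>\<open>tensor_map\<close> unites the classes of the images of all representatives; these
  coincide because each is the value of the additive map given by the universal property. The two
  base rings may differ, as they do for restriction maps, so the compatibility of f and g with
  scalars is stated as \<open>bal\<close>, inside the target.\<close>

lemma tensor_map:
  assumes T: "tensor_product R M N" and T': "tensor_product R' M' N'"
    and f: "additive_map M M' f" and g: "additive_map N N' g"
    and bal: "\<And>a m n. \<lbrakk>a \<in> carrier R; m \<in> carrier M; n \<in> carrier N\<rbrakk>
      \<Longrightarrow> pure_tensor R' M' N' (f (a \<odot>\<^bsub>M\<^esub> m)) (g n) = pure_tensor R' M' N' (f m) (g (a \<odot>\<^bsub>N\<^esub> n))"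
  shows tensor_map_additive:
      "additive_map (tensor_module R M N \<mu>) (tensor_module R' M' N' \<mu>') (tensor_map R' M' N' f g)"
    and tensor_map_pure: "\<lbrakk>m \<in> carrier M; n \<in> carrier N\<rbrakk>
      \<Longrightarrow> tensor_map R' M' N' f g (pure_tensor R M N m n) = pure_tensor R' M' N' (f m) (g n)"
proof -
  interpret T: tensor_product R M N by fact
  interpret T': tensor_product R' M' N' by fact
  let ?\<phi> = "\<lambda>(p, q). frag_of (f p, g q)"
  have fc: "f m \<in> carrier M'" if "m \<in> carrier M" for m using additive_closed[OF f that] .
  have gc: "g n \<in> carrier N'" if "n \<in> carrier N" for n using additive_closed[OF g that] .
  obtain h where h: "additive_map (tensor_module R M N \<mu>) (tensor_module R' M' N' \<mu>') h"
    and hp: "\<And>m n. m \<in> carrier M \<Longrightarrow> n \<in> carrier N \<Longrightarrow> h (pure_tensor R M N m n) = pure_tensor R' M' N' (f m) (g n)"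
  proof (rule T.tensor_universal[where \<beta>="\<lambda>m n. pure_tensor R' M' N' (f m) (g n)" and \<mu>=\<mu>])
    show "abelian_group (tensor_module R' M' N' \<mu>')" by (rule T'.abelian_group_T)
    show "additive_map M (tensor_module R' M' N' \<mu>') (\<lambda>m. pure_tensor R' M' N' (f m) (g n))" if "n \<in> carrier N" for n
      using additive_compose[OF f T'.pure_additive_left[OF gc[OF that]]] .
    show "additive_map N (tensor_module R' M' N' \<mu>') (\<lambda>n. pure_tensor R' M' N' (f m) (g n))" if "m \<in> carrier M" for m
      using additive_compose[OF g T'.pure_additive_right[OF fc[OF that]]] .
  qed (use bal in auto)
  have ext: "frag_extend ?\<phi> c \<in> carrier T'.P \<and> T'.cls (frag_extend ?\<phi> c) = h (T.cls c)"
    if "c \<in> carrier T.P" for c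
  proof -
    have "Poly_Mapping.keys c \<subseteq> carrier M \<times> carrier N" using that by simp
    then show ?thesis
    proof (induction rule: free_Abelian_group_induct[consumes 1, case_names z d f])
      case z
      show ?case
        using additive_zero[OF T.abelian_group_T T'.abelian_group_T h] by (simp add: T.T_zero T'.T_zero)
    next
      case (d x y)
      interpret A: abelian_group "tensor_module R M N \<mu>" by (rule T.abelian_group_T)
      interpret A': abelian_group "tensor_module R' M' N' \<mu>'" by (rule T'.abelian_group_T)
      have xy: "x \<in> carrier T.P" "y \<in> carrier T.P" using d by simp_all
      let ?x = "frag_extend ?\<phi> x" and ?y = "frag_extend ?\<phi> y"
      have c: "?x \<in> carrier T'.P" "?y \<in> carrier T'.P" using d by blast+
      note d' = d
      have e: "?x - ?y \<in> carrier T'.P" "x - y \<in> carrier T.P" using T'.P_diff[OF c] T.P_diff[OF xy] .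
      have 1: "T'.cls (?x - ?y) \<oplus>\<^bsub>tensor_module R' M' N' \<mu>'\<^esub> T'.cls ?y = T'.cls ?x"
        using e c by (simp only: T'.cls_add diff_add_cancel)
      have 3: "h (T.cls (x - y)) \<oplus>\<^bsub>tensor_module R' M' N' \<mu>'\<^esub> h (T.cls y) = h (T.cls x)"
        using additive_add[OF h T.cls_closed[OF e(2)] T.cls_closed[OF xy(2)]] e xy
        by (simp only: T.cls_add diff_add_cancel)
      have "T'.cls (?x - ?y) = h (T.cls (x - y))"
      proof (rule A'.add.r_cancel[of _ "T'.cls ?y"])
        show "T'.cls (?x - ?y) \<oplus>\<^bsub>tensor_module R' M' N' \<mu>'\<^esub> T'.cls ?y
            = h (T.cls (x - y)) \<oplus>\<^bsub>tensor_module R' M' N' \<mu>'\<^esub> T'.cls ?y"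
          using 1 3 d' by simp
        show "h (T.cls (x - y)) \<in> carrier (tensor_module R' M' N' \<mu>')"
          using additive_closed[OF h T.cls_closed[OF e(2)]] .
      qed (use e(1) c(2) in \<open>blast intro: T'.cls_closed\<close>)+
      then show ?case using e(1) by (simp only: frag_extend_diff)
    next
      case (f a)
      then obtain m n where "a = (m, n)" "m \<in> carrier M" "n \<in> carrier N" by auto
      then show ?case using hp[of m n] fc gc by (simp add: pure_tensor_def)
    qed
  qed
  have eq: "tensor_map R' M' N' f g A = h A" if A: "A \<in> carrier (tensor_module R M N \<mu>)" for A
  proof -
    obtain c where c: "c \<in> carrier T.P" "A = T.cls c" using A by (rule T.cls_cases)
    have "tensor_map R' M' N' f g A = (\<Union>d\<in>T.cls c. h (T.cls c))"
      unfolding tensor_map_def c(2)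
    proof (rule SUP_cong[OF refl])
      fix d assume d: "d \<in> T.cls c"
      show "T'.cls (frag_extend ?\<phi> d) = h (T.cls c)"
        using ext[OF T.cls_carrier[OF c(1) d]] T.cls_eq[OF c(1) d] by simp
    qed
    also have "\<dots> = h A" using T.cls_self[OF c(1)] c(2) by auto
    finally show ?thesis .
  qed
  interpret A: abelian_group "tensor_module R M N \<mu>" by (rule T.abelian_group_T)
  show "additive_map (tensor_module R M N \<mu>) (tensor_module R' M' N' \<mu>') (tensor_map R' M' N' f g)"
    using h A.a_closed by (auto simp: additive_map_def eq)
  show "tensor_map R' M' N' f g (pure_tensor R M N m n) = pure_tensor R' M' N' (f m) (g n)"
    if "m \<in> carrier M" "n \<in> carrier N"
    using eq[OF T.pure_closed[OF that]] hp[OF that] by simp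
qed

section \<open>Germs and gluing\<close>

context presheaf
begin

abbreviation (input) is_section where "is_section x U s \<equiv> openin T U \<and> x \<in> U \<and> s \<in> F U"

lemma germ_self: "is_section x U s \<Longrightarrow> (U, s) \<in> germ T F r x U s"
  by (auto simp: germ_def intro!: exI[of _ U])

lemma germ_eqI:
  assumes s: "is_section x U s" and t: "is_section x V t"
    and W: "openin T W" "x \<in> W" "W \<subseteq> U" "W \<subseteq> V" "r U W s = r V W t"
  shows "germ T F r x U s = germ T F r x V t"
proof -
  have sub: "germ T F r x U s \<subseteq> germ T F r x V t"
    if s: "is_section x U s" and t: "is_section x V t"
      and W: "openin T W" "x \<in> W" "W \<subseteq> U" "W \<subseteq> V" "r U W s = r V W t" for U s V t
  proof clarify
    fix Y z assume "(Y, z) \<in> germ T F r x U s"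
    then obtain W' where Y: "openin T Y" "x \<in> Y" "z \<in> F Y" and W': "openin T W'" "x \<in> W'" "W' \<subseteq> U" "W' \<subseteq> Y"
      "r U W' s = r Y W' z" by (auto simp: germ_def)
    have o: "openin T (W \<inter> W')" using W W' by blast
    have "r V (W \<inter> W') t = r W (W \<inter> W') (r V W t)" using res_comp o W t by simp
    also have "\<dots> = r U (W \<inter> W') s"
      unfolding W(5)[symmetric] using res_comp[of U W "W \<inter> W'" s] o s W(1,3) by simp
    also have "\<dots> = r W' (W \<inter> W') (r U W' s)" using res_comp[of U W' "W \<inter> W'" s] o W'(1,3) s by simp
    also have "\<dots> = r Y (W \<inter> W') z"
      unfolding W'(5) using res_comp[of Y W' "W \<inter> W'" z] o W'(1,4) Y by simp
    finally show "(Y, z) \<in> germ T F r x V t"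
      using Y o W W' unfolding germ_def by (auto intro!: exI[of _ "W \<inter> W'"])
  qed
  show ?thesis using sub[OF s t W] sub[OF t s W(1,2,4,3) W(5)[symmetric]] by blast
qed

lemma germ_memD:
  assumes "is_section x U s" "(V, t) \<in> germ T F r x U s"
  shows "is_section x V t" "germ T F r x V t = germ T F r x U s"
proof -
  show V: "is_section x V t" using assms(2) by (auto simp: germ_def)
  obtain W where "openin T W" "x \<in> W" "W \<subseteq> U" "W \<subseteq> V" "r U W s = r V W t"
    using assms(2) by (auto simp: germ_def)
  then show "germ T F r x V t = germ T F r x U s" using germ_eqI[OF assms(1) V] by simp
qed

lemma germ_eqD:
  assumes "is_section x U s" "is_section x V t" "germ T F r x U s = germ T F r x V t"
  obtains W where "openin T W" "x \<in> W" "W \<subseteq> U" "W \<subseteq> V" "r U W s = r V W t"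
proof -
  have "(V, t) \<in> germ T F r x U s" using germ_self[OF assms(2)] assms(3) by simp
  then show thesis using that by (auto simp: germ_def)
qed

lemma germ_res:
  assumes "is_section x U s" "openin T V" "x \<in> V" "V \<subseteq> U"
  shows "germ T F r x V (r U V s) = germ T F r x U s"
proof (rule germ_eqI)
  have rc: "r U V s \<in> F V" using res_closed assms by blast
  then show "is_section x V (r U V s)" using assms by blast
  show "r V V (r U V s) = r U V s" using res_id rc assms by blast
qed (use assms in auto)

lemma germ_in_germs: "is_section x U s \<Longrightarrow> germ T F r x U s \<in> germs T F r x"
  by (auto simp: germs_def)

lemma germs_cases:
  assumes "A \<in> germs T F r x"
  obtains U s where "is_section x U s" "A = germ T F r x U s"
  using assms by (auto simp: germs_def)

lemma germs_cases2:
  assumes "A \<in> germs T F r x" "B \<in> germs T F r x"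
  obtains U s t where "is_section x U s" "t \<in> F U" "A = germ T F r x U s" "B = germ T F r x U t"
proof -
  obtain U s where U: "is_section x U s" "A = germ T F r x U s" using assms(1) by (rule germs_cases)
  obtain V t where V: "is_section x V t" "B = germ T F r x V t" using assms(2) by (rule germs_cases)
  have o: "openin T (U \<inter> V)" using U V by blast
  show thesis
    using that[of "U \<inter> V" "r U (U \<inter> V) s" "r V (U \<inter> V) t"] U V o res_closed germ_res by simp
qed

text \<open>Operations on germs are defined as unions over all representatives. Once the value is
  known not to depend on the representative, the union is the value at any one of them.\<close>

lemma UN_germ:
  assumes "is_section x U s"
    and "\<And>V t. is_section x V t \<Longrightarrow> germ T F r x V t = germ T F r x U s \<Longrightarrow> f V t = f U s"
  shows "(\<Union>(V, t)\<in>germ T F r x U s. f V t) = f U s"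
proof -
  have "f V t = f U s" if "(V, t) \<in> germ T F r x U s" for V t
    using germ_memD[OF assms(1) that] assms(2) by blast
  then show ?thesis using germ_self[OF assms(1)] by blast
qed

end

text \<open>Three presheaves and an operation that commutes with restriction: this covers sums and
  products of ring germs as well as sums and scalar multiples of module germs. Two choices of
  representatives give the same result after restriction to a neighbourhood on which both factors
  agree.\<close>

lemma germ_binary:
  assumes P: "presheaf T F r" and P': "presheaf T F' r'" and H: "presheaf T H rH"
    and op_closed: "\<And>W a b. openin T W \<Longrightarrow> a \<in> F W \<Longrightarrow> b \<in> F' W \<Longrightarrow> op W a b \<in> H W"
    and op_res: "\<And>W W' a b. \<lbrakk>openin T W; openin T W'; W' \<subseteq> W; a \<in> F W; b \<in> F' W\<rbrakk>
      \<Longrightarrow> rH W W' (op W a b) = op W' (r W W' a) (r' W W' b)"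
    and U: "openin T U" "x \<in> U" "s \<in> F U" "t \<in> F' U"
  shows "(\<Union>(V, a)\<in>germ T F r x U s. \<Union>(V', b)\<in>germ T F' r' x U t.
      germ T H rH x (V \<inter> V') (op (V \<inter> V') (r V (V \<inter> V') a) (r' V' (V \<inter> V') b)))
    = germ T H rH x U (op U s t)"
proof -
  interpret P: presheaf T F r by fact
  interpret P': presheaf T F' r' by fact
  interpret H: presheaf T H rH by fact
  let ?g = "\<lambda>V a V' b. germ T H rH x (V \<inter> V') (op (V \<inter> V') (r V (V \<inter> V') a) (r' V' (V \<inter> V') b))"
  have eq: "?g V a V' b = germ T H rH x U (op U s t)"
    if V: "openin T V \<and> x \<in> V \<and> a \<in> F V" and e: "germ T F r x V a = germ T F r x U s"
      and V': "openin T V' \<and> x \<in> V' \<and> b \<in> F' V'" and e': "germ T F' r' x V' b = germ T F' r' x U t"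
    for V a V' b
  proof -
    obtain W where W: "openin T W" "x \<in> W" "W \<subseteq> V" "W \<subseteq> U" "r V W a = r U W s"
      using P.germ_eqD[OF V _ e] U by metis
    obtain W' where W': "openin T W'" "x \<in> W'" "W' \<subseteq> V'" "W' \<subseteq> U" "r' V' W' b = r' U W' t"
      using P'.germ_eqD[OF V' _ e'] U by metis
    let ?W = "W \<inter> W'" and ?V = "V \<inter> V'"
    have o: "openin T ?W" "openin T ?V" using W W' V V' by blast+
    have a1: "r ?V ?W (r V ?V a) = r U ?W s"
    proof -
      have "r ?V ?W (r V ?V a) = r V ?W a" using P.res_comp[of V ?V ?W a] o V W W' by blast
      also have "\<dots> = r W ?W (r V W a)" using P.res_comp[of V W ?W a] o V W by simp
      also have "\<dots> = r U ?W s" unfolding W(5) using P.res_comp[of U W ?W s] o U W by simp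
      finally show ?thesis .
    qed
    have b1: "r' ?V ?W (r' V' ?V b) = r' U ?W t"
    proof -
      have "r' ?V ?W (r' V' ?V b) = r' V' ?W b" using P'.res_comp[of V' ?V ?W b] o V' W W' by blast
      also have "\<dots> = r' W' ?W (r' V' W' b)" using P'.res_comp[of V' W' ?W b] o V' W' by simp
      also have "\<dots> = r' U ?W t" unfolding W'(5) using P'.res_comp[of U W' ?W t] o U W' by simp
      finally show ?thesis .
    qed
    have c: "r V ?V a \<in> F ?V" "r' V' ?V b \<in> F' ?V"
      using P.res_closed[of V ?V a] P'.res_closed[of V' ?V b] o V V' by auto
    have WV: "?W \<subseteq> ?V" "?W \<subseteq> U" using W W' by auto
    show ?thesis
    proof (rule H.germ_eqI[of ?V x _ U _ ?W])
      show "rH ?V ?W (op ?V (r V ?V a) (r' V' ?V b)) = rH U ?W (op U s t)"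
        unfolding op_res[OF o(2,1) WV(1) c] op_res[OF U(1) o(1) WV(2) U(3,4)] a1 b1 ..
    qed (use o c U V V' W W' WV op_closed in auto)
  qed
  have "(\<Union>(V, a)\<in>germ T F r x U s. \<Union>(V', b)\<in>germ T F' r' x U t. ?g V a V' b)
      = (\<Union>(V', b)\<in>germ T F' r' x U t. ?g U s V' b)"
  proof (rule P.UN_germ)
    fix V a assume V: "openin T V \<and> x \<in> V \<and> a \<in> F V" "germ T F r x V a = germ T F r x U s"
    show "(\<Union>(V', b)\<in>germ T F' r' x U t. ?g V a V' b) = (\<Union>(V', b)\<in>germ T F' r' x U t. ?g U s V' b)"
    proof (rule SUP_cong[OF refl])
      fix p assume p: "p \<in> germ T F' r' x U t"
      obtain V' b where "p = (V', b)" by (cases p)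
      then show "(case p of (V', b) \<Rightarrow> ?g V a V' b) = (case p of (V', b) \<Rightarrow> ?g U s V' b)"
        using P'.germ_memD[of U x t V' b] p U eq[OF V, of V' b] eq[of U s V' b] by simp
    qed
  qed (use U in auto)
  also have "\<dots> = ?g U s U t"
  proof (rule P'.UN_germ)
    fix V' b assume V': "openin T V' \<and> x \<in> V' \<and> b \<in> F' V'" "germ T F' r' x V' b = germ T F' r' x U t"
    have "?g U s V' b = germ T H rH x U (op U s t)" using U V' by (intro eq) auto
    also have "\<dots> = ?g U s U t" using U by (intro eq[symmetric]) auto
    finally show "?g U s V' b = ?g U s U t" .
  qed (use U in auto)
  also have "\<dots> = germ T H rH x U (op U s t)" using U by (intro eq) auto
  finally show ?thesis .
qed

context sheaf
begin

lemma section_eqI: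
  assumes U: "openin T U" "s \<in> F U" "t \<in> F U"
    and loc: "\<And>x. x \<in> U \<Longrightarrow> \<exists>W. openin T W \<and> x \<in> W \<and> W \<subseteq> U \<and> r U W s = r U W t"
  shows "s = t"
proof -
  \<comment> \<open>All open sets on which s and t agree. Both sections glue the same family over
    this cover of U.\<close>
  define C where "C = {W. openin T W \<and> W \<subseteq> U \<and> r U W s = r U W t}"
  have CU: "\<Union>C = U" using loc by (fastforce simp: C_def)
  have "\<exists>!u. u \<in> F (\<Union>C) \<and> (\<forall>W\<in>C. r (\<Union>C) W u = r U W s)"
  proof (rule glue)
    show "\<forall>W\<in>C. openin T W" by (simp add: C_def)
    show "\<forall>W\<in>C. r U W s \<in> F W" using U res_closed by (auto simp: C_def)
    show "\<forall>V\<in>C. \<forall>W\<in>C. r V (V \<inter> W) (r U V s) = r W (V \<inter> W) (r U W s)"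
    proof (intro ballI)
      fix V W assume VW: "V \<in> C" "W \<in> C"
      then have "openin T (V \<inter> W)" by (auto simp: C_def)
      then show "r V (V \<inter> W) (r U V s) = r W (V \<inter> W) (r U W s)"
        using U VW by (simp add: C_def res_comp)
    qed
  qed
  moreover have "\<forall>W\<in>C. r U W t = r U W s" by (simp add: C_def)
  ultimately show ?thesis using U CU by metis
qed

lemma section_eq_germsI:
  assumes U: "openin T U" "s \<in> F U" "t \<in> F U"
    and loc: "\<And>x. x \<in> U \<Longrightarrow> germ T F r x U s = germ T F r x U t"
  shows "s = t"
proof (rule section_eqI[OF U])
  fix x assume "x \<in> U"
  then show "\<exists>W. openin T W \<and> x \<in> W \<and> W \<subseteq> U \<and> r U W s = r U W t"
    using germ_eqD[of U x s U t] loc[of x] U by metis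
qed

text \<open>This is the surjectivity of the map from a sheaf to its sheafification: a family of
  germs given locally by sections is given by one section.\<close>

lemma glue_germs:
  assumes U: "openin T U"
    and loc: "\<And>x. x \<in> U \<Longrightarrow> \<exists>V. openin T V \<and> x \<in> V \<and> V \<subseteq> U \<and> (\<exists>m\<in>F V. \<forall>y\<in>V. \<sigma> y = germ T F r y V m)"
  obtains m where "m \<in> F U" "\<And>y. y \<in> U \<Longrightarrow> \<sigma> y = germ T F r y U m"
proof -
  define C where "C = {V. openin T V \<and> V \<subseteq> U \<and> (\<exists>m\<in>F V. \<forall>y\<in>V. \<sigma> y = germ T F r y V m)}"
  have CU: "\<Union>C = U" using loc by (fastforce simp: C_def)
  \<comment> \<open>The chosen sections agree on overlaps because their germs there are the
    prescribed ones.\<close>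
  define s where "s V = (SOME m. m \<in> F V \<and> (\<forall>y\<in>V. \<sigma> y = germ T F r y V m))" for V
  have s: "s V \<in> F V" "\<And>y. y \<in> V \<Longrightarrow> \<sigma> y = germ T F r y V (s V)" if V: "V \<in> C" for V
  proof -
    have "\<exists>m. m \<in> F V \<and> (\<forall>y\<in>V. \<sigma> y = germ T F r y V m)" using V by (auto simp: C_def)
    from someI_ex[OF this] show "s V \<in> F V" "\<And>y. y \<in> V \<Longrightarrow> \<sigma> y = germ T F r y V (s V)"
      unfolding s_def by auto
  qed
  have op: "openin T V" "V \<subseteq> U" if "V \<in> C" for V using that by (auto simp: C_def)
  have "\<exists>!u. u \<in> F (\<Union>C) \<and> (\<forall>W\<in>C. r (\<Union>C) W u = s W)"
  proof (rule glue)
    show "\<forall>V\<in>C. \<forall>W\<in>C. r V (V \<inter> W) (s V) = r W (V \<inter> W) (s W)"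
    proof (intro ballI)
      fix V W assume VW: "V \<in> C" "W \<in> C"
      have o: "openin T (V \<inter> W)" using op VW by blast
      show "r V (V \<inter> W) (s V) = r W (V \<inter> W) (s W)"
      proof (rule section_eq_germsI[OF o])
        fix x assume x: "x \<in> V \<inter> W"
        then show "germ T F r x (V \<inter> W) (r V (V \<inter> W) (s V)) = germ T F r x (V \<inter> W) (r W (V \<inter> W) (s W))"
          using germ_res[of V x "s V" "V \<inter> W"] germ_res[of W x "s W" "V \<inter> W"] o op s(1) VW
            s(2)[OF VW(1), of x, symmetric] s(2)[OF VW(2), of x, symmetric] by simp
      qed (use res_closed o op s VW in auto)
    qed
  qed (use op s in auto)
  then obtain m where m: "m \<in> F U" "\<And>W. W \<in> C \<Longrightarrow> r U W m = s W" using CU by auto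
  show thesis
  proof (rule that[OF m(1)])
    fix y assume "y \<in> U"
    then obtain V where V: "V \<in> C" "y \<in> V" using CU by blast
    then show "\<sigma> y = germ T F r y U m"
      using s(2)[OF V] m(2)[OF V(1)] germ_res[of U y m V] m(1) op[OF V(1)] U \<open>y \<in> U\<close> by simp
  qed
qed

end

section \<open>Stalks\<close>

context ringed_space
begin

sublocale O: sheaf "pts S" "\<lambda>U. carrier (sec_ring S U)" "ring_res S"
  by (rule sheaf_of_rings)

lemma open_topspace: "openin (pts S) (topspace (pts S))" by simp

lemma ring_res_closed:
  "openin (pts S) U \<Longrightarrow> openin (pts S) V \<Longrightarrow> V \<subseteq> U \<Longrightarrow> a \<in> carrier (sec_ring S U)
    \<Longrightarrow> ring_res S U V a \<in> carrier (sec_ring S V)"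
  by (rule O.res_closed)

lemma sec_monoids:
  assumes "openin (pts S) U"
  shows "abelian_group (sec_ring S U)" "monoid (sec_ring S U)"
  using sec_cring[OF assms] by (auto simp: cring_def ring_def)

lemma stalk_carrier: "openin (pts S) U \<Longrightarrow> x \<in> U \<Longrightarrow> a \<in> carrier (sec_ring S U)
    \<Longrightarrow> ring_germ S x U a \<in> carrier (ring_stalk S x)"
  by (auto simp: ring_stalk_def intro: O.germ_in_germs)

lemma stalk_cases:
  assumes "A \<in> carrier (ring_stalk S x)"
  obtains U a where "openin (pts S) U" "x \<in> U" "a \<in> carrier (sec_ring S U)" "A = ring_germ S x U a"
proof -
  have "A \<in> germs (pts S) (\<lambda>U. carrier (sec_ring S U)) (ring_res S) x"
    using assms by (simp add: ring_stalk_def)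
  then show thesis by (rule O.germs_cases) (rule that, auto)
qed

lemma stalk_add:
  assumes "openin (pts S) U" "x \<in> U" "a \<in> carrier (sec_ring S U)" "b \<in> carrier (sec_ring S U)"
  shows "ring_germ S x U a \<oplus>\<^bsub>ring_stalk S x\<^esub> ring_germ S x U b = ring_germ S x U (a \<oplus>\<^bsub>sec_ring S U\<^esub> b)"
  unfolding ring_stalk_def ring.simps
  by (rule germ_binary[where op="\<lambda>U a b. a \<oplus>\<^bsub>sec_ring S U\<^esub> b", OF O.presheaf_axioms O.presheaf_axioms O.presheaf_axioms _ _ assms])
    (auto dest: sec_cring simp: cring.cring_simprules ring_hom_add[OF res_ring_hom])

lemma stalk_mult:
  assumes "openin (pts S) U" "x \<in> U" "a \<in> carrier (sec_ring S U)" "b \<in> carrier (sec_ring S U)"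
  shows "ring_germ S x U a \<otimes>\<^bsub>ring_stalk S x\<^esub> ring_germ S x U b = ring_germ S x U (a \<otimes>\<^bsub>sec_ring S U\<^esub> b)"
  unfolding ring_stalk_def ring.simps monoid.simps
  by (rule germ_binary[where op="\<lambda>U a b. a \<otimes>\<^bsub>sec_ring S U\<^esub> b", OF O.presheaf_axioms O.presheaf_axioms O.presheaf_axioms _ _ assms])
    (auto dest: sec_cring simp: cring.cring_simprules ring_hom_mult[OF res_ring_hom])

lemma res_zero: "openin (pts S) U \<Longrightarrow> openin (pts S) V \<Longrightarrow> V \<subseteq> U
    \<Longrightarrow> ring_res S U V \<zero>\<^bsub>sec_ring S U\<^esub> = \<zero>\<^bsub>sec_ring S V\<^esub>"
  by (rule ring_hom_zero[OF res_ring_hom]) (auto dest: sec_cring simp: cring_def)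

lemma stalk_zero: "openin (pts S) U \<Longrightarrow> x \<in> U \<Longrightarrow> \<zero>\<^bsub>ring_stalk S x\<^esub> = ring_germ S x U \<zero>\<^bsub>sec_ring S U\<^esub>"
  using O.germ_res[of "topspace (pts S)" x "\<zero>\<^bsub>sec_ring S (topspace (pts S))\<^esub>" U]
    openin_subset[of "pts S" U] sec_cring[OF open_topspace]
  by (auto simp: ring_stalk_def res_zero cring.cring_simprules)

lemma stalk_one: "openin (pts S) U \<Longrightarrow> x \<in> U \<Longrightarrow> \<one>\<^bsub>ring_stalk S x\<^esub> = ring_germ S x U \<one>\<^bsub>sec_ring S U\<^esub>"
  using O.germ_res[of "topspace (pts S)" x "\<one>\<^bsub>sec_ring S (topspace (pts S))\<^esub>" U]
    openin_subset[of "pts S" U] sec_cring[OF open_topspace] ring_hom_one[OF res_ring_hom[OF open_topspace, of U]]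
  by (auto simp: ring_stalk_def cring.cring_simprules)

end

context sheaf_of_modules
begin

sublocale M: sheaf "pts S" "\<lambda>U. carrier (sec M U)" "mres M"
  by (rule sheaf_of_sections)

lemma sec_abelian: "openin (pts S) U \<Longrightarrow> abelian_group (sec M U)"
  using sec_module by (auto simp: module_def)

lemma mres_additive: "openin (pts S) U \<Longrightarrow> openin (pts S) V \<Longrightarrow> V \<subseteq> U
    \<Longrightarrow> additive_map (sec M U) (sec M V) (mres M U V)"
  using mres_add M.res_closed by (auto simp: additive_map_def)

lemma mres_zero: "openin (pts S) U \<Longrightarrow> openin (pts S) V \<Longrightarrow> V \<subseteq> U
    \<Longrightarrow> mres M U V \<zero>\<^bsub>sec M U\<^esub> = \<zero>\<^bsub>sec M V\<^esub>"
  using additive_zero[OF sec_abelian sec_abelian mres_additive] .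

lemma mod_stalk_carrier: "openin (pts S) U \<Longrightarrow> x \<in> U \<Longrightarrow> m \<in> carrier (sec M U)
    \<Longrightarrow> mod_germ S M x U m \<in> carrier (mod_stalk S M x)"
  by (auto simp: mod_stalk_def intro: M.germ_in_germs)

lemma mod_stalk_cases:
  assumes "A \<in> carrier (mod_stalk S M x)"
  obtains U m where "openin (pts S) U" "x \<in> U" "m \<in> carrier (sec M U)" "A = mod_germ S M x U m"
proof -
  have "A \<in> germs (pts S) (\<lambda>U. carrier (sec M U)) (mres M) x"
    using assms by (simp add: mod_stalk_def)
  then show thesis by (rule M.germs_cases) (rule that, auto)
qed

lemma mod_stalk_add:
  assumes "openin (pts S) U" "x \<in> U" "m \<in> carrier (sec M U)" "n \<in> carrier (sec M U)"
  shows "mod_germ S M x U m \<oplus>\<^bsub>mod_stalk S M x\<^esub> mod_germ S M x U n = mod_germ S M x U (m \<oplus>\<^bsub>sec M U\<^esub> n)"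
  unfolding mod_stalk_def ring.simps
  by (rule germ_binary[where op="\<lambda>U a b. a \<oplus>\<^bsub>sec M U\<^esub> b", OF M.presheaf_axioms M.presheaf_axioms M.presheaf_axioms _ _ assms])
    (auto simp: mres_add abelian_groupE(1)[OF sec_abelian])

lemma mod_stalk_smult:
  assumes "openin (pts S) U" "x \<in> U" "a \<in> carrier (sec_ring S U)" "m \<in> carrier (sec M U)"
  shows "ring_germ S x U a \<odot>\<^bsub>mod_stalk S M x\<^esub> mod_germ S M x U m = mod_germ S M x U (a \<odot>\<^bsub>sec M U\<^esub> m)"
  unfolding mod_stalk_def module.simps
  by (rule germ_binary[where op="\<lambda>U a b. a \<odot>\<^bsub>sec M U\<^esub> b", OF O.presheaf_axioms M.presheaf_axioms M.presheaf_axioms _ _ assms])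
    (auto simp: mres_smult module.smult_closed[OF sec_module])

lemma mod_stalk_zero: "openin (pts S) U \<Longrightarrow> x \<in> U \<Longrightarrow> \<zero>\<^bsub>mod_stalk S M x\<^esub> = mod_germ S M x U \<zero>\<^bsub>sec M U\<^esub>"
  using M.germ_res[of "topspace (pts S)" x "\<zero>\<^bsub>sec M (topspace (pts S))\<^esub>" U]
    openin_subset[of "pts S" U] abelian_groupE(2)[OF sec_abelian[OF open_topspace]]
  by (auto simp: mod_stalk_def mres_zero)

text \<open>Each module axiom involves finitely many germs. These have representatives over one
  neighbourhood of x, where the axiom holds for sections.\<close>

lemma mod_stalk_module:
  assumes "cring (ring_stalk S x)" "x \<in> topspace (pts S)"
  shows "module (ring_stalk S x) (mod_stalk S M x)"
proof -
  let ?K = "ring_stalk S x" and ?M = "mod_stalk S M x"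
  have common2: thesis
    if "A \<in> carrier ?M" "B \<in> carrier ?M"
      and "\<And>U m n. openin (pts S) U \<Longrightarrow> x \<in> U \<Longrightarrow> m \<in> carrier (sec M U) \<Longrightarrow> n \<in> carrier (sec M U)
        \<Longrightarrow> A = mod_germ S M x U m \<Longrightarrow> B = mod_germ S M x U n \<Longrightarrow> thesis" for A B thesis
    using M.germs_cases2[of A x B] that by (auto simp: mod_stalk_def)
  have restr: "\<exists>m'\<in>carrier (sec M W). A = mod_germ S M x W m'"
    if "openin (pts S) U" "m \<in> carrier (sec M U)" "A = mod_germ S M x U m" "openin (pts S) W" "x \<in> W" "W \<subseteq> U"
    for A U m W
    using M.germ_res[of U x m W] M.res_closed[of U W m] that by auto
  have rrestr: "\<exists>a'\<in>carrier (sec_ring S W). A = ring_germ S x W a'"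
    if "openin (pts S) U" "a \<in> carrier (sec_ring S U)" "A = ring_germ S x U a" "openin (pts S) W" "x \<in> W" "W \<subseteq> U"
    for A U a W
    using O.germ_res[of U x a W] O.res_closed[of U W a] that by auto
  have common: thesis
    if ab: "a \<in> carrier ?K" "b \<in> carrier ?K" "A \<in> carrier ?M" "B \<in> carrier ?M" "C \<in> carrier ?M"
      and th: "\<And>U a' b' m n l. openin (pts S) U \<Longrightarrow> x \<in> U \<Longrightarrow> a' \<in> carrier (sec_ring S U) \<Longrightarrow> b' \<in> carrier (sec_ring S U)
        \<Longrightarrow> m \<in> carrier (sec M U) \<Longrightarrow> n \<in> carrier (sec M U) \<Longrightarrow> l \<in> carrier (sec M U)
        \<Longrightarrow> a = ring_germ S x U a' \<Longrightarrow> b = ring_germ S x U b'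
        \<Longrightarrow> A = mod_germ S M x U m \<Longrightarrow> B = mod_germ S M x U n \<Longrightarrow> C = mod_germ S M x U l \<Longrightarrow> thesis"
    for a b A B C thesis
  proof -
    obtain U1 m where 1: "openin (pts S) U1" "x \<in> U1" "m \<in> carrier (sec M U1)" "A = mod_germ S M x U1 m"
      using ab(3) by (rule mod_stalk_cases)
    obtain U2 n where 2: "openin (pts S) U2" "x \<in> U2" "n \<in> carrier (sec M U2)" "B = mod_germ S M x U2 n"
      using ab(4) by (rule mod_stalk_cases)
    obtain U3 l where 3: "openin (pts S) U3" "x \<in> U3" "l \<in> carrier (sec M U3)" "C = mod_germ S M x U3 l"
      using ab(5) by (rule mod_stalk_cases)
    obtain U4 a' where 4: "openin (pts S) U4" "x \<in> U4" "a' \<in> carrier (sec_ring S U4)" "a = ring_germ S x U4 a'"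
      using ab(1) by (rule stalk_cases)
    obtain U5 b' where 5: "openin (pts S) U5" "x \<in> U5" "b' \<in> carrier (sec_ring S U5)" "b = ring_germ S x U5 b'"
      using ab(2) by (rule stalk_cases)
    let ?W = "U1 \<inter> U2 \<inter> U3 \<inter> U4 \<inter> U5"
    have W: "openin (pts S) ?W" "x \<in> ?W" using 1 2 3 4 5 by (auto intro!: openin_Int)
    show thesis
      using restr[OF 1(1,3,4) W] restr[OF 2(1,3,4) W] restr[OF 3(1,3,4) W]
        rrestr[OF 4(1,3,4) W] rrestr[OF 5(1,3,4) W] th[OF W] by blast
  qed
  have z: "\<zero>\<^bsub>?M\<^esub> \<in> carrier ?M"
    unfolding mod_stalk_zero[OF open_topspace assms(2)] using abelian_groupE(2)[OF sec_abelian[OF open_topspace]]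
    by (intro mod_stalk_carrier open_topspace assms)
  interpret K: cring ?K by fact
  note ops = mod_stalk_add mod_stalk_smult stalk_add stalk_mult
  have "abelian_group ?M"
  proof (rule abelian_groupI)
    fix A B C assume ABC: "A \<in> carrier ?M" "B \<in> carrier ?M" "C \<in> carrier ?M"
    obtain U a' b' m n l where U: "openin (pts S) U" "x \<in> U" "m \<in> carrier (sec M U)" "n \<in> carrier (sec M U)" "l \<in> carrier (sec M U)"
      and e: "A = mod_germ S M x U m" "B = mod_germ S M x U n" "C = mod_germ S M x U l"
      using common[OF K.zero_closed K.zero_closed ABC] by metis
    interpret N: abelian_group "sec M U" by (rule sec_abelian[OF U(1)])
    show "A \<oplus>\<^bsub>?M\<^esub> B \<in> carrier ?M" using U by (simp add: e ops mod_stalk_carrier)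
    show "A \<oplus>\<^bsub>?M\<^esub> B \<oplus>\<^bsub>?M\<^esub> C = A \<oplus>\<^bsub>?M\<^esub> (B \<oplus>\<^bsub>?M\<^esub> C)" using U by (simp add: e ops N.a_assoc)
    show "A \<oplus>\<^bsub>?M\<^esub> B = B \<oplus>\<^bsub>?M\<^esub> A" using U by (simp add: e ops N.a_comm)
    show "\<zero>\<^bsub>?M\<^esub> \<oplus>\<^bsub>?M\<^esub> A = A" using U by (simp add: e ops mod_stalk_zero[OF U(1,2)])
    show "\<exists>y\<in>carrier ?M. y \<oplus>\<^bsub>?M\<^esub> A = \<zero>\<^bsub>?M\<^esub>"
      using U by (intro bexI[of _ "mod_germ S M x U (\<ominus>\<^bsub>sec M U\<^esub> m)"])
        (simp_all add: e ops mod_stalk_zero[OF U(1,2)] mod_stalk_carrier N.l_neg)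
  qed (rule z)
  moreover have "module_axioms ?K ?M"
  proof (unfold module_axioms_def, intro conjI allI impI)
    fix a b A B assume ab: "a \<in> carrier ?K" "b \<in> carrier ?K" and AB: "A \<in> carrier ?M" "B \<in> carrier ?M"
    obtain U a' b' m n where U: "openin (pts S) U" "x \<in> U" "m \<in> carrier (sec M U)" "n \<in> carrier (sec M U)"
      "a' \<in> carrier (sec_ring S U)" "b' \<in> carrier (sec_ring S U)"
      and e: "A = mod_germ S M x U m" "B = mod_germ S M x U n" "a = ring_germ S x U a'" "b = ring_germ S x U b'"
      using common[OF ab AB AB(1)] by metis
    interpret N: module "sec_ring S U" "sec M U" by (rule sec_module[OF U(1)])
    show "(a \<oplus>\<^bsub>?K\<^esub> b) \<odot>\<^bsub>?M\<^esub> A = a \<odot>\<^bsub>?M\<^esub> A \<oplus>\<^bsub>?M\<^esub> b \<odot>\<^bsub>?M\<^esub> A"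
      using U by (simp add: e ops N.smult_l_distr)
    show "a \<odot>\<^bsub>?M\<^esub> (A \<oplus>\<^bsub>?M\<^esub> B) = a \<odot>\<^bsub>?M\<^esub> A \<oplus>\<^bsub>?M\<^esub> a \<odot>\<^bsub>?M\<^esub> B"
      using U by (simp add: e ops N.smult_r_distr)
    show "a \<otimes>\<^bsub>?K\<^esub> b \<odot>\<^bsub>?M\<^esub> A = a \<odot>\<^bsub>?M\<^esub> (b \<odot>\<^bsub>?M\<^esub> A)"
      using U by (simp add: e ops N.smult_assoc1)
  next
    fix a A assume ab: "a \<in> carrier ?K" "A \<in> carrier ?M"
    obtain U a' m where U: "openin (pts S) U" "x \<in> U" "m \<in> carrier (sec M U)" "a' \<in> carrier (sec_ring S U)"
      and e: "A = mod_germ S M x U m" "a = ring_germ S x U a'"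
      using common[OF ab(1,1,2,2,2)] by metis
    interpret N: module "sec_ring S U" "sec M U" by (rule sec_module[OF U(1)])
    show "a \<odot>\<^bsub>?M\<^esub> A \<in> carrier ?M" using U by (simp add: e ops mod_stalk_carrier)
  next
    fix A assume "A \<in> carrier ?M"
    then obtain U m where U: "openin (pts S) U" "x \<in> U" "m \<in> carrier (sec M U)" "A = mod_germ S M x U m"
      by (rule mod_stalk_cases)
    interpret N: module "sec_ring S U" "sec M U" by (rule sec_module[OF U(1)])
    show "\<one>\<^bsub>?K\<^esub> \<odot>\<^bsub>?M\<^esub> A = A" using U by (simp add: ops stalk_one[OF U(1,2)])
  qed
  ultimately show ?thesis using assms by (simp add: module_def)
qed

end

section \<open>Transport, sheafification and subsheaves\<close>

text \<open>N is a structure with operations that is not yet known to be a group, so preservation of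
  zero cannot be deduced by cancellation and is assumed as \<open>z\<close>.\<close>

lemma module_transport:
  assumes M: "module R M" and h: "h \<in> module_hom R M N" and bij: "bij_betw h (carrier M) (carrier N)"
    and z: "h \<zero>\<^bsub>M\<^esub> = \<zero>\<^bsub>N\<^esub>"
  shows "module R N"
proof -
  interpret M: module R M by fact
  have N: "carrier N = h ` carrier M" using bij by (auto simp: bij_betw_def)
  have add: "h x \<oplus>\<^bsub>N\<^esub> h y = h (x \<oplus>\<^bsub>M\<^esub> y)" if "x \<in> carrier M" "y \<in> carrier M" for x y
    using module_hom_add[OF h that] by simp
  have smult: "a \<odot>\<^bsub>N\<^esub> h x = h (a \<odot>\<^bsub>M\<^esub> x)" if "a \<in> carrier R" "x \<in> carrier M" for a x
    using module_hom_smult[OF h that] by simp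
  have cl: "h x \<in> carrier N" if "x \<in> carrier M" for x using N that by blast
  have "abelian_group N"
  proof (rule abelian_groupI)
    show "\<zero>\<^bsub>N\<^esub> \<in> carrier N" using cl[of "\<zero>\<^bsub>M\<^esub>"] z by simp
    fix x y w assume "x \<in> carrier N" "y \<in> carrier N" "w \<in> carrier N"
    then obtain x' y' w' where e: "x = h x'" "x' \<in> carrier M" "y = h y'" "y' \<in> carrier M" "w = h w'" "w' \<in> carrier M"
      unfolding N by blast
    show "x \<oplus>\<^bsub>N\<^esub> y \<in> carrier N" using e cl by (simp add: add)
    show "x \<oplus>\<^bsub>N\<^esub> y \<oplus>\<^bsub>N\<^esub> w = x \<oplus>\<^bsub>N\<^esub> (y \<oplus>\<^bsub>N\<^esub> w)" using e by (simp add: add M.M.a_assoc)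
    show "x \<oplus>\<^bsub>N\<^esub> y = y \<oplus>\<^bsub>N\<^esub> x" using e by (simp add: add M.M.a_comm)
    show "\<zero>\<^bsub>N\<^esub> \<oplus>\<^bsub>N\<^esub> x = x" using e add[of "\<zero>\<^bsub>M\<^esub>" x'] z by simp
    show "\<exists>y\<in>carrier N. y \<oplus>\<^bsub>N\<^esub> x = \<zero>\<^bsub>N\<^esub>"
      using e cl add[of "\<ominus>\<^bsub>M\<^esub> x'" x'] z by (intro bexI[of _ "h (\<ominus>\<^bsub>M\<^esub> x')"]) (simp_all add: M.M.l_neg)
  qed
  moreover have "module_axioms R N"
    unfolding module_axioms_def
  proof (intro conjI allI impI)
    fix a b x y assume ab: "a \<in> carrier R" "b \<in> carrier R" and "x \<in> carrier N" "y \<in> carrier N"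
    then obtain x' y' where e: "x = h x'" "x' \<in> carrier M" "y = h y'" "y' \<in> carrier M"
      unfolding N by blast
    show "(a \<oplus>\<^bsub>R\<^esub> b) \<odot>\<^bsub>N\<^esub> x = a \<odot>\<^bsub>N\<^esub> x \<oplus>\<^bsub>N\<^esub> b \<odot>\<^bsub>N\<^esub> x"
      using ab e by (simp add: add smult M.smult_l_distr)
    show "a \<odot>\<^bsub>N\<^esub> (x \<oplus>\<^bsub>N\<^esub> y) = a \<odot>\<^bsub>N\<^esub> x \<oplus>\<^bsub>N\<^esub> a \<odot>\<^bsub>N\<^esub> y"
      using ab e by (simp add: add smult M.smult_r_distr)
    show "a \<otimes>\<^bsub>R\<^esub> b \<odot>\<^bsub>N\<^esub> x = a \<odot>\<^bsub>N\<^esub> (b \<odot>\<^bsub>N\<^esub> x)"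
      using ab e by (simp add: smult M.smult_assoc1)
  next
    fix a x assume "a \<in> carrier R" "x \<in> carrier N"
    then show "a \<odot>\<^bsub>N\<^esub> x \<in> carrier N" unfolding N using cl by (auto simp: smult)
  next
    fix x assume "x \<in> carrier N"
    then show "\<one>\<^bsub>R\<^esub> \<odot>\<^bsub>N\<^esub> x = x" unfolding N by (auto simp: smult)
  qed
  ultimately show ?thesis using M by (simp add: module_def)
qed

text \<open>Used for the sheafification of a sheaf and for the tensor presheaf, whose gluing
  property is inherited from E through the isomorphism. Sections are glued after pulling them back
  along h.\<close>

lemma sheaf_of_modules_transport:
  assumes Q: "sheaf_of_modules S Q" and iso: "mod_isomorphism S Q P h"
    and z: "\<And>U. openin (pts S) U \<Longrightarrow> h U \<zero>\<^bsub>sec Q U\<^esub> = \<zero>\<^bsub>sec P U\<^esub>"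
  shows "sheaf_of_modules S P"
proof -
  interpret Q: sheaf_of_modules S Q by fact
  have hom: "h U \<in> module_hom (sec_ring S U) (sec Q U) (sec P U)"
    and bij: "bij_betw (h U) (carrier (sec Q U)) (carrier (sec P U))" if "openin (pts S) U" for U
    using iso that by (auto simp: mod_isomorphism_def)
  have res: "mres P U V (h U m) = h V (mres Q U V m)"
    if "openin (pts S) U" "openin (pts S) V" "V \<subseteq> U" "m \<in> carrier (sec Q U)" for U V m
    using iso that by (auto simp: mod_isomorphism_def)
  have car: "carrier (sec P U) = h U ` carrier (sec Q U)" if "openin (pts S) U" for U
    using bij[OF that] by (auto simp: bij_betw_def)
  have inj: "x = y" if "openin (pts S) U" "x \<in> carrier (sec Q U)" "y \<in> carrier (sec Q U)" "h U x = h U y" for U x y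
    using bij[OF that(1)] that(2-4) by (auto simp: bij_betw_def dest: inj_onD)
  have add: "h U x \<oplus>\<^bsub>sec P U\<^esub> h U y = h U (x \<oplus>\<^bsub>sec Q U\<^esub> y)"
    if "openin (pts S) U" "x \<in> carrier (sec Q U)" "y \<in> carrier (sec Q U)" for U x y
    using module_hom_add[OF hom[OF that(1)] that(2,3)] by simp
  have smult: "a \<odot>\<^bsub>sec P U\<^esub> h U x = h U (a \<odot>\<^bsub>sec Q U\<^esub> x)"
    if "openin (pts S) U" "a \<in> carrier (sec_ring S U)" "x \<in> carrier (sec Q U)" for U a x
    using module_hom_smult[OF hom[OF that(1)] that(2,3)] by simp
  have "presheaf (pts S) (\<lambda>U. carrier (sec P U)) (mres P)"
  proof
    fix U V W s assume UV: "openin (pts S) U" "openin (pts S) V"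
    show "V \<subseteq> U \<Longrightarrow> s \<in> carrier (sec P U) \<Longrightarrow> mres P U V s \<in> carrier (sec P V)"
      using UV by (auto simp: car res Q.M.res_closed)
    show "openin (pts S) W \<Longrightarrow> W \<subseteq> V \<Longrightarrow> V \<subseteq> U \<Longrightarrow> s \<in> carrier (sec P U) \<Longrightarrow> mres P V W (mres P U V s) = mres P U W s"
      using UV by (auto simp: car res Q.M.res_closed Q.M.res_comp)
  next
    fix U s assume "openin (pts S) U" "s \<in> carrier (sec P U)"
    then show "mres P U U s = s" by (auto simp: car res Q.M.res_id)
  qed
  moreover have "sheaf_axioms (pts S) (\<lambda>U. carrier (sec P U)) (mres P)"
  proof
    fix C s
    assume C: "\<forall>U\<in>C. openin (pts S) U" "\<forall>U\<in>C. s U \<in> carrier (sec P U)"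
      and comp: "\<forall>U\<in>C. \<forall>V\<in>C. mres P U (U \<inter> V) (s U) = mres P V (U \<inter> V) (s V)"
    define s' where "s' U = the_inv_into (carrier (sec Q U)) (h U) (s U)" for U
    have s': "s' U \<in> carrier (sec Q U)" "h U (s' U) = s U" if "U \<in> C" for U
      using bij[of U] C that unfolding s'_def
      by (auto simp: bij_betw_def f_the_inv_into_f intro!: the_inv_into_into[OF _ _ order_refl])
    have oC: "openin (pts S) (\<Union>C)" using C(1) by blast
    have "\<exists>!t. t \<in> carrier (sec Q (\<Union>C)) \<and> (\<forall>U\<in>C. mres Q (\<Union>C) U t = s' U)"
    proof (rule Q.M.glue)
      show "\<forall>U\<in>C. \<forall>V\<in>C. mres Q U (U \<inter> V) (s' U) = mres Q V (U \<inter> V) (s' V)"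
      proof (intro ballI)
        fix U V assume UV: "U \<in> C" "V \<in> C"
        then have o: "openin (pts S) U" "openin (pts S) V" "openin (pts S) (U \<inter> V)" using C(1) by auto
        show "mres Q U (U \<inter> V) (s' U) = mres Q V (U \<inter> V) (s' V)"
        proof (rule inj[OF o(3)])
          show "h (U \<inter> V) (mres Q U (U \<inter> V) (s' U)) = h (U \<inter> V) (mres Q V (U \<inter> V) (s' V))"
            using o s' UV comp[rule_format, OF UV] by (simp add: res[symmetric])
        qed (use o s' UV Q.M.res_closed in auto)
      qed
    qed (use C s' in auto)
    then obtain t where t: "t \<in> carrier (sec Q (\<Union>C))" "\<And>U. U \<in> C \<Longrightarrow> mres Q (\<Union>C) U t = s' U"
      and uniq: "\<And>t'. t' \<in> carrier (sec Q (\<Union>C)) \<Longrightarrow> (\<And>U. U \<in> C \<Longrightarrow> mres Q (\<Union>C) U t' = s' U) \<Longrightarrow> t' = t"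
      by (elim ex1E) blast
    show "\<exists>!t. t \<in> carrier (sec P (\<Union>C)) \<and> (\<forall>U\<in>C. mres P (\<Union>C) U t = s U)"
    proof (rule ex1I[of _ "h (\<Union>C) t"])
      have "mres P (\<Union>C) U (h (\<Union>C) t) = s U" if "U \<in> C" for U
        using that C(1) by (subst res[OF oC _ _ t(1)]) (auto simp: t(2) s'(2))
      then show "h (\<Union>C) t \<in> carrier (sec P (\<Union>C)) \<and> (\<forall>U\<in>C. mres P (\<Union>C) U (h (\<Union>C) t) = s U)"
        using t(1) oC by (auto simp: car)
      fix u assume u: "u \<in> carrier (sec P (\<Union>C)) \<and> (\<forall>U\<in>C. mres P (\<Union>C) U u = s U)"
      then obtain v where v: "v \<in> carrier (sec Q (\<Union>C))" "u = h (\<Union>C) v" using car[OF oC] by blast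
      have "v = t"
      proof (rule uniq[OF v(1)])
        fix U assume U: "U \<in> C"
        then have o: "openin (pts S) U" "U \<subseteq> \<Union>C" using C(1) by auto
        show "mres Q (\<Union>C) U v = s' U"
        proof (rule inj[OF o(1) Q.M.res_closed[OF oC o v(1)] s'(1)[OF U]])
          show "h U (mres Q (\<Union>C) U v) = h U (s' U)"
            using u U v(2) s'(2)[OF U] res[OF oC o v(1)] by simp
        qed
      qed
      then show "u = h (\<Union>C) t" using v by simp
    qed
  qed
  ultimately have "sheaf (pts S) (\<lambda>U. carrier (sec P U)) (mres P)" by (simp add: sheaf_def)
  moreover have "module (sec_ring S U) (sec P U)" if "openin (pts S) U" for U
    using module_transport[OF Q.sec_module hom bij z] that by blast
  ultimately show ?thesis
    using Q.ringed_space_axioms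
    by (auto simp: sheaf_of_modules_def sheaf_of_modules_axioms_def car res add smult Q.mres_add
        Q.mres_smult Q.M.res_closed Q.ring_res_closed abelian_groupE(1)[OF Q.sec_abelian]
        module.smult_closed[OF Q.sec_module])
qed

section \<open>Sheafification of a presheaf that is already a sheaf\<close>

definition unit_map ::
  "('x, 'r) rspace \<Rightarrow> ('x, 'r, 'm, 'g) gmsheaf \<Rightarrow> 'x set \<Rightarrow> 'm \<Rightarrow> 'x \<Rightarrow> ('x set \<times> 'm) set"
  where "unit_map S P U m = (\<lambda>x\<in>U. mod_germ S P x U m)"

lemma sheafification_sec: "sec (sheafification S P) U =
       \<lparr>carrier = {s \<in> \<Pi>\<^sub>E x\<in>U. carrier (mod_stalk S P x).
          \<forall>x\<in>U. \<exists>V. openin (pts S) V \<and> x \<in> V \<and> V \<subseteq> U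
            \<and> (\<exists>m\<in>carrier (sec P V). \<forall>y\<in>V. s y = mod_germ S P y V m)},
        monoid.mult = undefined, monoid.one = undefined,
        ring.zero = (\<lambda>x\<in>U. \<zero>\<^bsub>mod_stalk S P x\<^esub>),
        ring.add = (\<lambda>s t. \<lambda>x\<in>U. s x \<oplus>\<^bsub>mod_stalk S P x\<^esub> t x),
        module.smult = (\<lambda>a s. \<lambda>x\<in>U. ring_germ S x U a \<odot>\<^bsub>mod_stalk S P x\<^esub> s x)\<rparr>"
  by (simp add: sheafification_def)

text \<open>Germs separate the sections of a sheaf, and \<open>glue_germs\<close> lifts compatible
  families. The sheaves in the theorem are defined as sheafifications; this identifies them with
  presheaves in which elements can be computed.\<close>

lemma unit_map_isomorphism:
  assumes P: "sheaf_of_modules S P"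
  shows "mod_isomorphism S P (sheafification S P) (unit_map S P)"
  unfolding mod_isomorphism_def
proof (intro conjI allI impI ballI)
  interpret sheaf_of_modules S P by fact
  fix U assume U: "openin (pts S) U"
  have gc: "unit_map S P U m \<in> carrier (sec (sheafification S P) U)" if "m \<in> carrier (sec P U)" for m
    using that U by (auto simp: sheafification_sec unit_map_def mod_stalk_carrier)
  show "unit_map S P U \<in> module_hom (sec_ring S U) (sec P U) (sec (sheafification S P) U)"
  proof (rule module_homI)
    show "additive_map (sec P U) (sec (sheafification S P) U) (unit_map S P U)"
      unfolding additive_map_def using gc U
      by (auto simp: sheafification_sec unit_map_def mod_stalk_add intro!: restrict_ext)
    show "unit_map S P U (a \<odot>\<^bsub>sec P U\<^esub> m) = a \<odot>\<^bsub>sec (sheafification S P) U\<^esub> unit_map S P U m"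
      if "a \<in> carrier (sec_ring S U)" "m \<in> carrier (sec P U)" for a m
      using that U by (auto simp: sheafification_sec unit_map_def mod_stalk_smult intro!: restrict_ext)
  qed
  show "bij_betw (unit_map S P U) (carrier (sec P U)) (carrier (sec (sheafification S P) U))"
    unfolding bij_betw_def
  proof
    show "inj_on (unit_map S P U) (carrier (sec P U))"
    proof (rule inj_onI)
      fix m n assume mn: "m \<in> carrier (sec P U)" "n \<in> carrier (sec P U)" "unit_map S P U m = unit_map S P U n"
      show "m = n"
      proof (rule M.section_eq_germsI[OF U mn(1,2)])
        fix x assume "x \<in> U"
        then show "mod_germ S P x U m = mod_germ S P x U n" using fun_cong[OF mn(3), of x] by (simp add: unit_map_def)
      qed
    qed
    show "unit_map S P U ` carrier (sec P U) = carrier (sec (sheafification S P) U)"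
    proof
      show "carrier (sec (sheafification S P) U) \<subseteq> unit_map S P U ` carrier (sec P U)"
      proof
        fix s assume s: "s \<in> carrier (sec (sheafification S P) U)"
        then have "\<And>x. x \<in> U \<Longrightarrow> \<exists>V. openin (pts S) V \<and> x \<in> V \<and> V \<subseteq> U
            \<and> (\<exists>m\<in>carrier (sec P V). \<forall>y\<in>V. s y = mod_germ S P y V m)"
          by (simp add: sheafification_sec)
        from M.glue_germs[OF U this] obtain m
          where m: "m \<in> carrier (sec P U)" "\<And>y. y \<in> U \<Longrightarrow> s y = mod_germ S P y U m" by blast
        have "s \<in> extensional U" using s by (simp add: sheafification_sec PiE_iff)
        then have "s = unit_map S P U m" using m(2) by (intro extensionalityI[of _ U]) (auto simp: unit_map_def)
        then show "s \<in> unit_map S P U ` carrier (sec P U)" using m(1) by blast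
      qed
    qed (use gc in auto)
  qed
next
  interpret sheaf_of_modules S P by fact
  fix U V m assume "openin (pts S) U \<and> openin (pts S) V \<and> V \<subseteq> U" "m \<in> carrier (sec P U)"
  then show "mres (sheafification S P) U V (unit_map S P U m) = unit_map S P V (mres P U V m)"
    by (auto simp: sheafification_def unit_map_def fun_eq_iff restrict_def M.germ_res)
qed

lemma stalk_act_germ:
  assumes P: "sheaf_of_modules S P"
    and c: "\<And>U m. openin (pts S) U \<Longrightarrow> m \<in> carrier (sec P U) \<Longrightarrow> act P g U m \<in> carrier (sec P U)"
    and r: "\<And>U V m. openin (pts S) U \<Longrightarrow> openin (pts S) V \<Longrightarrow> V \<subseteq> U \<Longrightarrow> m \<in> carrier (sec P U)
      \<Longrightarrow> mres P U V (act P g U m) = act P g V (mres P U V m)"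
    and U: "openin (pts S) U" "x \<in> U" "m \<in> carrier (sec P U)"
  shows "stalk_act S P x g (mod_germ S P x U m) = mod_germ S P x U (act P g U m)"
proof -
  interpret sheaf_of_modules S P by fact
  show ?thesis
    unfolding stalk_act_def
  proof (rule M.UN_germ)
    fix V n assume V: "openin (pts S) V \<and> x \<in> V \<and> n \<in> carrier (sec P V)"
      and e: "mod_germ S P x V n = mod_germ S P x U m"
    obtain W where W: "openin (pts S) W" "x \<in> W" "W \<subseteq> V" "W \<subseteq> U" "mres P V W n = mres P U W m"
      using M.germ_eqD[OF V _ e] U by metis
    show "mod_germ S P x V (act P g V n) = mod_germ S P x U (act P g U m)"
      using W V U by (intro M.germ_eqI[of V x _ U _ W]) (auto simp: c r)
  qed (use U in auto)
qed

lemma unit_map_act: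
  assumes "sheaf_of_modules S P"
    and "\<And>U m. openin (pts S) U \<Longrightarrow> m \<in> carrier (sec P U) \<Longrightarrow> act P g U m \<in> carrier (sec P U)"
    and "\<And>U V m. openin (pts S) U \<Longrightarrow> openin (pts S) V \<Longrightarrow> V \<subseteq> U \<Longrightarrow> m \<in> carrier (sec P U)
      \<Longrightarrow> mres P U V (act P g U m) = act P g V (mres P U V m)"
    and "openin (pts S) U" "m \<in> carrier (sec P U)"
  shows "act (sheafification S P) g U (unit_map S P U m) = unit_map S P U (act P g U m)"
  using stalk_act_germ[OF assms(1-3)] assms(4,5)
  by (auto simp: sheafification_def unit_map_def fun_eq_iff restrict_def)

lemma sheafification_sheaf:
  assumes "sheaf_of_modules S P"
  shows "sheaf_of_modules S (sheafification S P)"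
proof (rule sheaf_of_modules_transport[OF assms unit_map_isomorphism[OF assms]])
  interpret sheaf_of_modules S P by fact
  fix U assume "openin (pts S) U"
  then show "unit_map S P U \<zero>\<^bsub>sec P U\<^esub> = \<zero>\<^bsub>sec (sheafification S P) U\<^esub>"
    by (auto simp: sheafification_sec unit_map_def mod_stalk_zero intro!: restrict_ext)
qed

text \<open>The kernel of \<theta> - id. For an idempotent \<theta> it is also the image, and the
  description as a kernel makes it a subsheaf without sheafification.\<close>

definition fix_sheaf ::
  "('x, 'r, 'm, 'z) msheaf_scheme \<Rightarrow> ('x set \<Rightarrow> 'm \<Rightarrow> 'm) \<Rightarrow> ('x, 'r, 'm, 'z) msheaf_scheme"
  where "fix_sheaf M \<theta> = M\<lparr>sec := (\<lambda>U. (sec M U)\<lparr>carrier := {m \<in> carrier (sec M U). \<theta> U m = m}\<rparr>)\<rparr>"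

locale sheaf_endomorphism = sheaf_of_modules S M
  for S :: "('x, 'r) rspace" and M :: "('x, 'r, 'm, 'z) msheaf_scheme" +
  fixes \<theta> :: "'x set \<Rightarrow> 'm \<Rightarrow> 'm"
  assumes theta_hom: "openin (pts S) U \<Longrightarrow> \<theta> U \<in> module_hom (sec_ring S U) (sec M U) (sec M U)"
    and theta_res: "\<lbrakk>openin (pts S) U; openin (pts S) V; V \<subseteq> U; m \<in> carrier (sec M U)\<rbrakk>
      \<Longrightarrow> mres M U V (\<theta> U m) = \<theta> V (mres M U V m)"
begin

lemma theta_additive: "openin (pts S) U \<Longrightarrow> additive_map (sec M U) (sec M U) (\<theta> U)"
  using module_hom_additive[OF theta_hom] .

lemma theta_closed: "openin (pts S) U \<Longrightarrow> m \<in> carrier (sec M U) \<Longrightarrow> \<theta> U m \<in> carrier (sec M U)"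
  using additive_closed[OF theta_additive] .

lemma theta_zero: "openin (pts S) U \<Longrightarrow> \<theta> U \<zero>\<^bsub>sec M U\<^esub> = \<zero>\<^bsub>sec M U\<^esub>"
  using additive_zero[OF sec_abelian sec_abelian theta_additive] .

lemma fix_sheaf: "sheaf_of_modules S (fix_sheaf M \<theta>)"
proof -
  let ?F = "fix_sheaf M \<theta>"
  have car: "carrier (sec ?F U) = {m \<in> carrier (sec M U). \<theta> U m = m}" for U by (simp add: fix_sheaf_def)
  have mr: "mres ?F = mres M" by (simp add: fix_sheaf_def)
  have ops: "\<zero>\<^bsub>sec ?F U\<^esub> = \<zero>\<^bsub>sec M U\<^esub>" "x \<oplus>\<^bsub>sec ?F U\<^esub> y = x \<oplus>\<^bsub>sec M U\<^esub> y"
    "a \<odot>\<^bsub>sec ?F U\<^esub> x = a \<odot>\<^bsub>sec M U\<^esub> x" for U x y a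
    by (simp_all add: fix_sheaf_def)
  have "presheaf (pts S) (\<lambda>U. carrier (sec ?F U)) (mres ?F)"
    by standard (auto simp: car mr M.res_closed M.res_id M.res_comp theta_res[symmetric])
  moreover have "sheaf_axioms (pts S) (\<lambda>U. carrier (sec ?F U)) (mres ?F)"
  proof
    fix C s
    assume C: "\<forall>U\<in>C. openin (pts S) U" "\<forall>U\<in>C. s U \<in> carrier (sec ?F U)"
      and comp: "\<forall>U\<in>C. \<forall>V\<in>C. mres ?F U (U \<inter> V) (s U) = mres ?F V (U \<inter> V) (s V)"
    have oC: "openin (pts S) (\<Union>C)" using C(1) by blast
    have ex: "\<exists>!t. t \<in> carrier (sec M (\<Union>C)) \<and> (\<forall>U\<in>C. mres M (\<Union>C) U t = s U)"
      using C comp by (intro M.glue) (auto simp: car mr)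
    then obtain t where t: "t \<in> carrier (sec M (\<Union>C))" "\<And>U. U \<in> C \<Longrightarrow> mres M (\<Union>C) U t = s U"
      and uniq: "\<And>u. u \<in> carrier (sec M (\<Union>C)) \<Longrightarrow> (\<And>U. U \<in> C \<Longrightarrow> mres M (\<Union>C) U u = s U) \<Longrightarrow> u = t"
      by (elim ex1E) blast
    \<comment> \<open>The section \<theta> t restricts to the same members of the cover as t does,
      so uniqueness of gluing makes t a fixed section.\<close>
    have "mres M (\<Union>C) U (\<theta> (\<Union>C) t) = s U" if "U \<in> C" for U
      using theta_res[OF oC _ _ t(1), of U] C that t(2)[OF that] by (auto simp: car)
    then have "\<theta> (\<Union>C) t = t" by (rule uniq[OF theta_closed[OF oC t(1)]])
    then have "t \<in> carrier (sec ?F (\<Union>C)) \<and> (\<forall>U\<in>C. mres ?F (\<Union>C) U t = s U)"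
      using t by (simp add: car mr)
    moreover have "u = t" if "u \<in> carrier (sec ?F (\<Union>C)) \<and> (\<forall>U\<in>C. mres ?F (\<Union>C) U u = s U)" for u
      using that by (intro uniq) (simp_all add: car mr)
    ultimately show "\<exists>!t. t \<in> carrier (sec ?F (\<Union>C)) \<and> (\<forall>U\<in>C. mres ?F (\<Union>C) U t = s U)" by (rule ex1I)
  qed
  ultimately have "sheaf (pts S) (\<lambda>U. carrier (sec ?F U)) (mres ?F)" by (simp add: sheaf_def)
  moreover have "module (sec_ring S U) (sec ?F U)" if U: "openin (pts S) U" for U
  proof -
    interpret N: module "sec_ring S U" "sec M U" by (rule sec_module[OF U])
    have "submodule (sec_ring S U) {m \<in> carrier (sec M U). \<theta> U m = m} (sec M U)"
      using module_hom_add[OF theta_hom[OF U]] module_hom_smult[OF theta_hom[OF U]] theta_zero[OF U] 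
      by (intro submodule.intro N.module_axioms) auto
    then show ?thesis using N.submodule_is_module by (simp add: fix_sheaf_def)
  qed
  ultimately show ?thesis
    using ringed_space_axioms
    by (auto simp: sheaf_of_modules_def sheaf_of_modules_axioms_def car mr ops mres_add mres_smult)
qed

end

text \<open>With the complementary idempotent \<open>\<theta>'\<close> = id - \<theta>, the map m ->
  (\<theta> m, \<theta>' m) identifies E with the direct sum of the two fixed sheaves. The first is
  nonzero unless \<theta> = 0, the second unless \<theta> = id.\<close>

lemma nonsplitting_idempotent:
  assumes E: "sheaf_of_gmodules G S E" and ns: "nonsplitting_gmodule G S E"
    and endo: "sheaf_endomorphism S E \<theta>"
    and act: "\<And>g U m. g \<in> carrier G \<Longrightarrow> openin (pts S) U \<Longrightarrow> m \<in> carrier (sec E U)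
      \<Longrightarrow> \<theta> U (act E g U m) = act E g U (\<theta> U m)"
    and idem: "\<And>U m. openin (pts S) U \<Longrightarrow> m \<in> carrier (sec E U) \<Longrightarrow> \<theta> U (\<theta> U m) = \<theta> U m"
  shows "(\<forall>U. openin (pts S) U \<longrightarrow> (\<forall>m\<in>carrier (sec E U). \<theta> U m = \<zero>\<^bsub>sec E U\<^esub>))
    \<or> (\<forall>U. openin (pts S) U \<longrightarrow> (\<forall>m\<in>carrier (sec E U). \<theta> U m = m))"
proof (rule ccontr)
  assume no: "\<not> ?thesis"
  interpret E: sheaf_of_gmodules G S E by fact
  interpret \<theta>: sheaf_endomorphism S E \<theta> by fact
  define \<theta>' where "\<theta>' U m = m \<ominus>\<^bsub>sec E U\<^esub> \<theta> U m" for U m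
  have ab: "abelian_group (sec E U)" if "openin (pts S) U" for U using E.sec_abelian[OF that] .
  have add': "additive_map (sec E U) (sec E U) (\<theta>' U)" if U: "openin (pts S) U" for U
  proof -
    interpret N: abelian_group "sec E U" by (rule ab[OF U])
    show ?thesis unfolding additive_map_def
    proof (intro conjI ballI funcsetI)
      fix x y assume xy: "x \<in> carrier (sec E U)" "y \<in> carrier (sec E U)"
      show "\<theta>' U (x \<oplus>\<^bsub>sec E U\<^esub> y) = \<theta>' U x \<oplus>\<^bsub>sec E U\<^esub> \<theta>' U y"
        using xy \<theta>.theta_closed[OF U] additive_add[OF \<theta>.theta_additive[OF U] xy]
        by (simp add: \<theta>'_def N.minus_eq N.minus_add N.a_ac)
    qed (use \<theta>.theta_closed[OF U] in \<open>simp add: \<theta>'_def\<close>)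
  qed
  have "sheaf_endomorphism S E \<theta>'"
  proof
    fix U assume U: "openin (pts S) U"
    interpret N: module "sec_ring S U" "sec E U" by (rule E.sec_module[OF U])
    show "\<theta>' U \<in> module_hom (sec_ring S U) (sec E U) (sec E U)"
      using \<theta>.theta_closed[OF U] module_hom_smult[OF \<theta>.theta_hom[OF U]]
      by (intro module_homI add'[OF U]) (simp add: \<theta>'_def N.M.minus_eq N.smult_r_distr N.smult_r_minus)
    fix V m assume V: "openin (pts S) V" "V \<subseteq> U" "m \<in> carrier (sec E U)"
    interpret N': abelian_group "sec E V" by (rule ab[OF V(1)])
    have "mres E U V (\<theta>' U m) \<oplus>\<^bsub>sec E V\<^esub> \<theta> V (mres E U V m) = mres E U V (\<theta>' U m \<oplus>\<^bsub>sec E U\<^esub> \<theta> U m)"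
      using V U by (simp add: E.mres_add additive_closed[OF add'] \<theta>.theta_closed \<theta>.theta_res)
    also have "\<theta>' U m \<oplus>\<^bsub>sec E U\<^esub> \<theta> U m = m"
      using V \<theta>.theta_closed[OF U] by (simp add: \<theta>'_def N.M.minus_eq N.M.a_assoc N.M.l_neg)
    finally show "mres E U V (\<theta>' U m) = \<theta>' V (mres E U V m)"
      unfolding \<theta>'_def[of V]
      using V U E.M.res_closed[OF U V] additive_closed[OF add'[OF U] V(3)] E.M.res_closed[OF U V(1,2)]
         \<theta>.theta_closed[OF V(1)]
      by (metis N'.add.inv_solve_right N'.minus_eq)
  qed
  then interpret \<theta>': sheaf_endomorphism S E \<theta>' .
  have sum: "\<theta> U m \<oplus>\<^bsub>sec E U\<^esub> \<theta>' U m = m" if U: "openin (pts S) U" "m \<in> carrier (sec E U)" for U m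
  proof -
    interpret N: abelian_group "sec E U" by (rule ab[OF U(1)])
    show ?thesis using \<theta>.theta_closed[OF U] U by (simp add: \<theta>'_def N.minus_eq N.a_lcomm N.r_neg)
  qed
  have cross: "\<theta> U (\<theta>' U m) = \<zero>\<^bsub>sec E U\<^esub>" "\<theta>' U (\<theta> U m) = \<zero>\<^bsub>sec E U\<^esub>" "\<theta>' U (\<theta>' U m) = \<theta>' U m"
    if U: "openin (pts S) U" "m \<in> carrier (sec E U)" for U m
  proof -
    interpret N: abelian_group "sec E U" by (rule ab[OF U(1)])
    have "\<theta> U m \<oplus>\<^bsub>sec E U\<^esub> \<theta> U (\<theta>' U m) = \<theta> U m \<oplus>\<^bsub>sec E U\<^esub> \<zero>\<^bsub>sec E U\<^esub>"
      using additive_add[OF \<theta>.theta_additive[OF U(1)] \<theta>.theta_closed[OF U] \<theta>'.theta_closed[OF U]]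
        sum[OF U] idem[OF U] \<theta>.theta_closed[OF U] by simp
    then show 1: "\<theta> U (\<theta>' U m) = \<zero>\<^bsub>sec E U\<^esub>"
      using \<theta>.theta_closed[OF U] \<theta>.theta_closed[OF U(1) \<theta>'.theta_closed[OF U]]
      by (simp only: N.add.l_cancel N.zero_closed)
    show "\<theta>' U (\<theta> U m) = \<zero>\<^bsub>sec E U\<^esub>"
      using \<theta>.theta_closed[OF U] idem[OF U] by (simp add: \<theta>'_def N.r_neg N.minus_eq)
    show "\<theta>' U (\<theta>' U m) = \<theta>' U m"
      using 1 \<theta>'.theta_closed[OF U] by (simp add: \<theta>'_def[of U "\<theta>' U m"] N.minus_eq)
  qed
  have act': "\<theta>' U (act E g U m) = act E g U (\<theta>' U m)"
    if g: "g \<in> carrier G" "openin (pts S) U" "m \<in> carrier (sec E U)" for g U m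
  proof -
    interpret N: abelian_group "sec E U" by (rule ab[OF g(2)])
    note aa = module_hom_additive[OF E.act_hom[OF g(1,2)]]
    have "act E g U (\<theta> U m) \<oplus>\<^bsub>sec E U\<^esub> act E g U (\<theta>' U m) = act E g U m"
      using additive_add[OF aa \<theta>.theta_closed[OF g(2,3)] \<theta>'.theta_closed[OF g(2,3)]] sum[OF g(2,3)] by simp
    moreover have "act E g U (\<theta> U m) \<oplus>\<^bsub>sec E U\<^esub> \<theta>' U (act E g U m) = act E g U m"
      using sum[OF g(2) additive_closed[OF aa g(3)]] act[OF g] by simp
    ultimately show ?thesis
      using additive_closed[OF aa \<theta>.theta_closed[OF g(2,3)]] additive_closed[OF aa \<theta>'.theta_closed[OF g(2,3)]]
        \<theta>'.theta_closed[OF g(2) additive_closed[OF aa g(3)]]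
      by (metis N.add.l_cancel)
  qed
  have fix_g: "sheaf_of_gmodules G S (fix_sheaf E \<eta>)"
    if "sheaf_endomorphism S E \<eta>" and c: "\<And>g U m. g \<in> carrier G \<Longrightarrow> openin (pts S) U \<Longrightarrow> m \<in> carrier (sec E U)
      \<Longrightarrow> \<eta> U (act E g U m) = act E g U (\<eta> U m)" for \<eta>
  proof (intro sheaf_of_gmodules.intro sheaf_endomorphism.fix_sheaf[OF that(1)] E.group_axioms sheaf_of_gmodules_axioms.intro)
    fix g U assume g: "g \<in> carrier G" "openin (pts S) U"
    show "act (fix_sheaf E \<eta>) g U \<in> module_hom (sec_ring S U) (sec (fix_sheaf E \<eta>) U) (sec (fix_sheaf E \<eta>) U)"
      using E.act_hom[OF g] c[OF g] by (auto simp: fix_sheaf_def module_hom_def Pi_iff)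
  qed (auto simp: fix_sheaf_def E.act_res E.act_one E.act_mult)
  let ?A = "fix_sheaf E \<theta>" and ?B = "fix_sheaf E \<theta>'"
  have A: "sheaf_of_gmodules G S ?A" by (rule fix_g[OF endo act])
  have B: "sheaf_of_gmodules G S ?B" by (rule fix_g[OF \<theta>'.sheaf_endomorphism_axioms act'])
  have nA: "nonzero_mod S ?A"
  proof -
    obtain U m where U: "openin (pts S) U" "m \<in> carrier (sec E U)" "\<theta> U m \<noteq> \<zero>\<^bsub>sec E U\<^esub>" using no by blast
    then have "\<theta> U m \<in> carrier (sec ?A U)" "\<zero>\<^bsub>sec ?A U\<^esub> = \<zero>\<^bsub>sec E U\<^esub>"
      using \<theta>.theta_closed idem by (auto simp: fix_sheaf_def)
    then show ?thesis using U unfolding nonzero_mod_def by (metis singletonD)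
  qed
  have nB: "nonzero_mod S ?B"
  proof -
    obtain U m where U: "openin (pts S) U" "m \<in> carrier (sec E U)" "\<theta> U m \<noteq> m" using no by blast
    interpret N: abelian_group "sec E U" by (rule ab[OF U(1)])
    have "\<theta>' U m \<noteq> \<zero>\<^bsub>sec E U\<^esub>" using sum[OF U(1,2)] \<theta>.theta_closed[OF U(1,2)] U(3) by auto
    moreover have "\<theta>' U m \<in> carrier (sec ?B U)" "\<zero>\<^bsub>sec ?B U\<^esub> = \<zero>\<^bsub>sec E U\<^esub>"
      using \<theta>'.theta_closed cross U by (auto simp: fix_sheaf_def)
    ultimately show ?thesis using U unfolding nonzero_mod_def by (metis singletonD)
  qed
  have "gmod_isomorphic G S E (gmod_sum ?A ?B)"
    unfolding gmod_isomorphic_def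
  proof (intro exI[of _ "\<lambda>U m. (\<theta> U m, \<theta>' U m)"] conjI ballI allI impI)
    show "mod_isomorphism S E (gmod_sum ?A ?B) (\<lambda>U m. (\<theta> U m, \<theta>' U m))"
      unfolding mod_isomorphism_def
    proof (intro conjI allI impI ballI)
      fix U assume U: "openin (pts S) U"
      interpret N: abelian_group "sec E U" by (rule ab[OF U])
      show "(\<lambda>m. (\<theta> U m, \<theta>' U m)) \<in> module_hom (sec_ring S U) (sec E U) (sec (gmod_sum ?A ?B) U)"
        using \<theta>.theta_hom[OF U] \<theta>'.theta_hom[OF U] U idem cross
        by (auto simp: module_hom_def gmod_sum_def direct_sum_def fix_sheaf_def)
      show "bij_betw (\<lambda>m. (\<theta> U m, \<theta>' U m)) (carrier (sec E U)) (carrier (sec (gmod_sum ?A ?B) U))"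
      proof (rule bij_betw_byWitness[where f'="\<lambda>(a, b). a \<oplus>\<^bsub>sec E U\<^esub> b"])
        show "\<forall>m\<in>carrier (sec E U). (case (\<theta> U m, \<theta>' U m) of (a, b) \<Rightarrow> a \<oplus>\<^bsub>sec E U\<^esub> b) = m"
          using sum[OF U] by simp
        have "\<theta> U (a \<oplus>\<^bsub>sec E U\<^esub> b) = a" "\<theta>' U (a \<oplus>\<^bsub>sec E U\<^esub> b) = b"
          if "a \<in> carrier (sec E U)" "b \<in> carrier (sec E U)" "\<theta> U a = a" "\<theta>' U b = b" for a b
          using additive_add[OF \<theta>.theta_additive[OF U] that(1,2)] additive_add[OF \<theta>'.theta_additive[OF U] that(1,2)]
            cross(1)[OF U that(2)] cross(2)[OF U that(1)] that by simp_all
        then show "\<forall>ab\<in>carrier (sec (gmod_sum ?A ?B) U).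
            (\<theta> U (case ab of (a, b) \<Rightarrow> a \<oplus>\<^bsub>sec E U\<^esub> b), \<theta>' U (case ab of (a, b) \<Rightarrow> a \<oplus>\<^bsub>sec E U\<^esub> b)) = ab"
          by (auto simp: gmod_sum_def direct_sum_def fix_sheaf_def)
      qed (use \<theta>.theta_closed[OF U] \<theta>'.theta_closed[OF U] idem[OF U] cross[OF U] in
          \<open>auto simp: gmod_sum_def direct_sum_def fix_sheaf_def\<close>)
    next
      fix U V m assume "openin (pts S) U \<and> openin (pts S) V \<and> V \<subseteq> U" "m \<in> carrier (sec E U)"
      then show "mres (gmod_sum ?A ?B) U V (\<theta> U m, \<theta>' U m) = (\<theta> V (mres E U V m), \<theta>' V (mres E U V m))"
        by (auto simp: gmod_sum_def fix_sheaf_def \<theta>.theta_res \<theta>'.theta_res)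
    qed
  next
    fix g U m assume "g \<in> carrier G" "openin (pts S) U" "m \<in> carrier (sec E U)"
    then show "(\<theta> U (act E g U m), \<theta>' U (act E g U m)) = act (gmod_sum ?A ?B) g U (\<theta> U m, \<theta>' U m)"
      by (auto simp: gmod_sum_def fix_sheaf_def act act')
  qed
  then show False using ns A B nA nB unfolding nonsplitting_gmodule_def by blast
qed

section \<open>Localizations and affine schemes\<close>

locale mult_subset = cring A for A :: "('a, 'b) ring_scheme" (structure) and M :: "'a set" +
  assumes M_sub: "M \<subseteq> carrier A" and M_one: "\<one> \<in> M"
    and M_mult: "s \<in> M \<Longrightarrow> t \<in> M \<Longrightarrow> s \<otimes> t \<in> M"
begin

lemma M_carrier: "s \<in> M \<Longrightarrow> s \<in> carrier A"
  using M_sub by blast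

lemma frac_mem:
  "(b, t) \<in> frac A M a s \<longleftrightarrow> b \<in> carrier A \<and> t \<in> M \<and> (\<exists>u\<in>M. u \<otimes> (t \<otimes> a) = u \<otimes> (s \<otimes> b))"
  by (simp add: frac_def)

lemma frac_self: "a \<in> carrier A \<Longrightarrow> s \<in> M \<Longrightarrow> (a, s) \<in> frac A M a s"
  using M_one by (auto simp: frac_mem)

lemma frac_subset:
  assumes "a \<in> carrier A" "s \<in> M" "b \<in> carrier A" "t \<in> M" "u \<in> M" "u \<otimes> (t \<otimes> a) = u \<otimes> (s \<otimes> b)"
  shows "frac A M b t \<subseteq> frac A M a s"
proof clarify
  fix c v assume "(c, v) \<in> frac A M b t"
  then obtain w where c: "c \<in> carrier A" "v \<in> M" "w \<in> M" "w \<otimes> (v \<otimes> b) = w \<otimes> (t \<otimes> c)" by (auto simp: frac_mem)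
  note cl = assms(1,3) c(1) M_carrier[OF assms(2)] M_carrier[OF assms(4)] M_carrier[OF assms(5)]
    M_carrier[OF c(2)] M_carrier[OF c(3)]
  have "(u \<otimes> w \<otimes> t) \<otimes> (v \<otimes> a) = (w \<otimes> v) \<otimes> (u \<otimes> (t \<otimes> a))" using cl by (simp add: m_ac)
  also have "\<dots> = (u \<otimes> s) \<otimes> (w \<otimes> (v \<otimes> b))" unfolding assms(6) using cl by (simp add: m_ac)
  also have "\<dots> = (u \<otimes> w \<otimes> t) \<otimes> (s \<otimes> c)" unfolding c(4) using cl by (simp add: m_ac)
  finally show "(c, v) \<in> frac A M a s" using c assms M_mult by (auto simp: frac_mem intro!: bexI[of _ "u \<otimes> w \<otimes> t"])
qed

lemma frac_eqI:
  assumes "a \<in> carrier A" "s \<in> M" "b \<in> carrier A" "t \<in> M" "u \<in> M" "u \<otimes> (t \<otimes> a) = u \<otimes> (s \<otimes> b)"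
  shows "frac A M a s = frac A M b t"
  using frac_subset[OF assms] frac_subset[OF assms(3,4,1,2,5) assms(6)[symmetric]] by blast

lemma UN_frac:
  assumes "a \<in> carrier A" "s \<in> M" "b \<in> carrier A" "t \<in> M"
    and "\<And>a' s' b' t'. (a', s') \<in> frac A M a s \<Longrightarrow> (b', t') \<in> frac A M b t \<Longrightarrow> f a' s' b' t' = f a s b t"
  shows "(\<Union>(a', s')\<in>frac A M a s. \<Union>(b', t')\<in>frac A M b t. f a' s' b' t') = f a s b t"
  using frac_self[OF assms(1,2)] frac_self[OF assms(3,4)] assms(5) by blast

lemma localization_mult:
  assumes "a \<in> carrier A" "s \<in> M" "b \<in> carrier A" "t \<in> M"
  shows "frac A M a s \<otimes>\<^bsub>localization A M\<^esub> frac A M b t = frac A M (a \<otimes> b) (s \<otimes> t)"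
proof -
  have "frac A M (a' \<otimes> b') (s' \<otimes> t') = frac A M (a \<otimes> b) (s \<otimes> t)"
    if m: "(a', s') \<in> frac A M a s" "(b', t') \<in> frac A M b t" for a' s' b' t'
  proof -
    obtain u v where e: "a' \<in> carrier A" "s' \<in> M" "b' \<in> carrier A" "t' \<in> M" "u \<in> M" "v \<in> M"
      "u \<otimes> (s' \<otimes> a) = u \<otimes> (s \<otimes> a')" "v \<otimes> (t' \<otimes> b) = v \<otimes> (t \<otimes> b')"
      using m by (auto simp: frac_mem)
    note cl = assms(1,3) e(1,3) M_carrier[OF assms(2)] M_carrier[OF assms(4)] e(2,4,5,6)[THEN M_carrier]
    have "(u \<otimes> v) \<otimes> (s \<otimes> t \<otimes> (a' \<otimes> b')) = (u \<otimes> (s \<otimes> a')) \<otimes> (v \<otimes> (t \<otimes> b'))" using cl by (simp add: m_ac)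
    also have "\<dots> = (u \<otimes> v) \<otimes> (s' \<otimes> t' \<otimes> (a \<otimes> b))" unfolding e(7,8)[symmetric] using cl by (simp add: m_ac)
    finally show ?thesis using e assms M_mult cl by (intro frac_eqI) auto
  qed
  then show ?thesis unfolding localization_def
    using UN_frac[OF assms, of "\<lambda>a' s' b' t'. frac A M (a' \<otimes> b') (s' \<otimes> t')"] by simp
qed

lemma localization_add:
  assumes "a \<in> carrier A" "s \<in> M" "b \<in> carrier A" "t \<in> M"
  shows "frac A M a s \<oplus>\<^bsub>localization A M\<^esub> frac A M b t = frac A M (a \<otimes> t \<oplus> b \<otimes> s) (s \<otimes> t)"
proof -
  have "frac A M (a' \<otimes> t' \<oplus> b' \<otimes> s') (s' \<otimes> t') = frac A M (a \<otimes> t \<oplus> b \<otimes> s) (s \<otimes> t)"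
    if m: "(a', s') \<in> frac A M a s" "(b', t') \<in> frac A M b t" for a' s' b' t'
  proof -
    obtain u v where e: "a' \<in> carrier A" "s' \<in> M" "b' \<in> carrier A" "t' \<in> M" "u \<in> M" "v \<in> M"
      "u \<otimes> (s' \<otimes> a) = u \<otimes> (s \<otimes> a')" "v \<otimes> (t' \<otimes> b) = v \<otimes> (t \<otimes> b')"
      using m by (auto simp: frac_mem)
    note cl = assms(1,3) e(1,3) M_carrier[OF assms(2)] M_carrier[OF assms(4)] e(2,4,5,6)[THEN M_carrier]
    have "(u \<otimes> v) \<otimes> (s \<otimes> t \<otimes> (a' \<otimes> t' \<oplus> b' \<otimes> s'))
        = (u \<otimes> (s \<otimes> a')) \<otimes> (v \<otimes> t \<otimes> t') \<oplus> (v \<otimes> (t \<otimes> b')) \<otimes> (u \<otimes> s \<otimes> s')"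
      using cl by (simp add: m_ac r_distr)
    also have "\<dots> = (u \<otimes> v) \<otimes> (s' \<otimes> t' \<otimes> (a \<otimes> t \<oplus> b \<otimes> s))"
      unfolding e(7,8)[symmetric] using cl by (simp add: m_ac r_distr)
    finally show ?thesis using e assms M_mult cl by (intro frac_eqI) auto
  qed
  then show ?thesis unfolding localization_def
    using UN_frac[OF assms, of "\<lambda>a' s' b' t'. frac A M (a' \<otimes> t' \<oplus> b' \<otimes> s') (s' \<otimes> t')"] by simp
qed

end

lemma (in primeideal) mult_subset_compl: "mult_subset R (carrier R - I)"
proof
  show "\<one> \<in> carrier R - I" using I_notcarr one_imp_carrier by blast
  show "s \<otimes> t \<in> carrier R - I" if "s \<in> carrier R - I" "t \<in> carrier R - I" for s t
    using that I_prime by blast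
qed auto

lemma local_at_frac_closed:
  "a \<in> carrier A \<Longrightarrow> d \<in> carrier A \<Longrightarrow> d \<notin> P \<Longrightarrow> frac A (carrier A - P) a d \<in> carrier (local_at A P)"
  by (auto simp: localization_def)

lemma frac_section:
  assumes "openin (Zariski A) V" "a \<in> carrier A" "d \<in> carrier A" "\<And>Q. Q \<in> V \<Longrightarrow> d \<notin> Q"
  shows "(\<lambda>Q\<in>V. frac A (carrier A - Q) a d) \<in> spec_sections A V"
  unfolding spec_sections_def
proof (intro CollectI conjI ballI)
  show "(\<lambda>Q\<in>V. frac A (carrier A - Q) a d) \<in> (\<Pi>\<^sub>E P\<in>V. carrier (local_at A P))"
    using assms by (auto intro!: local_at_frac_closed)
  fix P assume "P \<in> V"
  then show "\<exists>V'. openin (Zariski A) V' \<and> P \<in> V' \<and> V' \<subseteq> V \<and> (\<exists>a'\<in>carrier A. \<exists>d'\<in>carrier A.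
      \<forall>Q\<in>V'. d' \<notin> Q \<and> (\<lambda>Q\<in>V. frac A (carrier A - Q) a d) Q = frac A (carrier A - Q) a' d')"
    using assms by (intro exI[of _ V] conjI bexI[of _ a] bexI[of _ d]) auto
qed

lemma Zariski_prime: "openin (Zariski A) V \<Longrightarrow> P \<in> V \<Longrightarrow> primeideal P A"
  by (auto simp: openin_Zariski)

lemma Zariski_basic: "x \<in> carrier A \<Longrightarrow> openin (Zariski A) {P. primeideal P A \<and> x \<notin> P}"
  unfolding openin_Zariski by (intro exI[of _ "{x}"]) auto

lemma topspace_Zariski:
  assumes "cring A" shows "topspace (Zariski A) = {P. primeideal P A}"
proof
  show "topspace (Zariski A) \<subseteq> {P. primeideal P A}"
    using Zariski_prime openin_topspace by blast
  interpret cring A by fact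
  have "openin (Zariski A) {P. primeideal P A \<and> \<one>\<^bsub>A\<^esub> \<notin> P}" by (rule Zariski_basic) simp
  moreover have "\<one>\<^bsub>A\<^esub> \<notin> P" if "primeideal P A" for P
    using that ideal.one_imp_carrier[of P A] primeideal.I_notcarr primeideal.axioms(1) by fastforce
  ultimately have "openin (Zariski A) {P. primeideal P A}" by (metis (mono_tags, lifting) Collect_cong)
  then show "{P. primeideal P A} \<subseteq> topspace (Zariski A)" by (rule openin_subset)
qed

lemma Spec_simps:
  "pts (Spec A) = Zariski A"
  "ring_res (Spec A) U V s = restrict s V"
  "carrier (sec_ring (Spec A) U) = spec_sections A U"
  "s \<otimes>\<^bsub>sec_ring (Spec A) U\<^esub> t = (\<lambda>P\<in>U. s P \<otimes>\<^bsub>local_at A P\<^esub> t P)"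
  "s \<oplus>\<^bsub>sec_ring (Spec A) U\<^esub> t = (\<lambda>P\<in>U. s P \<oplus>\<^bsub>local_at A P\<^esub> t P)"
  "\<one>\<^bsub>sec_ring (Spec A) U\<^esub> = (\<lambda>P\<in>U. frac A (carrier A - P) \<one>\<^bsub>A\<^esub> \<one>\<^bsub>A\<^esub>)"
  "\<zero>\<^bsub>sec_ring (Spec A) U\<^esub> = (\<lambda>P\<in>U. frac A (carrier A - P) \<zero>\<^bsub>A\<^esub> \<one>\<^bsub>A\<^esub>)"
  by (simp_all add: Spec_def localization_def)

lemma global_section_hom:
  assumes "cring A" "openin (Zariski A) U"
  shows "(\<lambda>c. \<lambda>P\<in>U. frac A (carrier A - P) c \<one>\<^bsub>A\<^esub>) \<in> ring_hom A (sec_ring (Spec A) U)"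
proof (rule ring_hom_memI)
  interpret cring A by fact
  have M: "mult_subset A (carrier A - P)" if "P \<in> U" for P
    using primeideal.mult_subset_compl[OF Zariski_prime[OF assms(2) that]] .
  fix c assume c: "c \<in> carrier A"
  show "(\<lambda>P\<in>U. frac A (carrier A - P) c \<one>\<^bsub>A\<^esub>) \<in> carrier (sec_ring (Spec A) U)"
    unfolding Spec_simps using mult_subset.M_one[OF M] by (intro frac_section assms c) auto
  fix d assume d: "d \<in> carrier A"
  show "(\<lambda>P\<in>U. frac A (carrier A - P) (c \<otimes>\<^bsub>A\<^esub> d) \<one>\<^bsub>A\<^esub>)
    = (\<lambda>P\<in>U. frac A (carrier A - P) c \<one>\<^bsub>A\<^esub>) \<otimes>\<^bsub>sec_ring (Spec A) U\<^esub> (\<lambda>P\<in>U. frac A (carrier A - P) d \<one>\<^bsub>A\<^esub>)"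
    unfolding Spec_simps using c d mult_subset.M_one[OF M]
    by (auto simp: fun_eq_iff restrict_def mult_subset.localization_mult[OF M])
  show "(\<lambda>P\<in>U. frac A (carrier A - P) (c \<oplus>\<^bsub>A\<^esub> d) \<one>\<^bsub>A\<^esub>)
    = (\<lambda>P\<in>U. frac A (carrier A - P) c \<one>\<^bsub>A\<^esub>) \<oplus>\<^bsub>sec_ring (Spec A) U\<^esub> (\<lambda>P\<in>U. frac A (carrier A - P) d \<one>\<^bsub>A\<^esub>)"
    unfolding Spec_simps using c d mult_subset.M_one[OF M]
    by (auto simp: fun_eq_iff restrict_def mult_subset.localization_add[OF M])
qed (simp add: Spec_simps)

lemma (in cring) exists_maximalideal:
  assumes I: "ideal I R" "I \<noteq> carrier R"
  obtains J where "maximalideal J R" "I \<subseteq> J"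
proof -
  define C where "C = {J. ideal J R \<and> I \<subseteq> J \<and> \<one> \<notin> J}"
  have "\<exists>M\<in>C. \<forall>J\<in>C. M \<subseteq> J \<longrightarrow> J = M"
  proof (rule subset_Zorn_nonempty)
    have "\<one> \<notin> I" using ideal.one_imp_carrier[OF I(1)] I(2) by blast
    then show "C \<noteq> {}" using I unfolding C_def by blast
    fix D assume D: "D \<noteq> {}" "subset.chain C D"
    then have DC: "D \<subseteq> C" by (auto simp: subset_chain_def)
    have ch: "subset.chain {J. ideal J R} D" using D by (auto simp: subset_chain_def C_def)
    have "ideal (if D = {} then {\<zero>} else \<Union>D) R" by (rule chain_Union_is_ideal[OF ch])
    then have "ideal (\<Union>D) R" using D by simp
    moreover obtain J where J: "J \<in> D" using D by blast
    then have "I \<subseteq> J" using DC by (auto simp: C_def)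
    then have "I \<subseteq> \<Union>D" using J by blast
    moreover have "\<one> \<notin> \<Union>D" using DC by (auto simp: C_def)
    ultimately show "\<Union>D \<in> C" by (simp add: C_def)
  qed
  then obtain M where MC: "M \<in> C" and max: "\<And>J. J \<in> C \<Longrightarrow> M \<subseteq> J \<Longrightarrow> J = M" by blast
  then have M: "ideal M R" "I \<subseteq> M" "\<one> \<notin> M" by (auto simp: C_def)
  show thesis
  proof (rule that[OF maximalidealI M(2)])
    show "ideal M R" by (rule M)
    show "carrier R \<noteq> M" using M(3) by auto
    fix J assume J: "ideal J R" "M \<subseteq> J" "J \<subseteq> carrier R"
    show "J = M \<or> J = carrier R"
    proof (cases "\<one> \<in> J")
      case True
      then show ?thesis using ideal.one_imp_carrier[OF J(1)] by blast
    next
      case False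
      then have "J \<in> C" using J M by (auto simp: C_def)
      then show ?thesis using max J by blast
    qed
  qed
qed

text \<open>If x vanishes in every localization, no maximal ideal contains its annihilator, which is
  therefore the whole ring. This is the injectivity of A -> O(Spec A), through which A inherits from
  the sections the absence of zero divisors.\<close>

lemma (in cring) locally_zero_imp_zero:
  assumes x: "x \<in> carrier R"
    and loc: "\<And>P. primeideal P R \<Longrightarrow> frac R (carrier R - P) x \<one> = frac R (carrier R - P) \<zero> \<one>"
  shows "x = \<zero>"
proof -
  define I where "I = {a \<in> carrier R. a \<otimes> x = \<zero>}"
  have "ideal I R"
  proof (rule idealI)
    show "ring R" by (rule ring_axioms)
    show "subgroup I (add_monoid R)"
      using x by (unfold_locales) (auto simp: I_def l_distr a_inv_def[symmetric] l_minus)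
    fix a y assume "a \<in> I" "y \<in> carrier R"
    then have y: "y \<in> carrier R" "a \<in> carrier R" "a \<otimes> x = \<zero>" by (auto simp: I_def)
    then have "y \<otimes> a \<in> carrier R" "y \<otimes> a \<otimes> x = \<zero>" "a \<otimes> y = y \<otimes> a"
      using x by (simp_all add: m_assoc) (simp add: m_comm)
    then show "y \<otimes> a \<in> I" "a \<otimes> y \<in> I" by (simp_all add: I_def)
  qed
  have "I = carrier R"
  proof (rule ccontr)
    assume "I \<noteq> carrier R"
    then obtain J where J: "maximalideal J R" "I \<subseteq> J" using exists_maximalideal[OF \<open>ideal I R\<close>] by blast
    then have P: "primeideal J R" by (intro maximalideal_prime)
    interpret J: mult_subset R "carrier R - J" by (rule primeideal.mult_subset_compl[OF P])
    have "(x, \<one>) \<in> frac R (carrier R - J) \<zero> \<one>"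
      unfolding loc[OF P, symmetric] by (rule J.frac_self[OF x J.M_one])
    then obtain u where "u \<in> carrier R - J" "u \<otimes> (\<one> \<otimes> \<zero>) = u \<otimes> (\<one> \<otimes> x)" by (auto simp: J.frac_mem)
    then show False using J(2) x by (auto simp: I_def)
  qed
  then have "\<one> \<in> I" by simp
  then show ?thesis using x by (simp add: I_def)
qed

section \<open>The generic point of an integral scheme\<close>

lemma generic_point_in_open:
  assumes "generic_point S \<epsilon>" "openin (pts S) U" "U \<noteq> {}"
  shows "\<epsilon> \<in> U"
proof -
  obtain x where "x \<in> U" using assms(3) by blast
  moreover have "x \<in> pts S closure_of {\<epsilon>}"
    using assms openin_subset[OF assms(2)] \<open>x \<in> U\<close> by (auto simp: generic_point_def)
  ultimately show ?thesis using assms(2) by (auto simp: in_closure_of)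
qed

lemma integral_lrs: "integral_scheme S \<Longrightarrow> locally_ringed_space S"
  by (simp add: integral_scheme_def scheme_def)

text \<open>An equality 1 = 0 of germs would hold in the sections over some neighbourhood, and these
  form a domain.\<close>

lemma integral_stalk_nontrivial:
  assumes "integral_scheme S" "x \<in> topspace (pts S)"
  shows "cring (ring_stalk S x)" "\<one>\<^bsub>ring_stalk S x\<^esub> \<noteq> \<zero>\<^bsub>ring_stalk S x\<^esub>"
proof -
  interpret locally_ringed_space S by (rule integral_lrs[OF assms(1)])
  show "cring (ring_stalk S x)" using stalk_local[OF assms(2)] by (simp add: local_ring_def)
  show "\<one>\<^bsub>ring_stalk S x\<^esub> \<noteq> \<zero>\<^bsub>ring_stalk S x\<^esub>"
  proof
    let ?X = "topspace (pts S)"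
    interpret X: cring "sec_ring S ?X" by (rule sec_cring) simp
    assume "\<one>\<^bsub>ring_stalk S x\<^esub> = \<zero>\<^bsub>ring_stalk S x\<^esub>"
    then have e: "ring_germ S x ?X \<one>\<^bsub>sec_ring S ?X\<^esub> = ring_germ S x ?X \<zero>\<^bsub>sec_ring S ?X\<^esub>"
      using stalk_one[OF open_topspace assms(2)] stalk_zero[OF open_topspace assms(2)] by simp
    obtain W where W: "openin (pts S) W" "x \<in> W"
      "ring_res S ?X W \<one>\<^bsub>sec_ring S ?X\<^esub> = ring_res S ?X W \<zero>\<^bsub>sec_ring S ?X\<^esub>"
      using O.germ_eqD[OF _ _ e] assms(2) by auto
    have sub: "W \<subseteq> ?X" using openin_subset[OF W(1)] .
    have "\<one>\<^bsub>sec_ring S W\<^esub> = \<zero>\<^bsub>sec_ring S W\<^esub>"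
      using W(3) ring_hom_one[OF res_ring_hom[OF open_topspace W(1) sub]] res_zero[OF open_topspace W(1) sub] by simp
    moreover have "domain (sec_ring S W)" using assms(1) W by (auto simp: integral_scheme_def)
    ultimately show False by (simp add: domain_def domain_axioms_def)
  qed
qed

text \<open>In an affine neighbourhood Spec A of the generic point, A is a domain and the generic
  point corresponds to the zero ideal. A nonzero germ is given near it by a fraction x/d with x
  nonzero, and d/x is a section near it that inverts the germ.\<close>

lemma generic_stalk_field:
  assumes S: "integral_scheme S" and gen: "generic_point S \<epsilon>"
  shows "field (ring_stalk S \<epsilon>)"
proof -
  let ?K = "ring_stalk S \<epsilon>"
  interpret locally_ringed_space S by (rule integral_lrs[OF S])
  have eX: "\<epsilon> \<in> topspace (pts S)" using gen by (simp add: generic_point_def)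
  interpret K: cring ?K by (rule integral_stalk_nontrivial[OF S eX])
  have "scheme S" using S by (simp add: integral_scheme_def)
  then obtain U and A :: "'b ring" and f \<phi> where U: "openin (pts S) U" "\<epsilon> \<in> U" "cring A"
    and iso: "lrs_isomorphism (open_subspace S U) (Spec A) f \<phi>"
    using eX unfolding scheme_def by blast
  interpret A: cring A by fact
  interpret I: lrs_isomorphism "open_subspace S U" "Spec A" f \<phi> by fact
  define pre where "pre V = {x \<in> U. f x \<in> V}" for V
  have topU: "topspace (pts (open_subspace S U)) = U"
    using openin_subset[OF U(1)] by (auto simp: open_subspace_def)
  have pre: "preim (open_subspace S U) f V = pre V" for V
    unfolding preim_def topU pre_def ..
  have oU: "openin (pts (open_subspace S U)) V \<longleftrightarrow> openin (pts S) V \<and> V \<subseteq> U" for V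
    using U(1) by (auto simp: open_subspace_def openin_open_subtopology)
  have [simp]: "sec_ring (open_subspace S U) = sec_ring S" "ring_res (open_subspace S U) = ring_res S"
    by (simp_all add: open_subspace_def)
  have pre_open: "openin (pts S) (pre V)" if "openin (Zariski A) V" for V
    using openin_continuous_map_preimage[OF I.continuous, of V] that oU topU by (simp add: Spec_simps pre_def)
  have phi_iso: "\<phi> V \<in> ring_iso (sec_ring (Spec A) V) (sec_ring S (pre V))" if "openin (Zariski A) V" for V
    using I.comorphism_iso[of V] that by (simp add: Spec_simps pre)
  have phi_hom: "\<phi> V \<in> ring_hom (sec_ring (Spec A) V) (sec_ring S (pre V))" if "openin (Zariski A) V" for V
    using phi_iso[OF that] by (simp add: ring_iso_def)
  have sec_ring_Spec: "ring (sec_ring (Spec A) V)" if "openin (Zariski A) V" for V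
    using I.Y.sec_cring[of V] that by (simp add: Spec_simps cring_def)
  have phi_res: "\<phi> W (restrict s W) = ring_res S (pre V) (pre W) (\<phi> V s)"
    if "openin (Zariski A) V" "openin (Zariski A) W" "W \<subseteq> V" "s \<in> spec_sections A V" for V W s
    using I.comorphism_res[of V W s] that by (simp add: Spec_simps pre)
  have phi_zero: "\<phi> V \<zero>\<^bsub>sec_ring (Spec A) V\<^esub> = \<zero>\<^bsub>sec_ring S (pre V)\<^esub>" if "openin (Zariski A) V" for V
    using ring_hom_zero[OF phi_hom[OF that] sec_ring_Spec[OF that]] sec_cring[OF pre_open[OF that]] by (simp add: cring_def)
  define P where "P = f \<epsilon>"
  have img: "f ` U = topspace (Zariski A)"
    using homeomorphic_imp_surjective_map[OF I.homeomorphic] topU by (simp add: Spec_simps)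
  have inj: "inj_on f U"
    using homeomorphic_imp_injective_map[OF I.homeomorphic] topU by simp
  have Pgen: "P \<in> V" if V: "openin (Zariski A) V" "Q \<in> V" for V Q
  proof -
    have "Q \<in> f ` U" using img openin_subset[OF V(1)] V(2) by blast
    then have "pre V \<noteq> {}" using V by (auto simp: pre_def)
    then have "\<epsilon> \<in> pre V" by (rule generic_point_in_open[OF gen pre_open[OF V(1)]])
    then show ?thesis by (simp add: pre_def P_def)
  qed
  have P: "primeideal P A" using img U(2) topspace_Zariski[OF U(3)] by (auto simp: P_def)
  let ?X = "topspace (Zariski A)"
  have oX: "openin (Zariski A) ?X" by simp
  have preX: "pre ?X = U" using img by (auto simp: pre_def)
  have dom: "domain (sec_ring S U)" using S U by (auto simp: integral_scheme_def)
  \<comment> \<open>A embeds into the ring of sections over U, which is a domain because the scheme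
    is integral.\<close>
  have zero_prime: "primeideal {\<zero>\<^bsub>A\<^esub>} A"
  proof (rule primeidealI)
    show "ideal {\<zero>\<^bsub>A\<^esub>} A" by (rule A.zeroideal)
    show "cring A" by (rule U)
    show "carrier A \<noteq> {\<zero>\<^bsub>A\<^esub>}"
      using primeideal.I_notcarr[OF P] additive_subgroup.zero_closed[OF ideal.axioms(1)[OF primeideal.axioms(1)[OF P]]]
        additive_subgroup.a_subset[OF ideal.axioms(1)[OF primeideal.axioms(1)[OF P]]] by auto
    fix a b assume ab: "a \<in> carrier A" "b \<in> carrier A" "a \<otimes>\<^bsub>A\<^esub> b \<in> {\<zero>\<^bsub>A\<^esub>}"
    let ?j = "\<lambda>c. \<lambda>P\<in>?X. frac A (carrier A - P) c \<one>\<^bsub>A\<^esub>"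
    note j = global_section_hom[OF U(3) oX]
    have jc: "?j c \<in> carrier (sec_ring (Spec A) ?X)" if "c \<in> carrier A" for c using ring_hom_closed[OF j that] .
    have jz: "?j \<zero>\<^bsub>A\<^esub> = \<zero>\<^bsub>sec_ring (Spec A) ?X\<^esub>" by (simp add: Spec_simps)
    have hz: "c = \<zero>\<^bsub>A\<^esub>" if c: "c \<in> carrier A" and z: "\<phi> ?X (?j c) = \<zero>\<^bsub>sec_ring S U\<^esub>" for c
    proof (rule A.locally_zero_imp_zero[OF c])
      have "?j c = ?j \<zero>\<^bsub>A\<^esub>"
      proof (rule inj_onD[of "\<phi> ?X" "carrier (sec_ring (Spec A) ?X)"])
        show "inj_on (\<phi> ?X) (carrier (sec_ring (Spec A) ?X))"
          using phi_iso[OF oX] by (auto simp: ring_iso_def bij_betw_def)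
        show "\<phi> ?X (?j c) = \<phi> ?X (?j \<zero>\<^bsub>A\<^esub>)" using z phi_zero[OF oX] jz preX by simp
      qed (use jc c in auto)
      fix Q assume "primeideal Q A"
      then have "Q \<in> ?X" using topspace_Zariski[OF U(3)] by simp
      then show "frac A (carrier A - Q) c \<one>\<^bsub>A\<^esub> = frac A (carrier A - Q) \<zero>\<^bsub>A\<^esub> \<one>\<^bsub>A\<^esub>"
        using fun_cong[OF \<open>?j c = ?j \<zero>\<^bsub>A\<^esub>\<close>, of Q] by simp
    qed
    have "\<phi> ?X (?j a) \<otimes>\<^bsub>sec_ring S U\<^esub> \<phi> ?X (?j b) = \<phi> ?X (?j (a \<otimes>\<^bsub>A\<^esub> b))"
      using ring_hom_mult[OF phi_hom[OF oX] jc[OF ab(1)] jc[OF ab(2)]] ring_hom_mult[OF j ab(1,2)] preX by simp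
    also have "\<dots> = \<zero>\<^bsub>sec_ring S U\<^esub>" using ab(3) jz phi_zero[OF oX] preX by simp
    finally have "\<phi> ?X (?j a) = \<zero>\<^bsub>sec_ring S U\<^esub> \<or> \<phi> ?X (?j b) = \<zero>\<^bsub>sec_ring S U\<^esub>"
      using domain.integral[OF dom] ring_hom_closed[OF phi_hom[OF oX]] jc ab preX by auto
    then show "a \<in> {\<zero>\<^bsub>A\<^esub>} \<or> b \<in> {\<zero>\<^bsub>A\<^esub>}" using hz ab by blast
  qed
  \<comment> \<open>For nonzero x the basic open set of x contains the zero ideal, so it is nonempty
    and the generic point P lies in it, which means that x is not in P.\<close>
  have P0: "x = \<zero>\<^bsub>A\<^esub>" if "x \<in> P" for x
  proof (rule ccontr)
    assume "x \<noteq> \<zero>\<^bsub>A\<^esub>"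
    moreover have "x \<in> carrier A"
      using that additive_subgroup.a_subset[OF ideal.axioms(1)[OF primeideal.axioms(1)[OF P]]] by blast
    ultimately show False using Pgen[OF Zariski_basic, of x "{\<zero>\<^bsub>A\<^esub>}"] zero_prime that by auto
  qed
  have unit: "a \<in> Units ?K" if a: "a \<in> carrier ?K" "a \<noteq> \<zero>\<^bsub>?K\<^esub>" for a
  proof -
    obtain W0 a0 where W0: "openin (pts S) W0" "\<epsilon> \<in> W0" "a0 \<in> carrier (sec_ring S W0)" "a = ring_germ S \<epsilon> W0 a0"
      using a(1) by (rule stalk_cases)
    define W where "W = W0 \<inter> U"
    define a1 where "a1 = ring_res S W0 W a0"
    have W: "openin (pts S) W" "\<epsilon> \<in> W" "W \<subseteq> U" "a1 \<in> carrier (sec_ring S W)" "a = ring_germ S \<epsilon> W a1"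
      using W0 U O.germ_res[of W0 \<epsilon> a0 W] ring_res_closed[of W0 W a0] by (auto simp: W_def a1_def)
    define V where "V = f ` W"
    have V: "openin (Zariski A) V"
      using homeomorphic_imp_open_map[OF I.homeomorphic] W oU by (auto simp: open_map_def V_def Spec_simps)
    have preV: "pre V = W" using inj W(3) by (auto simp: pre_def V_def inj_on_def)
    obtain s where s: "s \<in> spec_sections A V" "\<phi> V s = a1"
      using phi_iso[OF V] W(4) preV by (auto simp: ring_iso_def bij_betw_def Spec_simps) (metis imageE)
    have "P \<in> V" using W(2) by (simp add: V_def P_def)
    then have "\<exists>V'. openin (Zariski A) V' \<and> P \<in> V' \<and> V' \<subseteq> V \<and>
        (\<exists>a\<in>carrier A. \<exists>d\<in>carrier A. \<forall>Q\<in>V'. d \<notin> Q \<and> s Q = frac A (carrier A - Q) a d)"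
      using s(1) by (simp add: spec_sections_def)
    then obtain V' where V0': "openin (Zariski A) V'" "P \<in> V'" "V' \<subseteq> V"
      and "\<exists>a\<in>carrier A. \<exists>d\<in>carrier A. \<forall>Q\<in>V'. d \<notin> Q \<and> s Q = frac A (carrier A - Q) a d" by (elim exE conjE)
    then obtain x d where xd: "x \<in> carrier A" "d \<in> carrier A"
      and sV: "\<forall>Q\<in>V'. d \<notin> Q \<and> s Q = frac A (carrier A - Q) x d" by (elim bexE)
    have sV': "d \<notin> Q \<and> s Q = frac A (carrier A - Q) x d" if "Q \<in> V'" for Q using sV that by (rule bspec)
    note V' = V0' xd
    have germ_pre: "a = ring_germ S \<epsilon> (pre Y) (\<phi> Y (restrict s Y))" and pre_eps: "\<epsilon> \<in> pre Y"
      if Y: "openin (Zariski A) Y" "P \<in> Y" "Y \<subseteq> V'" for Y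
    proof -
      show e: "\<epsilon> \<in> pre Y" using Y U by (simp add: pre_def P_def)
      have YV: "Y \<subseteq> V" using Y V' by blast
      have "pre Y \<subseteq> W" using YV preV by (auto simp: pre_def)
      then show "a = ring_germ S \<epsilon> (pre Y) (\<phi> Y (restrict s Y))"
        unfolding phi_res[OF V Y(1) YV s(1)] s(2) preV using O.germ_res[of W \<epsilon> a1 "pre Y"] W e pre_open[OF Y(1)] by simp
    qed
    have "x \<noteq> \<zero>\<^bsub>A\<^esub>"
    proof
      assume x0: "x = \<zero>\<^bsub>A\<^esub>"
      have "restrict s V' = \<zero>\<^bsub>sec_ring (Spec A) V'\<^esub>"
      proof (rule ext)
        fix Q
        show "restrict s V' Q = \<zero>\<^bsub>sec_ring (Spec A) V'\<^esub> Q"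
        proof (cases "Q \<in> V'")
          case True
          interpret Q: mult_subset A "carrier A - Q"
            by (rule primeideal.mult_subset_compl[OF Zariski_prime[OF V'(1) True]])
          show ?thesis using True sV'[OF True] x0 V'(5) Q.M_one
            by (simp add: Spec_simps) (intro Q.frac_eqI[of _ _ _ _ "\<one>\<^bsub>A\<^esub>"], auto)
        qed (simp add: Spec_simps)
      qed
      then have "a = ring_germ S \<epsilon> (pre V') \<zero>\<^bsub>sec_ring S (pre V')\<^esub>"
        using germ_pre[OF V'(1,2) order_refl] phi_zero[OF V'(1)] by simp
      then show False using a(2) stalk_zero[OF pre_open[OF V'(1)] pre_eps[OF V'(1,2) order_refl]] by simp
    qed
    then have xP: "x \<notin> P" using P0 by blast
    \<comment> \<open>The part of V' on which the numerator is invertible as well, so that d/x is a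
      section there. It contains P because x is not in P.\<close>
    define Y where "Y = V' \<inter> {Q. primeideal Q A \<and> x \<notin> Q}"
    have Y: "openin (Zariski A) Y" "P \<in> Y" "Y \<subseteq> V'"
      using V' Zariski_basic[of x A] P xP by (auto simp: Y_def)
    define t where "t = (\<lambda>Q\<in>Y. frac A (carrier A - Q) d x)"
    have t: "t \<in> carrier (sec_ring (Spec A) Y)"
      unfolding t_def Spec_simps by (rule frac_section[OF Y(1) V'(5,4)]) (auto simp: Y_def)
    have sY: "restrict s Y \<in> carrier (sec_ring (Spec A) Y)"
    proof -
      have "restrict s Y = (\<lambda>Q\<in>Y. frac A (carrier A - Q) x d)" using sV' Y by (auto simp: fun_eq_iff)
      then show ?thesis unfolding Spec_simps using frac_section[OF Y(1) V'(4,5)] sV' Y by auto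
    qed
    have "restrict s Y \<otimes>\<^bsub>sec_ring (Spec A) Y\<^esub> t = \<one>\<^bsub>sec_ring (Spec A) Y\<^esub>"
    proof (rule ext)
      fix Q
      show "(restrict s Y \<otimes>\<^bsub>sec_ring (Spec A) Y\<^esub> t) Q = \<one>\<^bsub>sec_ring (Spec A) Y\<^esub> Q"
      proof (cases "Q \<in> Y")
        case True
        interpret Q: mult_subset A "carrier A - Q"
          by (rule primeideal.mult_subset_compl[OF Zariski_prime[OF Y(1) True]])
        have m: "d \<in> carrier A - Q" "x \<in> carrier A - Q" "Q \<in> V'" using True sV' V' by (auto simp: Y_def)
        have "s Q \<otimes>\<^bsub>local_at A Q\<^esub> t Q = frac A (carrier A - Q) (x \<otimes>\<^bsub>A\<^esub> d) (d \<otimes>\<^bsub>A\<^esub> x)"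
          using True sV'[OF m(3)] m V' by (simp add: t_def Q.localization_mult)
        also have "\<dots> = frac A (carrier A - Q) \<one>\<^bsub>A\<^esub> \<one>\<^bsub>A\<^esub>"
          using V'(4,5) Q.M_mult[OF m(1,2)] Q.M_one by (intro Q.frac_eqI[of _ _ _ _ "\<one>\<^bsub>A\<^esub>"]) (auto simp: A.m_comm)
        finally show ?thesis using True by (simp add: Spec_simps)
      qed (simp add: Spec_simps)
    qed
    then have "\<phi> Y (restrict s Y) \<otimes>\<^bsub>sec_ring S (pre Y)\<^esub> \<phi> Y t = \<one>\<^bsub>sec_ring S (pre Y)\<^esub>"
      using ring_hom_mult[OF phi_hom[OF Y(1)] sY t] ring_hom_one[OF phi_hom[OF Y(1)]] by simp
    then have "a \<otimes>\<^bsub>?K\<^esub> ring_germ S \<epsilon> (pre Y) (\<phi> Y t) = \<one>\<^bsub>?K\<^esub>"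
      using stalk_mult[OF pre_open[OF Y(1)] pre_eps[OF Y] ring_hom_closed[OF phi_hom[OF Y(1)] sY] ring_hom_closed[OF phi_hom[OF Y(1)] t]]
        germ_pre[OF Y] stalk_one[OF pre_open[OF Y(1)] pre_eps[OF Y]] by simp
    moreover have u: "ring_germ S \<epsilon> (pre Y) (\<phi> Y t) \<in> carrier ?K"
      by (rule stalk_carrier[OF pre_open[OF Y(1)] pre_eps[OF Y] ring_hom_closed[OF phi_hom[OF Y(1)] t]])
    ultimately show ?thesis
      using K.m_comm[OF a(1) u] a(1) unfolding Units_def by (auto intro!: bexI[OF _ u])
  qed
  have "Units ?K = carrier ?K - {\<zero>\<^bsub>?K\<^esub>}"
  proof (intro equalityI subsetI)
    fix u assume u: "u \<in> Units ?K"
    then obtain v where "v \<in> carrier ?K" "v \<otimes>\<^bsub>?K\<^esub> u = \<one>\<^bsub>?K\<^esub>" by (auto simp: Units_def)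
    then have "u \<noteq> \<zero>\<^bsub>?K\<^esub>" using integral_stalk_nontrivial(2)[OF S eX] K.r_null[of v] by metis
    then show "u \<in> carrier ?K - {\<zero>\<^bsub>?K\<^esub>}" using K.Units_closed[OF u] by simp
  qed (use unit in simp)
  then show ?thesis by (rule K.cring_fieldI)
qed

section \<open>Generic stalks of coherent modules\<close>

context sheaf_of_modules
begin

lemma germ_additive: "openin (pts S) U \<Longrightarrow> x \<in> U \<Longrightarrow>
    additive_map (sec M U) (mod_stalk S M x) (\<lambda>m. mod_germ S M x U m)"
  by (simp add: additive_map_def mod_stalk_carrier mod_stalk_add)

lemma finite_type_stalk:
  assumes "finite_type S M" and x: "x \<in> topspace (pts S)" and K: "cring (ring_stalk S x)"
  obtains n g where "g \<in> {..<n} \<rightarrow> carrier (mod_stalk S M x)"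
    "\<And>A. A \<in> carrier (mod_stalk S M x) \<Longrightarrow> \<exists>a\<in>{..<n::nat} \<rightarrow> carrier (ring_stalk S x).
      A = (\<Oplus>\<^bsub>mod_stalk S M x\<^esub>i\<in>{..<n}. a i \<odot>\<^bsub>mod_stalk S M x\<^esub> g i)"
proof -
  interpret N: module "ring_stalk S x" "mod_stalk S M x" by (rule mod_stalk_module[OF K x])
  obtain U n s where U: "openin (pts S) U" "x \<in> U" "s \<in> {..<n} \<rightarrow> carrier (sec M U)" "generates S M U n s"
    using bspec[OF assms(1)[unfolded finite_type_def] x] by (elim exE conjE bexE)
  have sc: "s i \<in> carrier (sec M U)" if "i < n" for i using U(3) that by auto
  show thesis
  proof (rule that[of "\<lambda>i. mod_germ S M x U (s i)" n])
    show "(\<lambda>i. mod_germ S M x U (s i)) \<in> {..<n} \<rightarrow> carrier (mod_stalk S M x)"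
      using U sc by (auto intro!: mod_stalk_carrier)
    fix A assume "A \<in> carrier (mod_stalk S M x)"
    then obtain V0 t0 where V0: "openin (pts S) V0" "x \<in> V0" "t0 \<in> carrier (sec M V0)" "A = mod_germ S M x V0 t0"
      by (rule mod_stalk_cases)
    define V where "V = V0 \<inter> U"
    define t where "t = mres M V0 V t0"
    have V: "openin (pts S) V" "x \<in> V" "V \<subseteq> U" "t \<in> carrier (sec M V)" "A = mod_germ S M x V t"
      using V0 U M.germ_res[of V0 x t0 V] M.res_closed[of V0 V t0] by (auto simp: V_def t_def)
    obtain W a where W: "openin (pts S) W" "x \<in> W" "W \<subseteq> V" "a \<in> {..<n} \<rightarrow> carrier (sec_ring S W)"
      "mres M V W t = (\<Oplus>\<^bsub>sec M W\<^esub>i\<in>{..<n}. a i \<odot>\<^bsub>sec M W\<^esub> mres M U W (s i))"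
      using U(4) V unfolding generates_def by meson
    interpret MW: module "sec_ring S W" "sec M W" by (rule sec_module[OF W(1)])
    have WU: "W \<subseteq> U" using W V by blast
    have rc: "mres M U W (s i) \<in> carrier (sec M W)" if "i < n" for i
      using M.res_closed[OF U(1) W(1) WU sc[OF that]] .
    have ac: "a i \<in> carrier (sec_ring S W)" if "i < n" for i using W(4) that by auto
    have "A = mod_germ S M x W (mres M V W t)" using V W M.germ_res[of V x t W] by simp
    also have "\<dots> = (\<Oplus>\<^bsub>mod_stalk S M x\<^esub>i\<in>{..<n}. mod_germ S M x W (a i \<odot>\<^bsub>sec M W\<^esub> mres M U W (s i)))"
      unfolding W(5) using rc ac
      by (intro additive_finsum[OF sec_abelian[OF W(1)] N.M.abelian_group_axioms germ_additive[OF W(1,2)]]) auto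
    also have "\<dots> = (\<Oplus>\<^bsub>mod_stalk S M x\<^esub>i\<in>{..<n}. ring_germ S x W (a i) \<odot>\<^bsub>mod_stalk S M x\<^esub> mod_germ S M x U (s i))"
    proof (rule N.M.finsum_cong'[OF refl])
      have gs: "mod_germ S M x W (mres M U W (s i)) = mod_germ S M x U (s i)" if "i < n" for i
        using M.germ_res[of U x "s i" W] U W WU sc[OF that] by simp
      show "mod_germ S M x W (a i \<odot>\<^bsub>sec M W\<^esub> mres M U W (s i))
          = ring_germ S x W (a i) \<odot>\<^bsub>mod_stalk S M x\<^esub> mod_germ S M x U (s i)" if "i \<in> {..<n}" for i
        using that mod_stalk_smult[OF W(1,2) ac rc, of i i] gs by simp
    qed (use U W sc ac in \<open>auto intro!: mod_stalk_carrier stalk_carrier\<close>)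
    finally show "\<exists>a\<in>{..<n} \<rightarrow> carrier (ring_stalk S x). A = (\<Oplus>\<^bsub>mod_stalk S M x\<^esub>i\<in>{..<n}. a i \<odot>\<^bsub>mod_stalk S M x\<^esub> mod_germ S M x U (s i))"
      using W ac by (intro bexI[of _ "\<lambda>i. ring_germ S x W (a i)"]) (auto intro!: stalk_carrier)
  qed
qed

text \<open>
  The annihilator of a section is locally finitely generated by coherence. If all its generators
  vanish near \<open>x\<close>, then the section is nonzero at the generic point; otherwise a nonzero generator
  kills its germ at \<open>x\<close>.
\<close>

lemma generic_germ_zero:
  assumes coh: "coherent S M" and tf: "torsion_free S M"
    and S: "integral_scheme S" and gen: "generic_point S \<epsilon>"
    and U: "openin (pts S) U" "x \<in> U" "m \<in> carrier (sec M U)"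
    and z: "mod_germ S M \<epsilon> U m = \<zero>\<^bsub>mod_stalk S M \<epsilon>\<^esub>"
  shows "mod_germ S M x U m = \<zero>\<^bsub>mod_stalk S M x\<^esub>"
proof -
  \<comment> \<open>Keeps the index set of a single relation in the form
    \<open>{..<1}\<close>.\<close>
  note One_nat_def [simp del]
  \<comment> \<open>The relations of the single section m form its annihilator, with ring elements
    written as functions on \<open>{..<1}\<close>.\<close>
  let ?R = "relation_sheaf S M U 1 (\<lambda>_. m)"
  let ?T = "open_subspace S U"
  have eX: "\<epsilon> \<in> topspace (pts S)" using gen by (simp add: generic_point_def)
  have xX: "x \<in> topspace (pts S)" using U openin_subset by blast
  have eU: "\<epsilon> \<in> U" using generic_point_in_open[OF gen U(1)] U(2) by blast
  have topT: "topspace (pts ?T) = U" using openin_subset[OF U(1)] by (auto simp: open_subspace_def)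
  have oT: "openin (pts ?T) V \<longleftrightarrow> openin (pts S) V \<and> V \<subseteq> U" for V
    using U(1) by (auto simp: open_subspace_def openin_open_subtopology)
  have secT: "sec_ring ?T = sec_ring S" by (simp add: open_subspace_def)
  have one: "{..<1::nat} = {0}" by auto
  have Rcar: "carrier (sec ?R V) = {a \<in> {..<1} \<rightarrow>\<^sub>E carrier (sec_ring S V). a 0 \<odot>\<^bsub>sec M V\<^esub> mres M U V m = \<zero>\<^bsub>sec M V\<^esub>}"
    if V: "openin (pts S) V" "V \<subseteq> U" for V
  proof -
    interpret MV: module "sec_ring S V" "sec M V" by (rule sec_module[OF V(1)])
    have *: "(\<Oplus>\<^bsub>sec M V\<^esub>i\<in>{..<1}. a i \<odot>\<^bsub>sec M V\<^esub> mres M U V m) = a 0 \<odot>\<^bsub>sec M V\<^esub> mres M U V m"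
      if "a \<in> {..<1::nat} \<rightarrow>\<^sub>E carrier (sec_ring S V)" for a
      using that[unfolded one] M.res_closed[OF U(1) V U(3)] unfolding one by (auto simp: PiE_iff)
    have "carrier (sec ?R V) = {a \<in> {..<1} \<rightarrow>\<^sub>E carrier (sec_ring S V).
        (\<Oplus>\<^bsub>sec M V\<^esub>i\<in>{..<1}. a i \<odot>\<^bsub>sec M V\<^esub> mres M U V m) = \<zero>\<^bsub>sec M V\<^esub>}"
      by (simp add: relation_sheaf_def)
    also have "\<dots> = {a \<in> {..<1} \<rightarrow>\<^sub>E carrier (sec_ring S V). a 0 \<odot>\<^bsub>sec M V\<^esub> mres M U V m = \<zero>\<^bsub>sec M V\<^esub>}"
      by (intro Collect_cong conj_cong refl) (simp only: *)
    finally show ?thesis .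
  qed
  have "finite_type ?T ?R"
    using coh[unfolded coherent_def, THEN conjunct2, rule_format, of U "\<lambda>_. m" 1] U by simp
  then have "\<exists>V. openin (pts ?T) V \<and> x \<in> V \<and> (\<exists>n. \<exists>s\<in>{..<n} \<rightarrow> carrier (sec ?R V). generates ?T ?R V n s)"
    unfolding finite_type_def topT using U(2) by (rule bspec)
  then obtain U' n t where "openin (pts ?T) U'" "x \<in> U'" and t: "t \<in> {..<n} \<rightarrow> carrier (sec ?R U')"
    and gn: "generates ?T ?R U' n t"
    by (elim exE conjE bexE)
  then have U': "openin (pts S) U'" "U' \<subseteq> U" "x \<in> U'" by (simp_all add: oT)
  define a where "a j = t j 0" for j :: nat
  have a: "a j \<in> carrier (sec_ring S U')" "a j \<odot>\<^bsub>sec M U'\<^esub> mres M U U' m = \<zero>\<^bsub>sec M U'\<^esub>" if "j < n" for j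
    using t that by (auto simp: a_def Rcar[OF U'(1,2)] Pi_iff PiE_iff)
  show ?thesis
  proof (cases "\<forall>j<n. ring_germ S x U' (a j) = \<zero>\<^bsub>ring_stalk S x\<^esub>")
    case False
    then obtain j where j: "j < n" "ring_germ S x U' (a j) \<noteq> \<zero>\<^bsub>ring_stalk S x\<^esub>" by blast
    have m': "mres M U U' m \<in> carrier (sec M U')" by (rule M.res_closed[OF U(1) U'(1,2) U(3)])
    have "ring_germ S x U' (a j) \<odot>\<^bsub>mod_stalk S M x\<^esub> mod_germ S M x U' (mres M U U' m) = \<zero>\<^bsub>mod_stalk S M x\<^esub>"
      using mod_stalk_smult[OF U'(1,3) a(1)[OF j(1)] m'] a(2)[OF j(1)] mod_stalk_zero[OF U'(1,3)] by simp
    then have "mod_germ S M x U' (mres M U U' m) = \<zero>\<^bsub>mod_stalk S M x\<^esub>"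
      using tf[unfolded torsion_free_def, rule_format, OF xX stalk_carrier[OF U'(1,3) a(1)[OF j(1)]]
          mod_stalk_carrier[OF U'(1,3) m']] j(2) by simp
    then show ?thesis using M.germ_res[of U x m U'] U U' by simp
  next
    case True
    have loc: "\<exists>W. openin (pts S) W \<and> x \<in> W \<and> W \<subseteq> U' \<and> ring_res S U' W (a j) = \<zero>\<^bsub>sec_ring S W\<^esub>" if j: "j < n" for j
    proof -
      have e: "ring_germ S x U' (a j) = ring_germ S x U' \<zero>\<^bsub>sec_ring S U'\<^esub>"
        using True j stalk_zero[OF U'(1,3)] by simp
      have zc: "\<zero>\<^bsub>sec_ring S U'\<^esub> \<in> carrier (sec_ring S U')" using sec_cring[OF U'(1)] by (simp add: cring.cring_simprules)
      obtain W where "openin (pts S) W" "x \<in> W" "W \<subseteq> U'" "ring_res S U' W (a j) = ring_res S U' W \<zero>\<^bsub>sec_ring S U'\<^esub>"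
        using O.germ_eqD[OF _ _ e] U' a(1)[OF j] zc by auto
      then show ?thesis using res_zero[OF U'(1)] by auto
    qed
    define D where "D j = (SOME W. openin (pts S) W \<and> x \<in> W \<and> W \<subseteq> U' \<and> ring_res S U' W (a j) = \<zero>\<^bsub>sec_ring S W\<^esub>)" for j
    have D: "openin (pts S) (D j)" "x \<in> D j" "D j \<subseteq> U'" "ring_res S U' (D j) (a j) = \<zero>\<^bsub>sec_ring S (D j)\<^esub>" if "j < n" for j
      using someI_ex[OF loc[OF that]] unfolding D_def by blast+
    \<comment> \<open>A neighbourhood of x on which all generators vanish. The case without
      generators is separate below, since the intersection over j is then the whole type.\<close>
    define W where "W = U' \<inter> (\<Inter>j\<in>{..<n}. D j)"
    have oW: "openin (pts S) W"
    proof (cases "n = 0")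
      case True
      then show ?thesis using U' by (simp add: W_def)
    next
      case False
      then show ?thesis unfolding W_def using U' D by (intro openin_Int openin_INT2) auto
    qed
    have xW: "x \<in> W" using U' D by (auto simp: W_def)
    have zc0: "\<zero>\<^bsub>sec M U\<^esub> \<in> carrier (sec M U)" using abelian_groupE(2)[OF sec_abelian[OF U(1)]] .
    have ez: "mod_germ S M \<epsilon> U m = mod_germ S M \<epsilon> U \<zero>\<^bsub>sec M U\<^esub>" using z mod_stalk_zero[OF U(1) eU] by simp
    obtain W1 where W1: "openin (pts S) W1" "\<epsilon> \<in> W1" "W1 \<subseteq> U" "mres M U W1 m = mres M U W1 \<zero>\<^bsub>sec M U\<^esub>"
      using M.germ_eqD[OF _ _ ez] U(1,3) eU zc0 by auto
    define W2 where "W2 = W \<inter> W1"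
    have W2: "openin (pts S) W2" "\<epsilon> \<in> W2" "W2 \<subseteq> U" "W2 \<subseteq> U'" "W2 \<subseteq> W" "W2 \<subseteq> W1"
      using oW W1 U' generic_point_in_open[OF gen oW] xW by (auto simp: W2_def W_def)
    have "mres M U W2 m = mres M W1 W2 (mres M U W1 m)"
      using M.res_comp[OF U(1) W1(1) W2(1,6) W1(3) U(3)] by simp
    also have "\<dots> = \<zero>\<^bsub>sec M W2\<^esub>"
      unfolding W1(4) using mres_zero[OF U(1) W1(1,3)] mres_zero[OF W1(1) W2(1,6)] by simp
    finally have mz: "mres M U W2 m = \<zero>\<^bsub>sec M W2\<^esub>" .
    interpret C2: cring "sec_ring S W2" by (rule sec_cring[OF W2(1)])
    interpret M2: module "sec_ring S W2" "sec M W2" by (rule sec_module[OF W2(1)])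
    \<comment> \<open>Over W2 the section m vanishes, so the function one belongs to its annihilator
      and is locally a combination of the generators, all of which vanish there. Hence 1 = 0 on a
      nonempty open set, against integrality.\<close>
    have "(\<lambda>i\<in>{..<1::nat}. \<one>\<^bsub>sec_ring S W2\<^esub>) \<in> carrier (sec ?R W2)"
      by (simp add: Rcar[OF W2(1,3)] mz)
    then obtain W3 b where W3: "openin (pts S) W3" "W3 \<subseteq> U" "\<epsilon> \<in> W3" "W3 \<subseteq> W2" "b \<in> {..<n} \<rightarrow> carrier (sec_ring S W3)"
      and eq: "mres ?R W2 W3 (\<lambda>i\<in>{..<1::nat}. \<one>\<^bsub>sec_ring S W2\<^esub>)
        = (\<Oplus>\<^bsub>sec ?R W3\<^esub>i\<in>{..<n}. b i \<odot>\<^bsub>sec ?R W3\<^esub> mres ?R U' W3 (t i))"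
      using gn W2 unfolding generates_def oT secT by meson
    interpret C3: cring "sec_ring S W3" by (rule sec_cring[OF W3(1)])
    interpret M3: module "sec_ring S W3" "sec M W3" by (rule sec_module[OF W3(1)])
    have m3: "mres M U W3 m \<in> carrier (sec M W3)" by (rule M.res_closed[OF U(1) W3(1,2) U(3)])
    have Rops: "\<zero>\<^bsub>sec ?R W3\<^esub> = (\<lambda>i\<in>{..<1}. \<zero>\<^bsub>sec_ring S W3\<^esub>)"
      "f \<oplus>\<^bsub>sec ?R W3\<^esub> g = (\<lambda>i\<in>{..<1}. f i \<oplus>\<^bsub>sec_ring S W3\<^esub> g i)"
      "d \<odot>\<^bsub>sec ?R W3\<^esub> f = (\<lambda>i\<in>{..<1}. d \<otimes>\<^bsub>sec_ring S W3\<^esub> f i)" for f g d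
      by (simp_all add: relation_sheaf_def)
    \<comment> \<open>This serves to evaluate a finite sum of zeros in the relation module.\<close>
    have "abelian_monoid (sec ?R W3)"
      unfolding one
    proof (rule abelian_monoidI)
      fix f g h
      assume fgh: "f \<in> carrier (sec ?R W3)" "g \<in> carrier (sec ?R W3)" "h \<in> carrier (sec ?R W3)"
      then have c: "f \<in> {..<1} \<rightarrow>\<^sub>E carrier (sec_ring S W3)" "g \<in> {..<1} \<rightarrow>\<^sub>E carrier (sec_ring S W3)"
        "h \<in> {..<1} \<rightarrow>\<^sub>E carrier (sec_ring S W3)" by (simp_all add: Rcar[OF W3(1,2)])
      then have c0: "f 0 \<in> carrier (sec_ring S W3)" "g 0 \<in> carrier (sec_ring S W3)" "h 0 \<in> carrier (sec_ring S W3)" by auto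
      show "f \<oplus>\<^bsub>sec ?R W3\<^esub> g \<in> carrier (sec ?R W3)"
        using fgh c0 m3 by (auto simp: Rcar[OF W3(1,2)] Rops M3.smult_l_distr)
      show "f \<oplus>\<^bsub>sec ?R W3\<^esub> g \<oplus>\<^bsub>sec ?R W3\<^esub> h = f \<oplus>\<^bsub>sec ?R W3\<^esub> (g \<oplus>\<^bsub>sec ?R W3\<^esub> h)"
        using c0 by (auto simp: Rops fun_eq_iff C3.a_assoc)
      show "\<zero>\<^bsub>sec ?R W3\<^esub> \<oplus>\<^bsub>sec ?R W3\<^esub> f = f"
        using c c0 by (auto simp: Rops fun_eq_iff PiE_iff extensional_def)
      show "f \<oplus>\<^bsub>sec ?R W3\<^esub> g = g \<oplus>\<^bsub>sec ?R W3\<^esub> f"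
        using c0 by (auto simp: Rops fun_eq_iff C3.a_comm)
    next
      show "\<zero>\<^bsub>sec ?R W3\<^esub> \<in> carrier (sec ?R W3)"
        using m3 by (auto simp: Rcar[OF W3(1,2)] Rops)
    qed
    then interpret R3: abelian_monoid "sec ?R W3" .
    have "b i \<odot>\<^bsub>sec ?R W3\<^esub> mres ?R U' W3 (t i) = \<zero>\<^bsub>sec ?R W3\<^esub>" if i: "i < n" for i
    proof -
      have sub: "W3 \<subseteq> D i" using W3 W2 i by (auto simp: W_def)
      have "ring_res S U' W3 (a i) = ring_res S (D i) W3 (ring_res S U' (D i) (a i))"
        using O.res_comp[OF U'(1) D(1)[OF i] W3(1) sub D(3)[OF i] a(1)[OF i]] by simp
      also have "\<dots> = \<zero>\<^bsub>sec_ring S W3\<^esub>" unfolding D(4)[OF i] by (rule res_zero[OF D(1)[OF i] W3(1) sub])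
      finally have "ring_res S U' W3 (t i 0) = \<zero>\<^bsub>sec_ring S W3\<^esub>" by (simp add: a_def)
      moreover have "b i \<in> carrier (sec_ring S W3)" using W3(5) i by auto
      ultimately show ?thesis by (auto simp: relation_sheaf_def fun_eq_iff)
    qed
    then have "(\<Oplus>\<^bsub>sec ?R W3\<^esub>i\<in>{..<n}. b i \<odot>\<^bsub>sec ?R W3\<^esub> mres ?R U' W3 (t i)) = \<zero>\<^bsub>sec ?R W3\<^esub>"
      by (intro R3.add.finprod_one_eqI) auto
    then have "mres ?R W2 W3 (\<lambda>i\<in>{..<1::nat}. \<one>\<^bsub>sec_ring S W2\<^esub>) 0 = \<zero>\<^bsub>sec_ring S W3\<^esub>"
      unfolding eq by (simp add: Rops)
    then have "ring_res S W2 W3 \<one>\<^bsub>sec_ring S W2\<^esub> = \<zero>\<^bsub>sec_ring S W3\<^esub>" by (simp add: relation_sheaf_def)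
    then have "\<one>\<^bsub>sec_ring S W3\<^esub> = \<zero>\<^bsub>sec_ring S W3\<^esub>" using ring_hom_one[OF res_ring_hom[OF W2(1) W3(1,4)]] by simp
    moreover have "domain (sec_ring S W3)" using S W3 by (auto simp: integral_scheme_def)
    ultimately show ?thesis by (simp add: domain_def domain_axioms_def)
  qed
qed

text \<open>If the generic stalk were zero, every section would have zero germ at the generic point,
  hence at every point by \<open>generic_germ_zero\<close>.\<close>

lemma generic_stalk_nonzero:
  assumes "coherent S M" "torsion_free S M" "integral_scheme S" "generic_point S \<epsilon>" "nonzero_mod S M"
  shows "carrier (mod_stalk S M \<epsilon>) \<noteq> {\<zero>\<^bsub>mod_stalk S M \<epsilon>\<^esub>}"
proof
  assume z: "carrier (mod_stalk S M \<epsilon>) = {\<zero>\<^bsub>mod_stalk S M \<epsilon>\<^esub>}"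
  obtain U where U: "openin (pts S) U" "carrier (sec M U) \<noteq> {\<zero>\<^bsub>sec M U\<^esub>}"
    using assms(5) by (auto simp: nonzero_mod_def)
  interpret N: abelian_group "sec M U" by (rule sec_abelian[OF U(1)])
  have "m = \<zero>\<^bsub>sec M U\<^esub>" if m: "m \<in> carrier (sec M U)" for m
  proof (rule M.section_eq_germsI[OF U(1) m N.zero_closed])
    fix x assume x: "x \<in> U"
    have "\<epsilon> \<in> U" using generic_point_in_open[OF assms(4) U(1)] x by blast
    then have "mod_germ S M \<epsilon> U m = \<zero>\<^bsub>mod_stalk S M \<epsilon>\<^esub>" using mod_stalk_carrier[OF U(1) _ m] z by blast
    then show "mod_germ S M x U m = mod_germ S M x U \<zero>\<^bsub>sec M U\<^esub>"
      using generic_germ_zero[OF assms(1-4) U(1) x m] mod_stalk_zero[OF U(1) x] by simp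
  qed
  then show False using U(2) by auto
qed

end

section \<open>The structure map from k to rings of sections\<close>

lemma scalar_section_hom:
  assumes k: "cring k" and S: "scheme_over k S p \<phi>" and U: "openin (pts S) U"
  shows "scalar_section k S \<phi> U \<in> ring_hom k (sec_ring S U)"
proof -
  interpret I: lrs_morphism S "Spec k" p \<phi> using S by (simp add: scheme_over_def)
  let ?Z = "topspace (Zariski k)" and ?X = "topspace (pts S)"
  have pre: "preim S p ?Z = ?X"
    using I.continuous by (auto simp: preim_def Spec_simps continuous_map_def)
  have oZ: "openin (Zariski k) ?Z" by simp
  have 1: "\<phi> ?Z \<in> ring_hom (sec_ring (Spec k) ?Z) (sec_ring S ?X)"
    using I.comorphism_hom[of ?Z] pre by (simp add: Spec_simps)
  have 2: "ring_res S ?X U \<in> ring_hom (sec_ring S ?X) (sec_ring S U)"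
    using I.S.res_ring_hom[of ?X U] U openin_subset[OF U] by simp
  show ?thesis
    using ring_hom_trans[OF ring_hom_trans[OF global_section_hom[OF k oZ] 1] 2]
    by (simp add: scalar_section_def[abs_def] comp_def)
qed

lemma scalar_section_res:
  assumes k: "cring k" and S: "scheme_over k S p \<phi>"
    and U: "openin (pts S) U" "openin (pts S) V" "V \<subseteq> U" and c: "c \<in> carrier k"
  shows "ring_res S U V (scalar_section k S \<phi> U c) = scalar_section k S \<phi> V c"
proof -
  interpret I: lrs_morphism S "Spec k" p \<phi> using S by (simp add: scheme_over_def)
  let ?X = "topspace (pts S)"
  have top: "scalar_section k S \<phi> ?X c \<in> carrier (sec_ring S ?X)"
    using ring_hom_closed[OF scalar_section_hom[OF k S] c] by simp
  have id: "ring_res S ?X W (scalar_section k S \<phi> ?X c) = scalar_section k S \<phi> W c" if W: "openin (pts S) W" for W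
  proof -
    have "\<phi> (topspace (Zariski k)) (\<lambda>P\<in>topspace (Zariski k). frac k (carrier k - P) c \<one>\<^bsub>k\<^esub>) \<in> carrier (sec_ring S ?X)"
    proof -
      have oZ: "openin (Zariski k) (topspace (Zariski k))" by simp
      have "preim S p (topspace (Zariski k)) = ?X"
        using I.continuous by (auto simp: preim_def Spec_simps continuous_map_def)
      then show ?thesis
        using ring_hom_closed[OF I.comorphism_hom[of "topspace (Zariski k)"] ring_hom_closed[OF global_section_hom[OF k oZ] c]]
        by (simp add: Spec_simps(1))
    qed
    then show ?thesis
      unfolding scalar_section_def using I.S.O.res_comp[of ?X ?X W] I.S.O.res_id[of ?X] W openin_subset[OF W] by simp
  qed
  show ?thesis
    unfolding id[OF U(1), symmetric] id[OF U(2), symmetric]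
    using I.S.O.res_comp[of ?X U V] U top openin_subset[OF U(1)] by simp
qed

section \<open>Restriction of scalars and subrepresentations\<close>

text \<open>Matrix units are developed for representations over k. Viewing modules of sections and
  the generic stalk as vector spaces over k makes the same theory apply to them; their linearity
  over the larger rings is then an instance of naturality.\<close>

definition restrict_scalars :: "('k \<Rightarrow> 'r) \<Rightarrow> ('r, 'm, 'z) module_scheme \<Rightarrow> ('k, 'm) module"
  where "restrict_scalars \<sigma> M =
    \<lparr>carrier = carrier M, monoid.mult = monoid.mult M, monoid.one = monoid.one M,
     ring.zero = ring.zero M, ring.add = ring.add M,
     module.smult = (\<lambda>c m. \<sigma> c \<odot>\<^bsub>M\<^esub> m)\<rparr>"

lemma restrict_scalars_simps [simp]:
  "carrier (restrict_scalars \<sigma> M) = carrier M"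
  "\<zero>\<^bsub>restrict_scalars \<sigma> M\<^esub> = \<zero>\<^bsub>M\<^esub>"
  "x \<oplus>\<^bsub>restrict_scalars \<sigma> M\<^esub> y = x \<oplus>\<^bsub>M\<^esub> y"
  "c \<odot>\<^bsub>restrict_scalars \<sigma> M\<^esub> x = \<sigma> c \<odot>\<^bsub>M\<^esub> x"
  by (simp_all add: restrict_scalars_def)

lemma finsum_restrict_scalars [simp]: "finsum (restrict_scalars \<sigma> M) = finsum M"
  by (intro ext) (simp add: finsum_def finprod_def restrict_scalars_def)

lemma additive_restrict_scalars [simp]:
  "additive_map (restrict_scalars \<sigma> M) N f \<longleftrightarrow> additive_map M N f"
  "additive_map N (restrict_scalars \<sigma> M) g \<longleftrightarrow> additive_map N M g"
  by (simp_all add: additive_map_def)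

lemma abelian_group_restrict_scalars:
  assumes "abelian_group M" shows "abelian_group (restrict_scalars \<sigma> M)"
proof -
  interpret abelian_group M by fact
  show ?thesis
    by (rule abelian_groupI) (auto simp: a_ac intro!: bexI[of _ "\<ominus>\<^bsub>M\<^esub> _"] l_neg)
qed

lemma module_restrict_scalars:
  assumes M: "module R M" and k: "cring k" and s: "\<sigma> \<in> ring_hom k R"
  shows "module k (restrict_scalars \<sigma> M)"
proof -
  interpret M: module R M by fact
  have c: "\<sigma> a \<in> carrier R" if "a \<in> carrier k" for a using ring_hom_closed[OF s that] .
  show ?thesis
    unfolding module_def module_axioms_def
    using k abelian_group_restrict_scalars[OF M.M.abelian_group_axioms] c
    by (auto simp: ring_hom_add[OF s] ring_hom_mult[OF s] ring_hom_one[OF s] M.smult_l_distr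
        M.smult_r_distr M.smult_assoc1)
qed

lemma group_rep_restrict_scalars:
  assumes M: "module R M" and k: "field k" and s: "\<sigma> \<in> ring_hom k R" and G: "Group.group G"
    and hom: "\<And>g. g \<in> carrier G \<Longrightarrow> \<alpha> g \<in> module_hom R M M"
    and one: "\<And>m. m \<in> carrier M \<Longrightarrow> \<alpha> \<one>\<^bsub>G\<^esub> m = m"
    and mult: "\<And>g h m. g \<in> carrier G \<Longrightarrow> h \<in> carrier G \<Longrightarrow> m \<in> carrier M \<Longrightarrow> \<alpha> (g \<otimes>\<^bsub>G\<^esub> h) m = \<alpha> g (\<alpha> h m)"
  shows "group_rep k G (restrict_scalars \<sigma> M) \<alpha>"
proof -
  have "cring k" using k by (simp add: field_def domain_def)
  then have "vectorspace k (restrict_scalars \<sigma> M)"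
    using module_restrict_scalars[OF M _ s] k by (simp add: vectorspace_def)
  moreover have "\<alpha> g \<in> module_hom k (restrict_scalars \<sigma> M) (restrict_scalars \<sigma> M)" if "g \<in> carrier G" for g
    using hom[OF that] ring_hom_closed[OF s] by (auto simp: module_hom_def)
  ultimately show ?thesis using G one mult by (simp add: group_rep_def group_rep_axioms_def)
qed

section \<open>Irreducible subrepresentations and the isotypic decomposition\<close>

context vectorspace
begin

lemma fin_dimI: "finite B \<Longrightarrow> B \<subseteq> carrier V \<Longrightarrow> carrier V \<subseteq> span B \<Longrightarrow> fin_dim"
  unfolding fin_dim_def using span_is_subset2[of B] by (intro exI[of _ B]) auto

text \<open>The dimension of a subspace, measured by independent sets of the ambient space, so that
  nested subspaces are compared without passing to their own structures.\<close>

definition rank_of :: "'c set \<Rightarrow> nat"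
  where "rank_of H = Max {card B | B. B \<subseteq> H \<and> lin_indpt B}"

text \<open>Independent sets have at most \<open>dim\<close> elements, so the maximum is attained.
  An independent subset of H of maximal size spans H, since a vector outside its span could be
  added.\<close>

lemma
  assumes fd: "fin_dim" and H: "VectorSpace.subspace K H V"
  shows rank_of_le: "B \<subseteq> H \<Longrightarrow> lin_indpt B \<Longrightarrow> card B \<le> rank_of H"
    and rank_of_basis: "\<exists>B. B \<subseteq> H \<and> lin_indpt B \<and> card B = rank_of H"
    and subspace_span: "B \<subseteq> H \<Longrightarrow> lin_indpt B \<Longrightarrow> card B = rank_of H \<Longrightarrow> span B = H"
proof -
  have HV: "H \<subseteq> carrier V" using H by (simp add: subspace_def submodule_def)
  let ?C = "{card B | B. B \<subseteq> H \<and> lin_indpt B}"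
  have "?C \<subseteq> {..dim}" using li_le_dim(2)[OF fd] HV by (auto intro: subset_trans)
  then have fin: "finite ?C" by (rule finite_subset) simp
  have "lin_indpt {}" by (simp add: lin_dep_def)
  then have ne: "?C \<noteq> {}" by blast
  show le: "card B \<le> rank_of H" if "B \<subseteq> H" "lin_indpt B" for B
  proof -
    have "card B \<in> ?C" using that by blast
    then show ?thesis unfolding rank_of_def by (rule Max_ge[OF fin])
  qed
  have "rank_of H \<in> ?C" unfolding rank_of_def using fin ne by (rule Max_in)
  then show "\<exists>B. B \<subseteq> H \<and> lin_indpt B \<and> card B = rank_of H" by auto
  assume B: "B \<subseteq> H" "lin_indpt B" "card B = rank_of H"
  have BV: "B \<subseteq> carrier V" using B HV by blast
  have finB: "finite B" using li_le_dim(1)[OF fd BV B(2)] .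
  have sp: "span B \<subseteq> H" using H B by (intro span_is_subset) (auto simp: subspace_def)
  have "x \<in> span B" if x: "x \<in> H" for x
  proof (rule ccontr)
    assume no: "x \<notin> span B"
    then have xB: "x \<notin> B" using span_mem[OF BV] by blast
    have "lin_indpt (B \<union> {x})" using lin_dep_iff_in_span[OF BV B(2) subsetD[OF HV x] xB] no by simp
    then have "card (B \<union> {x}) \<le> rank_of H" using B x by (intro le) auto
    then show False using finB xB B(3) by simp
  qed
  then show "span B = H" using sp by blast
qed

lemma subspace_fin_dim:
  assumes "fin_dim" and H: "VectorSpace.subspace K H V"
  shows "vectorspace.fin_dim K (vs H)"
proof -
  obtain B where B: "B \<subseteq> H" "lin_indpt B" "card B = rank_of H" using rank_of_basis[OF assms] by blast
  interpret H: vectorspace K "vs H" by (rule subspace_is_vs[OF H])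
  have HV: "H \<subseteq> carrier V" and sm: "submodule K H V" using H by (simp_all add: subspace_def submodule_def)
  have "H.span B = span B" by (rule span_li_not_depend(1)[OF B(1) sm])
  then show ?thesis
    using subspace_span[OF assms B] B li_le_dim(1)[OF assms(1) _ B(2)] HV by (intro H.fin_dimI[of B]) auto
qed

end

text \<open>Take a nonzero invariant subspace H of least rank. A nonzero invariant subspace H' of H
  has the same rank, so a largest independent subset of H' already spans H.\<close>

lemma (in group_rep) irreducible_subrep_exists:
  assumes fd: fin_dim and nz: "carrier V \<noteq> {\<zero>\<^bsub>V\<^esub>}"
  obtains H where "VectorSpace.subspace k H V" "irreducible_group_rep k G (V\<lparr>carrier := H\<rparr>) \<rho>"
proof -
  define D where "D = {H. VectorSpace.subspace k H V \<and> H \<noteq> {\<zero>\<^bsub>V\<^esub>} \<and> (\<forall>g\<in>carrier G. \<rho> g ` H \<subseteq> H)}"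
  have rc: "\<rho> g v \<in> carrier V" if "g \<in> carrier G" "v \<in> carrier V" for g v
    using module_hom_apply[OF rep_hom] that .
  have "submodule k (carrier V) V" by (intro submodule.intro module_axioms) auto
  then have "carrier V \<in> D" using nz rc vectorspace_axioms by (auto simp: D_def subspace_def)
  then obtain H where HD: "H \<in> D" and min: "\<And>H'. H' \<in> D \<Longrightarrow> rank_of H \<le> rank_of H'"
    using ex_has_least_nat[of "\<lambda>H. H \<in> D" "carrier V" rank_of] by blast
  then have H: "VectorSpace.subspace k H V" "H \<noteq> {\<zero>\<^bsub>V\<^esub>}" "\<And>g v. g \<in> carrier G \<Longrightarrow> v \<in> H \<Longrightarrow> \<rho> g v \<in> H"
    by (auto simp: D_def)
  have HV: "H \<subseteq> carrier V" using H(1) by (simp add: subspace_def submodule_def)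
  let ?H = "V\<lparr>carrier := H\<rparr>"
  interpret H: vectorspace k ?H by (rule subspace_is_vs[OF H(1)])
  have "irreducible_group_rep k G ?H \<rho>"
  proof
    fix g assume g: "g \<in> carrier G"
    show "\<rho> g \<in> module_hom k ?H ?H"
      using rep_hom[OF g] H(3)[OF g] HV unfolding module_hom_def by (auto simp: subset_iff)
  next
    fix v assume "v \<in> carrier ?H"
    then show "\<rho> \<one>\<^bsub>G\<^esub> v = v" using HV by (intro rep_one) auto
  next
    fix g h v assume "g \<in> carrier G" "h \<in> carrier G" "v \<in> carrier ?H"
    then show "\<rho> (g \<otimes>\<^bsub>G\<^esub> h) v = \<rho> g (\<rho> h v)" using HV by (intro rep_mult) auto
  next
    show "carrier ?H \<noteq> {\<zero>\<^bsub>?H\<^esub>}" using H(2) by simp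
    fix H' assume H': "VectorSpace.subspace k H' ?H" "\<forall>g\<in>carrier G. \<rho> g ` H' \<subseteq> H'"
    have sub: "H' \<subseteq> H" using H'(1) by (simp add: subspace_def submodule_def)
    show "H' = {\<zero>\<^bsub>?H\<^esub>} \<or> H' = carrier ?H"
    proof (cases "H' = {\<zero>\<^bsub>V\<^esub>}")
      case False
      have HS: "VectorSpace.subspace k H' V"
        using H'(1) sub HV module_axioms vectorspace_axioms by (auto simp: subspace_def submodule_def)
      then have "rank_of H \<le> rank_of H'" using False H'(2) by (intro min) (simp add: D_def)
      moreover obtain B where B: "B \<subseteq> H'" "lin_indpt B" "card B = rank_of H'" using rank_of_basis[OF fd HS] by blast
      moreover have "card B \<le> rank_of H" using B sub by (intro rank_of_le[OF fd H(1)]) auto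
      ultimately have "span B = H" using sub by (intro subspace_span[OF fd H(1)]) auto
      then show ?thesis using subspace_span[OF fd HS B] by simp
    qed simp
  qed
  then show thesis using H(1) that by blast
qed

text \<open>By \<open>tot\<close> the space V is the sum of the images of the E_ii, and E_0i carries
  the image of E_ii isomorphically onto that of E_00. The m basis vectors of the latter, each moved
  by the E_i0, span the m copies of U.\<close>

lemma (in munits) isotypic_decomposition:
  assumes U: "irreducible_group_rep k G U \<tau>" and B: "coord_basis k U n b c"
    and A: "\<And>g i j. g \<in> carrier G \<Longrightarrow> i < n \<Longrightarrow> j < n \<Longrightarrow> A g i j = c i (\<tau> g (b j))"
    and tot: "\<And>v. v \<in> carrier V \<Longrightarrow> (\<Oplus>\<^bsub>V\<^esub>i\<in>{..<n}. E i i v) = v"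
    and F: "coord_basis k (V\<lparr>carrier := {v \<in> carrier V. E 0 0 v = v}\<rparr>) m u d"
  shows "rep_isomorphic k G V \<rho> (power_module U m) (power_action \<tau> m)"
proof -
  interpret U: irreducible_group_rep k G U \<tau> by fact
  interpret B: coord_basis k U n b c by fact
  interpret F: coord_basis k "V\<lparr>carrier := {v \<in> carrier V. E 0 0 v = v}\<rparr>" m u d by fact
  note n0 = n_pos
  have uV: "u j \<in> carrier V" "E 0 0 (u j) = u j" if "j < m" for j using F.b_closed[OF that] by auto
  have E0: "E 0 i v \<in> carrier V" "E 0 0 (E 0 i v) = E 0 i v" if "i < n" "v \<in> carrier V" for i v
    using that n0 munit_closed munit_munit[of 0 0 0 i v] by auto
  have dc: "d j (E 0 i v) \<in> carrier k" if "i < n" "j < m" "v \<in> carrier V" for i j v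
    using F.c_closed[of j "E 0 i v"] E0[OF that(1,3)] that(2) by simp
  \<comment> \<open>In the j-th copy, the coordinate of v along b_i is the j-th coordinate of E_0i v
    in the image of E_00.\<close>
  define h where "h v = (\<lambda>j\<in>{..<m}. \<Oplus>\<^bsub>U\<^esub>i\<in>{..<n}. d j (E 0 i v) \<odot>\<^bsub>U\<^esub> b i)" for v
  have hj: "h v j = (\<Oplus>\<^bsub>U\<^esub>i\<in>{..<n}. d j (E 0 i v) \<odot>\<^bsub>U\<^esub> b i)" if "j < m" for v j using that by (simp add: h_def)
  have hc: "h v \<in> carrier (power_module U m)" if "v \<in> carrier V" for v
    using that dc by (auto simp: power_module_def h_def intro!: B.lincomb_closed')
  have hcoef: "c i (h v j) = d j (E 0 i v)" if "i < n" "j < m" "v \<in> carrier V" for i j v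
    using that dc by (simp add: hj B.c_lincomb)
  have Uext: "x = y" if "x \<in> carrier U" "y \<in> carrier U" "\<And>i. i < n \<Longrightarrow> c i x = c i y" for x y
  proof -
    have "x = (\<Oplus>\<^bsub>U\<^esub>i\<in>{..<n}. c i x \<odot>\<^bsub>U\<^esub> b i)" by (rule B.expand[OF that(1)])
    also have "\<dots> = (\<Oplus>\<^bsub>U\<^esub>i\<in>{..<n}. c i y \<odot>\<^bsub>U\<^esub> b i)"
      using that B.c_closed B.b_closed by (intro U.M.finsum_cong') auto
    also have "\<dots> = y" by (rule B.expand[OF that(2), symmetric])
    finally show ?thesis .
  qed
  have hU: "h v j \<in> carrier U" if "v \<in> carrier V" "j < m" for v j using hc[OF that(1)] that(2) by (auto simp: power_module_def)
  have d_add: "d j (x \<oplus>\<^bsub>V\<^esub> y) = d j x \<oplus>\<^bsub>k\<^esub> d j y"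
    if "j < m" "x \<in> carrier V" "E 0 0 x = x" "y \<in> carrier V" "E 0 0 y = y" for j x y
    using F.c_add[of j x y] that by simp
  have d_smult: "d j (a \<odot>\<^bsub>V\<^esub> x) = a \<otimes>\<^bsub>k\<^esub> d j x"
    if "j < m" "a \<in> carrier k" "x \<in> carrier V" "E 0 0 x = x" for j a x
    using F.c_smult[of j a x] that by simp
  have hom: "h \<in> module_hom k V (power_module U m)"
  proof (rule module_homI)
    show "additive_map V (power_module U m) h"
      unfolding additive_map_def
    proof (intro conjI ballI funcsetI hc)
      fix x y assume xy: "x \<in> carrier V" "y \<in> carrier V"
      have "h (x \<oplus>\<^bsub>V\<^esub> y) j = h x j \<oplus>\<^bsub>U\<^esub> h y j" if j: "j < m" for j
      proof (rule Uext)
        fix i assume i: "i < n"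
        have "c i (h (x \<oplus>\<^bsub>V\<^esub> y) j) = d j (E 0 i x \<oplus>\<^bsub>V\<^esub> E 0 i y)"
          using i j xy n0 by (simp add: hcoef additive_add[OF munit_additive])
        also have "\<dots> = d j (E 0 i x) \<oplus>\<^bsub>k\<^esub> d j (E 0 i y)"
          using i j xy E0 by (intro d_add) auto
        finally show "c i (h (x \<oplus>\<^bsub>V\<^esub> y) j) = c i (h x j \<oplus>\<^bsub>U\<^esub> h y j)"
          using i j xy hU by (simp add: hcoef B.c_add)
      qed (use xy j hU in auto)
      then show "h (x \<oplus>\<^bsub>V\<^esub> y) = h x \<oplus>\<^bsub>power_module U m\<^esub> h y"
        by (auto simp: power_module_def fun_eq_iff h_def)
    qed
    fix a x assume ax: "a \<in> carrier k" "x \<in> carrier V"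
    have "h (a \<odot>\<^bsub>V\<^esub> x) j = a \<odot>\<^bsub>U\<^esub> h x j" if j: "j < m" for j
    proof (rule Uext)
      fix i assume i: "i < n"
      have "c i (h (a \<odot>\<^bsub>V\<^esub> x) j) = d j (a \<odot>\<^bsub>V\<^esub> E 0 i x)"
        using i j ax n0 by (simp add: hcoef munit_smult)
      also have "\<dots> = a \<otimes>\<^bsub>k\<^esub> d j (E 0 i x)" using i j ax E0 by (intro d_smult) auto
      finally show "c i (h (a \<odot>\<^bsub>V\<^esub> x) j) = c i (a \<odot>\<^bsub>U\<^esub> h x j)"
        using i j ax hU by (simp add: hcoef B.c_smult)
    qed (use ax j hU in auto)
    then show "h (a \<odot>\<^bsub>V\<^esub> x) = a \<odot>\<^bsub>power_module U m\<^esub> h x"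
      by (auto simp: power_module_def fun_eq_iff h_def)
  qed
  have act: "h (\<rho> g v) = power_action \<tau> m g (h v)" if g: "g \<in> carrier G" and v: "v \<in> carrier V" for g v
  proof -
    have tc: "\<tau> g x \<in> carrier U" if "x \<in> carrier U" for x
      using module_hom_apply[OF U.rep_hom[OF g] that] .
    have "h (\<rho> g v) j = \<tau> g (h v j)" if j: "j < m" for j
    proof (rule Uext)
      fix i assume i: "i < n"
      have dEl: "additive_map (V\<lparr>carrier := {v \<in> carrier V. E 0 0 v = v}\<rparr>) k (d j)" by (rule F.c_additive[OF j])
      have fin: "(\<Oplus>\<^bsub>V\<^esub>l\<in>{..<n}. A g i l \<odot>\<^bsub>V\<^esub> E 0 l v)
          = (\<Oplus>\<^bsub>V\<lparr>carrier := {v \<in> carrier V. E 0 0 v = v}\<rparr>\<^esub>l\<in>{..<n}. A g i l \<odot>\<^bsub>V\<^esub> E 0 l v)"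
      proof -
        have incl: "additive_map (V\<lparr>carrier := {v \<in> carrier V. E 0 0 v = v}\<rparr>) V (\<lambda>x. x)"
          by (simp add: additive_map_def)
        show ?thesis
          using i g v n0 A_closed E0 munit_smult
          by (intro additive_finsum[OF F.M.abelian_group_axioms M.abelian_group_axioms incl, symmetric]) auto
      qed
      have "c i (h (\<rho> g v) j) = d j (\<Oplus>\<^bsub>V\<^esub>l\<in>{..<n}. A g i l \<odot>\<^bsub>V\<^esub> E 0 l v)"
        using i j g v n0 rho_closed by (simp add: hcoef munit_act)
      also have "\<dots> = (\<Oplus>\<^bsub>k\<^esub>l\<in>{..<n}. d j (A g i l \<odot>\<^bsub>V\<^esub> E 0 l v))"
        unfolding fin using i g v n0 A_closed E0 munit_smult
        by (intro additive_finsum[OF F.M.abelian_group_axioms R.abelian_group_axioms dEl]) auto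
      also have "\<dots> = (\<Oplus>\<^bsub>k\<^esub>l\<in>{..<n}. c i (\<tau> g (d j (E 0 l v) \<odot>\<^bsub>U\<^esub> b l)))"
      proof (intro R.finsum_cong' refl)
        fix l assume l: "l \<in> {..<n}"
        have "c i (\<tau> g (d j (E 0 l v) \<odot>\<^bsub>U\<^esub> b l)) = d j (E 0 l v) \<otimes>\<^bsub>k\<^esub> A g i l"
          using l i j g v dc B.b_closed tc A by (simp add: module_hom_smult[OF U.rep_hom[OF g]] B.c_smult)
        then show "d j (A g i l \<odot>\<^bsub>V\<^esub> E 0 l v) = c i (\<tau> g (d j (E 0 l v) \<odot>\<^bsub>U\<^esub> b l))"
          using l i j g v A_closed E0 dc by (simp add: d_smult R.m_comm)
      qed (use i j g v dc B.b_closed B.c_closed tc in auto)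
      also have "\<dots> = c i (\<tau> g (\<Oplus>\<^bsub>U\<^esub>l\<in>{..<n}. d j (E 0 l v) \<odot>\<^bsub>U\<^esub> b l))"
        using i j g v dc B.b_closed
        by (intro additive_finsum[OF U.M.abelian_group_axioms R.abelian_group_axioms
              additive_compose[OF module_hom_additive[OF U.rep_hom[OF g]] B.c_additive], symmetric]) auto
      finally show "c i (h (\<rho> g v) j) = c i (\<tau> g (h v j))" by (simp add: hj[OF j])
    qed (use g v j hU rho_closed tc in auto)
    then show ?thesis by (auto simp: power_action_def fun_eq_iff h_def)
  qed
  have inj: "inj_on h (carrier V)"
  proof (rule inj_onI)
    fix x y assume xy: "x \<in> carrier V" "y \<in> carrier V" "h x = h y"
    have Fext: "x' = y'" if "x' \<in> carrier V" "E 0 0 x' = x'" "y' \<in> carrier V" "E 0 0 y' = y'" "\<And>j. j < m \<Longrightarrow> d j x' = d j y'" for x' y'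
    proof -
      have "x' = (\<Oplus>\<^bsub>V\<lparr>carrier := {v \<in> carrier V. E 0 0 v = v}\<rparr>\<^esub>j\<in>{..<m}. d j x' \<odot>\<^bsub>V\<^esub> u j)"
        using F.expand[of x'] that by simp
      also have "\<dots> = (\<Oplus>\<^bsub>V\<lparr>carrier := {v \<in> carrier V. E 0 0 v = v}\<rparr>\<^esub>j\<in>{..<m}. d j y' \<odot>\<^bsub>V\<^esub> u j)"
        using that F.smult_closed F.c_closed F.b_closed by (intro F.M.finsum_cong') auto
      also have "\<dots> = y'" using F.expand[of y'] that by simp
      finally show ?thesis .
    qed
    have eq: "E 0 i x = E 0 i y" if i: "i < n" for i
    proof (rule Fext)
      fix j assume "j < m"
      then show "d j (E 0 i x) = d j (E 0 i y)" using hcoef[OF i _ xy(1)] hcoef[OF i _ xy(2)] xy(3) by metis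
    qed (use E0 i xy in auto)
    \<comment> \<open>E_ii = E_i0 E_0i, so the components E_0i x determine every E_ii x and hence,
      by \<open>tot\<close>, x.\<close>
    have "E i i x = E i i y" if i: "i < n" for i
      using munit_munit[of i 0 0 i x] munit_munit[of i 0 0 i y] i n0 xy eq[OF i] by simp
    then have "(\<Oplus>\<^bsub>V\<^esub>i\<in>{..<n}. E i i x) = (\<Oplus>\<^bsub>V\<^esub>i\<in>{..<n}. E i i y)"
      using xy munit_closed by (intro M.finsum_cong') auto
    then show "x = y" using tot xy by simp
  qed
  have surj: "w \<in> h ` carrier V" if w: "w \<in> carrier (power_module U m)" for w
  proof
    have wU: "w j \<in> carrier U" if "j < m" for j using w that by (auto simp: power_module_def)
    \<comment> \<open>The preimage of w: the vector E_i0 u_j plays the role of b_i in the j-th copy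
      of U.\<close>
    define x where "x = (\<Oplus>\<^bsub>V\<^esub>j\<in>{..<m}. \<Oplus>\<^bsub>V\<^esub>i\<in>{..<n}. c i (w j) \<odot>\<^bsub>V\<^esub> E i 0 (u j))"
    have tc: "c i (w j) \<odot>\<^bsub>V\<^esub> E i 0 (u j) \<in> carrier V" if "i < n" "j < m" for i j
      using that n0 wU uV B.c_closed munit_closed by simp
    show x: "x \<in> carrier V" unfolding x_def using tc by (auto intro!: M.finsum_closed)
    have E0x: "E 0 l x = (\<Oplus>\<^bsub>V\<lparr>carrier := {v \<in> carrier V. E 0 0 v = v}\<rparr>\<^esub>j\<in>{..<m}. c l (w j) \<odot>\<^bsub>V\<^esub> u j)" if l: "l < n" for l
    proof -
      note ad = munit_additive[OF n0 l]
      have "E 0 l x = (\<Oplus>\<^bsub>V\<^esub>j\<in>{..<m}. E 0 l (\<Oplus>\<^bsub>V\<^esub>i\<in>{..<n}. c i (w j) \<odot>\<^bsub>V\<^esub> E i 0 (u j)))"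
        unfolding x_def using tc
        by (intro additive_finsum[OF M.abelian_group_axioms M.abelian_group_axioms ad]) (auto intro!: M.finsum_closed)
      also have "\<dots> = (\<Oplus>\<^bsub>V\<^esub>j\<in>{..<m}. c l (w j) \<odot>\<^bsub>V\<^esub> u j)"
      proof (intro M.finsum_cong' refl)
        fix j assume j: "j \<in> {..<m}"
        have "E 0 l (\<Oplus>\<^bsub>V\<^esub>i\<in>{..<n}. c i (w j) \<odot>\<^bsub>V\<^esub> E i 0 (u j)) = (\<Oplus>\<^bsub>V\<^esub>i\<in>{..<n}. E 0 l (c i (w j) \<odot>\<^bsub>V\<^esub> E i 0 (u j)))"
          using tc j by (intro additive_finsum[OF M.abelian_group_axioms M.abelian_group_axioms ad]) auto
        also have "\<dots> = (\<Oplus>\<^bsub>V\<^esub>i\<in>{..<n}. if i = l then c i (w j) \<odot>\<^bsub>V\<^esub> u j else \<zero>\<^bsub>V\<^esub>)"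
          using j l n0 wU uV B.c_closed munit_closed by (intro M.finsum_cong') (auto simp: munit_smult munit_munit)
        also have "\<dots> = c l (w j) \<odot>\<^bsub>V\<^esub> u j"
          using j l wU uV B.c_closed by (intro M.finsum_delta) auto
        finally show "E 0 l (\<Oplus>\<^bsub>V\<^esub>i\<in>{..<n}. c i (w j) \<odot>\<^bsub>V\<^esub> E i 0 (u j)) = c l (w j) \<odot>\<^bsub>V\<^esub> u j" .
      qed (use l wU uV B.c_closed in auto)
      also have "\<dots> = (\<Oplus>\<^bsub>V\<lparr>carrier := {v \<in> carrier V. E 0 0 v = v}\<rparr>\<^esub>j\<in>{..<m}. c l (w j) \<odot>\<^bsub>V\<^esub> u j)"
      proof -
        have incl: "additive_map (V\<lparr>carrier := {v \<in> carrier V. E 0 0 v = v}\<rparr>) V (\<lambda>x. x)"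
          by (simp add: additive_map_def)
        show ?thesis
          using l wU uV B.c_closed munit_smult n0
          by (intro additive_finsum[OF F.M.abelian_group_axioms M.abelian_group_axioms incl, symmetric]) auto
      qed
      finally show ?thesis .
    qed
    have "h x j = w j" if j: "j < m" for j
    proof (rule Uext)
      fix l assume l: "l < n"
      show "c l (h x j) = c l (w j)"
        using l j x wU B.c_closed F.c_lincomb[of j "\<lambda>j. c l (w j)"] by (simp add: hcoef E0x)
    qed (use x wU hU j in auto)
    then show "w = h x" using w by (auto simp: h_def fun_eq_iff power_module_def PiE_iff extensional_def)
  qed
  have "bij_betw h (carrier V) (carrier (power_module U m))"
    using inj surj hc by (auto simp: bij_betw_def)
  then show ?thesis using hom act unfolding rep_isomorphic_def by blast
qed

section \<open>The type of a module with group action\<close>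

lemma algebra_module_simps [simp]:
  "carrier (algebra_module R \<sigma>) = carrier R"
  "\<zero>\<^bsub>algebra_module R \<sigma>\<^esub> = \<zero>\<^bsub>R\<^esub>"
  "x \<oplus>\<^bsub>algebra_module R \<sigma>\<^esub> y = x \<oplus>\<^bsub>R\<^esub> y"
  "c \<odot>\<^bsub>algebra_module R \<sigma>\<^esub> x = \<sigma> c \<otimes>\<^bsub>R\<^esub> x"
  by (simp_all add: algebra_module_def)

lemma module_algebra_module:
  assumes R: "cring R" and k: "cring k" and s: "\<sigma> \<in> ring_hom k R"
  shows "module k (algebra_module R \<sigma>)"
proof -
  interpret R: cring R by fact
  have c: "\<sigma> a \<in> carrier R" if "a \<in> carrier k" for a using ring_hom_closed[OF s that] .
  have "abelian_group (algebra_module R \<sigma>)"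
    by (rule abelian_groupI) (auto simp: R.a_ac intro!: bexI[of _ "\<ominus>\<^bsub>R\<^esub> _"] R.l_neg)
  then show ?thesis
    unfolding module_def module_axioms_def
    using k c
    by (auto simp: ring_hom_add[OF s] ring_hom_mult[OF s] ring_hom_one[OF s] R.l_distr R.r_distr R.m_assoc)
qed

lemma additive_algebra_module [simp]:
  "additive_map (algebra_module R \<sigma>) N f \<longleftrightarrow> additive_map R N f"
  "additive_map N (algebra_module R \<sigma>) g \<longleftrightarrow> additive_map N R g"
  by (simp_all add: additive_map_def)

text \<open>Scalar multiplication on a base change is the \<open>tensor_map\<close> of
  multiplication by a and the identity. Multiplication by a commutes with the scalars of k, which is
  the required balancedness.\<close>

lemma tensor_base_change_smult:
  assumes R: "cring R" and s: "\<sigma> \<in> ring_hom k R" and N: "module k N" and a: "a \<in> carrier R"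
  defines "T \<equiv> tensor_module k (algebra_module R \<sigma>) N (\<lambda>a b. a \<otimes>\<^bsub>R\<^esub> b)"
  shows "additive_map T T (\<lambda>t. a \<odot>\<^bsub>T\<^esub> t)"
    and "\<lbrakk>b \<in> carrier R; n \<in> carrier N\<rbrakk>
      \<Longrightarrow> a \<odot>\<^bsub>T\<^esub> pure_tensor k (algebra_module R \<sigma>) N b n = pure_tensor k (algebra_module R \<sigma>) N (a \<otimes>\<^bsub>R\<^esub> b) n"
proof -
  interpret R: cring R by fact
  have k: "cring k" using N by (simp add: module_def)
  have t: "tensor_product k (algebra_module R \<sigma>) N"
    using module_algebra_module[OF R k s] N by (simp add: tensor_product_def)
  interpret tensor_product k "algebra_module R \<sigma>" N by (rule t)
  have f: "additive_map (algebra_module R \<sigma>) (algebra_module R \<sigma>) (\<lambda>b. a \<otimes>\<^bsub>R\<^esub> b)"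
    using a by (simp add: additive_map_def R.r_distr)
  have g: "additive_map N N id" by (simp add: additive_map_def)
  have bal: "pure (a \<otimes>\<^bsub>R\<^esub> (c \<odot>\<^bsub>algebra_module R \<sigma>\<^esub> m)) (id n) = pure (a \<otimes>\<^bsub>R\<^esub> m) (id (c \<odot>\<^bsub>N\<^esub> n))"
    if "c \<in> carrier k" "m \<in> carrier (algebra_module R \<sigma>)" "n \<in> carrier N" for c m n
    using that a ring_hom_closed[OF s] pure_smult[of c "a \<otimes>\<^bsub>R\<^esub> m" n] by (simp add: R.m_lcomm)
  have sm: "(\<lambda>t. a \<odot>\<^bsub>T\<^esub> t) = tensor_map k (algebra_module R \<sigma>) N (\<lambda>b. a \<otimes>\<^bsub>R\<^esub> b) id"
    by (simp add: T_def tensor_module_def)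
  show "additive_map T T (\<lambda>t. a \<odot>\<^bsub>T\<^esub> t)"
    unfolding sm unfolding T_def by (rule tensor_map_additive[OF t t f g bal])
  show "a \<odot>\<^bsub>T\<^esub> pure b n = pure (a \<otimes>\<^bsub>R\<^esub> b) n"
    if "b \<in> carrier R" "n \<in> carrier N"
  proof -
    have "tensor_map k (algebra_module R \<sigma>) N (\<lambda>b. a \<otimes>\<^bsub>R\<^esub> b) id (pure b n) = pure (a \<otimes>\<^bsub>R\<^esub> b) (id n)"
      using that by (intro tensor_map_pure[OF t t f g bal]) auto
    then show ?thesis using fun_cong[OF sm, of "pure b n"] by (simp only: id_apply)
  qed
qed

locale equivariant_setting =
  fixes k :: "'k ring" and G :: "'g monoid" and S :: "('x, 'r) rspace"
    and p :: "'x \<Rightarrow> 'k set"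
    and \<phi> :: "'k set set \<Rightarrow> ('k set \<Rightarrow> ('k \<times> 'k) set) \<Rightarrow> 'r"
    and \<epsilon> :: 'x
    and E :: "('x, 'r, 'm, 'g) gmsheaf"
  assumes field_k: "field k" and group_G: "Group.group G"
    and over_k: "scheme_over k S p \<phi>" and integral: "integral_scheme S"
    and generic: "generic_point S \<epsilon>"
    and gmodule_E: "sheaf_of_gmodules G S E"
begin

sublocale E: sheaf_of_gmodules G S E by (rule gmodule_E)

abbreviation K where "K \<equiv> ring_stalk S \<epsilon>"
abbreviation E\<epsilon> where "E\<epsilon> \<equiv> mod_stalk S E \<epsilon>"
abbreviation sc where "sc \<equiv> scalar_section k S \<phi>"
abbreviation scK where "scK \<equiv> (\<lambda>c. ring_germ S \<epsilon> (topspace (pts S)) (sc (topspace (pts S)) c))"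
abbreviation kE where "kE U \<equiv> restrict_scalars (sc U) (sec E U)"
abbreviation kE\<epsilon> where "kE\<epsilon> \<equiv> restrict_scalars scK E\<epsilon>"

lemma cring_k: "cring k"
  using field_k by (simp add: field_def domain_def)

lemma eps: "\<epsilon> \<in> topspace (pts S)"
  using generic by (simp add: generic_point_def)

lemma field_K: "field K"
  by (rule generic_stalk_field[OF integral generic])

lemma cring_K: "cring K"
  using field_K by (simp add: field_def domain_def)

lemma module_stalk: "module K E\<epsilon>"
  by (rule E.mod_stalk_module[OF cring_K eps])

lemma sc_hom: "openin (pts S) U \<Longrightarrow> sc U \<in> ring_hom k (sec_ring S U)"
  by (rule scalar_section_hom[OF cring_k over_k])

lemma sc_closed: "openin (pts S) U \<Longrightarrow> c \<in> carrier k \<Longrightarrow> sc U c \<in> carrier (sec_ring S U)"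
  using ring_hom_closed[OF sc_hom] .

lemma sc_res: "openin (pts S) U \<Longrightarrow> openin (pts S) V \<Longrightarrow> V \<subseteq> U \<Longrightarrow> c \<in> carrier k \<Longrightarrow> ring_res S U V (sc U c) = sc V c"
  by (rule scalar_section_res[OF cring_k over_k])

lemma scK_germ: "openin (pts S) U \<Longrightarrow> \<epsilon> \<in> U \<Longrightarrow> c \<in> carrier k \<Longrightarrow> scK c = ring_germ S \<epsilon> U (sc U c)"
  using E.O.germ_res[of "topspace (pts S)" \<epsilon> "sc (topspace (pts S)) c" U]
    sc_closed[OF E.open_topspace, of c] sc_res[OF E.open_topspace, of U c] openin_subset[of "pts S" U] eps by simp

lemma scK_hom: "scK \<in> ring_hom k K"
proof (rule ring_hom_memI)
  note X = E.open_topspace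
  fix c d assume c: "c \<in> carrier k"
  show "scK c \<in> carrier K" by (rule E.stalk_carrier[OF X eps sc_closed[OF X c]])
  assume d: "d \<in> carrier k"
  show "scK (c \<otimes>\<^bsub>k\<^esub> d) = scK c \<otimes>\<^bsub>K\<^esub> scK d"
    using E.stalk_mult[OF X eps sc_closed[OF X c] sc_closed[OF X d]] ring_hom_mult[OF sc_hom[OF X] c d] by simp
  show "scK (c \<oplus>\<^bsub>k\<^esub> d) = scK c \<oplus>\<^bsub>K\<^esub> scK d"
    using E.stalk_add[OF X eps sc_closed[OF X c] sc_closed[OF X d]] ring_hom_add[OF sc_hom[OF X] c d] by simp
next
  show "scK \<one>\<^bsub>k\<^esub> = \<one>\<^bsub>K\<^esub>"
    using E.stalk_one[OF E.open_topspace eps] ring_hom_one[OF sc_hom[OF E.open_topspace]] by simp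
qed

lemma act_closed: "g \<in> carrier G \<Longrightarrow> openin (pts S) U \<Longrightarrow> m \<in> carrier (sec E U) \<Longrightarrow> act E g U m \<in> carrier (sec E U)"
  using module_hom_apply[OF E.act_hom] .

lemma stalk_act: "g \<in> carrier G \<Longrightarrow> openin (pts S) U \<Longrightarrow> x \<in> U \<Longrightarrow> m \<in> carrier (sec E U)
    \<Longrightarrow> stalk_act S E x g (mod_germ S E x U m) = mod_germ S E x U (act E g U m)"
  using stalk_act_germ[OF E.sheaf_of_modules_axioms, of g U x m] act_closed E.act_res by blast

lemma rep_sections: "openin (pts S) U \<Longrightarrow> group_rep k G (kE U) (\<lambda>g. act E g U)"
  by (intro group_rep_restrict_scalars[OF E.sec_module field_k sc_hom group_G])
    (auto simp: E.act_hom E.act_one E.act_mult)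

lemma stalk_act_hom:
  assumes g: "g \<in> carrier G"
  shows "stalk_act S E \<epsilon> g \<in> module_hom K E\<epsilon> E\<epsilon>"
proof -
  have c: "stalk_act S E \<epsilon> g A \<in> carrier E\<epsilon>" if "A \<in> carrier E\<epsilon>" for A
    using that by (rule E.mod_stalk_cases) (auto simp: stalk_act[OF g] intro!: E.mod_stalk_carrier act_closed[OF g])
  show ?thesis
  proof (rule module_homI)
    show "additive_map E\<epsilon> E\<epsilon> (stalk_act S E \<epsilon> g)"
      unfolding additive_map_def
    proof (intro conjI ballI funcsetI c)
      fix A B assume "A \<in> carrier E\<epsilon>" "B \<in> carrier E\<epsilon>"
      then have "A \<in> germs (pts S) (\<lambda>U. carrier (sec E U)) (mres E) \<epsilon>" "B \<in> germs (pts S) (\<lambda>U. carrier (sec E U)) (mres E) \<epsilon>"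
        by (simp_all add: mod_stalk_def)
      then obtain U m n where U: "openin (pts S) U \<and> \<epsilon> \<in> U \<and> m \<in> carrier (sec E U)" "n \<in> carrier (sec E U)"
        "A = mod_germ S E \<epsilon> U m" "B = mod_germ S E \<epsilon> U n"
        by (rule E.M.germs_cases2)
      interpret N: abelian_group "sec E U" by (rule E.sec_abelian) (use U(1) in blast)
      show "stalk_act S E \<epsilon> g (A \<oplus>\<^bsub>E\<epsilon>\<^esub> B) = stalk_act S E \<epsilon> g A \<oplus>\<^bsub>E\<epsilon>\<^esub> stalk_act S E \<epsilon> g B"
        using U by (simp add: E.mod_stalk_add stalk_act[OF g] act_closed[OF g] module_hom_add[OF E.act_hom[OF g]])
    qed
    fix r A assume r: "r \<in> carrier K" and A: "A \<in> carrier E\<epsilon>"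
    obtain U a where U: "openin (pts S) U" "\<epsilon> \<in> U" "a \<in> carrier (sec_ring S U)" "r = ring_germ S \<epsilon> U a"
      using r by (rule E.stalk_cases)
    obtain V m where V: "openin (pts S) V" "\<epsilon> \<in> V" "m \<in> carrier (sec E V)" "A = mod_germ S E \<epsilon> V m"
      using A by (rule E.mod_stalk_cases)
    let ?W = "U \<inter> V"
    have W: "openin (pts S) ?W" "\<epsilon> \<in> ?W" using U V by auto
    have a: "ring_res S U ?W a \<in> carrier (sec_ring S ?W)" "r = ring_germ S \<epsilon> ?W (ring_res S U ?W a)"
      using E.ring_res_closed[of U ?W a] E.O.germ_res[of U \<epsilon> a ?W] U W by auto
    have m: "mres E V ?W m \<in> carrier (sec E ?W)" "A = mod_germ S E \<epsilon> ?W (mres E V ?W m)"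
      using E.M.res_closed[of V ?W m] E.M.germ_res[of V \<epsilon> m ?W] V W by auto
    show "stalk_act S E \<epsilon> g (r \<odot>\<^bsub>E\<epsilon>\<^esub> A) = r \<odot>\<^bsub>E\<epsilon>\<^esub> stalk_act S E \<epsilon> g A"
      unfolding a(2) m(2) using a(1) m(1) W module.smult_closed[OF E.sec_module[OF W(1)] a(1) m(1)]
      by (simp add: E.mod_stalk_smult stalk_act[OF g] act_closed[OF g] module_hom_smult[OF E.act_hom[OF g]])
  qed
qed

lemma rep_stalk: "group_rep k G kE\<epsilon> (stalk_act S E \<epsilon>)"
proof (rule group_rep_restrict_scalars[OF module_stalk field_k scK_hom group_G stalk_act_hom])
  fix A assume "A \<in> carrier E\<epsilon>"
  then show "stalk_act S E \<epsilon> \<one>\<^bsub>G\<^esub> A = A"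
    by (rule E.mod_stalk_cases) (auto simp: stalk_act E.act_one)
next
  fix g h A assume gh: "g \<in> carrier G" "h \<in> carrier G" and "A \<in> carrier E\<epsilon>"
  from this(3) show "stalk_act S E \<epsilon> (g \<otimes>\<^bsub>G\<^esub> h) A = stalk_act S E \<epsilon> g (stalk_act S E \<epsilon> h A)"
    by (rule E.mod_stalk_cases) (use gh in \<open>auto simp: stalk_act E.act_mult act_closed\<close>)
qed

end

text \<open>
  The embedding \<open>\<iota>\<close> of a representation \<open>W\<close> into the generic stalk of a module of type \<open>W\<close>.
  The last two assumptions say that the induced map from the base change of \<open>W\<close> is surjective and
  injective.
\<close>

locale type_embedding = equivariant_setting k G S p \<phi> \<epsilon> E + W: group_rep k G W \<sigma>
  for k :: "'k ring" and G :: "'g monoid" and S :: "('x, 'r) rspace" and p \<phi> and \<epsilon> :: 'x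
    and E :: "('x, 'r, 'm, 'g) gmsheaf" and W :: "('k, 'w) module" and \<sigma> +
  fixes \<iota> :: "'w \<Rightarrow> ('x set \<times> 'm) set"
  assumes iota_additive: "additive_map W E\<epsilon> \<iota>"
    and iota_smult: "c \<in> carrier k \<Longrightarrow> w \<in> carrier W \<Longrightarrow> \<iota> (c \<odot>\<^bsub>W\<^esub> w) = scK c \<odot>\<^bsub>E\<epsilon>\<^esub> \<iota> w"
    and iota_act: "g \<in> carrier G \<Longrightarrow> w \<in> carrier W \<Longrightarrow> \<iota> (\<sigma> g w) = stalk_act S E \<epsilon> g (\<iota> w)"
    and iota_induct: "x \<in> carrier E\<epsilon> \<Longrightarrow> Q \<zero>\<^bsub>E\<epsilon>\<^esub> \<Longrightarrow>
      (\<And>a w. a \<in> carrier K \<Longrightarrow> w \<in> carrier W \<Longrightarrow> Q (a \<odot>\<^bsub>E\<epsilon>\<^esub> \<iota> w)) \<Longrightarrow>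
      (\<And>x y. x \<in> carrier E\<epsilon> \<Longrightarrow> y \<in> carrier E\<epsilon> \<Longrightarrow> Q x \<Longrightarrow> Q y \<Longrightarrow> Q (x \<oplus>\<^bsub>E\<epsilon>\<^esub> y)) \<Longrightarrow> Q x"
    and iota_functional: "additive_map W k l \<Longrightarrow>
      (\<And>c w. c \<in> carrier k \<Longrightarrow> w \<in> carrier W \<Longrightarrow> l (c \<odot>\<^bsub>W\<^esub> w) = c \<otimes>\<^bsub>k\<^esub> l w) \<Longrightarrow>
      \<exists>L. additive_map E\<epsilon> K L \<and> (\<forall>a\<in>carrier K. \<forall>x\<in>carrier E\<epsilon>. L (a \<odot>\<^bsub>E\<epsilon>\<^esub> x) = a \<otimes>\<^bsub>K\<^esub> L x)
        \<and> (\<forall>w\<in>carrier W. L (\<iota> w) = scK (l w))"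

text \<open>With h the isomorphism from the generic stalk to K \<otimes> W, the embedding sends w to
  the preimage of 1 \<otimes> w. A functional l on W extends by composing h with the map a \<otimes>
  w -> a l(w), and \<open>iota_induct\<close> is \<open>tensor_induct\<close> carried back along
  h.\<close>

lemma (in equivariant_setting) type_embedding_exists:
  assumes W: "group_rep k G W \<sigma>" and type: "has_type k G S \<phi> \<epsilon> E W \<sigma>"
  obtains \<iota> where "type_embedding k G S p \<phi> \<epsilon> E W \<sigma> \<iota>"
proof -
  interpret W: group_rep k G W \<sigma> by fact
  interpret K: cring K by (rule cring_K)
  interpret St: module K E\<epsilon> by (rule module_stalk)
  define Kk where "Kk = algebra_module K scK"
  define T where "T = tensor_module k Kk W (\<lambda>a b. a \<otimes>\<^bsub>K\<^esub> b)"
  have t: "tensor_product k Kk W"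
    using module_algebra_module[OF cring_K cring_k scK_hom] W.module_axioms by (simp add: tensor_product_def Kk_def)
  interpret t: tensor_product k Kk W by (rule t)
  interpret T: abelian_group T unfolding T_def by (rule t.abelian_group_T)
  have "\<exists>h\<in>module_hom K E\<epsilon> T. bij_betw h (carrier E\<epsilon>) (carrier T)
      \<and> (\<forall>g\<in>carrier G. \<forall>m\<in>carrier E\<epsilon>. h (stalk_act S E \<epsilon> g m) = tensor_map k Kk W id (\<sigma> g) (h m))"
    using type by (simp only: has_type_def Let_def T_def Kk_def)
  then obtain h where h: "h \<in> module_hom K E\<epsilon> T" "bij_betw h (carrier E\<epsilon>) (carrier T)"
    and hact': "\<forall>g\<in>carrier G. \<forall>m\<in>carrier E\<epsilon>. h (stalk_act S E \<epsilon> g m) = tensor_map k Kk W id (\<sigma> g) (h m)"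
    by (elim bexE conjE)
  note hact = hact'[rule_format]
  have hc: "h x \<in> carrier T" if "x \<in> carrier E\<epsilon>" for x using module_hom_apply[OF h(1) that] .
  have hinj: "x = y" if "x \<in> carrier E\<epsilon>" "y \<in> carrier E\<epsilon>" "h x = h y" for x y
    using h(2) that by (auto simp: bij_betw_def dest: inj_onD)
  define h' where "h' = the_inv_into (carrier E\<epsilon>) h"
  have h': "h' y \<in> carrier E\<epsilon>" "h (h' y) = y" if "y \<in> carrier T" for y
  proof -
    have inj: "inj_on h (carrier E\<epsilon>)" and y: "y \<in> h ` carrier E\<epsilon>" using h(2) that by (auto simp: bij_betw_def)
    show "h' y \<in> carrier E\<epsilon>" unfolding h'_def by (rule the_inv_into_into[OF inj y order_refl])
    show "h (h' y) = y" unfolding h'_def by (rule f_the_inv_into_f[OF inj y])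
  qed
  have smT: "additive_map T T (\<lambda>t. a \<odot>\<^bsub>T\<^esub> t)" if "a \<in> carrier K" for a
    using tensor_base_change_smult(1)[OF cring_K scK_hom W.module_axioms that] by (simp add: T_def Kk_def)
  have smp: "a \<odot>\<^bsub>T\<^esub> t.pure b w = t.pure (a \<otimes>\<^bsub>K\<^esub> b) w" if "a \<in> carrier K" "b \<in> carrier K" "w \<in> carrier W" for a b w
    using tensor_base_change_smult(2)[OF cring_K scK_hom W.module_axioms that] by (simp add: T_def Kk_def)
  have KkK: "carrier Kk = carrier K" by (simp add: Kk_def)
  have pc: "t.pure a w \<in> carrier T" if "a \<in> carrier K" "w \<in> carrier W" for a w
    unfolding T_def using that by (intro t.pure_closed) (simp_all add: KkK)
  define \<iota> where "\<iota> w = h' (t.pure \<one>\<^bsub>K\<^esub> w)" for w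
  have \<iota>: "\<iota> w \<in> carrier E\<epsilon>" "h (\<iota> w) = t.pure \<one>\<^bsub>K\<^esub> w" if "w \<in> carrier W" for w
    using h'[OF pc[OF K.one_closed that]] by (simp_all add: \<iota>_def)
  have scKc: "scK c \<in> carrier K" if "c \<in> carrier k" for c using ring_hom_closed[OF scK_hom that] .
  show thesis
  proof (rule that[of \<iota>], intro type_embedding.intro type_embedding_axioms.intro equivariant_setting_axioms W)
    show "additive_map W E\<epsilon> \<iota>"
      unfolding additive_map_def
    proof (intro conjI ballI funcsetI \<iota>)
      fix x y assume xy: "x \<in> carrier W" "y \<in> carrier W"
      show "\<iota> (x \<oplus>\<^bsub>W\<^esub> y) = \<iota> x \<oplus>\<^bsub>E\<epsilon>\<^esub> \<iota> y"
      proof (rule hinj)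
        show "h (\<iota> (x \<oplus>\<^bsub>W\<^esub> y)) = h (\<iota> x \<oplus>\<^bsub>E\<epsilon>\<^esub> \<iota> y)"
          using xy \<iota> module_hom_add[OF h(1) \<iota>(1)[OF xy(1)] \<iota>(1)[OF xy(2)]]
            t.pure_add_right[of "\<one>\<^bsub>K\<^esub>" x y "\<lambda>a b. a \<otimes>\<^bsub>K\<^esub> b"] by (simp add: T_def KkK)
      qed (use xy \<iota> in auto)
    qed
  next
    fix c w assume cw: "c \<in> carrier k" "w \<in> carrier W"
    show "\<iota> (c \<odot>\<^bsub>W\<^esub> w) = scK c \<odot>\<^bsub>E\<epsilon>\<^esub> \<iota> w"
    proof (rule hinj)
      have "h (\<iota> (c \<odot>\<^bsub>W\<^esub> w)) = t.pure (scK c \<otimes>\<^bsub>K\<^esub> \<one>\<^bsub>K\<^esub>) w"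
        using cw \<iota> t.pure_smult[of c "\<one>\<^bsub>K\<^esub>" w] by (simp add: Kk_def)
      also have "\<dots> = h (scK c \<odot>\<^bsub>E\<epsilon>\<^esub> \<iota> w)"
        using cw \<iota> scKc module_hom_smult[OF h(1) scKc[OF cw(1)] \<iota>(1)[OF cw(2)]] smp[OF scKc[OF cw(1)] K.one_closed cw(2)] by simp
      finally show "h (\<iota> (c \<odot>\<^bsub>W\<^esub> w)) = h (scK c \<odot>\<^bsub>E\<epsilon>\<^esub> \<iota> w)" .
    qed (use cw \<iota> scKc in auto)
  next
    fix g w assume gw: "g \<in> carrier G" "w \<in> carrier W"
    have sw: "\<sigma> g w \<in> carrier W" using module_hom_apply[OF W.rep_hom[OF gw(1)] gw(2)] .
    have idK: "additive_map Kk Kk id" by (simp add: additive_map_def)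
    show "\<iota> (\<sigma> g w) = stalk_act S E \<epsilon> g (\<iota> w)"
    proof (rule hinj)
      have bal: "t.pure (id (c \<odot>\<^bsub>Kk\<^esub> m)) (\<sigma> g v) = t.pure (id m) (\<sigma> g (c \<odot>\<^bsub>W\<^esub> v))"
        if "c \<in> carrier k" "m \<in> carrier Kk" "v \<in> carrier W" for c m v
        using that t.pure_smult[of c m "\<sigma> g v"] module_hom_apply[OF W.rep_hom[OF gw(1)] that(3)]
        by (simp add: module_hom_smult[OF W.rep_hom[OF gw(1)]])
      have "tensor_map k Kk W id (\<sigma> g) (t.pure \<one>\<^bsub>K\<^esub> w) = t.pure (id \<one>\<^bsub>K\<^esub>) (\<sigma> g w)"
        by (rule tensor_map_pure[OF t t idK module_hom_additive[OF W.rep_hom[OF gw(1)]] bal]) (simp_all add: KkK gw)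
      then show "h (\<iota> (\<sigma> g w)) = h (stalk_act S E \<epsilon> g (\<iota> w))"
        using gw sw \<iota> hact by simp
      interpret R: group_rep k G kE\<epsilon> "stalk_act S E \<epsilon>" by (rule rep_stalk)
      show "stalk_act S E \<epsilon> g (\<iota> w) \<in> carrier E\<epsilon>"
        using module_hom_apply[OF R.rep_hom[OF gw(1)], of "\<iota> w"] \<iota>(1)[OF gw(2)] by simp
    qed (use sw \<iota> in auto)
  next
    fix Q x
    assume x: "x \<in> carrier E\<epsilon>" and Q0: "Q \<zero>\<^bsub>E\<epsilon>\<^esub>"
      and Qp: "\<And>a w. a \<in> carrier K \<Longrightarrow> w \<in> carrier W \<Longrightarrow> Q (a \<odot>\<^bsub>E\<epsilon>\<^esub> \<iota> w)"
      and Qa: "\<And>x y. x \<in> carrier E\<epsilon> \<Longrightarrow> y \<in> carrier E\<epsilon> \<Longrightarrow> Q x \<Longrightarrow> Q y \<Longrightarrow> Q (x \<oplus>\<^bsub>E\<epsilon>\<^esub> y)"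
    have "Q (h' A)" if "A \<in> carrier T" for A
      using that unfolding T_def
    proof (induction rule: t.tensor_induct)
      case zero
      have "h' \<zero>\<^bsub>T\<^esub> = \<zero>\<^bsub>E\<epsilon>\<^esub>"
        using h'[OF T.zero_closed] additive_zero[OF St.M.abelian_group_axioms T.abelian_group_axioms module_hom_additive[OF h(1)]]
        by (intro hinj) auto
      then show ?case using Q0 by (simp add: T_def)
    next
      case (pure m n)
      then have mn: "m \<in> carrier K" "n \<in> carrier W" by (simp_all add: KkK)
      have "h' (t.pure m n) = m \<odot>\<^bsub>E\<epsilon>\<^esub> \<iota> n"
        using h'[OF pc[OF mn]] mn \<iota> module_hom_smult[OF h(1) mn(1) \<iota>(1)[OF mn(2)]] smp[OF mn(1) K.one_closed mn(2)]
        by (intro hinj) auto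
      then show ?case using Qp mn by simp
    next
      case (add A B)
      then have AB: "A \<in> carrier T" "B \<in> carrier T" by (simp_all add: T_def)
      have "h' (A \<oplus>\<^bsub>T\<^esub> B) = h' A \<oplus>\<^bsub>E\<epsilon>\<^esub> h' B"
        using h'[OF T.a_closed[OF AB]] h'[OF AB(1)] h'[OF AB(2)] module_hom_add[OF h(1) h'(1)[OF AB(1)] h'(1)[OF AB(2)]]
        by (intro hinj) auto
      then show ?case using Qa[OF h'(1)[OF AB(1)] h'(1)[OF AB(2)]] add by (simp add: T_def)
    qed
    moreover have "h' (h x) = x" using h'[OF hc[OF x]] x by (intro hinj) auto
    ultimately show "Q x" using hc[OF x] by metis
  next
    fix l assume l: "additive_map W k l"
      and ls: "\<And>c w. c \<in> carrier k \<Longrightarrow> w \<in> carrier W \<Longrightarrow> l (c \<odot>\<^bsub>W\<^esub> w) = c \<otimes>\<^bsub>k\<^esub> l w"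
    have lc: "l w \<in> carrier k" if "w \<in> carrier W" for w using additive_closed[OF l that] .
    obtain L where L: "additive_map T K L"
      and Lp: "\<And>a w. a \<in> carrier Kk \<Longrightarrow> w \<in> carrier W \<Longrightarrow> L (t.pure a w) = a \<otimes>\<^bsub>K\<^esub> scK (l w)"
    proof (rule t.tensor_universal[of K "\<lambda>a w. a \<otimes>\<^bsub>K\<^esub> scK (l w)" "\<lambda>a b. a \<otimes>\<^bsub>K\<^esub> b", OF K.abelian_group_axioms])
      show "additive_map Kk K (\<lambda>a. a \<otimes>\<^bsub>K\<^esub> scK (l w))" if "w \<in> carrier W" for w
        using scKc[OF lc[OF that]] by (simp add: Kk_def additive_map_def K.l_distr)
      show "additive_map W K (\<lambda>w. a \<otimes>\<^bsub>K\<^esub> scK (l w))" if "a \<in> carrier Kk" for a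
        using that scKc[OF lc] additive_add[OF l] ring_hom_add[OF scK_hom] lc
        by (simp add: KkK additive_map_def K.r_distr)
      show "(c \<odot>\<^bsub>Kk\<^esub> a) \<otimes>\<^bsub>K\<^esub> scK (l w) = a \<otimes>\<^bsub>K\<^esub> scK (l (c \<odot>\<^bsub>W\<^esub> w))"
        if "c \<in> carrier k" "a \<in> carrier Kk" "w \<in> carrier W" for c a w
        using that scKc lc ring_hom_mult[OF scK_hom] by (simp add: Kk_def ls K.m_ac)
    qed (simp_all add: T_def)
    have Ls: "L (a \<odot>\<^bsub>T\<^esub> A) = a \<otimes>\<^bsub>K\<^esub> L A" if a: "a \<in> carrier K" and A: "A \<in> carrier T" for a A
    proof (rule t.additive_ext[OF K.abelian_group_axioms, of "\<lambda>a b. a \<otimes>\<^bsub>K\<^esub> b"])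
      show "additive_map (t.T (\<lambda>a b. a \<otimes>\<^bsub>K\<^esub> b)) K (\<lambda>A. L (a \<odot>\<^bsub>T\<^esub> A))"
        using additive_compose[OF smT[OF a] L] by (simp add: T_def)
      show "additive_map (t.T (\<lambda>a b. a \<otimes>\<^bsub>K\<^esub> b)) K (\<lambda>A. a \<otimes>\<^bsub>K\<^esub> L A)"
        using L a by (simp add: T_def additive_map_def K.r_distr Pi_iff)
      show "L (a \<odot>\<^bsub>T\<^esub> t.pure m n) = a \<otimes>\<^bsub>K\<^esub> L (t.pure m n)" if "m \<in> carrier Kk" "n \<in> carrier W" for m n
        using that a smp[of a m n] Lp scKc lc by (simp add: KkK K.m_assoc)
    qed (use A in \<open>simp add: T_def\<close>)
    show "\<exists>L. additive_map E\<epsilon> K L \<and> (\<forall>a\<in>carrier K. \<forall>x\<in>carrier E\<epsilon>. L (a \<odot>\<^bsub>E\<epsilon>\<^esub> x) = a \<otimes>\<^bsub>K\<^esub> L x)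
        \<and> (\<forall>w\<in>carrier W. L (\<iota> w) = scK (l w))"
    proof (intro exI[of _ "\<lambda>x. L (h x)"] conjI ballI)
      show "additive_map E\<epsilon> K (\<lambda>x. L (h x))" by (rule additive_compose[OF module_hom_additive[OF h(1)] L])
      show "L (h (a \<odot>\<^bsub>E\<epsilon>\<^esub> x)) = a \<otimes>\<^bsub>K\<^esub> L (h x)" if "a \<in> carrier K" "x \<in> carrier E\<epsilon>" for a x
        using module_hom_smult[OF h(1) that] Ls[OF that(1) hc[OF that(2)]] by simp
      show "L (h (\<iota> w)) = scK (l w)" if "w \<in> carrier W" for w
        using \<iota>[OF that] Lp[of "\<one>\<^bsub>K\<^esub>" w] that scKc[OF lc[OF that]] by (simp add: KkK)
    qed
  qed
qed

context type_embedding
begin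

lemma iota_closed: "w \<in> carrier W \<Longrightarrow> \<iota> w \<in> carrier E\<epsilon>"
  by (rule additive_closed[OF iota_additive])

text \<open>A functional on W taking the value one at w - w' extends to the generic stalk. If w and
  w' had the same image, the extension would give 1 = 0 in the function field.\<close>

lemma iota_inj:
  assumes w: "w \<in> carrier W" "w' \<in> carrier W" "\<iota> w = \<iota> w'"
  shows "w = w'"
proof (rule ccontr)
  assume ne: "w \<noteq> w'"
  interpret K: cring K by (rule cring_K)
  interpret St: module K E\<epsilon> by (rule module_stalk)
  have d: "w \<ominus>\<^bsub>W\<^esub> w' \<in> carrier W" "w \<ominus>\<^bsub>W\<^esub> w' \<notin> {\<zero>\<^bsub>W\<^esub>}" using w(1,2) ne by simp_all
  have "VectorSpace.subspace k {\<zero>\<^bsub>W\<^esub>} W"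
    by (intro VectorSpace.subspace.intro W.vectorspace_axioms submodule.intro W.module_axioms) auto
  then obtain l where l: "additive_map W k l" "\<And>a x. a \<in> carrier k \<Longrightarrow> x \<in> carrier W \<Longrightarrow> l (a \<odot>\<^bsub>W\<^esub> x) = a \<otimes>\<^bsub>k\<^esub> l x"
    "l (w \<ominus>\<^bsub>W\<^esub> w') = \<one>\<^bsub>k\<^esub>"
    using W.separating_functional[OF _ d] by metis
  obtain L where L: "additive_map E\<epsilon> K L" "\<And>w. w \<in> carrier W \<Longrightarrow> L (\<iota> w) = scK (l w)"
    using iota_functional[OF l(1)] l(2) by blast
  have "\<iota> (w \<ominus>\<^bsub>W\<^esub> w') \<oplus>\<^bsub>E\<epsilon>\<^esub> \<iota> w' = \<zero>\<^bsub>E\<epsilon>\<^esub> \<oplus>\<^bsub>E\<epsilon>\<^esub> \<iota> w'"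
    using w iota_closed additive_add[OF iota_additive d(1) w(2)] by (simp add: W.M.minus_eq W.M.a_assoc W.M.l_neg)
  then have "\<iota> (w \<ominus>\<^bsub>W\<^esub> w') = \<zero>\<^bsub>E\<epsilon>\<^esub>" using w iota_closed d(1) by (subst (asm) St.M.add.r_cancel) simp_all
  then have "scK \<one>\<^bsub>k\<^esub> = \<zero>\<^bsub>K\<^esub>"
    using L(2)[OF d(1)] additive_zero[OF St.M.abelian_group_axioms K.abelian_group_axioms L(1)] by (simp add: l(3))
  then show False using ring_hom_one[OF scK_hom] integral_stalk_nontrivial(2)[OF integral eps] by simp
qed

lemma type_nonzero:
  assumes "carrier E\<epsilon> \<noteq> {\<zero>\<^bsub>E\<epsilon>\<^esub>}"
  shows "carrier W \<noteq> {\<zero>\<^bsub>W\<^esub>}"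
proof
  assume z: "carrier W = {\<zero>\<^bsub>W\<^esub>}"
  interpret St: module K E\<epsilon> by (rule module_stalk)
  have "x = \<zero>\<^bsub>E\<epsilon>\<^esub>" if "x \<in> carrier E\<epsilon>" for x
  proof (rule iota_induct[OF that])
    fix a w assume a: "a \<in> carrier K" and "w \<in> carrier W"
    then have "\<iota> w = \<zero>\<^bsub>E\<epsilon>\<^esub>"
      using additive_zero[OF W.M.abelian_group_axioms St.M.abelian_group_axioms iota_additive] z by simp
    then show "a \<odot>\<^bsub>E\<epsilon>\<^esub> \<iota> w = \<zero>\<^bsub>E\<epsilon>\<^esub>" using a by simp
  qed simp_all
  then show False using assms St.M.zero_closed by blast
qed

text \<open>The generic stalk has finitely many generators, and each of them involves finitely many
  vectors of W. If these vectors did not span W, a functional killing their span but not some w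
  would extend to the generic stalk, kill all generators there, and so kill the image of w.\<close>

lemma type_fin_dim:
  assumes ft: "finite_type S E"
  shows "W.fin_dim"
proof -
  interpret K: cring K by (rule cring_K)
  interpret St: module K E\<epsilon> by (rule module_stalk)
  define lin where "lin L \<longleftrightarrow> additive_map E\<epsilon> K L \<and> (\<forall>a\<in>carrier K. \<forall>x\<in>carrier E\<epsilon>. L (a \<odot>\<^bsub>E\<epsilon>\<^esub> x) = a \<otimes>\<^bsub>K\<^esub> L x)" for L
  have linD: "additive_map E\<epsilon> K L" "\<And>a x. a \<in> carrier K \<Longrightarrow> x \<in> carrier E\<epsilon> \<Longrightarrow> L (a \<odot>\<^bsub>E\<epsilon>\<^esub> x) = a \<otimes>\<^bsub>K\<^esub> L x"
    if "lin L" for L using that by (auto simp: lin_def)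
  \<comment> \<open>A substitute, phrased through functionals, for membership of x in the span over
    K of the image of B.\<close>
  define R where "R B x \<longleftrightarrow> (\<forall>L. lin L \<longrightarrow> (\<forall>w\<in>B. L (\<iota> w) = \<zero>\<^bsub>K\<^esub>) \<longrightarrow> L x = \<zero>\<^bsub>K\<^esub>)" for B x
  have fin: "\<exists>B. finite B \<and> B \<subseteq> carrier W \<and> R B x" if "x \<in> carrier E\<epsilon>" for x
  proof (rule iota_induct[OF that])
    have "R {} \<zero>\<^bsub>E\<epsilon>\<^esub>"
      unfolding R_def using additive_zero[OF St.M.abelian_group_axioms K.abelian_group_axioms linD(1)] by blast
    then show "\<exists>B. finite B \<and> B \<subseteq> carrier W \<and> R B \<zero>\<^bsub>E\<epsilon>\<^esub>" by blast
    show "\<exists>B. finite B \<and> B \<subseteq> carrier W \<and> R B (a \<odot>\<^bsub>E\<epsilon>\<^esub> \<iota> w)" if "a \<in> carrier K" "w \<in> carrier W" for a w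
      using that iota_closed by (auto intro!: exI[of _ "{w}"] simp: R_def linD(2))
    fix x y assume xy: "x \<in> carrier E\<epsilon>" "y \<in> carrier E\<epsilon>"
      and "\<exists>B. finite B \<and> B \<subseteq> carrier W \<and> R B x" "\<exists>B. finite B \<and> B \<subseteq> carrier W \<and> R B y"
    then obtain B B' where B: "finite B" "B \<subseteq> carrier W" "R B x" "finite B'" "B' \<subseteq> carrier W" "R B' y" by blast
    have "R (B \<union> B') (x \<oplus>\<^bsub>E\<epsilon>\<^esub> y)"
      unfolding R_def
    proof (intro allI impI)
      fix L assume L: "lin L" "\<forall>w\<in>B \<union> B'. L (\<iota> w) = \<zero>\<^bsub>K\<^esub>"
      then have "L x = \<zero>\<^bsub>K\<^esub>" "L y = \<zero>\<^bsub>K\<^esub>" using B(3,6) unfolding R_def by simp_all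
      then show "L (x \<oplus>\<^bsub>E\<epsilon>\<^esub> y) = \<zero>\<^bsub>K\<^esub>" using additive_add[OF linD(1)[OF L(1)] xy] by simp
    qed
    then show "\<exists>B. finite B \<and> B \<subseteq> carrier W \<and> R B (x \<oplus>\<^bsub>E\<epsilon>\<^esub> y)"
      using B by (intro exI[of _ "B \<union> B'"]) simp
  qed
  obtain n g where g: "g \<in> {..<n::nat} \<rightarrow> carrier E\<epsilon>"
    and gen: "\<And>A. A \<in> carrier E\<epsilon> \<Longrightarrow> \<exists>a\<in>{..<n} \<rightarrow> carrier K. A = (\<Oplus>\<^bsub>E\<epsilon>\<^esub>i\<in>{..<n}. a i \<odot>\<^bsub>E\<epsilon>\<^esub> g i)"
    by (rule E.finite_type_stalk[OF ft eps cring_K]) (rule that)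
  define B where "B i = (SOME B. finite B \<and> B \<subseteq> carrier W \<and> R B (g i))" for i
  have gc: "g i \<in> carrier E\<epsilon>" if "i < n" for i using g that by auto
  have B: "finite (B i)" "B i \<subseteq> carrier W" "R (B i) (g i)" if "i < n" for i
    using someI_ex[OF fin[OF gc[OF that]]] unfolding B_def by blast+
  define C where "C = (\<Union>i\<in>{..<n}. B i)"
  have C: "finite C" "C \<subseteq> carrier W" using B by (auto simp: C_def)
  have "w \<in> W.span C" if w: "w \<in> carrier W" for w
  proof (rule ccontr)
    assume "w \<notin> W.span C"
    from W.separating_functional[OF W.span_is_subspace[OF C(2)] w this] obtain l
      where l: "additive_map W k l" "\<And>a x. a \<in> carrier k \<Longrightarrow> x \<in> carrier W \<Longrightarrow> l (a \<odot>\<^bsub>W\<^esub> x) = a \<otimes>\<^bsub>k\<^esub> l x"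
        "l w = \<one>\<^bsub>k\<^esub>" "\<And>h. h \<in> W.span C \<Longrightarrow> l h = \<zero>\<^bsub>k\<^esub>" by blast
    obtain L where L: "lin L" "\<And>w. w \<in> carrier W \<Longrightarrow> L (\<iota> w) = scK (l w)"
      using iota_functional[OF l(1,2)] unfolding lin_def by blast
    have sz: "scK \<zero>\<^bsub>k\<^esub> = \<zero>\<^bsub>K\<^esub>"
      using ring_hom_zero[OF scK_hom] cring_k cring_K by (simp add: cring_def)
    have "L (g i) = \<zero>\<^bsub>K\<^esub>" if i: "i < n" for i
    proof -
      have "L (\<iota> u) = \<zero>\<^bsub>K\<^esub>" if u: "u \<in> B i" for u
      proof -
        have "u \<in> C" using u i by (auto simp: C_def)
        then have "l u = \<zero>\<^bsub>k\<^esub>" using l(4) W.span_mem[OF C(2)] by simp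
        then show ?thesis using L(2)[of u] B(2)[OF i] u sz by auto
      qed
      then show ?thesis using B(3)[OF i] L(1) unfolding R_def by simp
    qed
    note Lg = this
    obtain a where a: "a \<in> {..<n} \<rightarrow> carrier K" "\<iota> w = (\<Oplus>\<^bsub>E\<epsilon>\<^esub>i\<in>{..<n}. a i \<odot>\<^bsub>E\<epsilon>\<^esub> g i)"
      using gen[OF iota_closed[OF w]] by blast
    have ac: "a i \<in> carrier K" if "i < n" for i using a(1) that by auto
    have "L (\<iota> w) = (\<Oplus>\<^bsub>K\<^esub>i\<in>{..<n}. L (a i \<odot>\<^bsub>E\<epsilon>\<^esub> g i))"
      unfolding a(2) using ac gc
      by (intro additive_finsum[OF St.M.abelian_group_axioms K.abelian_group_axioms linD(1)[OF L(1)]]) auto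
    also have "\<dots> = \<zero>\<^bsub>K\<^esub>"
      using ac gc Lg linD(2)[OF L(1)] by (intro K.add.finprod_one_eqI) auto
    finally have "scK \<one>\<^bsub>k\<^esub> = \<zero>\<^bsub>K\<^esub>" using L(2)[OF w] l(3) by simp
    then show False
      using ring_hom_one[OF scK_hom] integral_stalk_nontrivial(2)[OF integral eps] by simp
  qed
  then show ?thesis by (intro W.fin_dimI[OF C]) auto
qed

end

section \<open>The isotypic projection\<close>

context munits
begin

abbreviation total where "total v \<equiv> (\<Oplus>\<^bsub>V\<^esub>i\<in>{..<n}. E i i v)"

text \<open>Summed over the diagonal, \<open>munit_act\<close> and \<open>act_munit\<close> give the
  same double sum, up to the order of summation.\<close>

lemma total_act:
  assumes "h \<in> carrier G" "v \<in> carrier V"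
  shows "total (\<rho> h v) = \<rho> h (total v)"
proof -
  have c: "A h i j \<odot>\<^bsub>V\<^esub> E i j v \<in> carrier V" if "i < n" "j < n" for i j
    using that assms A_closed munit_closed by simp
  have "total (\<rho> h v) = (\<Oplus>\<^bsub>V\<^esub>i\<in>{..<n}. \<Oplus>\<^bsub>V\<^esub>l\<in>{..<n}. A h i l \<odot>\<^bsub>V\<^esub> E i l v)"
    using assms c by (intro M.finsum_cong') (auto simp: munit_act intro!: M.finsum_closed)
  also have "\<dots> = (\<Oplus>\<^bsub>V\<^esub>l\<in>{..<n}. \<Oplus>\<^bsub>V\<^esub>i\<in>{..<n}. A h i l \<odot>\<^bsub>V\<^esub> E i l v)"
    using c by (intro M.finsum_swap) auto
  also have "\<dots> = (\<Oplus>\<^bsub>V\<^esub>l\<in>{..<n}. \<rho> h (E l l v))"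
    using assms c munit_closed rho_closed by (intro M.finsum_cong') (auto simp: act_munit)
  also have "\<dots> = \<rho> h (total v)"
    using assms munit_closed
    by (intro additive_finsum[OF M.abelian_group_axioms M.abelian_group_axioms rho_additive, symmetric]) auto
  finally show ?thesis .
qed

lemma munit_total:
  assumes "i < n" "j < n" "v \<in> carrier V"
  shows "E i j (total v) = E i j v"
proof -
  have "E i j (total v) = (\<Oplus>\<^bsub>V\<^esub>l\<in>{..<n}. E i j (E l l v))"
    using assms munit_closed
    by (intro additive_finsum[OF M.abelian_group_axioms M.abelian_group_axioms munit_additive]) auto
  also have "\<dots> = (\<Oplus>\<^bsub>V\<^esub>l\<in>{..<n}. if l = j then E i l v else \<zero>\<^bsub>V\<^esub>)"
    using assms munit_closed by (intro M.finsum_cong') (auto simp: munit_munit)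
  also have "\<dots> = E i j v" using assms munit_closed by (intro M.finsum_delta) auto
  finally show ?thesis .
qed

lemma total_idem: "v \<in> carrier V \<Longrightarrow> total (total v) = total v"
  using munit_closed by (intro M.finsum_cong') (auto simp: munit_total)

end

section \<open>Matrix units on sections, the sheaf F and its generic stalk\<close>

locale equivariant_munits = equivariant_setting k G S p \<phi> \<epsilon> E + irr_matrix k G n A \<mu>
  for k :: "'k ring" and G :: "'g monoid" and S :: "('x, 'r) rspace"
    and p :: "'x \<Rightarrow> 'k set"
    and \<phi> :: "'k set set \<Rightarrow> ('k set \<Rightarrow> ('k \<times> 'k) set) \<Rightarrow> 'r"
    and \<epsilon> :: 'x
    and E :: "('x, 'r, 'm, 'g) gmsheaf" and n A \<mu>
begin

abbreviation pE where "pE i j U \<equiv> munit k G A \<mu> (kE U) (\<lambda>g. act E g U) i j"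
abbreviation pE\<epsilon> where "pE\<epsilon> i j \<equiv> munit k G A \<mu> kE\<epsilon> (stalk_act S E \<epsilon>) i j"

lemma munits_sec: "openin (pts S) U \<Longrightarrow> munits k G n A \<mu> (kE U) (\<lambda>g. act E g U)"
  by (intro munits.intro irr_matrix_axioms rep_sections)

lemma munits_stalk: "munits k G n A \<mu> kE\<epsilon> (stalk_act S E \<epsilon>)"
  by (intro munits.intro irr_matrix_axioms rep_stalk)

lemma pE_closed: "openin (pts S) U \<Longrightarrow> i < n \<Longrightarrow> j < n \<Longrightarrow> m \<in> carrier (sec E U) \<Longrightarrow> pE i j U m \<in> carrier (sec E U)"
  using munits.munit_closed[OF munits_sec, of U i j m] by simp

lemma pE_additive: "openin (pts S) U \<Longrightarrow> i < n \<Longrightarrow> j < n \<Longrightarrow> additive_map (sec E U) (sec E U) (pE i j U)"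
  using munits.munit_additive[OF munits_sec, of U i j] by simp

lemma pE_smult:
  assumes U: "openin (pts S) U" and ij: "i < n" "j < n" and a: "a \<in> carrier (sec_ring S U)" and m: "m \<in> carrier (sec E U)"
  shows "pE i j U (a \<odot>\<^bsub>sec E U\<^esub> m) = a \<odot>\<^bsub>sec E U\<^esub> pE i j U m"
proof -
  interpret N: module "sec_ring S U" "sec E U" by (rule E.sec_module[OF U])
  show ?thesis
    using ij a m sc_closed[OF U] act_closed[OF _ U] module_hom_smult[OF E.act_hom[OF _ U]]
      additive_smult[OF N.module_axioms a]
    by (intro munits.munit_natural[OF munits_sec[OF U], symmetric] abelian_group_restrict_scalars N.M.abelian_group_axioms)
      (auto simp: N.smult_assoc1[symmetric] N.R.m_comm)
qed

lemma pE_res: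
  assumes U: "openin (pts S) U" "openin (pts S) V" "V \<subseteq> U" and ij: "i < n" "j < n" and m: "m \<in> carrier (sec E U)"
  shows "mres E U V (pE i j U m) = pE i j V (mres E U V m)"
proof -
  interpret N: module "sec_ring S V" "sec E V" by (rule E.sec_module[OF U(2)])
  show ?thesis
    using ij m U sc_closed act_closed E.act_res E.mres_additive[OF U] E.mres_smult[OF U sc_closed[OF U(1)]] sc_res[OF U]
    by (intro munits.munit_natural[OF munits_sec[OF U(1)]] abelian_group_restrict_scalars N.M.abelian_group_axioms)
      auto
qed

lemma pE_germ:
  assumes U: "openin (pts S) U" "\<epsilon> \<in> U" and ij: "i < n" "j < n" and m: "m \<in> carrier (sec E U)"
  shows "mod_germ S E \<epsilon> U (pE i j U m) = pE\<epsilon> i j (mod_germ S E \<epsilon> U m)"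
proof -
  interpret St: module K E\<epsilon> by (rule module_stalk)
  show ?thesis
    using ij m U E.germ_additive[OF U] ring_hom_closed[OF scK_hom] scK_germ[OF U]
    by (intro munits.munit_natural[OF munits_sec[OF U(1)]] abelian_group_restrict_scalars St.M.abelian_group_axioms)
      (auto simp: E.mod_stalk_smult[symmetric] sc_closed stalk_act
        intro: module_hom_apply[OF stalk_act_hom] intro!: St.smult_closed)
qed

lemma pE\<epsilon>_smult:
  assumes ij: "i < n" "j < n" and a: "a \<in> carrier K" and x: "x \<in> carrier E\<epsilon>"
  shows "pE\<epsilon> i j (a \<odot>\<^bsub>E\<epsilon>\<^esub> x) = a \<odot>\<^bsub>E\<epsilon>\<^esub> pE\<epsilon> i j x"
proof -
  interpret St: module K E\<epsilon> by (rule module_stalk)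
  show ?thesis
    using ij a x ring_hom_closed[OF scK_hom] module_hom_smult[OF stalk_act_hom] additive_smult[OF St.module_axioms a]
      module_hom_apply[OF stalk_act_hom]
    by (intro munits.munit_natural[OF munits_stalk, symmetric] abelian_group_restrict_scalars St.M.abelian_group_axioms)
      (auto simp: St.smult_assoc1[symmetric] St.R.m_comm)
qed

lemma pE_endomorphism: "i < n \<Longrightarrow> j < n \<Longrightarrow> sheaf_endomorphism S E (\<lambda>U. pE i j U)"
  by (intro sheaf_endomorphism.intro E.sheaf_of_modules_axioms sheaf_endomorphism_axioms.intro module_homI)
    (auto simp: pE_additive pE_smult pE_res)

abbreviation PE where "PE U m \<equiv> (\<Oplus>\<^bsub>sec E U\<^esub>i\<in>{..<n}. pE i i U m)"

lemma isotypic: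
  assumes ns: "nonsplitting_gmodule G S E" and U0: "openin (pts S) U0" "m0 \<in> carrier (sec E U0)"
    and nz: "PE U0 m0 \<noteq> \<zero>\<^bsub>sec E U0\<^esub>"
    and U: "openin (pts S) U" and m: "m \<in> carrier (sec E U)"
  shows "PE U m = m"
proof -
  have "sheaf_endomorphism S E (\<lambda>U. PE U)"
  proof (intro sheaf_endomorphism.intro E.sheaf_of_modules_axioms sheaf_endomorphism_axioms.intro module_homI)
    fix U assume U: "openin (pts S) U"
    interpret N: module "sec_ring S U" "sec E U" by (rule E.sec_module[OF U])
    show "additive_map (sec E U) (sec E U) (PE U)"
      using U by (intro additive_finsum_fun N.M.abelian_group_axioms pE_additive) auto
    show "PE U (a \<odot>\<^bsub>sec E U\<^esub> m) = a \<odot>\<^bsub>sec E U\<^esub> PE U m"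
      if a: "a \<in> carrier (sec_ring S U)" and m: "m \<in> carrier (sec E U)" for a m
    proof -
      have "PE U (a \<odot>\<^bsub>sec E U\<^esub> m) = (\<Oplus>\<^bsub>sec E U\<^esub>i\<in>{..<n}. a \<odot>\<^bsub>sec E U\<^esub> pE i i U m)"
        using a m U pE_closed by (intro N.M.finsum_cong') (auto simp: pE_smult)
      then show ?thesis using a m U pE_closed by (simp add: N.finsum_smult Pi_iff)
    qed
  next
    fix U V m assume U: "openin (pts S) U" "openin (pts S) V" "V \<subseteq> U" and m: "m \<in> carrier (sec E U)"
    interpret N: module "sec_ring S V" "sec E V" by (rule E.sec_module[OF U(2)])
    have "mres E U V (PE U m) = (\<Oplus>\<^bsub>sec E V\<^esub>i\<in>{..<n}. mres E U V (pE i i U m))"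
      using U m pE_closed
      by (intro additive_finsum[OF E.sec_abelian[OF U(1)] N.M.abelian_group_axioms E.mres_additive[OF U]]) auto
    also have "\<dots> = PE V (mres E U V m)"
      using U m pE_closed E.M.res_closed by (intro N.M.finsum_cong') (auto simp: pE_res)
    finally show "mres E U V (PE U m) = PE V (mres E U V m)" .
  qed
  moreover have "PE U (act E g U m) = act E g U (PE U m)"
    if "g \<in> carrier G" "openin (pts S) U" "m \<in> carrier (sec E U)" for g U m
    using munits.total_act[OF munits_sec[OF that(2)] that(1)] that(3) by simp
  moreover have "PE U (PE U m) = PE U m" if "openin (pts S) U" "m \<in> carrier (sec E U)" for U m
    using munits.total_idem[OF munits_sec[OF that(1)]] that(2) by simp
  ultimately have "(\<forall>U. openin (pts S) U \<longrightarrow> (\<forall>m\<in>carrier (sec E U). PE U m = \<zero>\<^bsub>sec E U\<^esub>))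
    \<or> (\<forall>U. openin (pts S) U \<longrightarrow> (\<forall>m\<in>carrier (sec E U). PE U m = m))"
    by (rule nonsplitting_idempotent[OF gmodule_E ns])
  then show ?thesis using U0 nz U m by blast
qed

text \<open>The sheaf E_00 E. Sending an equivariant map from V to its value at the first basis
  vector identifies the sheaf of such maps with it. The action is dropped from the record because
  E_00 need not commute with G.\<close>

definition F :: "('x, 'r, 'm) msheaf"
  where "F = fix_sheaf \<lparr>sec = sec E, mres = mres E\<rparr> (\<lambda>U. pE 0 0 U)"

lemma F_simps:
  "carrier (sec F U) = {m \<in> carrier (sec E U). pE 0 0 U m = m}"
  "\<zero>\<^bsub>sec F U\<^esub> = \<zero>\<^bsub>sec E U\<^esub>"
  "x \<oplus>\<^bsub>sec F U\<^esub> y = x \<oplus>\<^bsub>sec E U\<^esub> y"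
  "a \<odot>\<^bsub>sec F U\<^esub> x = a \<odot>\<^bsub>sec E U\<^esub> x"
  "mres F = mres E"
  by (simp_all add: F_def fix_sheaf_def)

lemma F_sheaf: "sheaf_of_modules S F"
proof -
  have "sheaf_endomorphism S \<lparr>sec = sec E, mres = mres E\<rparr> (\<lambda>U. pE 0 0 U)"
    using pE_endomorphism[OF n_pos n_pos]
    by (simp add: sheaf_endomorphism_def sheaf_endomorphism_axioms_def sheaf_of_modules_def sheaf_of_modules_axioms_def)
  then show ?thesis unfolding F_def by (rule sheaf_endomorphism.fix_sheaf)
qed

sublocale F: sheaf_of_modules S F by (rule F_sheaf)

lemma pE0_in_F: "openin (pts S) U \<Longrightarrow> i < n \<Longrightarrow> m \<in> carrier (sec E U) \<Longrightarrow> pE 0 i U m \<in> carrier (sec F U)"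
  using munits.munit_munit[OF munits_sec, of U 0 0 0 i m] munits.munit_closed[OF munits_sec, of U 0 i m] n_pos
  by (simp add: F_simps)

text \<open>As a set of representatives, a germ in F is smaller than the germ of the same section in
  E, so the embedding of stalks needs a map. By the lemmas below it identifies the generic stalk of
  F with the fixed space of E_00 on the generic stalk of E.\<close>

definition incl :: "('x set \<times> 'm) set \<Rightarrow> ('x set \<times> 'm) set"
  where "incl y = (\<Union>(U, m)\<in>y. mod_germ S E \<epsilon> U m)"

lemma incl_germ:
  assumes "openin (pts S) U" "\<epsilon> \<in> U" "m \<in> carrier (sec F U)"
  shows "incl (mod_germ S F \<epsilon> U m) = mod_germ S E \<epsilon> U m"
  unfolding incl_def
proof (rule F.M.UN_germ)
  show "openin (pts S) U \<and> \<epsilon> \<in> U \<and> m \<in> carrier (sec F U)" using assms by blast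
  fix V n assume V: "openin (pts S) V \<and> \<epsilon> \<in> V \<and> n \<in> carrier (sec F V)"
    and e: "mod_germ S F \<epsilon> V n = mod_germ S F \<epsilon> U m"
  obtain W where W: "openin (pts S) W" "\<epsilon> \<in> W" "W \<subseteq> V" "W \<subseteq> U" "mres F V W n = mres F U W m"
    using F.M.germ_eqD[OF V _ e] assms by metis
  show "mod_germ S E \<epsilon> V n = mod_germ S E \<epsilon> U m"
    using V assms W by (intro E.M.germ_eqI[of V \<epsilon> n U m W]) (auto simp: F_simps)
qed

lemma incl_closed: "y \<in> carrier (mod_stalk S F \<epsilon>) \<Longrightarrow> incl y \<in> carrier E\<epsilon>"
proof (erule F.mod_stalk_cases)
  fix U m assume "openin (pts S) U" "\<epsilon> \<in> U" "m \<in> carrier (sec F U)" "y = mod_germ S F \<epsilon> U m"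
  then show "incl y \<in> carrier E\<epsilon>" using E.mod_stalk_carrier[of U \<epsilon> m] by (simp only: incl_germ) (simp add: F_simps(1))
qed

lemma incl_inj:
  assumes "y \<in> carrier (mod_stalk S F \<epsilon>)" "z \<in> carrier (mod_stalk S F \<epsilon>)" "incl y = incl z"
  shows "y = z"
proof -
  obtain U m where U: "openin (pts S) U" "\<epsilon> \<in> U" "m \<in> carrier (sec F U)" "y = mod_germ S F \<epsilon> U m"
    using assms(1) by (rule F.mod_stalk_cases)
  obtain V n where V: "openin (pts S) V" "\<epsilon> \<in> V" "n \<in> carrier (sec F V)" "z = mod_germ S F \<epsilon> V n"
    using assms(2) by (rule F.mod_stalk_cases)
  have e: "mod_germ S E \<epsilon> U m = mod_germ S E \<epsilon> V n" using assms(3) U V by (simp add: incl_germ)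
  have mE: "openin (pts S) U \<and> \<epsilon> \<in> U \<and> m \<in> carrier (sec E U)" "openin (pts S) V \<and> \<epsilon> \<in> V \<and> n \<in> carrier (sec E V)"
    using U V by (simp_all add: F_simps)
  obtain W where W: "openin (pts S) W" "\<epsilon> \<in> W" "W \<subseteq> U" "W \<subseteq> V" "mres E U W m = mres E V W n"
    using E.M.germ_eqD[OF mE e] by metis
  show ?thesis unfolding U(4) V(4)
    using U V W by (intro F.M.germ_eqI[of U \<epsilon> m V n W]) (auto simp: F_simps(5))
qed

lemma incl_additive: "additive_map (mod_stalk S F \<epsilon>) E\<epsilon> incl"
  unfolding additive_map_def
proof (intro conjI ballI funcsetI incl_closed)
  fix x y assume "x \<in> carrier (mod_stalk S F \<epsilon>)" "y \<in> carrier (mod_stalk S F \<epsilon>)"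
  then have "x \<in> germs (pts S) (\<lambda>U. carrier (sec F U)) (mres F) \<epsilon>" "y \<in> germs (pts S) (\<lambda>U. carrier (sec F U)) (mres F) \<epsilon>"
    by (simp_all add: mod_stalk_def)
  then obtain U m n where U: "openin (pts S) U \<and> \<epsilon> \<in> U \<and> m \<in> carrier (sec F U)" "n \<in> carrier (sec F U)"
    "x = mod_germ S F \<epsilon> U m" "y = mod_germ S F \<epsilon> U n" by (rule F.M.germs_cases2)
  then have o: "openin (pts S) U" "\<epsilon> \<in> U" "m \<in> carrier (sec F U)" by auto
  have E: "m \<in> carrier (sec E U)" "n \<in> carrier (sec E U)" using U(2) o(3) by (simp_all add: F_simps)
  have "m \<oplus>\<^bsub>sec F U\<^esub> n \<in> carrier (sec F U)" using abelian_groupE(1)[OF F.sec_abelian[OF o(1)] o(3) U(2)] .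
  then show "incl (x \<oplus>\<^bsub>mod_stalk S F \<epsilon>\<^esub> y) = incl x \<oplus>\<^bsub>E\<epsilon>\<^esub> incl y"
    using o U E by (simp add: F.mod_stalk_add incl_germ E.mod_stalk_add F_simps(3))
qed

lemma incl_smult:
  assumes r: "r \<in> carrier K" and y: "y \<in> carrier (mod_stalk S F \<epsilon>)"
  shows "incl (r \<odot>\<^bsub>mod_stalk S F \<epsilon>\<^esub> y) = r \<odot>\<^bsub>E\<epsilon>\<^esub> incl y"
proof -
  obtain U a where U: "openin (pts S) U" "\<epsilon> \<in> U" "a \<in> carrier (sec_ring S U)" "r = ring_germ S \<epsilon> U a"
    using r by (rule E.stalk_cases)
  obtain V m where V: "openin (pts S) V" "\<epsilon> \<in> V" "m \<in> carrier (sec F V)" "y = mod_germ S F \<epsilon> V m"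
    using y by (rule F.mod_stalk_cases)
  let ?W = "U \<inter> V"
  have W: "openin (pts S) ?W" "\<epsilon> \<in> ?W" using U V by auto
  have a: "ring_res S U ?W a \<in> carrier (sec_ring S ?W)" "r = ring_germ S \<epsilon> ?W (ring_res S U ?W a)"
    using E.ring_res_closed[of U ?W a] E.O.germ_res[of U \<epsilon> a ?W] U W by auto
  have m: "mres F V ?W m \<in> carrier (sec F ?W)" "y = mod_germ S F \<epsilon> ?W (mres F V ?W m)"
    using F.M.res_closed[of V ?W m] F.M.germ_res[of V \<epsilon> m ?W] V W by auto
  have mE: "mres F V ?W m \<in> carrier (sec E ?W)" using m(1) by (simp add: F_simps(1))
  show ?thesis
    unfolding a(2) m(2)
    using a(1) m(1) mE W module.smult_closed[OF F.sec_module[OF W(1)] a(1) m(1)]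
    by (simp add: F.mod_stalk_smult E.mod_stalk_smult incl_germ F_simps(4))
qed

lemma incl_fixed: "y \<in> carrier (mod_stalk S F \<epsilon>) \<Longrightarrow> pE\<epsilon> 0 0 (incl y) = incl y"
proof (erule F.mod_stalk_cases)
  fix U m assume U: "openin (pts S) U" "\<epsilon> \<in> U" "m \<in> carrier (sec F U)" "y = mod_germ S F \<epsilon> U m"
  then have "m \<in> carrier (sec E U)" "pE 0 0 U m = m" by (simp_all add: F_simps(1))
  then show ?thesis using pE_germ[OF U(1,2) n_pos n_pos, of m] U by (simp add: incl_germ)
qed

lemma incl_surj:
  assumes "x \<in> carrier E\<epsilon>" "pE\<epsilon> 0 0 x = x"
  obtains y where "y \<in> carrier (mod_stalk S F \<epsilon>)" "incl y = x"
proof -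
  obtain U m where U: "openin (pts S) U" "\<epsilon> \<in> U" "m \<in> carrier (sec E U)" "x = mod_germ S E \<epsilon> U m"
    using assms(1) by (rule E.mod_stalk_cases)
  have "incl (mod_germ S F \<epsilon> U (pE 0 0 U m)) = x"
    using U assms(2) pE_germ[OF U(1,2) n_pos n_pos U(3)] pE0_in_F[OF U(1) n_pos U(3)] by (simp add: incl_germ)
  then show thesis using that F.mod_stalk_carrier[OF U(1,2) pE0_in_F[OF U(1) n_pos U(3)]] by blast
qed

end

section \<open>The rank of F\<close>

locale typed_munits = equivariant_munits k G S p \<phi> \<epsilon> E n A \<mu> + type_embedding k G S p \<phi> \<epsilon> E W \<sigma> \<iota>
  for k :: "'k ring" and G :: "'g monoid" and S :: "('x, 'r) rspace" and p \<phi> and \<epsilon> :: 'x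
    and E :: "('x, 'r, 'm, 'g) gmsheaf" and n A \<mu> and W :: "('k, 'w) module" and \<sigma> \<iota>
begin

sublocale mW: munits k G n A \<mu> W \<sigma>
  by (intro munits.intro irr_matrix_axioms W.group_rep_axioms)

lemma iota_munit:
  assumes "i < n" "j < n" "w \<in> carrier W"
  shows "\<iota> (mW.E i j w) = pE\<epsilon> i j (\<iota> w)"
proof -
  interpret St: module K E\<epsilon> by (rule module_stalk)
  interpret mS: munits k G n A \<mu> kE\<epsilon> "stalk_act S E \<epsilon>" by (rule munits_stalk)
  show ?thesis
    using iota_additive assms iota_smult iota_act mS.rho_closed ring_hom_closed[OF scK_hom]
    by (intro mW.munit_natural abelian_group_restrict_scalars St.M.abelian_group_axioms) auto
qed

text \<open>A basis of E_00 W over k becomes a basis of the generic stalk of F over K. Its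
  coordinate functionals are the extensions to the generic stalk of the coordinates on W, restricted
  to the stalk of F.\<close>

lemma rank_F:
  assumes B: "coord_basis k (W\<lparr>carrier := {w \<in> carrier W. mW.E 0 0 w = w}\<rparr>) m u d"
  shows "mod_rank S \<epsilon> F = m"
proof -
  interpret K: field K by (rule field_K)
  interpret St: module K E\<epsilon> by (rule module_stalk)
  interpret FS: module K "mod_stalk S F \<epsilon>" by (rule F.mod_stalk_module[OF cring_K eps])
  interpret FV: vectorspace K "mod_stalk S F \<epsilon>" by (intro vectorspace.intro FS.module_axioms field_K)
  interpret mS: munits k G n A \<mu> kE\<epsilon> "stalk_act S E \<epsilon>" by (rule munits_stalk)
  let ?W0 = "W\<lparr>carrier := {w \<in> carrier W. mW.E 0 0 w = w}\<rparr>"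
  interpret B: coord_basis k ?W0 m u d by fact
  have scKc: "scK c \<in> carrier K" if "c \<in> carrier k" for c using ring_hom_closed[OF scK_hom that] .
  have E0: "mW.E 0 0 w \<in> carrier ?W0" if "w \<in> carrier W" for w
    using that n_pos mW.munit_closed mW.munit_munit[of 0 0 0 0 w] by simp
  have u: "u i \<in> carrier W" "mW.E 0 0 (u i) = u i" if "i < m" for i using B.b_closed[OF that] by simp_all
  \<comment> \<open>The coordinate \<open>d i\<close> lives on the image of E_00. Composition with
    the projection makes it a functional on all of W, to which \<open>iota_functional\<close>
    applies.\<close>
  define l where "l i w = d i (mW.E 0 0 w)" for i w
  have lc: "l i w \<in> carrier k" if "i < m" "w \<in> carrier W" for i w
    unfolding l_def by (rule B.c_closed[OF that(1) E0[OF that(2)]])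
  have lu: "l i (u j) = (if i = j then \<one>\<^bsub>k\<^esub> else \<zero>\<^bsub>k\<^esub>)" if "i < m" "j < m" for i j
    using that by (simp add: l_def u B.c_b)
  have "\<exists>L. additive_map E\<epsilon> K L \<and> (\<forall>a\<in>carrier K. \<forall>x\<in>carrier E\<epsilon>. L (a \<odot>\<^bsub>E\<epsilon>\<^esub> x) = a \<otimes>\<^bsub>K\<^esub> L x)
        \<and> (\<forall>w\<in>carrier W. L (\<iota> w) = scK (l i w))" if i: "i < m" for i
  proof (rule iota_functional)
    show "additive_map W k (l i)"
      unfolding additive_map_def
    proof (intro conjI ballI funcsetI lc[OF i])
      fix x y assume xy: "x \<in> carrier W" "y \<in> carrier W"
      show "l i (x \<oplus>\<^bsub>W\<^esub> y) = l i x \<oplus>\<^bsub>k\<^esub> l i y"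
        using B.c_add[OF i E0[OF xy(1)] E0[OF xy(2)]] xy additive_add[OF mW.munit_additive[OF n_pos n_pos] xy]
        by (simp add: l_def)
    qed
    show "l i (c \<odot>\<^bsub>W\<^esub> w) = c \<otimes>\<^bsub>k\<^esub> l i w" if "c \<in> carrier k" "w \<in> carrier W" for c w
      using B.c_smult[OF i that(1) E0[OF that(2)]] mW.munit_smult[OF n_pos n_pos that] by (simp add: l_def)
  qed
  then have "\<forall>i\<in>{..<m}. \<exists>L. additive_map E\<epsilon> K L \<and> (\<forall>a\<in>carrier K. \<forall>x\<in>carrier E\<epsilon>. L (a \<odot>\<^bsub>E\<epsilon>\<^esub> x) = a \<otimes>\<^bsub>K\<^esub> L x)
        \<and> (\<forall>w\<in>carrier W. L (\<iota> w) = scK (l i w))" by simp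
  from bchoice[OF this] obtain L where
    L: "\<forall>i\<in>{..<m}. additive_map E\<epsilon> K (L i) \<and> (\<forall>a\<in>carrier K. \<forall>x\<in>carrier E\<epsilon>. L i (a \<odot>\<^bsub>E\<epsilon>\<^esub> x) = a \<otimes>\<^bsub>K\<^esub> L i x)
        \<and> (\<forall>w\<in>carrier W. L i (\<iota> w) = scK (l i w))" ..
  have La: "additive_map E\<epsilon> K (L i)" and Ls: "\<And>a x. a \<in> carrier K \<Longrightarrow> x \<in> carrier E\<epsilon> \<Longrightarrow> L i (a \<odot>\<^bsub>E\<epsilon>\<^esub> x) = a \<otimes>\<^bsub>K\<^esub> L i x"
    and Lw: "\<And>w. w \<in> carrier W \<Longrightarrow> L i (\<iota> w) = scK (l i w)" if "i < m" for i
    using L that by simp_all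
  have Lc: "L i x \<in> carrier K" if "i < m" "x \<in> carrier E\<epsilon>" for i x using additive_closed[OF La[OF that(1)] that(2)] .
  \<comment> \<open>Both sides are additive in x, so it suffices to take multiples of images of
    vectors of W. There it is the expansion of E_00 w in the basis u, carried over by the
    embedding.\<close>
  have pexp: "pE\<epsilon> 0 0 x = (\<Oplus>\<^bsub>E\<epsilon>\<^esub>i\<in>{..<m}. L i x \<odot>\<^bsub>E\<epsilon>\<^esub> \<iota> (u i))" if "x \<in> carrier E\<epsilon>" for x
  proof -
    have pa: "additive_map E\<epsilon> E\<epsilon> (pE\<epsilon> 0 0)" using mS.munit_additive[OF n_pos n_pos] by simp
    have sa: "additive_map E\<epsilon> E\<epsilon> (\<lambda>x. \<Oplus>\<^bsub>E\<epsilon>\<^esub>i\<in>{..<m}. L i x \<odot>\<^bsub>E\<epsilon>\<^esub> \<iota> (u i))"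
      using u iota_closed by (intro additive_finsum_fun St.M.abelian_group_axioms
          additive_compose[OF La additive_smult_left[OF St.module_axioms]]) auto
    show ?thesis
    proof (rule iota_induct[OF that])
      show "pE\<epsilon> 0 0 \<zero>\<^bsub>E\<epsilon>\<^esub> = (\<Oplus>\<^bsub>E\<epsilon>\<^esub>i\<in>{..<m}. L i \<zero>\<^bsub>E\<epsilon>\<^esub> \<odot>\<^bsub>E\<epsilon>\<^esub> \<iota> (u i))"
        using additive_zero[OF St.M.abelian_group_axioms St.M.abelian_group_axioms pa]
          additive_zero[OF St.M.abelian_group_axioms St.M.abelian_group_axioms sa] by simp
      fix x y assume "x \<in> carrier E\<epsilon>" "y \<in> carrier E\<epsilon>"
        "pE\<epsilon> 0 0 x = (\<Oplus>\<^bsub>E\<epsilon>\<^esub>i\<in>{..<m}. L i x \<odot>\<^bsub>E\<epsilon>\<^esub> \<iota> (u i))" "pE\<epsilon> 0 0 y = (\<Oplus>\<^bsub>E\<epsilon>\<^esub>i\<in>{..<m}. L i y \<odot>\<^bsub>E\<epsilon>\<^esub> \<iota> (u i))"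
      then show "pE\<epsilon> 0 0 (x \<oplus>\<^bsub>E\<epsilon>\<^esub> y) = (\<Oplus>\<^bsub>E\<epsilon>\<^esub>i\<in>{..<m}. L i (x \<oplus>\<^bsub>E\<epsilon>\<^esub> y) \<odot>\<^bsub>E\<epsilon>\<^esub> \<iota> (u i))"
        using additive_add[OF pa] additive_add[OF sa] by simp
    next
      fix a w assume a: "a \<in> carrier K" and w: "w \<in> carrier W"
      let ?w = "mW.E 0 0 w"
      have "?w = (\<Oplus>\<^bsub>?W0\<^esub>i\<in>{..<m}. l i w \<odot>\<^bsub>?W0\<^esub> u i)" unfolding l_def by (rule B.expand[OF E0[OF w]])
      also have "\<dots> = (\<Oplus>\<^bsub>W\<^esub>i\<in>{..<m}. l i w \<odot>\<^bsub>W\<^esub> u i)"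
      proof -
        have incl: "additive_map ?W0 W (\<lambda>x. x)" by (simp add: additive_map_def)
        have "(\<Oplus>\<^bsub>?W0\<^esub>i\<in>{..<m}. l i w \<odot>\<^bsub>?W0\<^esub> u i) = (\<Oplus>\<^bsub>W\<^esub>i\<in>{..<m}. l i w \<odot>\<^bsub>?W0\<^esub> u i)"
          using w lc B.b_closed B.smult_closed
          by (intro additive_finsum[OF B.M.abelian_group_axioms W.M.abelian_group_axioms incl]) blast
        then show ?thesis by simp
      qed
      finally have "\<iota> ?w = (\<Oplus>\<^bsub>E\<epsilon>\<^esub>i\<in>{..<m}. \<iota> (l i w \<odot>\<^bsub>W\<^esub> u i))"
        using additive_finsum[OF W.M.abelian_group_axioms St.M.abelian_group_axioms iota_additive, of "\<lambda>i. l i w \<odot>\<^bsub>W\<^esub> u i" "{..<m}"] w lc u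
        by (simp add: Pi_iff)
      also have "\<dots> = (\<Oplus>\<^bsub>E\<epsilon>\<^esub>i\<in>{..<m}. scK (l i w) \<odot>\<^bsub>E\<epsilon>\<^esub> \<iota> (u i))"
        using w lc u iota_closed scKc by (intro St.M.finsum_cong') (auto simp: iota_smult)
      finally have e: "\<iota> ?w = (\<Oplus>\<^bsub>E\<epsilon>\<^esub>i\<in>{..<m}. scK (l i w) \<odot>\<^bsub>E\<epsilon>\<^esub> \<iota> (u i))" .
      have "pE\<epsilon> 0 0 (a \<odot>\<^bsub>E\<epsilon>\<^esub> \<iota> w) = a \<odot>\<^bsub>E\<epsilon>\<^esub> \<iota> ?w" using a w iota_closed n_pos by (simp add: pE\<epsilon>_smult iota_munit)
      also have "\<dots> = (\<Oplus>\<^bsub>E\<epsilon>\<^esub>i\<in>{..<m}. a \<odot>\<^bsub>E\<epsilon>\<^esub> (scK (l i w) \<odot>\<^bsub>E\<epsilon>\<^esub> \<iota> (u i)))"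
        unfolding e using a w lc u iota_closed scKc by (intro St.finsum_smult) auto
      also have "\<dots> = (\<Oplus>\<^bsub>E\<epsilon>\<^esub>i\<in>{..<m}. L i (a \<odot>\<^bsub>E\<epsilon>\<^esub> \<iota> w) \<odot>\<^bsub>E\<epsilon>\<^esub> \<iota> (u i))"
        using a w lc u iota_closed scKc Lc by (intro St.M.finsum_cong') (auto simp: Ls Lw St.smult_assoc1)
      finally show "pE\<epsilon> 0 0 (a \<odot>\<^bsub>E\<epsilon>\<^esub> \<iota> w) = (\<Oplus>\<^bsub>E\<epsilon>\<^esub>i\<in>{..<m}. L i (a \<odot>\<^bsub>E\<epsilon>\<^esub> \<iota> w) \<odot>\<^bsub>E\<epsilon>\<^esub> \<iota> (u i))" .
    qed
  qed
  have "\<exists>y. y \<in> carrier (mod_stalk S F \<epsilon>) \<and> incl y = \<iota> (u i)" if i: "i < m" for i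
    using incl_surj[of "\<iota> (u i)"] iota_closed[OF u(1)[OF i]] iota_munit[OF n_pos n_pos u(1)[OF i]] u(2)[OF i] by (metis (no_types))
  then have "\<forall>i\<in>{..<m}. \<exists>y. y \<in> carrier (mod_stalk S F \<epsilon>) \<and> incl y = \<iota> (u i)" by simp
  from bchoice[OF this] obtain y where y: "\<And>i. i < m \<Longrightarrow> y i \<in> carrier (mod_stalk S F \<epsilon>)" "\<And>i. i < m \<Longrightarrow> incl (y i) = \<iota> (u i)"
    by (metis lessThan_iff)
  have "coord_basis K (mod_stalk S F \<epsilon>) m y (\<lambda>i x. L i (incl x))"
  proof
    fix i assume i: "i < m"
    show "y i \<in> carrier (mod_stalk S F \<epsilon>)" by (rule y(1)[OF i])
    show "(\<lambda>x. L i (incl x)) \<in> carrier (mod_stalk S F \<epsilon>) \<rightarrow> carrier K" using Lc[OF i] incl_closed by auto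
    show "L i (incl (x \<oplus>\<^bsub>mod_stalk S F \<epsilon>\<^esub> z)) = L i (incl x) \<oplus>\<^bsub>K\<^esub> L i (incl z)"
      if "x \<in> carrier (mod_stalk S F \<epsilon>)" "z \<in> carrier (mod_stalk S F \<epsilon>)" for x z
      using additive_add[OF additive_compose[OF incl_additive La[OF i]] that] .
    show "L i (incl (a \<odot>\<^bsub>mod_stalk S F \<epsilon>\<^esub> x)) = a \<otimes>\<^bsub>K\<^esub> L i (incl x)"
      if "a \<in> carrier K" "x \<in> carrier (mod_stalk S F \<epsilon>)" for a x
      using that incl_closed by (simp add: incl_smult Ls[OF i])
    show "L i (incl (y j)) = (if i = j then \<one>\<^bsub>K\<^esub> else \<zero>\<^bsub>K\<^esub>)" if j: "j < m" for j
      using i j ring_hom_one[OF scK_hom] ring_hom_zero[OF scK_hom] cring_k cring_K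
      by (simp add: y u Lw lu cring_def)
  next
    fix x assume x: "x \<in> carrier (mod_stalk S F \<epsilon>)"
    have t: "L i (incl x) \<odot>\<^bsub>mod_stalk S F \<epsilon>\<^esub> y i \<in> carrier (mod_stalk S F \<epsilon>)" if "i < m" for i
      using that Lc incl_closed[OF x] y by simp
    show "x = (\<Oplus>\<^bsub>mod_stalk S F \<epsilon>\<^esub>i\<in>{..<m}. L i (incl x) \<odot>\<^bsub>mod_stalk S F \<epsilon>\<^esub> y i)"
    proof (rule incl_inj[OF x])
      show "(\<Oplus>\<^bsub>mod_stalk S F \<epsilon>\<^esub>i\<in>{..<m}. L i (incl x) \<odot>\<^bsub>mod_stalk S F \<epsilon>\<^esub> y i) \<in> carrier (mod_stalk S F \<epsilon>)"
        using t by (auto intro!: FS.M.finsum_closed)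
      have "incl (\<Oplus>\<^bsub>mod_stalk S F \<epsilon>\<^esub>i\<in>{..<m}. L i (incl x) \<odot>\<^bsub>mod_stalk S F \<epsilon>\<^esub> y i)
          = (\<Oplus>\<^bsub>E\<epsilon>\<^esub>i\<in>{..<m}. incl (L i (incl x) \<odot>\<^bsub>mod_stalk S F \<epsilon>\<^esub> y i))"
        using t by (intro additive_finsum[OF FS.M.abelian_group_axioms St.M.abelian_group_axioms incl_additive]) auto
      also have "\<dots> = (\<Oplus>\<^bsub>E\<epsilon>\<^esub>i\<in>{..<m}. L i (incl x) \<odot>\<^bsub>E\<epsilon>\<^esub> \<iota> (u i))"
        using Lc incl_closed[OF x] y u iota_closed by (intro St.M.finsum_cong') (auto simp: incl_smult)
      also have "\<dots> = incl x" using pexp[OF incl_closed[OF x]] incl_fixed[OF x] by simp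
      finally show "incl x = incl (\<Oplus>\<^bsub>mod_stalk S F \<epsilon>\<^esub>i\<in>{..<m}. L i (incl x) \<odot>\<^bsub>mod_stalk S F \<epsilon>\<^esub> y i)" ..
    qed
  qed
  then show ?thesis unfolding mod_rank_def by (rule FV.coord_basis_dim)
qed

end

section \<open>Extension of scalars and free sheaves\<close>

lemma coord_basis_transport:
  assumes B: "coord_basis R M n b c" and N: "module R N"
    and h: "h \<in> module_hom R M N" and bij: "bij_betw h (carrier M) (carrier N)"
  shows "coord_basis R N n (\<lambda>i. h (b i)) (\<lambda>i y. c i (the_inv_into (carrier M) h y))"
proof -
  interpret B: coord_basis R M n b c by fact
  interpret N: module R N by fact
  let ?g = "the_inv_into (carrier M) h"
  have inj: "inj_on h (carrier M)" using bij by (simp add: bij_betw_def)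
  have g: "?g y \<in> carrier M" "h (?g y) = y" if "y \<in> carrier N" for y
    using that bij the_inv_into_into[OF inj, of y "carrier M"] f_the_inv_into_f[OF inj, of y]
    by (auto simp: bij_betw_def)
  have gh: "?g (h x) = x" if "x \<in> carrier M" for x using the_inv_into_f_f[OF inj that] .
  show ?thesis
  proof
    fix i assume i: "i < n"
    show "h (b i) \<in> carrier N" using module_hom_apply[OF h B.b_closed[OF i]] .
    show "(\<lambda>y. c i (?g y)) \<in> carrier N \<rightarrow> carrier R" using B.c_closed[OF i] g by auto
    fix x assume x: "x \<in> carrier N"
    { fix y assume y: "y \<in> carrier N"
      have "?g (x \<oplus>\<^bsub>N\<^esub> y) = ?g x \<oplus>\<^bsub>M\<^esub> ?g y"
        using gh[OF B.M.a_closed[OF g(1)[OF x] g(1)[OF y]]] module_hom_add[OF h g(1)[OF x] g(1)[OF y]] x y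
        by (simp add: g(2))
      then show "c i (?g (x \<oplus>\<^bsub>N\<^esub> y)) = c i (?g x) \<oplus>\<^bsub>R\<^esub> c i (?g y)"
        using B.c_add[OF i g(1)[OF x] g(1)[OF y]] by simp }
    fix a assume a: "a \<in> carrier R"
    have "?g (a \<odot>\<^bsub>N\<^esub> x) = a \<odot>\<^bsub>M\<^esub> ?g x"
      using gh[OF B.smult_closed[OF a g(1)[OF x]]] module_hom_smult[OF h a g(1)[OF x]] x by (simp add: g(2))
    then show "c i (?g (a \<odot>\<^bsub>N\<^esub> x)) = a \<otimes>\<^bsub>R\<^esub> c i (?g x)" using B.c_smult[OF i a g(1)[OF x]] by simp
  next
    fix i j assume "i < n" "j < n"
    then show "c i (?g (h (b j))) = (if i = j then \<one>\<^bsub>R\<^esub> else \<zero>\<^bsub>R\<^esub>)" by (simp add: gh B.b_closed B.c_b)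
  next
    fix x assume x: "x \<in> carrier N"
    have "h (?g x) = h (\<Oplus>\<^bsub>M\<^esub>i\<in>{..<n}. c i (?g x) \<odot>\<^bsub>M\<^esub> b i)" using B.expand[OF g(1)[OF x]] by simp
    also have "\<dots> = (\<Oplus>\<^bsub>N\<^esub>i\<in>{..<n}. h (c i (?g x) \<odot>\<^bsub>M\<^esub> b i))"
      using g(1)[OF x] B.c_closed B.b_closed
      by (intro additive_finsum[OF B.M.abelian_group_axioms N.M.abelian_group_axioms module_hom_additive[OF h]]) auto
    also have "\<dots> = (\<Oplus>\<^bsub>N\<^esub>i\<in>{..<n}. c i (?g x) \<odot>\<^bsub>N\<^esub> h (b i))"
      using g(1)[OF x] B.c_closed B.b_closed module_hom_apply[OF h]
      by (intro N.M.finsum_cong') (auto simp: module_hom_smult[OF h])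
    finally show "x = (\<Oplus>\<^bsub>N\<^esub>i\<in>{..<n}. c i (?g x) \<odot>\<^bsub>N\<^esub> h (b i))" using g(2)[OF x] by simp
  qed
qed

text \<open>The i-th coordinate is the additive map determined by a \<otimes> v -> a
  \<sigma>(c_i(v)). The module axioms and the expansion are identities between additive maps, so
  they are checked on pure tensors.\<close>

lemma coord_basis_tensor_base_change:
  assumes R: "cring R" and s: "\<sigma> \<in> ring_hom k R" and N: "module k N"
    and B: "coord_basis k N n b c"
  shows "\<exists>c'. coord_basis R (tensor_module k (algebra_module R \<sigma>) N (\<lambda>a b. a \<otimes>\<^bsub>R\<^esub> b)) n
        (\<lambda>i. pure_tensor k (algebra_module R \<sigma>) N \<one>\<^bsub>R\<^esub> (b i)) c'"
proof -
  interpret R: cring R by fact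
  interpret N: module k N by fact
  define T where "T = tensor_module k (algebra_module R \<sigma>) N (\<lambda>a b. a \<otimes>\<^bsub>R\<^esub> b)"
  have k: "cring k" using N by (simp add: module_def)
  interpret t: tensor_product k "algebra_module R \<sigma>" N
    using module_algebra_module[OF R k s] N by (simp add: tensor_product_def)
  interpret T: abelian_group T unfolding T_def by (rule t.abelian_group_T)
  have pc: "t.pure a v \<in> carrier T" if "a \<in> carrier R" "v \<in> carrier N" for a v
    unfolding T_def using that by (intro t.pure_closed) auto
  have sma: "additive_map T T (\<lambda>t. a \<odot>\<^bsub>T\<^esub> t)" if "a \<in> carrier R" for a
    unfolding T_def by (rule tensor_base_change_smult(1)[OF R s N that])
  have smp: "a \<odot>\<^bsub>T\<^esub> t.pure x v = t.pure (a \<otimes>\<^bsub>R\<^esub> x) v" if "a \<in> carrier R" "x \<in> carrier R" "v \<in> carrier N" for a x v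
    unfolding T_def by (rule tensor_base_change_smult(2)[OF R s N that])
  have T_ext: "f A = g A" if "abelian_group Q" "additive_map T Q f" "additive_map T Q g"
      "\<And>m v. m \<in> carrier R \<Longrightarrow> v \<in> carrier N \<Longrightarrow> f (t.pure m v) = g (t.pure m v)" "A \<in> carrier T" for Q f g A
    using t.additive_ext[of Q "\<lambda>a b. a \<otimes>\<^bsub>R\<^esub> b" f g A] that by (simp add: T_def)
  note Tab = T.abelian_group_axioms
  have pl: "t.pure (a \<oplus>\<^bsub>R\<^esub> b) v = t.pure a v \<oplus>\<^bsub>T\<^esub> t.pure b v"
    if "a \<in> carrier R" "b \<in> carrier R" "v \<in> carrier N" for a b v
    unfolding T_def using that t.pure_add_left[of a b v] by simp
  have smc: "a \<odot>\<^bsub>T\<^esub> x \<in> carrier T" if "a \<in> carrier R" "x \<in> carrier T" for a x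
    by (rule additive_closed[OF sma[OF that(1)] that(2)])
  interpret T: module R T
  proof (intro module.intro R Tab module_axioms.intro)
    fix a x assume a: "a \<in> carrier R" and x: "x \<in> carrier T"
    show "a \<odot>\<^bsub>T\<^esub> x \<in> carrier T" by (rule smc[OF a x])
    { fix y assume y: "y \<in> carrier T"
      show "a \<odot>\<^bsub>T\<^esub> (x \<oplus>\<^bsub>T\<^esub> y) = a \<odot>\<^bsub>T\<^esub> x \<oplus>\<^bsub>T\<^esub> a \<odot>\<^bsub>T\<^esub> y" by (rule additive_add[OF sma[OF a] x y]) }
    fix b assume b: "b \<in> carrier R"
    show "(a \<oplus>\<^bsub>R\<^esub> b) \<odot>\<^bsub>T\<^esub> x = a \<odot>\<^bsub>T\<^esub> x \<oplus>\<^bsub>T\<^esub> b \<odot>\<^bsub>T\<^esub> x"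
    proof (rule T_ext[of T "\<lambda>x. (a \<oplus>\<^bsub>R\<^esub> b) \<odot>\<^bsub>T\<^esub> x", OF Tab sma _ _ x])
      show "additive_map T T (\<lambda>x. a \<odot>\<^bsub>T\<^esub> x \<oplus>\<^bsub>T\<^esub> b \<odot>\<^bsub>T\<^esub> x)"
        unfolding additive_map_def
        using smc a b by (auto simp: additive_add[OF sma] T.a_ac)
    qed (use a b in \<open>simp_all add: smp pl R.l_distr\<close>)
    show "a \<otimes>\<^bsub>R\<^esub> b \<odot>\<^bsub>T\<^esub> x = a \<odot>\<^bsub>T\<^esub> (b \<odot>\<^bsub>T\<^esub> x)"
      by (rule T_ext[of T "\<lambda>x. (a \<otimes>\<^bsub>R\<^esub> b) \<odot>\<^bsub>T\<^esub> x", OF Tab sma additive_compose[OF sma sma] _ x])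
        (use a b in \<open>simp_all add: smp R.m_assoc\<close>)
  next
    fix x assume x: "x \<in> carrier T"
    have "additive_map T T (\<lambda>x. x)" by (simp add: additive_map_def)
    then show "\<one>\<^bsub>R\<^esub> \<odot>\<^bsub>T\<^esub> x = x"
      by (rule T_ext[of T "\<lambda>x. \<one>\<^bsub>R\<^esub> \<odot>\<^bsub>T\<^esub> x", OF Tab sma[OF R.one_closed] _ _ x]) (simp_all add: smp)
  qed
  interpret B: coord_basis k N n b c by (rule B)
  have sgc: "\<sigma> a \<in> carrier R" if "a \<in> carrier k" for a using ring_hom_closed[OF s that] .
  have "\<exists>h. additive_map T R h \<and> (\<forall>a\<in>carrier R. \<forall>v\<in>carrier N. h (t.pure a v) = a \<otimes>\<^bsub>R\<^esub> \<sigma> (c i v))" if i: "i < n" for i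
  proof (rule t.tensor_universal[of R "\<lambda>a v. a \<otimes>\<^bsub>R\<^esub> \<sigma> (c i v)" "\<lambda>a b. a \<otimes>\<^bsub>R\<^esub> b", OF R.abelian_group_axioms])
    show "additive_map (algebra_module R \<sigma>) R (\<lambda>a. a \<otimes>\<^bsub>R\<^esub> \<sigma> (c i v))" if "v \<in> carrier N" for v
      using sgc[OF B.c_closed[OF i that]] by (simp add: additive_map_def R.l_distr)
    show "additive_map N R (\<lambda>v. a \<otimes>\<^bsub>R\<^esub> \<sigma> (c i v))" if "a \<in> carrier (algebra_module R \<sigma>)" for a
      using that sgc B.c_closed[OF i] ring_hom_add[OF s] by (simp add: additive_map_def R.r_distr B.c_add[OF i])
    show "(r \<odot>\<^bsub>algebra_module R \<sigma>\<^esub> a) \<otimes>\<^bsub>R\<^esub> \<sigma> (c i v) = a \<otimes>\<^bsub>R\<^esub> \<sigma> (c i (r \<odot>\<^bsub>N\<^esub> v))"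
      if "r \<in> carrier k" "a \<in> carrier (algebra_module R \<sigma>)" "v \<in> carrier N" for r a v
      using that sgc B.c_closed[OF i] ring_hom_mult[OF s] by (simp add: B.c_smult[OF i] R.m_ac)
  qed (auto simp: T_def)
  then have "\<forall>i\<in>{..<n}. \<exists>h. additive_map T R h \<and> (\<forall>a\<in>carrier R. \<forall>v\<in>carrier N. h (t.pure a v) = a \<otimes>\<^bsub>R\<^esub> \<sigma> (c i v))"
    by simp
  from bchoice[OF this] obtain c' where c':
    "\<forall>i\<in>{..<n}. additive_map T R (c' i) \<and> (\<forall>a\<in>carrier R. \<forall>v\<in>carrier N. c' i (t.pure a v) = a \<otimes>\<^bsub>R\<^esub> \<sigma> (c i v))" ..
  have ca: "additive_map T R (c' i)" and cp: "\<And>a v. a \<in> carrier R \<Longrightarrow> v \<in> carrier N \<Longrightarrow> c' i (t.pure a v) = a \<otimes>\<^bsub>R\<^esub> \<sigma> (c i v)"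
    if "i < n" for i using c' that by simp_all
  have cc: "c' i x \<in> carrier R" if "i < n" "x \<in> carrier T" for i x using additive_closed[OF ca[OF that(1)] that(2)] .
  have "coord_basis R T n (\<lambda>i. t.pure \<one>\<^bsub>R\<^esub> (b i)) c'"
  proof
    fix i assume i: "i < n"
    show "t.pure \<one>\<^bsub>R\<^esub> (b i) \<in> carrier T" by (rule pc[OF R.one_closed B.b_closed[OF i]])
    show "c' i \<in> carrier T \<rightarrow> carrier R" using cc[OF i] by blast
    fix x assume x: "x \<in> carrier T"
    show "c' i (x \<oplus>\<^bsub>T\<^esub> y) = c' i x \<oplus>\<^bsub>R\<^esub> c' i y" if "y \<in> carrier T" for y by (rule additive_add[OF ca[OF i] x that])
    fix a assume a: "a \<in> carrier R"
    show "c' i (a \<odot>\<^bsub>T\<^esub> x) = a \<otimes>\<^bsub>R\<^esub> c' i x"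
    proof (rule T_ext[OF R.abelian_group_axioms additive_compose[OF sma[OF a] ca[OF i]] _ _ x])
      show "additive_map T R (\<lambda>x. a \<otimes>\<^bsub>R\<^esub> c' i x)"
        using a cc[OF i] by (simp add: additive_map_def R.r_distr additive_add[OF ca[OF i]])
    qed (use a sgc B.c_closed i in \<open>simp add: smp cp R.m_assoc\<close>)
  next
    fix i j assume ij: "i < n" "j < n"
    have "\<sigma> \<zero>\<^bsub>k\<^esub> = \<zero>\<^bsub>R\<^esub>" using ring_hom_zero[OF s] k R by (simp add: cring_def)
    then show "c' i (t.pure \<one>\<^bsub>R\<^esub> (b j)) = (if i = j then \<one>\<^bsub>R\<^esub> else \<zero>\<^bsub>R\<^esub>)"
      using ij ring_hom_one[OF s] by (simp add: cp B.b_closed B.c_b)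
  next
    fix x assume x: "x \<in> carrier T"
    have i: "additive_map T T (\<lambda>x. x)" by (simp add: additive_map_def)
    have e: "additive_map T T (\<lambda>x. \<Oplus>\<^bsub>T\<^esub>i\<in>{..<n}. c' i x \<odot>\<^bsub>T\<^esub> t.pure \<one>\<^bsub>R\<^esub> (b i))"
      by (intro additive_finsum_fun Tab additive_compose[OF ca additive_smult_left[OF T.module_axioms pc]])
        (auto simp: B.b_closed)
    show "x = (\<Oplus>\<^bsub>T\<^esub>i\<in>{..<n}. c' i x \<odot>\<^bsub>T\<^esub> t.pure \<one>\<^bsub>R\<^esub> (b i))"
    proof (rule T_ext[OF Tab i e _ x])
      fix a v assume a: "a \<in> carrier R" and v: "v \<in> carrier N"
      have pr: "additive_map N T (\<lambda>v. t.pure a v)" unfolding T_def using a by (intro t.pure_additive_right) simp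
      have "t.pure a v = t.pure a (\<Oplus>\<^bsub>N\<^esub>i\<in>{..<n}. c i v \<odot>\<^bsub>N\<^esub> b i)" using B.expand[OF v] by simp
      also have "\<dots> = (\<Oplus>\<^bsub>T\<^esub>i\<in>{..<n}. t.pure a (c i v \<odot>\<^bsub>N\<^esub> b i))"
        using v B.c_closed B.b_closed by (intro additive_finsum[OF N.M.abelian_group_axioms Tab pr]) auto
      also have "\<dots> = (\<Oplus>\<^bsub>T\<^esub>i\<in>{..<n}. c' i (t.pure a v) \<odot>\<^bsub>T\<^esub> t.pure \<one>\<^bsub>R\<^esub> (b i))"
      proof (rule T.finsum_cong')
        fix i assume "i \<in> {..<n}"
        then show "t.pure a (c i v \<odot>\<^bsub>N\<^esub> b i) = c' i (t.pure a v) \<odot>\<^bsub>T\<^esub> t.pure \<one>\<^bsub>R\<^esub> (b i)"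
          using a v sgc B.c_closed B.b_closed t.pure_smult[of "c i v" a "b i"] by (simp add: cp smp R.m_comm)
      qed (use a v cc pc B.b_closed in auto)
      finally show "t.pure a v = (\<Oplus>\<^bsub>T\<^esub>i\<in>{..<n}. c' i (t.pure a v) \<odot>\<^bsub>T\<^esub> t.pure \<one>\<^bsub>R\<^esub> (b i))" .
    qed
  qed
  then show "\<exists>c'. coord_basis R (tensor_module k (algebra_module R \<sigma>) N (\<lambda>a b. a \<otimes>\<^bsub>R\<^esub> b)) n
        (\<lambda>i. t.pure \<one>\<^bsub>R\<^esub> (b i)) c'" unfolding T_def by (rule exI[of _ c'])
qed

text \<open>When the basis elements are compatible with restriction, restriction acts on coordinates
  by the restriction of functions. The presheaf is then a copy of n-tuples of functions, and
  sections are glued coordinate by coordinate.\<close>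

lemma (in ringed_space) free_presheaf_sheaf:
  assumes B: "\<And>U. openin (pts S) U \<Longrightarrow> \<exists>c. coord_basis (sec_ring S U) (sec P U) n (e U) c"
    and add: "\<And>U V. openin (pts S) U \<Longrightarrow> openin (pts S) V \<Longrightarrow> V \<subseteq> U
      \<Longrightarrow> additive_map (sec P U) (sec P V) (mres P U V)"
    and smult: "\<And>U V a i. openin (pts S) U \<Longrightarrow> openin (pts S) V \<Longrightarrow> V \<subseteq> U \<Longrightarrow> a \<in> carrier (sec_ring S U) \<Longrightarrow> i < n
      \<Longrightarrow> mres P U V (a \<odot>\<^bsub>sec P U\<^esub> e U i) = ring_res S U V a \<odot>\<^bsub>sec P V\<^esub> e V i"
  shows "sheaf_of_modules S P"
proof -
  obtain c where c: "\<And>U. openin (pts S) U \<Longrightarrow> coord_basis (sec_ring S U) (sec P U) n (e U) (c U)"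
    using B by metis
  have cc: "c U i x \<in> carrier (sec_ring S U)" if "openin (pts S) U" "i < n" "x \<in> carrier (sec P U)" for U i x
    using coord_basis.c_closed[OF c that(2,3)] that(1) by blast
  have eqI: "x = y" if U: "openin (pts S) U" and x: "x \<in> carrier (sec P U)" and y: "y \<in> carrier (sec P U)"
    and e: "\<And>i. i < n \<Longrightarrow> c U i x = c U i y" for U x y
  proof -
    interpret B: coord_basis "sec_ring S U" "sec P U" n "e U" "c U" by (rule c[OF U])
    have "x = (\<Oplus>\<^bsub>sec P U\<^esub>i\<in>{..<n}. c U i x \<odot>\<^bsub>sec P U\<^esub> e U i)" by (rule B.expand[OF x])
    also have "\<dots> = (\<Oplus>\<^bsub>sec P U\<^esub>i\<in>{..<n}. c U i y \<odot>\<^bsub>sec P U\<^esub> e U i)"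
      using e B.c_closed[OF _ y] B.b_closed by (intro B.M.finsum_cong') auto
    also have "\<dots> = y" by (rule B.expand[OF y, symmetric])
    finally show ?thesis .
  qed
  have nat: "c V i (mres P U V x) = ring_res S U V (c U i x)"
    if U: "openin (pts S) U" "openin (pts S) V" "V \<subseteq> U" and x: "x \<in> carrier (sec P U)" and i: "i < n" for U V x i
  proof -
    interpret B: coord_basis "sec_ring S U" "sec P U" n "e U" "c U" by (rule c[OF U(1)])
    interpret B': coord_basis "sec_ring S V" "sec P V" n "e V" "c V" by (rule c[OF U(2)])
    have "mres P U V x = mres P U V (\<Oplus>\<^bsub>sec P U\<^esub>j\<in>{..<n}. c U j x \<odot>\<^bsub>sec P U\<^esub> e U j)"
      using B.expand[OF x] by simp
    also have "\<dots> = (\<Oplus>\<^bsub>sec P V\<^esub>j\<in>{..<n}. mres P U V (c U j x \<odot>\<^bsub>sec P U\<^esub> e U j))"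
      using B.c_closed[OF _ x] B.b_closed
      by (intro additive_finsum[OF B.M.abelian_group_axioms B'.M.abelian_group_axioms add[OF U]]) auto
    also have "\<dots> = (\<Oplus>\<^bsub>sec P V\<^esub>j\<in>{..<n}. ring_res S U V (c U j x) \<odot>\<^bsub>sec P V\<^esub> e V j)"
      using B.c_closed[OF _ x] B'.b_closed ring_res_closed[OF U] by (intro B'.M.finsum_cong') (auto simp: smult[OF U])
    finally show ?thesis using B'.c_lincomb[OF i] ring_res_closed[OF U] B.c_closed[OF _ x] by simp
  qed
  note rc = additive_closed[OF add]
  have "presheaf (pts S) (\<lambda>U. carrier (sec P U)) (mres P)"
  proof (unfold_locales, goal_cases)
    case 1 then show ?case by (intro rc)
  next
    case (2 U x)
    then show ?case by (intro eqI[OF 2(1) rc[OF 2(1,1) order_refl]]) (simp_all add: nat cc O.res_id)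
  next
    case (3 U V W x)
    then have "W \<subseteq> U" by blast
    then show ?case using 3 by (intro eqI[OF 3(3)] rc) (simp_all add: nat cc O.res_comp rc)
  qed
  moreover have "sheaf_axioms (pts S) (\<lambda>U. carrier (sec P U)) (mres P)"
  proof
    fix C s
    assume C: "\<forall>U\<in>C. openin (pts S) U" "\<forall>U\<in>C. s U \<in> carrier (sec P U)"
      and comp: "\<forall>U\<in>C. \<forall>V\<in>C. mres P U (U \<inter> V) (s U) = mres P V (U \<inter> V) (s V)"
    have oC: "openin (pts S) (\<Union>C)" using C(1) by blast
    interpret B: coord_basis "sec_ring S (\<Union>C)" "sec P (\<Union>C)" n "e (\<Union>C)" "c (\<Union>C)" by (rule c[OF oC])
    have ex: "\<exists>!t. t \<in> carrier (sec_ring S (\<Union>C)) \<and> (\<forall>U\<in>C. ring_res S (\<Union>C) U t = c U i (s U))" if i: "i < n" for i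
    proof (rule O.glue)
      show "\<forall>U\<in>C. \<forall>V\<in>C. ring_res S U (U \<inter> V) (c U i (s U)) = ring_res S V (U \<inter> V) (c V i (s V))"
      proof (intro ballI)
        fix U V assume UV: "U \<in> C" "V \<in> C"
        then have o: "openin (pts S) U" "openin (pts S) V" "openin (pts S) (U \<inter> V)"
          and m: "s U \<in> carrier (sec P U)" "s V \<in> carrier (sec P V)" using C by auto
        show "ring_res S U (U \<inter> V) (c U i (s U)) = ring_res S V (U \<inter> V) (c V i (s V))"
          using nat[OF o(1,3) _ m(1) i] nat[OF o(2,3) _ m(2) i] comp[rule_format, OF UV] by simp
      qed
    qed (use C cc[OF _ i] in auto)
    define t where "t i = (THE t. t \<in> carrier (sec_ring S (\<Union>C)) \<and> (\<forall>U\<in>C. ring_res S (\<Union>C) U t = c U i (s U)))" for i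
    have t: "t i \<in> carrier (sec_ring S (\<Union>C))" "\<And>U. U \<in> C \<Longrightarrow> ring_res S (\<Union>C) U (t i) = c U i (s U)" if "i < n" for i
      using theI'[OF ex[OF that]] by (simp_all add: t_def)
    define x where "x = (\<Oplus>\<^bsub>sec P (\<Union>C)\<^esub>i\<in>{..<n}. t i \<odot>\<^bsub>sec P (\<Union>C)\<^esub> e (\<Union>C) i)"
    have x: "x \<in> carrier (sec P (\<Union>C))" "c (\<Union>C) i x = t i" if "i < n" for i
      unfolding x_def using t(1) that by (intro B.c_lincomb B.lincomb_closed'; auto)+
    have xc: "x \<in> carrier (sec P (\<Union>C))" unfolding x_def using t(1) by (intro B.lincomb_closed') auto
    show "\<exists>!t. t \<in> carrier (sec P (\<Union>C)) \<and> (\<forall>U\<in>C. mres P (\<Union>C) U t = s U)"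
    proof (rule ex1I[of _ x], intro conjI ballI xc)
      fix U assume U: "U \<in> C"
      then have o: "openin (pts S) U" "U \<subseteq> \<Union>C" "s U \<in> carrier (sec P U)" using C by auto
      show "mres P (\<Union>C) U x = s U"
        by (rule eqI[OF o(1) rc[OF oC o(1,2) xc] o(3)]) (simp add: nat[OF oC o(1,2) xc] x t(2)[OF _ U])
    next
      fix y assume y: "y \<in> carrier (sec P (\<Union>C)) \<and> (\<forall>U\<in>C. mres P (\<Union>C) U y = s U)"
      show "y = x"
      proof (rule eqI[OF oC _ xc])
        show "y \<in> carrier (sec P (\<Union>C))" using y by blast
        fix i assume i: "i < n"
        have "ring_res S (\<Union>C) U (c (\<Union>C) i y) = c U i (s U)" if U: "U \<in> C" for U
        proof -
          have o: "openin (pts S) U" "U \<subseteq> \<Union>C" using C(1) U by auto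
          show ?thesis using nat[OF oC o _ i, of y] y U by simp
        qed
        moreover have "c (\<Union>C) i y \<in> carrier (sec_ring S (\<Union>C))" using cc[OF oC i] y by blast
        ultimately show "c (\<Union>C) i y = c (\<Union>C) i x"
          using ex[OF i] t[OF i] x(2)[OF i] by (simp only:) blast
      qed
    qed
  qed
  ultimately have "sheaf (pts S) (\<lambda>U. carrier (sec P U)) (mres P)" by (simp add: sheaf_def)
  moreover have "mres P U V (a \<odot>\<^bsub>sec P U\<^esub> m) = ring_res S U V a \<odot>\<^bsub>sec P V\<^esub> mres P U V m"
    if U: "openin (pts S) U" "openin (pts S) V" "V \<subseteq> U" and a: "a \<in> carrier (sec_ring S U)" and m: "m \<in> carrier (sec P U)" for U V a m
  proof -
    interpret B: coord_basis "sec_ring S U" "sec P U" n "e U" "c U" by (rule c[OF U(1)])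
    interpret B': coord_basis "sec_ring S V" "sec P V" n "e V" "c V" by (rule c[OF U(2)])
    show ?thesis
      by (rule eqI[OF U(2)])
        (use a m in \<open>simp_all add: rc[OF U] ring_res_closed[OF U] nat[OF U] B.c_smult B'.c_smult B.c_closed ring_hom_mult[OF res_ring_hom[OF U]]\<close>)
  qed
  moreover have "module (sec_ring S U) (sec P U)" if "openin (pts S) U" for U
    using c[OF that] by (simp add: coord_basis_def)
  ultimately show ?thesis
    using ringed_space_axioms additive_add[OF add] by (simp add: sheaf_of_modules_def sheaf_of_modules_axioms_def)
qed

section \<open>The sheaf O(V) with its basis and action\<close>

locale representation_sheaf = ringed_space S + V: group_rep k G V \<rho> + B: coord_basis k V n b c
  for k :: "'k ring" and S :: "('x, 'r) rspace" and p :: "'x \<Rightarrow> 'k set"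
    and \<phi> :: "'k set set \<Rightarrow> ('k set \<Rightarrow> ('k \<times> 'k) set) \<Rightarrow> 'r"
    and G :: "'g monoid" and V :: "('k, 'v) module" and \<rho> :: "'g \<Rightarrow> 'v \<Rightarrow> 'v" and n b c +
  assumes over_k: "scheme_over k S p \<phi>"
begin

abbreviation sc where "sc \<equiv> scalar_section k S \<phi>"
abbreviation Ok where "Ok U \<equiv> algebra_module (sec_ring S U) (sc U)"
abbreviation pure where "pure U \<equiv> pure_tensor k (Ok U) V"

definition rep_pre :: "('x, 'r, (('r \<times> 'v) \<Rightarrow>\<^sub>0 int) set, 'g) gmsheaf"
  where "rep_pre = \<lparr>sec = (\<lambda>U. tensor_module k (Ok U) V (\<lambda>a b. a \<otimes>\<^bsub>sec_ring S U\<^esub> b)),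
       mres = (\<lambda>U W. tensor_map k (Ok W) V (ring_res S U W) id),
       act = (\<lambda>g U. tensor_map k (Ok U) V id (\<rho> g))\<rparr>"

lemma rep_sheaf_eq: "rep_sheaf k S \<phi> V \<rho> = sheafification S rep_pre"
  by (simp add: rep_sheaf_def rep_pre_def Let_def)

lemma cring_k: "cring k" by (rule V.R.cring_axioms)

lemma sc_hom: "openin (pts S) U \<Longrightarrow> sc U \<in> ring_hom k (sec_ring S U)"
  by (rule scalar_section_hom[OF cring_k over_k])

lemma tensor_product_V: "openin (pts S) U \<Longrightarrow> tensor_product k (Ok U) V"
  using module_algebra_module[OF sec_cring cring_k sc_hom] V.module_axioms by (simp add: tensor_product_def)

lemma rep_pre_abelian: "openin (pts S) U \<Longrightarrow> abelian_group (sec rep_pre U)"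
  using tensor_product.abelian_group_T[OF tensor_product_V] by (simp add: rep_pre_def)

lemma pure_closed: "openin (pts S) U \<Longrightarrow> a \<in> carrier (sec_ring S U) \<Longrightarrow> v \<in> carrier V \<Longrightarrow> pure U a v \<in> carrier (sec rep_pre U)"
  using tensor_product.pure_closed[OF tensor_product_V, of U a v "\<lambda>a b. a \<otimes>\<^bsub>sec_ring S U\<^esub> b"] by (simp add: rep_pre_def)

lemma rep_pre_ext:
  assumes "openin (pts S) U" "abelian_group Q" "additive_map (sec rep_pre U) Q f" "additive_map (sec rep_pre U) Q g"
    and "\<And>a v. a \<in> carrier (sec_ring S U) \<Longrightarrow> v \<in> carrier V \<Longrightarrow> f (pure U a v) = g (pure U a v)"
    and "A \<in> carrier (sec rep_pre U)"
  shows "f A = g A"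
  using tensor_product.additive_ext[OF tensor_product_V[OF assms(1)], of Q "\<lambda>a b. a \<otimes>\<^bsub>sec_ring S U\<^esub> b" f g A] assms(2-6)
  by (simp add: rep_pre_def)

lemma
  assumes U: "openin (pts S) U" and a: "a \<in> carrier (sec_ring S U)"
  shows smult_additive: "additive_map (sec rep_pre U) (sec rep_pre U) (\<lambda>t. a \<odot>\<^bsub>sec rep_pre U\<^esub> t)"
    and smult_pure: "\<lbrakk>x \<in> carrier (sec_ring S U); v \<in> carrier V\<rbrakk>
      \<Longrightarrow> a \<odot>\<^bsub>sec rep_pre U\<^esub> pure U x v = pure U (a \<otimes>\<^bsub>sec_ring S U\<^esub> x) v"
  using tensor_base_change_smult[OF sec_cring[OF U] sc_hom[OF U] V.module_axioms a] by (simp_all add: rep_pre_def)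

lemma rep_pre_basis: "openin (pts S) U \<Longrightarrow> \<exists>c'. coord_basis (sec_ring S U) (sec rep_pre U) n (\<lambda>i. pure U \<one>\<^bsub>sec_ring S U\<^esub> (b i)) c'"
  using coord_basis_tensor_base_change[OF sec_cring sc_hom V.module_axioms B.coord_basis_axioms] by (simp add: rep_pre_def)

lemma
  assumes U: "openin (pts S) U" "openin (pts S) W" "W \<subseteq> U"
  shows rep_pre_res_additive: "additive_map (sec rep_pre U) (sec rep_pre W) (mres rep_pre U W)"
    and rep_pre_res_pure: "\<lbrakk>a \<in> carrier (sec_ring S U); v \<in> carrier V\<rbrakk> \<Longrightarrow> mres rep_pre U W (pure U a v) = pure W (ring_res S U W a) v"
proof -
  have f: "additive_map (Ok U) (Ok W) (ring_res S U W)"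
    using ring_hom_add[OF res_ring_hom[OF U]] ring_res_closed[OF U] by (simp add: additive_map_def)
  have g: "additive_map V V id" by (simp add: additive_map_def)
  have bal: "pure W (ring_res S U W (r \<odot>\<^bsub>Ok U\<^esub> a)) (id v) = pure W (ring_res S U W a) (id (r \<odot>\<^bsub>V\<^esub> v))"
    if "r \<in> carrier k" "a \<in> carrier (Ok U)" "v \<in> carrier V" for r a v
    using that tensor_product.pure_smult[OF tensor_product_V[OF U(2)], of r "ring_res S U W a" v]
      ring_hom_mult[OF res_ring_hom[OF U]] ring_res_closed[OF U] ring_hom_closed[OF sc_hom[OF U(1)]]
      scalar_section_res[OF cring_k over_k U] by simp
  show "additive_map (sec rep_pre U) (sec rep_pre W) (mres rep_pre U W)"
    unfolding rep_pre_def by simp (rule tensor_map_additive[OF tensor_product_V[OF U(1)] tensor_product_V[OF U(2)] f g bal])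
  show "mres rep_pre U W (pure U a v) = pure W (ring_res S U W a) v" if "a \<in> carrier (sec_ring S U)" "v \<in> carrier V"
    using tensor_map_pure[OF tensor_product_V[OF U(1)] tensor_product_V[OF U(2)] f g bal, of a v] that by (simp add: rep_pre_def id_def)
qed

lemma
  assumes g: "g \<in> carrier G" and U: "openin (pts S) U"
  shows rep_pre_act_additive: "additive_map (sec rep_pre U) (sec rep_pre U) (act rep_pre g U)"
    and rep_pre_act_pure: "\<lbrakk>a \<in> carrier (sec_ring S U); v \<in> carrier V\<rbrakk> \<Longrightarrow> act rep_pre g U (pure U a v) = pure U a (\<rho> g v)"
proof -
  have f: "additive_map (Ok U) (Ok U) id" by (simp add: additive_map_def)
  note r = module_hom_additive[OF V.rep_hom[OF g]]
  have bal: "pure U (id (r \<odot>\<^bsub>Ok U\<^esub> a)) (\<rho> g v) = pure U (id a) (\<rho> g (r \<odot>\<^bsub>V\<^esub> v))"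
    if "r \<in> carrier k" "a \<in> carrier (Ok U)" "v \<in> carrier V" for r a v
    using that tensor_product.pure_smult[OF tensor_product_V[OF U], of r a "\<rho> g v"] additive_closed[OF r]
      module_hom_smult[OF V.rep_hom[OF g]] by simp
  show "additive_map (sec rep_pre U) (sec rep_pre U) (act rep_pre g U)"
    unfolding rep_pre_def by simp (rule tensor_map_additive[OF tensor_product_V[OF U] tensor_product_V[OF U] f r bal])
  show "act rep_pre g U (pure U a v) = pure U a (\<rho> g v)" if "a \<in> carrier (sec_ring S U)" "v \<in> carrier V"
    using tensor_map_pure[OF tensor_product_V[OF U] tensor_product_V[OF U] f r bal, of a v] that by (simp add: rep_pre_def id_def)
qed

lemma rho_closed: "g \<in> carrier G \<Longrightarrow> v \<in> carrier V \<Longrightarrow> \<rho> g v \<in> carrier V"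
  using module_hom_apply[OF V.rep_hom] .

text \<open>The presheaf of tensor products of O with V is free on the sections 1 \<otimes> b_i, so
  passing to its sheafification changes nothing up to isomorphism.\<close>

lemma rep_pre_sheaf: "sheaf_of_modules S rep_pre"
proof (rule free_presheaf_sheaf[where e = "\<lambda>U i. pure U \<one>\<^bsub>sec_ring S U\<^esub> (b i)"])
  show "mres rep_pre U W (a \<odot>\<^bsub>sec rep_pre U\<^esub> pure U \<one>\<^bsub>sec_ring S U\<^esub> (b i))
      = ring_res S U W a \<odot>\<^bsub>sec rep_pre W\<^esub> pure W \<one>\<^bsub>sec_ring S W\<^esub> (b i)"
    if U: "openin (pts S) U" "openin (pts S) W" "W \<subseteq> U" and a: "a \<in> carrier (sec_ring S U)" and i: "i < n" for U W a i
  proof -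
    interpret RU: cring "sec_ring S U" by (rule sec_cring[OF U(1)])
    interpret RW: cring "sec_ring S W" by (rule sec_cring[OF U(2)])
    show ?thesis using U a B.b_closed[OF i] ring_res_closed[OF U a] by (simp add: smult_pure rep_pre_res_pure)
  qed
qed (auto simp: rep_pre_basis rep_pre_res_additive)

sublocale rep_pre: sheaf_of_modules S rep_pre by (rule rep_pre_sheaf)

lemma rep_pre_act_res:
  assumes g: "g \<in> carrier G" and U: "openin (pts S) U" "openin (pts S) W" "W \<subseteq> U" and A: "A \<in> carrier (sec rep_pre U)"
  shows "mres rep_pre U W (act rep_pre g U A) = act rep_pre g W (mres rep_pre U W A)"
  by (rule rep_pre_ext[OF U(1) rep_pre_abelian[OF U(2)] additive_compose[OF rep_pre_act_additive[OF g U(1)] rep_pre_res_additive[OF U]]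
        additive_compose[OF rep_pre_res_additive[OF U] rep_pre_act_additive[OF g U(2)]] _ A])
    (use U g in \<open>simp add: rep_pre_res_pure rep_pre_act_pure rho_closed ring_res_closed\<close>)

abbreviation RS where "RS \<equiv> rep_sheaf k S \<phi> V \<rho>"

lemma RS_sheaf: "sheaf_of_modules S RS"
  unfolding rep_sheaf_eq by (rule sheafification_sheaf[OF rep_pre_sheaf])

lemma unit_map_RS:
  assumes U: "openin (pts S) U"
  shows "unit_map S rep_pre U \<in> module_hom (sec_ring S U) (sec rep_pre U) (sec RS U)"
    and "bij_betw (unit_map S rep_pre U) (carrier (sec rep_pre U)) (carrier (sec RS U))"
    and "\<And>W m. openin (pts S) W \<Longrightarrow> W \<subseteq> U \<Longrightarrow> m \<in> carrier (sec rep_pre U)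
      \<Longrightarrow> mres RS U W (unit_map S rep_pre U m) = unit_map S rep_pre W (mres rep_pre U W m)"
  using unit_map_isomorphism[OF rep_pre_sheaf] U unfolding mod_isomorphism_def rep_sheaf_eq by simp_all

text \<open>The sections 1 \<otimes> b_i, seen in the sheafification. Over every open set they are a
  basis of O(V), compatible with restriction.\<close>

definition e where "e U i = unit_map S rep_pre U (pure U \<one>\<^bsub>sec_ring S U\<^esub> (b i))"

lemma one_closed: "openin (pts S) U \<Longrightarrow> \<one>\<^bsub>sec_ring S U\<^esub> \<in> carrier (sec_ring S U)"
  using monoid.one_closed[OF sec_monoids(2)] .

lemma RS_basis:
  assumes U: "openin (pts S) U"
  obtains c' where "coord_basis (sec_ring S U) (sec RS U) n (e U) c'"
proof -
  obtain c0 where "coord_basis (sec_ring S U) (sec rep_pre U) n (\<lambda>i. pure U \<one>\<^bsub>sec_ring S U\<^esub> (b i)) c0"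
    using rep_pre_basis[OF U] ..
  from that[OF coord_basis_transport[OF this sheaf_of_modules.sec_module[OF RS_sheaf U] unit_map_RS(1,2)[OF U], folded e_def]]
  show thesis .
qed

lemma RS_res_e: "openin (pts S) U \<Longrightarrow> openin (pts S) W \<Longrightarrow> W \<subseteq> U \<Longrightarrow> i < n \<Longrightarrow> mres RS U W (e U i) = e W i"
  unfolding e_def
  by (simp add: unit_map_RS(3) pure_closed one_closed B.b_closed rep_pre_res_pure ring_hom_one[OF res_ring_hom])

lemma RS_act: "g \<in> carrier G \<Longrightarrow> openin (pts S) U \<Longrightarrow> m \<in> carrier (sec rep_pre U)
    \<Longrightarrow> act RS g U (unit_map S rep_pre U m) = unit_map S rep_pre U (act rep_pre g U m)"
  unfolding rep_sheaf_eq
  by (intro unit_map_act[OF rep_pre_sheaf]) (auto simp: rep_pre_act_res intro: additive_closed[OF rep_pre_act_additive])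

lemma RS_act_e:
  assumes g: "g \<in> carrier G" and U: "openin (pts S) U" and i: "i < n"
  shows "act RS g U (e U i) = (\<Oplus>\<^bsub>sec RS U\<^esub>l\<in>{..<n}. sc U (c l (\<rho> g (b i))) \<odot>\<^bsub>sec RS U\<^esub> e U l)"
proof -
  interpret N: module "sec_ring S U" "sec rep_pre U" by (rule rep_pre.sec_module[OF U])
  interpret RSM: module "sec_ring S U" "sec RS U" by (rule sheaf_of_modules.sec_module[OF RS_sheaf U])
  interpret t: tensor_product k "Ok U" V by (rule tensor_product_V[OF U])
  let ?e = "\<lambda>l. pure U \<one>\<^bsub>sec_ring S U\<^esub> (b l)"
  let ?a = "\<lambda>l. c l (\<rho> g (b i))"
  have ec: "?e l \<in> carrier (sec rep_pre U)" if "l < n" for l by (rule pure_closed[OF U N.R.one_closed B.b_closed[OF that]])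
  have r: "\<rho> g (b i) \<in> carrier V" by (rule rho_closed[OF g B.b_closed[OF i]])
  have ac: "?a l \<in> carrier k" "sc U (?a l) \<in> carrier (sec_ring S U)" if "l < n" for l
    using B.c_closed[OF that r] ring_hom_closed[OF sc_hom[OF U]] by auto
  have pr: "additive_map V (sec rep_pre U) (\<lambda>v. pure U \<one>\<^bsub>sec_ring S U\<^esub> v)"
    using t.pure_additive_right[of "\<one>\<^bsub>sec_ring S U\<^esub>" "\<lambda>a b. a \<otimes>\<^bsub>sec_ring S U\<^esub> b"] by (simp add: rep_pre_def)
  have "act rep_pre g U (?e i) = pure U \<one>\<^bsub>sec_ring S U\<^esub> (\<Oplus>\<^bsub>V\<^esub>l\<in>{..<n}. ?a l \<odot>\<^bsub>V\<^esub> b l)"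
    using B.expand[OF r] rep_pre_act_pure[OF g U N.R.one_closed B.b_closed[OF i]] by simp
  also have "\<dots> = (\<Oplus>\<^bsub>sec rep_pre U\<^esub>l\<in>{..<n}. pure U \<one>\<^bsub>sec_ring S U\<^esub> (?a l \<odot>\<^bsub>V\<^esub> b l))"
    using ac B.b_closed by (intro additive_finsum[OF V.M.abelian_group_axioms N.M.abelian_group_axioms pr]) auto
  also have "\<dots> = (\<Oplus>\<^bsub>sec rep_pre U\<^esub>l\<in>{..<n}. sc U (?a l) \<odot>\<^bsub>sec rep_pre U\<^esub> ?e l)"
  proof (rule N.M.finsum_cong')
    fix l assume "l \<in> {..<n}"
    then show "pure U \<one>\<^bsub>sec_ring S U\<^esub> (?a l \<odot>\<^bsub>V\<^esub> b l) = sc U (?a l) \<odot>\<^bsub>sec rep_pre U\<^esub> ?e l"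
      using ac[of l] B.b_closed[of l] t.pure_smult[of "?a l" "\<one>\<^bsub>sec_ring S U\<^esub>" "b l"] U by (simp add: smult_pure)
  qed (use ac ec in auto)
  finally have "act RS g U (e U i) = unit_map S rep_pre U (\<Oplus>\<^bsub>sec rep_pre U\<^esub>l\<in>{..<n}. sc U (?a l) \<odot>\<^bsub>sec rep_pre U\<^esub> ?e l)"
    using RS_act[OF g U ec[OF i]] by (simp add: e_def)
  also have "\<dots> = (\<Oplus>\<^bsub>sec RS U\<^esub>l\<in>{..<n}. unit_map S rep_pre U (sc U (?a l) \<odot>\<^bsub>sec rep_pre U\<^esub> ?e l))"
    using ac ec
    by (intro additive_finsum[OF N.M.abelian_group_axioms RSM.M.abelian_group_axioms module_hom_additive[OF unit_map_RS(1)[OF U]]]) auto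
  also have "\<dots> = (\<Oplus>\<^bsub>sec RS U\<^esub>l\<in>{..<n}. sc U (?a l) \<odot>\<^bsub>sec RS U\<^esub> e U l)"
    using ac ec module_hom_apply[OF unit_map_RS(1)[OF U]]
    by (intro RSM.M.finsum_cong') (auto simp: module_hom_smult[OF unit_map_RS(1)[OF U]] e_def)
  finally show ?thesis .
qed

lemma RS_act_hom:
  assumes g: "g \<in> carrier G" and U: "openin (pts S) U"
  shows "act RS g U \<in> module_hom (sec_ring S U) (sec RS U) (sec RS U)"
proof -
  interpret N: module "sec_ring S U" "sec rep_pre U" by (rule rep_pre.sec_module[OF U])
  note u = unit_map_RS(1,2)[OF U]
  note uc = module_hom_apply[OF u(1)]
  note pa = rep_pre_act_additive[OF g U]
  have ex: "\<exists>m\<in>carrier (sec rep_pre U). s = unit_map S rep_pre U m" if "s \<in> carrier (sec RS U)" for s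
    using that unfolding bij_betw_imp_surj_on[OF u(2), symmetric] by (rule imageE) (rule bexI)
  have smult: "act rep_pre g U (a \<odot>\<^bsub>sec rep_pre U\<^esub> m) = a \<odot>\<^bsub>sec rep_pre U\<^esub> act rep_pre g U m"
    if a: "a \<in> carrier (sec_ring S U)" and m: "m \<in> carrier (sec rep_pre U)" for a m
    by (rule rep_pre_ext[OF U rep_pre_abelian[OF U] additive_compose[OF smult_additive[OF U a] pa]
        additive_compose[OF pa smult_additive[OF U a]] _ m])
      (use a g U in \<open>simp add: smult_pure rep_pre_act_pure rho_closed\<close>)
  show ?thesis
  proof (rule module_homI)
    show "additive_map (sec RS U) (sec RS U) (act RS g U)"
      unfolding additive_map_def
    proof (intro conjI ballI funcsetI)
      fix s assume "s \<in> carrier (sec RS U)"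
      then obtain m where m: "m \<in> carrier (sec rep_pre U)" "s = unit_map S rep_pre U m" using ex by blast
      show "act RS g U s \<in> carrier (sec RS U)"
        unfolding m(2) RS_act[OF g U m(1)] by (rule uc[OF additive_closed[OF pa m(1)]])
      fix s' assume "s' \<in> carrier (sec RS U)"
      then obtain m' where m': "m' \<in> carrier (sec rep_pre U)" "s' = unit_map S rep_pre U m'" using ex by blast
      have "act RS g U (s \<oplus>\<^bsub>sec RS U\<^esub> s') = act RS g U (unit_map S rep_pre U (m \<oplus>\<^bsub>sec rep_pre U\<^esub> m'))"
        unfolding m(2) m'(2) by (simp only: module_hom_add[OF u(1) m(1) m'(1)])
      also have "\<dots> = unit_map S rep_pre U (act rep_pre g U m \<oplus>\<^bsub>sec rep_pre U\<^esub> act rep_pre g U m')"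
        by (simp only: RS_act[OF g U N.a_closed[OF m(1) m'(1)]] additive_add[OF pa m(1) m'(1)])
      also have "\<dots> = act RS g U s \<oplus>\<^bsub>sec RS U\<^esub> act RS g U s'"
        unfolding m(2) m'(2) RS_act[OF g U m(1)] RS_act[OF g U m'(1)]
        by (rule module_hom_add[OF u(1) additive_closed[OF pa m(1)] additive_closed[OF pa m'(1)]])
      finally show "act RS g U (s \<oplus>\<^bsub>sec RS U\<^esub> s') = act RS g U s \<oplus>\<^bsub>sec RS U\<^esub> act RS g U s'" .
    qed
    fix a s assume a: "a \<in> carrier (sec_ring S U)" and "s \<in> carrier (sec RS U)"
    then obtain m where m: "m \<in> carrier (sec rep_pre U)" "s = unit_map S rep_pre U m" using ex by blast
    have "act RS g U (a \<odot>\<^bsub>sec RS U\<^esub> s) = act RS g U (unit_map S rep_pre U (a \<odot>\<^bsub>sec rep_pre U\<^esub> m))"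
      unfolding m(2) by (simp only: module_hom_smult[OF u(1) a m(1)])
    also have "\<dots> = unit_map S rep_pre U (a \<odot>\<^bsub>sec rep_pre U\<^esub> act rep_pre g U m)"
      by (simp only: RS_act[OF g U N.smult_closed[OF a m(1)]] smult[OF a m(1)])
    also have "\<dots> = a \<odot>\<^bsub>sec RS U\<^esub> act RS g U s"
      unfolding m(2) RS_act[OF g U m(1)] by (rule module_hom_smult[OF u(1) a additive_closed[OF pa m(1)]])
    finally show "act RS g U (a \<odot>\<^bsub>sec RS U\<^esub> s) = a \<odot>\<^bsub>sec RS U\<^esub> act RS g U s" .
  qed
qed

end

section \<open>The tensor decomposition\<close>

text \<open>Being isomorphic to the sheaf E, the presheaf P is itself a sheaf, so its map to the
  sheafification is an isomorphism and can be composed with \<tau>. Nothing about gluing in P has to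
  be proved separately.\<close>

lemma gmod_isomorphic_sheafification:
  assumes E: "sheaf_of_gmodules G S E" and iso: "mod_isomorphism S E P \<tau>"
    and zero: "\<And>U. openin (pts S) U \<Longrightarrow> \<tau> U \<zero>\<^bsub>sec E U\<^esub> = \<zero>\<^bsub>sec P U\<^esub>"
    and act: "\<And>g U m. g \<in> carrier G \<Longrightarrow> openin (pts S) U \<Longrightarrow> m \<in> carrier (sec E U)
      \<Longrightarrow> \<tau> U (act E g U m) = act P g U (\<tau> U m)"
  shows "gmod_isomorphic G S E (sheafification S P)"
proof -
  interpret E: sheaf_of_gmodules G S E by fact
  have P: "sheaf_of_modules S P" by (rule sheaf_of_modules_transport[OF E.sheaf_of_modules_axioms iso zero])
  have hom: "\<tau> U \<in> module_hom (sec_ring S U) (sec E U) (sec P U)"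
    and bij: "bij_betw (\<tau> U) (carrier (sec E U)) (carrier (sec P U))" if "openin (pts S) U" for U
    using iso that unfolding mod_isomorphism_def by simp_all
  have nat: "mres P U V (\<tau> U m) = \<tau> V (mres E U V m)"
    if "openin (pts S) U" "openin (pts S) V" "V \<subseteq> U" "m \<in> carrier (sec E U)" for U V m
    using iso that unfolding mod_isomorphism_def by simp
  note u = unit_map_isomorphism[OF P]
  have uhom: "unit_map S P U \<in> module_hom (sec_ring S U) (sec P U) (sec (sheafification S P) U)"
    and ubij: "bij_betw (unit_map S P U) (carrier (sec P U)) (carrier (sec (sheafification S P) U))" if "openin (pts S) U" for U
    using u that unfolding mod_isomorphism_def by simp_all
  have unat: "mres (sheafification S P) U V (unit_map S P U m) = unit_map S P V (mres P U V m)"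
    if "openin (pts S) U" "openin (pts S) V" "V \<subseteq> U" "m \<in> carrier (sec P U)" for U V m
    using u that unfolding mod_isomorphism_def by simp
  have tc: "\<tau> U m \<in> carrier (sec P U)" if "openin (pts S) U" "m \<in> carrier (sec E U)" for U m
    using module_hom_apply[OF hom[OF that(1)] that(2)] .
  have ac: "act E g U m \<in> carrier (sec E U)" if "g \<in> carrier G" "openin (pts S) U" "m \<in> carrier (sec E U)" for g U m
    using module_hom_apply[OF E.act_hom[OF that(1,2)] that(3)] .
  have ex: "\<exists>m. m \<in> carrier (sec E U) \<and> x = \<tau> U m" if "openin (pts S) U" "x \<in> carrier (sec P U)" for U x
    using that(2) unfolding bij_betw_imp_surj_on[OF bij[OF that(1)], symmetric] by (rule imageE) (intro exI conjI)
  show ?thesis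
    unfolding gmod_isomorphic_def
  proof (intro exI[of _ "\<lambda>U m. unit_map S P U (\<tau> U m)"] conjI ballI allI impI)
    show "mod_isomorphism S E (sheafification S P) (\<lambda>U m. unit_map S P U (\<tau> U m))"
      unfolding mod_isomorphism_def
    proof (intro conjI allI impI ballI)
      fix U assume U: "openin (pts S) U"
      show "(\<lambda>m. unit_map S P U (\<tau> U m)) \<in> module_hom (sec_ring S U) (sec E U) (sec (sheafification S P) U)"
        by (intro module_homI additive_compose[OF module_hom_additive[OF hom[OF U]] module_hom_additive[OF uhom[OF U]]])
          (simp add: module_hom_smult[OF hom[OF U]] module_hom_smult[OF uhom[OF U]] tc[OF U])
      show "bij_betw (\<lambda>m. unit_map S P U (\<tau> U m)) (carrier (sec E U)) (carrier (sec (sheafification S P) U))"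
        using bij_betw_trans[OF bij[OF U] ubij[OF U]] by (simp add: comp_def)
    next
      fix U V m assume "openin (pts S) U \<and> openin (pts S) V \<and> V \<subseteq> U" and m: "m \<in> carrier (sec E U)"
      then have UV: "openin (pts S) U" "openin (pts S) V" "V \<subseteq> U" by auto
      show "mres (sheafification S P) U V (unit_map S P U (\<tau> U m)) = unit_map S P V (\<tau> V (mres E U V m))"
        unfolding unat[OF UV tc[OF UV(1) m]] nat[OF UV m] ..
    qed
  next
    fix g U m assume g: "g \<in> carrier G" and U: "openin (pts S) U" and m: "m \<in> carrier (sec E U)"
    have "act (sheafification S P) g U (unit_map S P U (\<tau> U m)) = unit_map S P U (act P g U (\<tau> U m))"
    proof (rule unit_map_act[OF P _ _ U tc[OF U m]])
      fix U x assume U: "openin (pts S) U" and "x \<in> carrier (sec P U)"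
      then obtain m where m: "m \<in> carrier (sec E U)" "x = \<tau> U m" using ex by blast
      show "act P g U x \<in> carrier (sec P U)"
        unfolding m(2) act[OF g U m(1), symmetric] by (rule tc[OF U ac[OF g U m(1)]])
      fix V assume V: "openin (pts S) V" "V \<subseteq> U"
      show "mres P U V (act P g U x) = act P g V (mres P U V x)"
        unfolding m(2) act[OF g U m(1), symmetric] nat[OF U V m(1)] nat[OF U V ac[OF g U m(1)]]
          act[OF g V(1) E.M.res_closed[OF U V m(1)], symmetric] E.act_res[OF g U V m(1)] ..
    qed
    then show "unit_map S P U (\<tau> U (act E g U m)) = act (sheafification S P) g U (unit_map S P U (\<tau> U m))"
      by (simp only: act[OF g U m])
  qed
qed

text \<open>q is the projection onto the first summand, conjugated by h. Together with
  \<open>nonsplitting_idempotent\<close> this turns questions about splittings into questions about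
  idempotents, which are easier to move from F to E than summands are.\<close>

lemma mod_sum_idempotent:
  assumes F: "sheaf_of_modules S F" and A: "sheaf_of_modules S A" and B: "sheaf_of_modules S B"
    and iso: "mod_isomorphism S F (mod_sum A B) h"
  obtains q where "sheaf_endomorphism S F q"
    "\<And>U m. openin (pts S) U \<Longrightarrow> m \<in> carrier (sec F U) \<Longrightarrow> q U (q U m) = q U m"
    "\<And>U. openin (pts S) U \<Longrightarrow> \<forall>m\<in>carrier (sec F U). q U m = \<zero>\<^bsub>sec F U\<^esub> \<Longrightarrow> carrier (sec A U) = {\<zero>\<^bsub>sec A U\<^esub>}"
    "\<And>U. openin (pts S) U \<Longrightarrow> \<forall>m\<in>carrier (sec F U). q U m = m \<Longrightarrow> carrier (sec B U) = {\<zero>\<^bsub>sec B U\<^esub>}"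
proof -
  interpret F: sheaf_of_modules S F by fact
  interpret A: sheaf_of_modules S A by fact
  interpret B: sheaf_of_modules S B by fact
  let ?D = "\<lambda>U. sec (mod_sum A B) U"
  have D: "carrier (?D U) = carrier (sec A U) \<times> carrier (sec B U)"
    "v \<oplus>\<^bsub>?D U\<^esub> w = (fst v \<oplus>\<^bsub>sec A U\<^esub> fst w, snd v \<oplus>\<^bsub>sec B U\<^esub> snd w)"
    "a \<odot>\<^bsub>?D U\<^esub> v = (a \<odot>\<^bsub>sec A U\<^esub> fst v, a \<odot>\<^bsub>sec B U\<^esub> snd v)"
    "mres (mod_sum A B) U V = map_prod (mres A U V) (mres B U V)" for U V v w a
    by (simp_all add: mod_sum_def direct_sum_def)
  have hom: "h U \<in> module_hom (sec_ring S U) (sec F U) (?D U)"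
    and bij: "bij_betw (h U) (carrier (sec F U)) (carrier (?D U))" if "openin (pts S) U" for U
    using iso that unfolding mod_isomorphism_def by simp_all
  have nat: "mres (mod_sum A B) U V (h U m) = h V (mres F U V m)"
    if "openin (pts S) U" "openin (pts S) V" "V \<subseteq> U" "m \<in> carrier (sec F U)" for U V m
    using iso that unfolding mod_isomorphism_def by simp
  have hc: "fst (h U m) \<in> carrier (sec A U)" "snd (h U m) \<in> carrier (sec B U)"
    if "openin (pts S) U" "m \<in> carrier (sec F U)" for U m
    using module_hom_apply[OF hom[OF that(1)] that(2)] by (auto simp: D(1))
  have hinj: "m = m'" if "openin (pts S) U" "m \<in> carrier (sec F U)" "m' \<in> carrier (sec F U)" "h U m = h U m'" for U m m'
    by (rule inj_onD[OF bij_betw_imp_inj_on[OF bij[OF that(1)]] that(4,2,3)])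
  define q where "q U m = the_inv_into (carrier (sec F U)) (h U) (fst (h U m), \<zero>\<^bsub>sec B U\<^esub>)" for U m
  have g: "the_inv_into (carrier (sec F U)) (h U) y \<in> carrier (sec F U)"
      "h U (the_inv_into (carrier (sec F U)) (h U) y) = y" if "openin (pts S) U" "y \<in> carrier (?D U)" for U y
    using that the_inv_into_into[OF bij_betw_imp_inj_on[OF bij[OF that(1)]], of y "carrier (sec F U)"]
      f_the_inv_into_f[OF bij_betw_imp_inj_on[OF bij[OF that(1)]], of y] bij_betw_imp_surj_on[OF bij[OF that(1)]]
    by simp_all
  have zB: "\<zero>\<^bsub>sec B U\<^esub> \<in> carrier (sec B U)" if "openin (pts S) U" for U
    using abelian_groupE(2)[OF B.sec_abelian[OF that]] .
  have q: "q U m \<in> carrier (sec F U)" "h U (q U m) = (fst (h U m), \<zero>\<^bsub>sec B U\<^esub>)"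
    if "openin (pts S) U" "m \<in> carrier (sec F U)" for U m
    using that g[of U "(fst (h U m), \<zero>\<^bsub>sec B U\<^esub>)"] hc[OF that] zB[OF that(1)] by (simp_all add: D q_def)
  have endo: "sheaf_endomorphism S F q"
  proof (intro sheaf_endomorphism.intro F sheaf_endomorphism_axioms.intro module_homI)
    fix U assume U: "openin (pts S) U"
    interpret N: module "sec_ring S U" "sec F U" by (rule F.sec_module[OF U])
    interpret NB: module "sec_ring S U" "sec B U" by (rule B.sec_module[OF U])
    show "additive_map (sec F U) (sec F U) (q U)"
      unfolding additive_map_def
    proof (intro conjI ballI funcsetI q(1)[OF U])
      fix x y assume xy: "x \<in> carrier (sec F U)" "y \<in> carrier (sec F U)"
      show "q U (x \<oplus>\<^bsub>sec F U\<^esub> y) = q U x \<oplus>\<^bsub>sec F U\<^esub> q U y"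
        by (rule hinj[OF U]) (use xy U in \<open>simp_all add: q D module_hom_add[OF hom[OF U]]\<close>)
    qed
    show "q U (a \<odot>\<^bsub>sec F U\<^esub> x) = a \<odot>\<^bsub>sec F U\<^esub> q U x"
      if "a \<in> carrier (sec_ring S U)" "x \<in> carrier (sec F U)" for a x
      by (rule hinj[OF U]) (use that U in \<open>simp_all add: q D module_hom_smult[OF hom[OF U]] NB.smult_r_null\<close>)
  next
    fix U V x assume U: "openin (pts S) U" "openin (pts S) V" "V \<subseteq> U" and x: "x \<in> carrier (sec F U)"
    note xV = F.M.res_closed[OF U x]
    show "mres F U V (q U x) = q V (mres F U V x)"
    proof (rule hinj[OF U(2) F.M.res_closed[OF U q(1)[OF U(1) x]] q(1)[OF U(2) xV]])
      show "h V (mres F U V (q U x)) = h V (q V (mres F U V x))"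
        using nat[OF U x, symmetric] nat[OF U q(1)[OF U(1) x], symmetric]
        by (simp add: q[OF U(1) x] q[OF U(2) xV] D B.mres_zero[OF U])
    qed
  qed
  show thesis
  proof (rule that[OF endo])
    fix U m assume U: "openin (pts S) U" and m: "m \<in> carrier (sec F U)"
    show "q U (q U m) = q U m"
      by (rule hinj[OF U q(1)[OF U q(1)[OF U m]] q(1)[OF U m]]) (simp add: q(2)[OF U q(1)[OF U m]] q(2)[OF U m])
  next
    fix U assume U: "openin (pts S) U" and z: "\<forall>m\<in>carrier (sec F U). q U m = \<zero>\<^bsub>sec F U\<^esub>"
    have "a = fst (h U \<zero>\<^bsub>sec F U\<^esub>)" if a: "a \<in> carrier (sec A U)" for a
    proof -
      have y: "(a, \<zero>\<^bsub>sec B U\<^esub>) \<in> carrier (?D U)" using a zB[OF U] by (simp add: D)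
      show ?thesis using q(2)[OF U g(1)[OF U y]] unfolding z[rule_format, OF g(1)[OF U y]] g(2)[OF U y] by simp
    qed
    then have "a = \<zero>\<^bsub>sec A U\<^esub>" if "a \<in> carrier (sec A U)" for a
      using that abelian_groupE(2)[OF A.sec_abelian[OF U]] by metis
    then show "carrier (sec A U) = {\<zero>\<^bsub>sec A U\<^esub>}" using abelian_groupE(2)[OF A.sec_abelian[OF U]] by blast
  next
    fix U assume U: "openin (pts S) U" and z: "\<forall>m\<in>carrier (sec F U). q U m = m"
    have "b = \<zero>\<^bsub>sec B U\<^esub>" if b: "b \<in> carrier (sec B U)" for b
    proof -
      have y: "(\<zero>\<^bsub>sec A U\<^esub>, b) \<in> carrier (?D U)" using b abelian_groupE(2)[OF A.sec_abelian[OF U]] by (simp add: D)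
      show ?thesis using q(2)[OF U g(1)[OF U y]] unfolding z[rule_format, OF g(1)[OF U y]] g(2)[OF U y] by simp
    qed
    then show "carrier (sec B U) = {\<zero>\<^bsub>sec B U\<^esub>}" using zB[OF U] by blast
  qed
qed

locale isotypic_setting = equivariant_munits k G S p \<phi> \<epsilon> E n A \<mu> + R: representation_sheaf k S p \<phi> G V \<rho> n b c
  for k :: "'k ring" and G :: "'g monoid" and S :: "('x, 'r) rspace"
    and p :: "'x \<Rightarrow> 'k set"
    and \<phi> :: "'k set set \<Rightarrow> ('k set \<Rightarrow> ('k \<times> 'k) set) \<Rightarrow> 'r"
    and \<epsilon> :: 'x
    and E :: "('x, 'r, 'm, 'g) gmsheaf" and n A \<mu>
    and V :: "('k, 'v) module" and \<rho> and b c +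
  assumes A_eq: "\<lbrakk>g \<in> carrier G; i < n; j < n\<rbrakk> \<Longrightarrow> A g i j = c i (\<rho> g (b j))"
    and PE_id: "\<lbrakk>openin (pts S) U; m \<in> carrier (sec E U)\<rbrakk> \<Longrightarrow> PE U m = m"
begin

lemma pE0_additive: "openin (pts S) U \<Longrightarrow> i < n \<Longrightarrow> additive_map (sec E U) (sec F U) (pE 0 i U)"
  using pE0_in_F[of U i] additive_add[OF pE_additive[OF _ n_pos, of U i]] by (simp add: additive_map_def F_simps)

lemma F_in_E: "x \<in> carrier (sec F U) \<Longrightarrow> x \<in> carrier (sec E U)"
  by (simp add: F_simps)

lemma pEi0_additive: "openin (pts S) U \<Longrightarrow> i < n \<Longrightarrow> additive_map (sec F U) (sec E U) (pE i 0 U)"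
  using pE_closed[of U i 0] additive_add[OF pE_additive[of U i 0]] n_pos by (simp add: additive_map_def F_simps)

lemma F_sum:
  assumes U: "openin (pts S) U" and f: "f \<in> I \<rightarrow> carrier (sec F U)"
  shows "(\<Oplus>\<^bsub>sec F U\<^esub>i\<in>I. f i) = (\<Oplus>\<^bsub>sec E U\<^esub>i\<in>I. f i)"
  by (rule additive_finsum[OF F.sec_abelian[OF U] E.sec_abelian[OF U] _ f])
    (simp add: additive_map_def F_simps)

lemma pE_pE:
  "\<lbrakk>openin (pts S) U; i < n; j < n; l < n; r < n; m \<in> carrier (sec E U)\<rbrakk>
    \<Longrightarrow> pE i j U (pE l r U m) = (if j = l then pE i r U m else \<zero>\<^bsub>sec E U\<^esub>)"
  using munits.munit_munit[OF munits_sec, of U i j l r m] by simp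

lemma pE_zero: "\<lbrakk>openin (pts S) U; i < n; j < n\<rbrakk> \<Longrightarrow> pE i j U \<zero>\<^bsub>sec E U\<^esub> = \<zero>\<^bsub>sec E U\<^esub>"
  by (rule additive_zero[OF E.sec_abelian E.sec_abelian pE_additive])

text \<open>A splitting of F gives an idempotent q of F, and q induces an equivariant idempotent
  \<theta> of E, which must be zero or the identity. Since q is recovered from \<theta> on F, it is
  zero or the identity too, and one summand vanishes.\<close>

lemma F_nonsplitting:
  assumes ns: "nonsplitting_gmodule G S E"
  shows "nonsplitting_module S F"
  unfolding nonsplitting_module_def
proof (intro conjI notI)
  show "nonzero_mod S F"
  proof (rule ccontr)
    assume no: "\<not> nonzero_mod S F"
    have "carrier (sec E U) = {\<zero>\<^bsub>sec E U\<^esub>}" if U: "openin (pts S) U" for U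
    proof -
      interpret N: module "sec_ring S U" "sec E U" by (rule E.sec_module[OF U])
      have z: "carrier (sec F U) = {\<zero>\<^bsub>sec E U\<^esub>}" using no U F_simps(2)[of U] unfolding nonzero_mod_def by metis
      have "m = \<zero>\<^bsub>sec E U\<^esub>" if m: "m \<in> carrier (sec E U)" for m
      proof -
        \<comment> \<open>E_ii = E_i0 E_0i factors through F.\<close>
        have "pE i i U m = \<zero>\<^bsub>sec E U\<^esub>" if i: "i < n" for i
        proof -
          have "pE 0 i U m = \<zero>\<^bsub>sec E U\<^esub>" using pE0_in_F[OF U i m] unfolding z by simp
          then show ?thesis using pE_pE[OF U i n_pos n_pos i m] pE_zero[OF U i n_pos] by simp
        qed
        then have "PE U m = \<zero>\<^bsub>sec E U\<^esub>" by (intro N.M.add.finprod_one_eqI) simp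
        then show ?thesis using PE_id[OF U m] by simp
      qed
      then show ?thesis using N.M.zero_closed by auto
    qed
    then show False using ns unfolding nonsplitting_gmodule_def nonzero_mod_def by blast
  qed
next
  assume "\<exists>(A :: ('x, 'r, 'm) msheaf) (B :: ('x, 'r, 'm) msheaf).
         sheaf_of_modules S A \<and> sheaf_of_modules S B \<and> nonzero_mod S A \<and> nonzero_mod S B
         \<and> mod_isomorphic S F (mod_sum A B)"
  then obtain A' B' :: "('x, 'r, 'm) msheaf" and h where AB: "sheaf_of_modules S A'" "sheaf_of_modules S B'"
    "nonzero_mod S A'" "nonzero_mod S B'" "mod_isomorphism S F (mod_sum A' B') h"
    unfolding mod_isomorphic_def by (elim exE conjE) (rule that)
  obtain q where q: "sheaf_endomorphism S F q"
    and qq: "\<And>U m. openin (pts S) U \<Longrightarrow> m \<in> carrier (sec F U) \<Longrightarrow> q U (q U m) = q U m"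
    and q0: "\<And>U. openin (pts S) U \<Longrightarrow> \<forall>m\<in>carrier (sec F U). q U m = \<zero>\<^bsub>sec F U\<^esub> \<Longrightarrow> carrier (sec A' U) = {\<zero>\<^bsub>sec A' U\<^esub>}"
    and q1: "\<And>U. openin (pts S) U \<Longrightarrow> \<forall>m\<in>carrier (sec F U). q U m = m \<Longrightarrow> carrier (sec B' U) = {\<zero>\<^bsub>sec B' U\<^esub>}"
    by (rule mod_sum_idempotent[OF F_sheaf AB(1,2,5)]) (rule that)
  interpret q: sheaf_endomorphism S F q by (rule q)
  \<comment> \<open>Under the decomposition of E as O(V) \<otimes> F this is the identity of O(V)
    tensored with q.\<close>
  define \<theta> where "\<theta> U m = (\<Oplus>\<^bsub>sec E U\<^esub>i\<in>{..<n}. pE i 0 U (q U (pE 0 i U m)))" for U m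
  have qF: "q U (pE 0 i U m) \<in> carrier (sec F U)" if "openin (pts S) U" "i < n" "m \<in> carrier (sec E U)" for U i m
    by (rule q.theta_closed[OF that(1) pE0_in_F[OF that]])
  have term_add: "additive_map (sec E U) (sec E U) (\<lambda>m. pE i 0 U (q U (pE 0 i U m)))" if "openin (pts S) U" "i < n" for U i
    by (rule additive_compose[OF additive_compose[OF pE0_additive[OF that] q.theta_additive[OF that(1)]] pEi0_additive[OF that]])
  have tc: "pE i 0 U (q U (pE 0 i U m)) \<in> carrier (sec E U)" if "openin (pts S) U" "i < n" "m \<in> carrier (sec E U)" for U i m
    by (rule additive_closed[OF term_add[OF that(1,2)] that(3)])
  have q_smult: "q U (a \<odot>\<^bsub>sec E U\<^esub> x) = a \<odot>\<^bsub>sec E U\<^esub> q U x"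
    if "openin (pts S) U" "a \<in> carrier (sec_ring S U)" "x \<in> carrier (sec F U)" for U a x
    using module_hom_smult[OF q.theta_hom[OF that(1)] that(2,3)] by (simp add: F_simps)
  have endo: "sheaf_endomorphism S E \<theta>"
  proof (intro sheaf_endomorphism.intro E.sheaf_of_modules_axioms sheaf_endomorphism_axioms.intro module_homI)
    fix U assume U: "openin (pts S) U"
    interpret N: module "sec_ring S U" "sec E U" by (rule E.sec_module[OF U])
    show "additive_map (sec E U) (sec E U) (\<theta> U)"
      unfolding \<theta>_def by (intro additive_finsum_fun N.M.abelian_group_axioms term_add[OF U]) simp
    fix a m assume a: "a \<in> carrier (sec_ring S U)" and m: "m \<in> carrier (sec E U)"
    have "\<theta> U (a \<odot>\<^bsub>sec E U\<^esub> m) = (\<Oplus>\<^bsub>sec E U\<^esub>i\<in>{..<n}. a \<odot>\<^bsub>sec E U\<^esub> pE i 0 U (q U (pE 0 i U m)))"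
      unfolding \<theta>_def
    proof (rule N.M.finsum_cong')
      fix i assume "i \<in> {..<n}"
      then have i: "i < n" by simp
      show "pE i 0 U (q U (pE 0 i U (a \<odot>\<^bsub>sec E U\<^esub> m))) = a \<odot>\<^bsub>sec E U\<^esub> pE i 0 U (q U (pE 0 i U m))"
        by (simp only: pE_smult[OF U n_pos i a m] q_smult[OF U a pE0_in_F[OF U i m]]
            pE_smult[OF U i n_pos a F_in_E[OF qF[OF U i m]]])
    qed (use tc[OF U _ m] a in auto)
    also have "\<dots> = a \<odot>\<^bsub>sec E U\<^esub> \<theta> U m"
      unfolding \<theta>_def using tc[OF U _ m] a by (intro N.finsum_smult[symmetric]) auto
    finally show "\<theta> U (a \<odot>\<^bsub>sec E U\<^esub> m) = a \<odot>\<^bsub>sec E U\<^esub> \<theta> U m" .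
  next
    fix U V m assume U: "openin (pts S) U" "openin (pts S) V" "V \<subseteq> U" and m: "m \<in> carrier (sec E U)"
    interpret N: module "sec_ring S V" "sec E V" by (rule E.sec_module[OF U(2)])
    note mV = E.M.res_closed[OF U m]
    have "mres E U V (\<theta> U m) = (\<Oplus>\<^bsub>sec E V\<^esub>i\<in>{..<n}. mres E U V (pE i 0 U (q U (pE 0 i U m))))"
      unfolding \<theta>_def using tc[OF U(1) _ m]
      by (intro additive_finsum[OF E.sec_abelian[OF U(1)] N.M.abelian_group_axioms E.mres_additive[OF U]]) auto
    also have "\<dots> = \<theta> V (mres E U V m)"
      unfolding \<theta>_def
    proof (rule N.M.finsum_cong')
      fix i assume "i \<in> {..<n}"
      then have i: "i < n" by simp
      show "mres E U V (pE i 0 U (q U (pE 0 i U m))) = pE i 0 V (q V (pE 0 i V (mres E U V m)))"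
        using q.theta_res[OF U pE0_in_F[OF U(1) i m]]
        by (simp only: pE_res[OF U i n_pos F_in_E[OF qF[OF U(1) i m]]] F_simps(5) pE_res[OF U n_pos i m])
    qed (use tc[OF U(2) _ mV] in auto)
    finally show "mres E U V (\<theta> U m) = \<theta> V (mres E U V m)" .
  qed
  \<comment> \<open>By the multiplication table, E_0i singles out the i-th term of the sum. For i =
    0 and a section of F this recovers q from \<theta>.\<close>
  have p\<theta>: "pE 0 i U (\<theta> U m) = q U (pE 0 i U m)"
    if U: "openin (pts S) U" and i: "i < n" and m: "m \<in> carrier (sec E U)" for U i m
  proof -
    interpret N: module "sec_ring S U" "sec E U" by (rule E.sec_module[OF U])
    let ?y = "\<lambda>j. q U (pE 0 j U m)"
    have fx: "pE 0 0 U (?y i) = ?y i" using qF[OF U i m] by (simp only: F_simps mem_Collect_eq)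
    have "pE 0 i U (\<theta> U m) = (\<Oplus>\<^bsub>sec E U\<^esub>j\<in>{..<n}. pE 0 i U (pE j 0 U (?y j)))"
      unfolding \<theta>_def using tc[OF U _ m]
      by (intro additive_finsum[OF N.M.abelian_group_axioms N.M.abelian_group_axioms pE_additive[OF U n_pos i]]) auto
    also have "\<dots> = (\<Oplus>\<^bsub>sec E U\<^esub>j\<in>{..<n}. if j = i then ?y j else \<zero>\<^bsub>sec E U\<^esub>)"
    proof (rule N.M.finsum_cong')
      fix j assume "j \<in> {..<n}"
      then have j: "j < n" by simp
      show "pE 0 i U (pE j 0 U (?y j)) = (if j = i then ?y j else \<zero>\<^bsub>sec E U\<^esub>)"
        using pE_pE[OF U n_pos i j n_pos F_in_E[OF qF[OF U j m]]] fx by simp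
    qed (use F_in_E[OF qF[OF U _ m]] in auto)
    also have "\<dots> = ?y i" using i F_in_E[OF qF[OF U i m]] by (intro N.M.finsum_delta) auto
    finally show ?thesis .
  qed
  have idem: "\<theta> U (\<theta> U m) = \<theta> U m" if U: "openin (pts S) U" and m: "m \<in> carrier (sec E U)" for U m
  proof -
    interpret N: module "sec_ring S U" "sec E U" by (rule E.sec_module[OF U])
    show ?thesis
      unfolding \<theta>_def[of U "\<theta> U m"] unfolding \<theta>_def[of U m, symmetric]
      by (subst \<theta>_def[of U m], rule N.M.finsum_cong')
        (use tc[OF U _ m] in \<open>auto simp: p\<theta>[OF U _ m] qq[OF U pE0_in_F[OF U _ m]]\<close>)
  qed
  \<comment> \<open>\<open>munit_act\<close> expands the inner E_0i, and after interchanging the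
    sums \<open>act_munit\<close> collects the outer E_i0. In between, q commutes with the matrix
    entries of g, which act as scalars.\<close>
  have act: "\<theta> U (act E g U m) = act E g U (\<theta> U m)"
    if g: "g \<in> carrier G" and U: "openin (pts S) U" and m: "m \<in> carrier (sec E U)" for g U m
  proof -
    interpret N: module "sec_ring S U" "sec E U" by (rule E.sec_module[OF U])
    interpret m: munits k G n A \<mu> "kE U" "\<lambda>g. act E g U" by (rule munits_sec[OF U])
    let ?y = "\<lambda>j. q U (pE 0 j U m)"
    let ?A = "\<lambda>i l. sc U (A g i l)"
    have yF: "?y l \<in> carrier (sec F U)" if "l < n" for l by (rule qF[OF U that m])
    have Ac: "?A i l \<in> carrier (sec_ring S U)" if "i < n" "l < n" for i l by (rule sc_closed[OF U A_closed[OF g that]])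
    have py: "pE i 0 U (?y l) \<in> carrier (sec E U)" if "i < n" "l < n" for i l
      by (rule pE_closed[OF U that(1) n_pos F_in_E[OF yF[OF that(2)]]])
    have "pE i 0 U (q U (pE 0 i U (act E g U m))) = (\<Oplus>\<^bsub>sec E U\<^esub>l\<in>{..<n}. ?A i l \<odot>\<^bsub>sec E U\<^esub> pE i 0 U (?y l))" if i: "i < n" for i
    proof -
      interpret NF: module "sec_ring S U" "sec F U" by (rule F.sec_module[OF U])
      have xF: "?A i l \<odot>\<^bsub>sec F U\<^esub> pE 0 l U m \<in> carrier (sec F U)" if "l < n" for l
        by (rule NF.smult_closed[OF Ac[OF i that] pE0_in_F[OF U that m]])
      have "pE 0 i U (act E g U m) = (\<Oplus>\<^bsub>sec E U\<^esub>l\<in>{..<n}. ?A i l \<odot>\<^bsub>sec E U\<^esub> pE 0 l U m)"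
        using m.munit_act[OF g n_pos i, of m] m by simp
      also have "\<dots> = (\<Oplus>\<^bsub>sec F U\<^esub>l\<in>{..<n}. ?A i l \<odot>\<^bsub>sec F U\<^esub> pE 0 l U m)"
        using F_sum[OF U, of "\<lambda>l. ?A i l \<odot>\<^bsub>sec F U\<^esub> pE 0 l U m" "{..<n}"] xF by (simp add: F_simps(4) Pi_iff)
      finally have "pE i 0 U (q U (pE 0 i U (act E g U m)))
        = (\<Oplus>\<^bsub>sec E U\<^esub>l\<in>{..<n}. pE i 0 U (q U (?A i l \<odot>\<^bsub>sec F U\<^esub> pE 0 l U m)))"
        using additive_finsum[OF NF.M.abelian_group_axioms N.M.abelian_group_axioms
            additive_compose[OF q.theta_additive[OF U] pEi0_additive[OF U i]],
            of "\<lambda>l. ?A i l \<odot>\<^bsub>sec F U\<^esub> pE 0 l U m" "{..<n}"] xF by (simp add: Pi_iff)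
      also have "\<dots> = (\<Oplus>\<^bsub>sec E U\<^esub>l\<in>{..<n}. ?A i l \<odot>\<^bsub>sec E U\<^esub> pE i 0 U (?y l))"
      proof (rule N.M.finsum_cong')
        fix l assume "l \<in> {..<n}"
        then have l: "l < n" by simp
        show "pE i 0 U (q U (?A i l \<odot>\<^bsub>sec F U\<^esub> pE 0 l U m)) = ?A i l \<odot>\<^bsub>sec E U\<^esub> pE i 0 U (?y l)"
          by (simp only: F_simps(4) q_smult[OF U Ac[OF i l] pE0_in_F[OF U l m]] pE_smult[OF U i n_pos Ac[OF i l] F_in_E[OF yF[OF l]]])
      qed (use py Ac i in auto)
      finally show ?thesis .
    qed
    then have "\<theta> U (act E g U m) = (\<Oplus>\<^bsub>sec E U\<^esub>i\<in>{..<n}. \<Oplus>\<^bsub>sec E U\<^esub>l\<in>{..<n}. ?A i l \<odot>\<^bsub>sec E U\<^esub> pE i 0 U (?y l))"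
      unfolding \<theta>_def using py Ac by (intro N.M.finsum_cong') auto
    also have "\<dots> = (\<Oplus>\<^bsub>sec E U\<^esub>l\<in>{..<n}. \<Oplus>\<^bsub>sec E U\<^esub>i\<in>{..<n}. ?A i l \<odot>\<^bsub>sec E U\<^esub> pE i 0 U (?y l))"
      using py Ac by (intro N.M.finsum_swap) auto
    also have "\<dots> = (\<Oplus>\<^bsub>sec E U\<^esub>l\<in>{..<n}. act E g U (pE l 0 U (?y l)))"
    proof (rule N.M.finsum_cong')
      fix l assume "l \<in> {..<n}"
      then have l: "l < n" by simp
      show "(\<Oplus>\<^bsub>sec E U\<^esub>i\<in>{..<n}. ?A i l \<odot>\<^bsub>sec E U\<^esub> pE i 0 U (?y l)) = act E g U (pE l 0 U (?y l))"
        using m.act_munit[OF g l n_pos, of "?y l"] F_in_E[OF yF[OF l]] by simp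
    qed (use py act_closed[OF g U] in auto)
    also have "\<dots> = act E g U (\<theta> U m)"
      unfolding \<theta>_def using py
      by (intro additive_finsum[OF N.M.abelian_group_axioms N.M.abelian_group_axioms module_hom_additive[OF E.act_hom[OF g U]], symmetric]) auto
    finally show ?thesis .
  qed
  have pF: "pE 0 0 U x = x" if "x \<in> carrier (sec F U)" for U x using that by (simp add: F_simps)
  have "(\<forall>U. openin (pts S) U \<longrightarrow> (\<forall>m\<in>carrier (sec E U). \<theta> U m = \<zero>\<^bsub>sec E U\<^esub>))
    \<or> (\<forall>U. openin (pts S) U \<longrightarrow> (\<forall>m\<in>carrier (sec E U). \<theta> U m = m))"
    by (rule nonsplitting_idempotent[OF gmodule_E ns endo act idem])
  then show False
  proof (elim disjE)
    assume z: "\<forall>U. openin (pts S) U \<longrightarrow> (\<forall>m\<in>carrier (sec E U). \<theta> U m = \<zero>\<^bsub>sec E U\<^esub>)"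
    have "carrier (sec A' U) = {\<zero>\<^bsub>sec A' U\<^esub>}" if U: "openin (pts S) U" for U
    proof (rule q0[OF U], rule ballI)
      fix x assume x: "x \<in> carrier (sec F U)"
      have "q U x = pE 0 0 U (\<theta> U x)" using p\<theta>[OF U n_pos F_in_E[OF x]] pF[OF x] by simp
      also have "\<dots> = \<zero>\<^bsub>sec E U\<^esub>" using z[rule_format, OF U F_in_E[OF x]] pE_zero[OF U n_pos n_pos] by simp
      finally show "q U x = \<zero>\<^bsub>sec F U\<^esub>" by (simp only: F_simps(2))
    qed
    then show False using AB(3) unfolding nonzero_mod_def by blast
  next
    assume z: "\<forall>U. openin (pts S) U \<longrightarrow> (\<forall>m\<in>carrier (sec E U). \<theta> U m = m)"
    have "carrier (sec B' U) = {\<zero>\<^bsub>sec B' U\<^esub>}" if U: "openin (pts S) U" for U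
    proof (rule q1[OF U], rule ballI)
      fix x assume x: "x \<in> carrier (sec F U)"
      show "q U x = x" using p\<theta>[OF U n_pos F_in_E[OF x]] pF[OF x] z[rule_format, OF U F_in_E[OF x]] by simp
    qed
    then show False using AB(4) unfolding nonzero_mod_def by blast
  qed
qed

end

section \<open>The isomorphism from E to the tensor product\<close>

context isotypic_setting
begin

definition tensor_pre :: "('x, 'r, (((('x \<Rightarrow> ('x set \<times> (('r \<times> 'v) \<Rightarrow>\<^sub>0 int) set) set)) \<times> 'm) \<Rightarrow>\<^sub>0 int) set, 'g) gmsheaf"
  where "tensor_pre = \<lparr>sec = (\<lambda>U. tensor_module (sec_ring S U) (sec R.RS U) (sec F U) (\<lambda>a m. a \<odot>\<^bsub>sec R.RS U\<^esub> m)),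
     mres = (\<lambda>U V. tensor_map (sec_ring S V) (sec R.RS V) (sec F V) (mres R.RS U V) (mres F U V)),
     act = (\<lambda>g U. tensor_map (sec_ring S U) (sec R.RS U) (sec F U) (act R.RS g U) (\<lambda>m. m))\<rparr>"

abbreviation pure where "pure U \<equiv> pure_tensor (sec_ring S U) (sec R.RS U) (sec F U)"

lemma tensor_sheaf_eq: "tensor_sheaf S R.RS (trivial_action F) = sheafification S tensor_pre"
  by (simp add: tensor_sheaf_def tensor_pre_def trivial_action_def)

sublocale RS: sheaf_of_modules S R.RS by (rule R.RS_sheaf)

lemma tensor_product_RS: "openin (pts S) U \<Longrightarrow> tensor_product (sec_ring S U) (sec R.RS U) (sec F U)"
  by (intro tensor_product.intro RS.sec_module F.sec_module)

lemma tensor_pre_abelian: "openin (pts S) U \<Longrightarrow> abelian_group (sec tensor_pre U)"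
  using tensor_product.abelian_group_T[OF tensor_product_RS] by (simp add: tensor_pre_def)

lemma pure_closed: "openin (pts S) U \<Longrightarrow> s \<in> carrier (sec R.RS U) \<Longrightarrow> x \<in> carrier (sec F U) \<Longrightarrow> pure U s x \<in> carrier (sec tensor_pre U)"
  using tensor_product.pure_closed[OF tensor_product_RS, of U s x "\<lambda>a m. a \<odot>\<^bsub>sec R.RS U\<^esub> m"] by (simp add: tensor_pre_def)

lemma pure_additive_left: "openin (pts S) U \<Longrightarrow> x \<in> carrier (sec F U) \<Longrightarrow> additive_map (sec R.RS U) (sec tensor_pre U) (\<lambda>s. pure U s x)"
  using tensor_product.pure_additive_left[OF tensor_product_RS, of U x "\<lambda>a m. a \<odot>\<^bsub>sec R.RS U\<^esub> m"] by (simp add: tensor_pre_def)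

lemma pure_additive_right: "openin (pts S) U \<Longrightarrow> s \<in> carrier (sec R.RS U) \<Longrightarrow> additive_map (sec F U) (sec tensor_pre U) (\<lambda>x. pure U s x)"
  using tensor_product.pure_additive_right[OF tensor_product_RS, of U s "\<lambda>a m. a \<odot>\<^bsub>sec R.RS U\<^esub> m"] by (simp add: tensor_pre_def)

lemma pure_smult: "openin (pts S) U \<Longrightarrow> a \<in> carrier (sec_ring S U) \<Longrightarrow> s \<in> carrier (sec R.RS U) \<Longrightarrow> x \<in> carrier (sec F U)
    \<Longrightarrow> pure U (a \<odot>\<^bsub>sec R.RS U\<^esub> s) x = pure U s (a \<odot>\<^bsub>sec E U\<^esub> x)"
  using tensor_product.pure_smult[OF tensor_product_RS] by (simp add: F_simps)

text \<open>F carries the trivial action, so scalars and group elements alike act through the left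
  factor alone. Both are instances of this lemma.\<close>

lemma tensor_pre_map:
  assumes U: "openin (pts S) U"
    and f: "f \<in> module_hom (sec_ring S U) (sec R.RS U) (sec R.RS U)"
  shows "additive_map (sec tensor_pre U) (sec tensor_pre U) (tensor_map (sec_ring S U) (sec R.RS U) (sec F U) f (\<lambda>m. m))"
    and "\<lbrakk>s \<in> carrier (sec R.RS U); x \<in> carrier (sec F U)\<rbrakk>
      \<Longrightarrow> tensor_map (sec_ring S U) (sec R.RS U) (sec F U) f (\<lambda>m. m) (pure U s x) = pure U (f s) x"
proof -
  note fa = module_hom_additive[OF f]
  have i: "additive_map (sec F U) (sec F U) (\<lambda>m. m)" by (simp add: additive_map_def)
  have bal: "pure U (f (a \<odot>\<^bsub>sec R.RS U\<^esub> s)) x = pure U (f s) (a \<odot>\<^bsub>sec F U\<^esub> x)"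
    if "a \<in> carrier (sec_ring S U)" "s \<in> carrier (sec R.RS U)" "x \<in> carrier (sec F U)" for a s x
    using pure_smult[OF U that(1) additive_closed[OF fa that(2)] that(3)]
    by (simp only: module_hom_smult[OF f that(1,2)] F_simps(4))
  show "additive_map (sec tensor_pre U) (sec tensor_pre U) (tensor_map (sec_ring S U) (sec R.RS U) (sec F U) f (\<lambda>m. m))"
    unfolding tensor_pre_def by simp (rule tensor_map_additive[where f = f and g = "\<lambda>m. m", OF tensor_product_RS[OF U] tensor_product_RS[OF U] fa i], rule bal)
  show "tensor_map (sec_ring S U) (sec R.RS U) (sec F U) f (\<lambda>m. m) (pure U s x) = pure U (f s) x"
    if "s \<in> carrier (sec R.RS U)" "x \<in> carrier (sec F U)"
    using tensor_map_pure[where f = f and g = "\<lambda>m. m", OF tensor_product_RS[OF U] tensor_product_RS[OF U] fa i bal that] by simp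
qed

lemma tensor_pre_smult:
  assumes U: "openin (pts S) U" and a: "a \<in> carrier (sec_ring S U)"
  shows "additive_map (sec tensor_pre U) (sec tensor_pre U) (\<lambda>t. a \<odot>\<^bsub>sec tensor_pre U\<^esub> t)"
    and "\<lbrakk>s \<in> carrier (sec R.RS U); x \<in> carrier (sec F U)\<rbrakk>
      \<Longrightarrow> a \<odot>\<^bsub>sec tensor_pre U\<^esub> pure U s x = pure U (a \<odot>\<^bsub>sec R.RS U\<^esub> s) x"
proof -
  interpret N: module "sec_ring S U" "sec R.RS U" by (rule RS.sec_module[OF U])
  have f: "(\<lambda>s. a \<odot>\<^bsub>sec R.RS U\<^esub> s) \<in> module_hom (sec_ring S U) (sec R.RS U) (sec R.RS U)"
    using a by (intro module_homI additive_smult[OF N.module_axioms a])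
      (simp add: N.smult_assoc1[symmetric] N.R.m_comm)
  have e: "(\<lambda>t. a \<odot>\<^bsub>sec tensor_pre U\<^esub> t) = tensor_map (sec_ring S U) (sec R.RS U) (sec F U) (\<lambda>s. a \<odot>\<^bsub>sec R.RS U\<^esub> s) (\<lambda>m. m)"
    by (simp add: tensor_pre_def tensor_module_def id_def)
  show "additive_map (sec tensor_pre U) (sec tensor_pre U) (\<lambda>t. a \<odot>\<^bsub>sec tensor_pre U\<^esub> t)"
    unfolding e by (rule tensor_pre_map(1)[OF U f])
  show "a \<odot>\<^bsub>sec tensor_pre U\<^esub> pure U s x = pure U (a \<odot>\<^bsub>sec R.RS U\<^esub> s) x" if "s \<in> carrier (sec R.RS U)" "x \<in> carrier (sec F U)"
    using tensor_pre_map(2)[OF U f that] fun_cong[OF e, of "pure U s x"] by (simp only:)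
qed

lemma tensor_pre_act:
  assumes g: "g \<in> carrier G" and U: "openin (pts S) U"
  shows "additive_map (sec tensor_pre U) (sec tensor_pre U) (act tensor_pre g U)"
    and "\<lbrakk>s \<in> carrier (sec R.RS U); x \<in> carrier (sec F U)\<rbrakk> \<Longrightarrow> act tensor_pre g U (pure U s x) = pure U (act R.RS g U s) x"
proof -
  have e: "act tensor_pre g U = tensor_map (sec_ring S U) (sec R.RS U) (sec F U) (act R.RS g U) (\<lambda>m. m)"
    by (simp add: tensor_pre_def)
  show "additive_map (sec tensor_pre U) (sec tensor_pre U) (act tensor_pre g U)"
    unfolding e by (rule tensor_pre_map(1)[OF U R.RS_act_hom[OF g U]])
  show "act tensor_pre g U (pure U s x) = pure U (act R.RS g U s) x" if "s \<in> carrier (sec R.RS U)" "x \<in> carrier (sec F U)"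
    unfolding e by (rule tensor_pre_map(2)[OF U R.RS_act_hom[OF g U] that])
qed

lemma tensor_pre_res:
  assumes U: "openin (pts S) U" "openin (pts S) W" "W \<subseteq> U"
  shows "additive_map (sec tensor_pre U) (sec tensor_pre W) (mres tensor_pre U W)"
    and "\<lbrakk>s \<in> carrier (sec R.RS U); x \<in> carrier (sec F U)\<rbrakk>
      \<Longrightarrow> mres tensor_pre U W (pure U s x) = pure W (mres R.RS U W s) (mres E U W x)"
proof -
  have bal: "pure W (mres R.RS U W (a \<odot>\<^bsub>sec R.RS U\<^esub> s)) (mres F U W x) = pure W (mres R.RS U W s) (mres F U W (a \<odot>\<^bsub>sec F U\<^esub> x))"
    if "a \<in> carrier (sec_ring S U)" "s \<in> carrier (sec R.RS U)" "x \<in> carrier (sec F U)" for a s x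
    using tensor_product.pure_smult[OF tensor_product_RS[OF U(2)] E.ring_res_closed[OF U that(1)] RS.M.res_closed[OF U that(2)] F.M.res_closed[OF U that(3)]]
    by (simp only: RS.mres_smult[OF U that(1,2)] F.mres_smult[OF U that(1,3)])
  show "additive_map (sec tensor_pre U) (sec tensor_pre W) (mres tensor_pre U W)"
    unfolding tensor_pre_def
    by simp (rule tensor_map_additive[where f = "mres R.RS U W" and g = "mres F U W", OF tensor_product_RS[OF U(1)] tensor_product_RS[OF U(2)] RS.mres_additive[OF U] F.mres_additive[OF U]], rule bal)
  show "mres tensor_pre U W (pure U s x) = pure W (mres R.RS U W s) (mres E U W x)"
    if "s \<in> carrier (sec R.RS U)" "x \<in> carrier (sec F U)"
    using tensor_map_pure[where f = "mres R.RS U W" and g = "mres F U W", OF tensor_product_RS[OF U(1)] tensor_product_RS[OF U(2)] RS.mres_additive[OF U] F.mres_additive[OF U] bal that]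
    by (simp add: tensor_pre_def F_simps(5))
qed

definition \<tau> where "\<tau> U m = (\<Oplus>\<^bsub>sec tensor_pre U\<^esub>i\<in>{..<n}. pure U (R.e U i) (pE 0 i U m))"

lemma e_closed: "openin (pts S) U \<Longrightarrow> i < n \<Longrightarrow> R.e U i \<in> carrier (sec R.RS U)"
  by (rule R.RS_basis) (auto intro: coord_basis.b_closed)

lemma tau_term_closed: "openin (pts S) U \<Longrightarrow> i < n \<Longrightarrow> m \<in> carrier (sec E U)
    \<Longrightarrow> pure U (R.e U i) (pE 0 i U m) \<in> carrier (sec tensor_pre U)"
  by (rule pure_closed[OF _ e_closed pE0_in_F])

lemma tau_additive:
  assumes U: "openin (pts S) U"
  shows "additive_map (sec E U) (sec tensor_pre U) (\<tau> U)"
  unfolding \<tau>_def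
  by (intro additive_finsum_fun tensor_pre_abelian[OF U] additive_compose[OF pE0_additive[OF U] pure_additive_right[OF U e_closed[OF U]]])
    auto

lemma tau_smult:
  assumes U: "openin (pts S) U" and a: "a \<in> carrier (sec_ring S U)" and m: "m \<in> carrier (sec E U)"
  shows "\<tau> U (a \<odot>\<^bsub>sec E U\<^esub> m) = a \<odot>\<^bsub>sec tensor_pre U\<^esub> \<tau> U m"
proof -
  interpret P: abelian_group "sec tensor_pre U" by (rule tensor_pre_abelian[OF U])
  have "\<tau> U (a \<odot>\<^bsub>sec E U\<^esub> m) = (\<Oplus>\<^bsub>sec tensor_pre U\<^esub>i\<in>{..<n}. a \<odot>\<^bsub>sec tensor_pre U\<^esub> pure U (R.e U i) (pE 0 i U m))"
    unfolding \<tau>_def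
  proof (rule P.finsum_cong')
    fix i assume "i \<in> {..<n}"
    then have i: "i < n" by simp
    show "pure U (R.e U i) (pE 0 i U (a \<odot>\<^bsub>sec E U\<^esub> m)) = a \<odot>\<^bsub>sec tensor_pre U\<^esub> pure U (R.e U i) (pE 0 i U m)"
      by (simp only: pE_smult[OF U n_pos i a m] tensor_pre_smult(2)[OF U a e_closed[OF U i] pE0_in_F[OF U i m]]
          pure_smult[OF U a e_closed[OF U i] pE0_in_F[OF U i m]])
  qed (use additive_closed[OF tensor_pre_smult(1)[OF U a] tau_term_closed[OF U _ m]] in auto)
  also have "\<dots> = a \<odot>\<^bsub>sec tensor_pre U\<^esub> \<tau> U m"
    unfolding \<tau>_def using tau_term_closed[OF U _ m]
    by (intro additive_finsum[OF P.abelian_group_axioms P.abelian_group_axioms tensor_pre_smult(1)[OF U a], symmetric]) auto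
  finally show ?thesis .
qed

text \<open>The inverse sends s \<otimes> x to the sum over i of c'_i(s) E_i0 x, with c' the
  coordinates of O(V) in the basis e. It exists by the universal property, and the two composites
  are computed with the matrix unit relations.\<close>

lemma tau_bij:
  assumes U: "openin (pts S) U"
  shows "bij_betw (\<tau> U) (carrier (sec E U)) (carrier (sec tensor_pre U))"
proof -
  interpret P: abelian_group "sec tensor_pre U" by (rule tensor_pre_abelian[OF U])
  interpret N: module "sec_ring S U" "sec E U" by (rule E.sec_module[OF U])
  interpret t: tensor_product "sec_ring S U" "sec R.RS U" "sec F U" by (rule tensor_product_RS[OF U])
  obtain c' where "coord_basis (sec_ring S U) (sec R.RS U) n (R.e U) c'" by (rule R.RS_basis[OF U])
  then interpret C: coord_basis "sec_ring S U" "sec R.RS U" n "R.e U" c' .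
  let ?\<beta> = "\<lambda>s x. \<Oplus>\<^bsub>sec E U\<^esub>i\<in>{..<n}. c' i s \<odot>\<^bsub>sec E U\<^esub> pE i 0 U x"
  let ?\<mu> = "\<lambda>a m. a \<odot>\<^bsub>sec R.RS U\<^esub> m"
  have sP1: "t.T ?\<mu> = sec tensor_pre U" by (simp add: tensor_pre_def)
  have px: "pE i 0 U x \<in> carrier (sec E U)" if "i < n" "x \<in> carrier (sec F U)" for i x
    by (rule pE_closed[OF U that(1) n_pos F_in_E[OF that(2)]])
  have bterm: "c' i s \<odot>\<^bsub>sec E U\<^esub> pE i 0 U x \<in> carrier (sec E U)"
    if "i < n" "s \<in> carrier (sec R.RS U)" "x \<in> carrier (sec F U)" for i s x
    using that px C.c_closed by simp
  obtain h where h: "additive_map (t.T ?\<mu>) (sec E U) h"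
    and hp: "\<And>s x. s \<in> carrier (sec R.RS U) \<Longrightarrow> x \<in> carrier (sec F U) \<Longrightarrow> h (pure U s x) = ?\<beta> s x"
  proof (rule t.tensor_universal[of "sec E U" ?\<beta> ?\<mu>])
    show "abelian_group (sec E U)" by (rule N.M.abelian_group_axioms)
    show "additive_map (sec R.RS U) (sec E U) (\<lambda>s. ?\<beta> s x)" if "x \<in> carrier (sec F U)" for x
      using px[OF _ that]
      by (intro additive_finsum_fun N.M.abelian_group_axioms additive_compose[OF C.c_additive additive_smult_left[OF N.module_axioms]]) auto
    show "additive_map (sec F U) (sec E U) (\<lambda>x. ?\<beta> s x)" if "s \<in> carrier (sec R.RS U)" for s
      using C.c_closed[OF _ that]
      by (intro additive_finsum_fun N.M.abelian_group_axioms additive_compose[OF pEi0_additive[OF U] additive_smult[OF N.module_axioms]]) auto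
    fix a s x assume a: "a \<in> carrier (sec_ring S U)" and s: "s \<in> carrier (sec R.RS U)" and x: "x \<in> carrier (sec F U)"
    show "?\<beta> (a \<odot>\<^bsub>sec R.RS U\<^esub> s) x = ?\<beta> s (a \<odot>\<^bsub>sec F U\<^esub> x)"
    proof (rule N.M.finsum_cong')
      fix i assume "i \<in> {..<n}"
      then have i: "i < n" by simp
      show "c' i (a \<odot>\<^bsub>sec R.RS U\<^esub> s) \<odot>\<^bsub>sec E U\<^esub> pE i 0 U x = c' i s \<odot>\<^bsub>sec E U\<^esub> pE i 0 U (a \<odot>\<^bsub>sec F U\<^esub> x)"
        using a C.c_closed[OF i s] px[OF i x]
        by (simp add: C.c_smult[OF i a s] F_simps(4) pE_smult[OF U i n_pos a F_in_E[OF x]] N.smult_assoc1[symmetric] N.R.m_comm del: N.smult_assoc1)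
    next
      have "a \<odot>\<^bsub>sec F U\<^esub> x \<in> carrier (sec F U)" using t.N.smult_closed[OF a x] .
      then show "(\<lambda>i. c' i s \<odot>\<^bsub>sec E U\<^esub> pE i 0 U (a \<odot>\<^bsub>sec F U\<^esub> x)) \<in> {..<n} \<rightarrow> carrier (sec E U)"
        using bterm s by blast
    qed simp
  qed (rule that)
  have h': "additive_map (sec tensor_pre U) (sec E U) h" using h unfolding sP1 .
  \<comment> \<open>E_0j singles out c'_j(s) x from the image of s \<otimes> x. Moving this scalar
    to the left factor and summing over j rebuilds s from its coordinates.\<close>
  have \<tau>h: "\<tau> U (h (pure U s x)) = pure U s x" if s: "s \<in> carrier (sec R.RS U)" and x: "x \<in> carrier (sec F U)" for s x
  proof -
    have pj: "pE 0 j U (?\<beta> s x) = c' j s \<odot>\<^bsub>sec E U\<^esub> x" if j: "j < n" for j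
    proof -
      have "pE 0 j U (?\<beta> s x) = (\<Oplus>\<^bsub>sec E U\<^esub>i\<in>{..<n}. pE 0 j U (c' i s \<odot>\<^bsub>sec E U\<^esub> pE i 0 U x))"
        using bterm[OF _ s x]
        by (intro additive_finsum[OF N.M.abelian_group_axioms N.M.abelian_group_axioms pE_additive[OF U n_pos j]]) auto
      also have "\<dots> = (\<Oplus>\<^bsub>sec E U\<^esub>i\<in>{..<n}. if i = j then c' i s \<odot>\<^bsub>sec E U\<^esub> x else \<zero>\<^bsub>sec E U\<^esub>)"
      proof (rule N.M.finsum_cong')
        fix i assume "i \<in> {..<n}"
        then have i: "i < n" by simp
        have x0: "pE 0 0 U x = x" using x by (simp add: F_simps(1))
        have "pE 0 j U (c' i s \<odot>\<^bsub>sec E U\<^esub> pE i 0 U x) = c' i s \<odot>\<^bsub>sec E U\<^esub> (if j = i then x else \<zero>\<^bsub>sec E U\<^esub>)"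
          by (simp only: pE_smult[OF U n_pos j C.c_closed[OF i s] px[OF i x]] pE_pE[OF U n_pos j i n_pos F_in_E[OF x]] x0)
        then show "pE 0 j U (c' i s \<odot>\<^bsub>sec E U\<^esub> pE i 0 U x) = (if i = j then c' i s \<odot>\<^bsub>sec E U\<^esub> x else \<zero>\<^bsub>sec E U\<^esub>)"
          using N.smult_r_null[OF C.c_closed[OF i s]] by simp
      qed (use C.c_closed[OF _ s] F_in_E[OF x] in auto)
      also have "\<dots> = c' j s \<odot>\<^bsub>sec E U\<^esub> x"
        using j C.c_closed[OF _ s] F_in_E[OF x] by (intro N.M.finsum_delta) auto
      finally show ?thesis .
    qed
    have "\<tau> U (h (pure U s x)) = (\<Oplus>\<^bsub>sec tensor_pre U\<^esub>j\<in>{..<n}. pure U (c' j s \<odot>\<^bsub>sec R.RS U\<^esub> R.e U j) x)"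
      unfolding \<tau>_def hp[OF s x]
    proof (rule P.finsum_cong')
      fix j assume "j \<in> {..<n}"
      then have j: "j < n" by simp
      show "pure U (R.e U j) (pE 0 j U (?\<beta> s x)) = pure U (c' j s \<odot>\<^bsub>sec R.RS U\<^esub> R.e U j) x"
        unfolding pj[OF j] by (rule pure_smult[OF U C.c_closed[OF j s] C.b_closed[OF j] x, symmetric])
    qed (use pure_closed[OF U t.M.smult_closed[OF C.c_closed[OF _ s] C.b_closed] x] in auto)
    also have "\<dots> = pure U (\<Oplus>\<^bsub>sec R.RS U\<^esub>j\<in>{..<n}. c' j s \<odot>\<^bsub>sec R.RS U\<^esub> R.e U j) x"
      using C.c_closed[OF _ s] C.b_closed
      by (intro additive_finsum[OF RS.sec_abelian[OF U] P.abelian_group_axioms pure_additive_left[OF U x], symmetric]) auto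
    finally show ?thesis using C.expand[OF s] by simp
  qed
  \<comment> \<open>The coordinates of a basis section are Kronecker deltas, so the j-th term
    becomes E_j0 E_0j m = E_jj m, and the sum is m by \<open>PE_id\<close>.\<close>
  have h\<tau>: "h (\<tau> U m) = m" if m: "m \<in> carrier (sec E U)" for m
  proof -
    have "h (\<tau> U m) = (\<Oplus>\<^bsub>sec E U\<^esub>j\<in>{..<n}. h (pure U (R.e U j) (pE 0 j U m)))"
      unfolding \<tau>_def using tau_term_closed[OF U _ m]
      by (intro additive_finsum[OF P.abelian_group_axioms N.M.abelian_group_axioms h']) auto
    also have "\<dots> = PE U m"
    proof (rule N.M.finsum_cong')
      fix j assume "j \<in> {..<n}"
      then have j: "j < n" by simp
      note x = pE0_in_F[OF U j m]
      have "h (pure U (R.e U j) (pE 0 j U m)) = (\<Oplus>\<^bsub>sec E U\<^esub>i\<in>{..<n}. if i = j then pE i 0 U (pE 0 j U m) else \<zero>\<^bsub>sec E U\<^esub>)"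
        unfolding hp[OF e_closed[OF U j] x]
        using px[OF _ x] j C.c_b by (intro N.M.finsum_cong') (auto simp: N.smult_one N.smult_l_null)
      also have "\<dots> = pE j 0 U (pE 0 j U m)" using j px[OF _ x] by (intro N.M.finsum_delta) auto
      also have "\<dots> = pE j j U m" using pE_pE[OF U j n_pos n_pos j m] by simp
      finally show "h (pure U (R.e U j) (pE 0 j U m)) = pE j j U m" .
    qed (use pE_closed[OF U _ _ m] in auto)
    finally show ?thesis using PE_id[OF U m] by simp
  qed
  have "\<tau> U (h A) = A" if "A \<in> carrier (sec tensor_pre U)" for A
  proof -
    have i: "additive_map (t.T ?\<mu>) (sec tensor_pre U) (\<lambda>A. A)" by (simp add: additive_map_def sP1)
    have "additive_map (t.T ?\<mu>) (sec tensor_pre U) (\<lambda>A. \<tau> U (h A))" by (rule additive_compose[OF h tau_additive[OF U]])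
    then show ?thesis
      by (rule t.additive_ext[OF P.abelian_group_axioms _ i]) (use \<tau>h that in \<open>auto simp: sP1\<close>)
  qed
  then show ?thesis
    using additive_closed[OF tau_additive[OF U]] additive_closed[OF h'] h\<tau>
    by (intro bij_betw_byWitness[where f' = h]) auto
qed

lemma tau_res:
  assumes U: "openin (pts S) U" "openin (pts S) W" "W \<subseteq> U" and m: "m \<in> carrier (sec E U)"
  shows "mres tensor_pre U W (\<tau> U m) = \<tau> W (mres E U W m)"
proof -
  interpret P: abelian_group "sec tensor_pre W" by (rule tensor_pre_abelian[OF U(2)])
  have "mres tensor_pre U W (\<tau> U m) = (\<Oplus>\<^bsub>sec tensor_pre W\<^esub>i\<in>{..<n}. mres tensor_pre U W (pure U (R.e U i) (pE 0 i U m)))"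
    unfolding \<tau>_def using tau_term_closed[OF U(1) _ m]
    by (intro additive_finsum[OF tensor_pre_abelian[OF U(1)] P.abelian_group_axioms tensor_pre_res(1)[OF U]]) auto
  also have "\<dots> = \<tau> W (mres E U W m)"
    unfolding \<tau>_def
  proof (rule P.finsum_cong')
    fix i assume "i \<in> {..<n}"
    then have i: "i < n" by simp
    show "mres tensor_pre U W (pure U (R.e U i) (pE 0 i U m)) = pure W (R.e W i) (pE 0 i W (mres E U W m))"
      by (simp only: tensor_pre_res(2)[OF U e_closed[OF U(1) i] pE0_in_F[OF U(1) i m]] R.RS_res_e[OF U i] pE_res[OF U n_pos i m])
  qed (use tau_term_closed[OF U(2) _ E.M.res_closed[OF U m]] in auto)
  finally show ?thesis .
qed

text \<open>\<open>munit_act\<close> writes E_0l(g m) as the combination of the E_0i m with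
  coefficients A(g)_li. Moved to the left factor and summed over l, these coefficients are the
  action of g on the basis section e_i.\<close>

lemma tau_act:
  assumes g: "g \<in> carrier G" and U: "openin (pts S) U" and m: "m \<in> carrier (sec E U)"
  shows "\<tau> U (act E g U m) = act tensor_pre g U (\<tau> U m)"
proof -
  interpret P: abelian_group "sec tensor_pre U" by (rule tensor_pre_abelian[OF U])
  interpret NF: module "sec_ring S U" "sec F U" by (rule F.sec_module[OF U])
  interpret NR: module "sec_ring S U" "sec R.RS U" by (rule RS.sec_module[OF U])
  interpret m: munits k G n A \<mu> "kE U" "\<lambda>g. act E g U" by (rule munits_sec[OF U])
  let ?A = "\<lambda>l i. sc U (A g l i)"
  let ?x = "\<lambda>i. pE 0 i U m"
  let ?t = "\<lambda>l i. pure U (R.e U l) (?A l i \<odot>\<^bsub>sec F U\<^esub> ?x i)"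
  have Ac: "?A l i \<in> carrier (sec_ring S U)" if "i < n" "l < n" for i l by (rule sc_closed[OF U A_closed[OF g that(2,1)]])
  have Ax: "?A l i \<odot>\<^bsub>sec F U\<^esub> ?x i \<in> carrier (sec F U)" if "i < n" "l < n" for i l
    by (rule NF.smult_closed[OF Ac[OF that] pE0_in_F[OF U that(1) m]])
  have tc: "?t l i \<in> carrier (sec tensor_pre U)" if "i < n" "l < n" for i l
    by (rule pure_closed[OF U e_closed[OF U that(2)] Ax[OF that]])
  have "\<tau> U (act E g U m) = (\<Oplus>\<^bsub>sec tensor_pre U\<^esub>l\<in>{..<n}. \<Oplus>\<^bsub>sec tensor_pre U\<^esub>i\<in>{..<n}. ?t l i)"
    unfolding \<tau>_def
  proof (rule P.finsum_cong')
    fix l assume "l \<in> {..<n}"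
    then have l: "l < n" by simp
    have "pE 0 l U (act E g U m) = (\<Oplus>\<^bsub>sec E U\<^esub>i\<in>{..<n}. ?A l i \<odot>\<^bsub>sec E U\<^esub> ?x i)"
      using m.munit_act[OF g n_pos l, of m] m by simp
    also have "\<dots> = (\<Oplus>\<^bsub>sec F U\<^esub>i\<in>{..<n}. ?A l i \<odot>\<^bsub>sec F U\<^esub> ?x i)"
      using F_sum[OF U, of "\<lambda>i. ?A l i \<odot>\<^bsub>sec F U\<^esub> ?x i" "{..<n}"] Ax[OF _ l] by (simp add: F_simps(4) Pi_iff)
    finally show "pure U (R.e U l) (pE 0 l U (act E g U m)) = (\<Oplus>\<^bsub>sec tensor_pre U\<^esub>i\<in>{..<n}. ?t l i)"
      using additive_finsum[OF NF.M.abelian_group_axioms P.abelian_group_axioms pure_additive_right[OF U e_closed[OF U l]],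
          of "\<lambda>i. ?A l i \<odot>\<^bsub>sec F U\<^esub> ?x i" "{..<n}"] Ax[OF _ l] by (simp add: Pi_iff)
  qed (use tc in auto)
  also have "\<dots> = (\<Oplus>\<^bsub>sec tensor_pre U\<^esub>i\<in>{..<n}. \<Oplus>\<^bsub>sec tensor_pre U\<^esub>l\<in>{..<n}. ?t l i)"
    using tc by (intro P.finsum_swap) auto
  also have "\<dots> = (\<Oplus>\<^bsub>sec tensor_pre U\<^esub>i\<in>{..<n}. act tensor_pre g U (pure U (R.e U i) (?x i)))"
  proof (rule P.finsum_cong')
    fix i assume "i \<in> {..<n}"
    then have i: "i < n" by simp
    have Ae: "?A l i \<odot>\<^bsub>sec R.RS U\<^esub> R.e U l \<in> carrier (sec R.RS U)" if "l < n" for l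
      by (rule NR.smult_closed[OF Ac[OF i that] e_closed[OF U that]])
    have "act R.RS g U (R.e U i) = (\<Oplus>\<^bsub>sec R.RS U\<^esub>l\<in>{..<n}. ?A l i \<odot>\<^bsub>sec R.RS U\<^esub> R.e U l)"
      unfolding R.RS_act_e[OF g U i] using Ae i by (intro NR.M.finsum_cong') (auto simp: A_eq[OF g])
    then have "act tensor_pre g U (pure U (R.e U i) (?x i)) = (\<Oplus>\<^bsub>sec tensor_pre U\<^esub>l\<in>{..<n}. pure U (?A l i \<odot>\<^bsub>sec R.RS U\<^esub> R.e U l) (?x i))"
      using additive_finsum[OF NR.M.abelian_group_axioms P.abelian_group_axioms pure_additive_left[OF U pE0_in_F[OF U i m]],
          of "\<lambda>l. ?A l i \<odot>\<^bsub>sec R.RS U\<^esub> R.e U l" "{..<n}"] Ae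
      by (simp add: tensor_pre_act(2)[OF g U e_closed[OF U i] pE0_in_F[OF U i m]] Pi_iff)
    also have "\<dots> = (\<Oplus>\<^bsub>sec tensor_pre U\<^esub>l\<in>{..<n}. ?t l i)"
      using tc[OF i] pure_smult[OF U Ac[OF i] e_closed[OF U] pE0_in_F[OF U i m]]
      by (intro P.finsum_cong') (auto simp: F_simps(4))
    finally show "(\<Oplus>\<^bsub>sec tensor_pre U\<^esub>l\<in>{..<n}. ?t l i) = act tensor_pre g U (pure U (R.e U i) (?x i))" ..
  qed (use additive_closed[OF tensor_pre_act(1)[OF g U] tau_term_closed[OF U _ m]] in auto)
  also have "\<dots> = act tensor_pre g U (\<tau> U m)"
    unfolding \<tau>_def using tau_term_closed[OF U _ m]
    by (intro additive_finsum[OF P.abelian_group_axioms P.abelian_group_axioms tensor_pre_act(1)[OF g U], symmetric]) auto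
  finally show ?thesis .
qed

lemma tensor_decomposition: "gmod_isomorphic G S E (tensor_sheaf S R.RS (trivial_action F))"
  unfolding tensor_sheaf_eq
proof (rule gmod_isomorphic_sheafification[OF gmodule_E])
  show "mod_isomorphism S E tensor_pre \<tau>"
    unfolding mod_isomorphism_def using tau_additive tau_smult tau_bij tau_res
    by (intro conjI allI impI ballI module_homI) auto
  show "\<tau> U \<zero>\<^bsub>sec E U\<^esub> = \<zero>\<^bsub>sec tensor_pre U\<^esub>" if U: "openin (pts S) U" for U
    by (rule additive_zero[OF E.sec_abelian[OF U] tensor_pre_abelian[OF U] tau_additive[OF U]])
qed (rule tau_act)

end

text \<open>The argument passes from W to E and back. The central idempotent fixes
  \<open>x 0\<close> by \<open>munit_family\<close>, so it does not kill a section of E representing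
  the image of \<open>x 0\<close> in the generic stalk; by non-splitting it is the identity on E.
  Hence it is the identity on the generic stalk and, by injectivity of the embedding, on W.\<close>

lemma (in typed_munits) isotypic_of_type:
  assumes ns: "nonsplitting_gmodule G S E"
    and x: "x \<in> {..<n} \<rightarrow> carrier W" "x 0 \<noteq> \<zero>\<^bsub>W\<^esub>"
    and act: "\<And>g l. g \<in> carrier G \<Longrightarrow> l < n \<Longrightarrow> \<sigma> g (x l) = (\<Oplus>\<^bsub>W\<^esub>r\<in>{..<n}. A g r l \<odot>\<^bsub>W\<^esub> x r)"
  shows "\<lbrakk>openin (pts S) U; m \<in> carrier (sec E U)\<rbrakk> \<Longrightarrow> PE U m = m"
    and "w \<in> carrier W \<Longrightarrow> mW.total w = w"
proof -
  interpret St: module K E\<epsilon> by (rule module_stalk)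
  interpret mS: munits k G n A \<mu> kE\<epsilon> "stalk_act S E \<epsilon>" by (rule munits_stalk)
  note \<iota>0 = additive_zero[OF W.M.abelian_group_axioms St.M.abelian_group_axioms iota_additive]
  have \<iota>t: "\<iota> (mW.total w) = (\<Oplus>\<^bsub>E\<epsilon>\<^esub>i\<in>{..<n}. pE\<epsilon> i i (\<iota> w))" if w: "w \<in> carrier W" for w
  proof -
    have "\<iota> (mW.total w) = (\<Oplus>\<^bsub>E\<epsilon>\<^esub>i\<in>{..<n}. \<iota> (mW.E i i w))"
      using mW.munit_closed w by (intro additive_finsum[OF W.M.abelian_group_axioms St.M.abelian_group_axioms iota_additive]) auto
    also have "\<dots> = (\<Oplus>\<^bsub>E\<epsilon>\<^esub>i\<in>{..<n}. pE\<epsilon> i i (\<iota> w))"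
      using mS.munit_closed w iota_closed by (intro St.M.finsum_cong') (auto simp: iota_munit)
    finally show ?thesis .
  qed
  have tg: "mod_germ S E \<epsilon> U (PE U m) = (\<Oplus>\<^bsub>E\<epsilon>\<^esub>i\<in>{..<n}. pE\<epsilon> i i (mod_germ S E \<epsilon> U m))"
    if U: "openin (pts S) U" "\<epsilon> \<in> U" and m: "m \<in> carrier (sec E U)" for U m
  proof -
    have "mod_germ S E \<epsilon> U (PE U m) = (\<Oplus>\<^bsub>E\<epsilon>\<^esub>i\<in>{..<n}. mod_germ S E \<epsilon> U (pE i i U m))"
      using pE_closed[OF U(1) _ _ m]
      by (intro additive_finsum[OF E.sec_abelian[OF U(1)] St.M.abelian_group_axioms E.germ_additive[OF U]]) auto
    also have "\<dots> = (\<Oplus>\<^bsub>E\<epsilon>\<^esub>i\<in>{..<n}. pE\<epsilon> i i (mod_germ S E \<epsilon> U m))"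
      using mS.munit_closed E.mod_stalk_carrier[OF U m] pE_germ[OF U _ _ m] by (intro St.M.finsum_cong') auto
    finally show ?thesis .
  qed
  have xc: "x l \<in> carrier W" if "l < n" for l using x(1) that by auto
  have tx: "mW.total (x 0) = x 0"
  proof -
    have "mW.total (x 0) = (\<Oplus>\<^bsub>W\<^esub>i\<in>{..<n}. if i = 0 then x i else \<zero>\<^bsub>W\<^esub>)"
      using xc mW.munit_family[OF x(1) act _ _ n_pos] by (intro W.M.finsum_cong') auto
    also have "\<dots> = x 0" using n_pos xc by (intro W.M.finsum_delta) auto
    finally show ?thesis .
  qed
  obtain U0 m0 where U0: "openin (pts S) U0" "\<epsilon> \<in> U0" "m0 \<in> carrier (sec E U0)" "\<iota> (x 0) = mod_germ S E \<epsilon> U0 m0"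
    using iota_closed[OF xc[OF n_pos]] by (rule E.mod_stalk_cases)
  have nz: "PE U0 m0 \<noteq> \<zero>\<^bsub>sec E U0\<^esub>"
  proof
    assume "PE U0 m0 = \<zero>\<^bsub>sec E U0\<^esub>"
    then have "\<iota> (x 0) = \<zero>\<^bsub>E\<epsilon>\<^esub>"
      using tg[OF U0(1,2,3)] \<iota>t[OF xc[OF n_pos]] E.mod_stalk_zero[OF U0(1,2)] by (simp add: tx U0(4))
    then show False using iota_inj[OF xc[OF n_pos] W.M.zero_closed] \<iota>0 x(2) by simp
  qed
  show id: "PE U m = m" if "openin (pts S) U" "m \<in> carrier (sec E U)" for U m
    by (rule isotypic[OF ns U0(1,3) nz that])
  show "mW.total w = w" if w: "w \<in> carrier W" for w
  proof (rule iota_inj[OF _ w])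
    show "mW.total w \<in> carrier W" using mW.munit_closed w by (intro W.M.finsum_closed) auto
    obtain U m where U: "openin (pts S) U" "\<epsilon> \<in> U" "m \<in> carrier (sec E U)" "\<iota> w = mod_germ S E \<epsilon> U m"
      using iota_closed[OF w] by (rule E.mod_stalk_cases)
    show "\<iota> (mW.total w) = \<iota> w" using tg[OF U(1,2,3)] by (simp add: \<iota>t[OF w] U(4) id[OF U(1,3)])
  qed
qed

theorem theorem2:
  fixes k :: "'k ring" and G :: "'g monoid" and S :: "('x, 'r) rspace"
    and p :: "'x \<Rightarrow> 'k set"
    and \<phi> :: "'k set set \<Rightarrow> ('k set \<Rightarrow> ('k \<times> 'k) set) \<Rightarrow> 'r"
    and \<epsilon> :: 'x
    and E :: "('x, 'r, 'm, 'g) gmsheaf"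
    and W :: "('k, 'w) module" and \<sigma> :: "'g \<Rightarrow> 'w \<Rightarrow> 'w"
  assumes "algebraically_closed k"
    and "Group.group G" and "finite (carrier G)"
    and "\<not> ring_char k dvd order G"
    and "scheme_over k S p \<phi>" and "integral_scheme S"
    and "generic_point S \<epsilon>"
    and "sheaf_of_gmodules G S E"
    and "coherent S E" and "torsion_free S E"
    and "nonsplitting_gmodule G S E"
    and "group_rep k G W \<sigma>" and "has_type k G S \<phi> \<epsilon> E W \<sigma>"
  shows "\<exists>(V :: ('k, 'w) module) (\<rho> :: 'g \<Rightarrow> 'w \<Rightarrow> 'w) (F :: ('x, 'r, 'm) msheaf).
      irreducible_group_rep k G V \<rho>
      \<and> sheaf_of_modules S F \<and> nonsplitting_module S F
      \<and> gmod_isomorphic G S E (tensor_sheaf S (rep_sheaf k S \<phi> V \<rho>) (trivial_action F))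
      \<and> rep_isomorphic k G W \<sigma> (power_module V (mod_rank S \<epsilon> F))
          (power_action \<rho> (mod_rank S \<epsilon> F))"
proof -
  have fk: "field k" using assms(1) by (simp add: algebraically_closed_def)
  interpret equivariant_setting k G S p \<phi> \<epsilon> E
    by (rule equivariant_setting.intro[OF fk assms(2,5-8)])
  obtain \<iota> where \<iota>: "type_embedding k G S p \<phi> \<epsilon> E W \<sigma> \<iota>"
    using assms(12,13) by (rule type_embedding_exists)
  interpret type_embedding k G S p \<phi> \<epsilon> E W \<sigma> \<iota> by (rule \<iota>)
  have fd: "W.fin_dim" using assms(9) by (intro type_fin_dim) (simp add: coherent_def)
  have nzW: "carrier W \<noteq> {\<zero>\<^bsub>W\<^esub>}"
    using assms(11) by (intro type_nonzero E.generic_stalk_nonzero[OF assms(9,10,6,7)]) (simp add: nonsplitting_gmodule_def)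
  obtain H where H: "VectorSpace.subspace k H W" "irreducible_group_rep k G (W\<lparr>carrier := H\<rparr>) \<sigma>"
    by (rule W.irreducible_subrep_exists[OF fd nzW])
  \<comment> \<open>V is a subspace of W with the action inherited from W, so \<sigma> itself serves
    as the witness for \<rho>.\<close>
  let ?V = "W\<lparr>carrier := H\<rparr>"
  interpret V: irreducible_group_rep k G ?V \<sigma> by (rule H(2))
  have HW: "h \<in> carrier W" if "h \<in> H" for h using H(1) that by (auto simp: subspace_def submodule_def)
  obtain n b c where B: "coord_basis k ?V n b c"
    using W.subspace_fin_dim[OF fd H(1)] by (rule V.coord_basis_exists)
  then interpret B: coord_basis k ?V n b c .
  \<comment> \<open>The matrices of V itself: the matrix units are those attached to the irreducible
    representation found inside W, so the vectors b, viewed in W, are a family to which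
    \<open>isotypic_of_type\<close> applies.\<close>
  define A where "A = (\<lambda>g i j. c i (\<sigma> g (b j)))"
  obtain \<mu> where mu: "irr_matrix k G n A \<mu>"
    using V.irr_matrix_exists[OF assms(1,3,4) B, folded A_def] by (elim exE) (rule that)
  interpret typed_munits k G S p \<phi> \<epsilon> E n A \<mu> W \<sigma> \<iota>
    by (intro typed_munits.intro equivariant_munits.intro equivariant_setting_axioms mu \<iota>)
  have b: "b l \<in> H" if "l < n" for l using B.b_closed[OF that] by simp
  have b0: "b 0 \<noteq> \<zero>\<^bsub>W\<^esub>"
  proof
    assume "b 0 = \<zero>\<^bsub>W\<^esub>"
    then have "c 0 (b 0) = \<zero>\<^bsub>k\<^esub>"
      using additive_zero[OF V.M.abelian_group_axioms ring.is_abelian_group[OF cring.axioms(1)[OF cring_k]] B.c_additive[OF n_pos]] by simp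
    then show False using B.c_b[OF n_pos n_pos] domain.one_not_zero[OF field.axioms(1)[OF fk]] by simp
  qed
  have act: "\<sigma> g (b l) = (\<Oplus>\<^bsub>W\<^esub>r\<in>{..<n}. A g r l \<odot>\<^bsub>W\<^esub> b r)" if g: "g \<in> carrier G" and l: "l < n" for g l
  proof -
    have r: "\<sigma> g (b l) \<in> carrier ?V" using module_hom_apply[OF V.rep_hom[OF g] B.b_closed[OF l]] .
    have incl: "additive_map ?V W (\<lambda>x. x)" using HW by (simp add: additive_map_def)
    have "\<sigma> g (b l) = (\<Oplus>\<^bsub>?V\<^esub>r\<in>{..<n}. A g r l \<odot>\<^bsub>?V\<^esub> b r)" unfolding A_def by (rule B.expand[OF r])
    also have "\<dots> = (\<Oplus>\<^bsub>W\<^esub>r\<in>{..<n}. A g r l \<odot>\<^bsub>?V\<^esub> b r)"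
      using V.smult_closed[OF A_closed[OF g _ l] B.b_closed]
      by (intro additive_finsum[OF V.M.abelian_group_axioms W.M.abelian_group_axioms incl]) blast
    finally show ?thesis by simp
  qed
  have bW: "b \<in> {..<n} \<rightarrow> carrier W" using HW b by blast
  note iso = isotypic_of_type[OF assms(11) bW b0 act]
  \<comment> \<open>The multiplicity space E_00 W. Its dimension m is the number of copies of V in W
    and, by \<open>rank_F\<close>, the rank of F.\<close>
  let ?W0 = "{w \<in> carrier W. mW.E 0 0 w = w}"
  have W0: "VectorSpace.subspace k ?W0 W"
    using n_pos additive_add[OF mW.munit_additive] mW.munit_smult
      additive_zero[OF W.M.abelian_group_axioms W.M.abelian_group_axioms mW.munit_additive]
    by (intro VectorSpace.subspace.intro W.vectorspace_axioms submodule.intro W.module_axioms) auto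
  interpret W0: vectorspace k "W\<lparr>carrier := ?W0\<rparr>" by (rule W.subspace_is_vs[OF W0])
  obtain m u d where W0B: "coord_basis k (W\<lparr>carrier := ?W0\<rparr>) m u d"
    using W.subspace_fin_dim[OF fd W0] by (rule W0.coord_basis_exists)
  have rk: "mod_rank S \<epsilon> F = m" by (rule rank_F[OF W0B])
  have dec: "rep_isomorphic k G W \<sigma> (power_module ?V m) (power_action \<sigma> m)"
    by (rule mW.isotypic_decomposition[OF H(2) B _ _ W0B]) (simp add: A_def, rule iso(2))
  interpret isotypic_setting k G S p \<phi> \<epsilon> E n A \<mu> ?V \<sigma> b c
    by (intro isotypic_setting.intro equivariant_munits_axioms representation_sheaf.intro
        representation_sheaf_axioms.intro isotypic_setting_axioms.intro E.ringed_space_axioms V.group_rep_axioms B assms(5))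
      (simp add: A_def, rule iso(1))
  show ?thesis
    using H(2) F_sheaf F_nonsplitting[OF assms(11)] tensor_decomposition dec unfolding rk[symmetric]
    by (intro exI[of _ ?V] exI[of _ \<sigma>] exI[of _ F] conjI)
qed

end
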